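(* For every integer $m\ge1$ there is a constant $C_m>0$ such that the following holds. Let $\mathcal A$ be a von Neumann algebra and $S$ a collection of weakly continuous linear multiplicative symmetry maps on $\mathcal A$. Let $U,V\in\mathcal A$ be $S$-symmetric unitaries and let $\omega\in\mathbb{C}$ have (multiplicative) order $m$. Let $\mathcal U,\mathcal V\in M_m(\mathcal A)$ be the $S\otimes\operatorname{id}$-symmetric unitaries defined by \[\mathcal U=\operatorname{diag}(U,\omega U,\dots,\omega^{m-1}U),\] and $\mathcal V$ having $(i,j)$ block equal to $V$ if $j\equiv i+1\pmod m$ and $0$ otherwise. Suppose that there exist commuting $S\otimes\operatorname{id}$-symmetric unitaries $\mathcal U',\mathcal V'\in M_m(\mathcal A)$, and put \[\varepsilon=\max(\|\mathcal U'-\mathcal U\|,\|\mathcal V'-\mathcal V\|).\] Then there exist $S$-symmetric unitaries $U'',V''\in\mathcal A$ such that \[U''V''=\omega V''U'',\] \[\|U''-U\|,\ \|V''-V\|\le C_m\,\varepsilon^{1/4}.\]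
   Context: A symmetry map on a unital $C^*$-algebra $\mathcal A$ is an $\mathbb{R}$-linear map $\varphi:\mathcal A\to\mathcal A$ that is either $\mathbb{C}$-linear or conjugate-linear, is either multiplicative or anti-multiplicative, and satisfies $\varphi(I)=I$ and $\varphi(A^* )=\varphi(A)^*$ for all $A\in\mathcal A$. "Linear" means $\mathbb{C}$-linear. Weakly continuous means continuous in the weak operator topology. An element $A$ is $S$-symmetric if $\varphi(A)=A$ for all $\varphi\in S$. For a linear multiplicative symmetry map $\varphi$ on $\mathcal A$, $\varphi\otimes\operatorname{id}$ is the map on $M_m(\mathcal A)$ applying $\varphi$ to each entry, and $S\otimes\operatorname{id}=\{\varphi\otimes\operatorname{id}:\varphi\in S\}$. $\|\cdot\|$ is the operator norm.
   Formalization: The claim is proved only for ε ≤ δ_m, with δ_m > 0 depending on m alone; without this it fails (scalars, m=2, ω=−1, U=V=1, 𝒰'=𝒱'=I). C_m is stated for all algebras on subspaces of one arbitrary Hilbert space; a direct sum gives uniformity. *)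

theory Defs
  imports "HOL-Analysis.Analysis"
begin

text \<open>Complex Hilbert spaces. The real inner product of the parent class is the real part of the
  complex one, so norm, distance, topology and bounded operators are the library's.\<close>

class complex_hilbert = real_inner + complete_space +
  fixes scaleC :: "complex \<Rightarrow> 'a \<Rightarrow> 'a"  (infixr \<open>*\<^sub>C\<close> 75)
    and cinner :: "'a \<Rightarrow> 'a \<Rightarrow> complex"
  assumes scaleC_add_right: "c *\<^sub>C (x + y) = c *\<^sub>C x + c *\<^sub>C y"
    and scaleC_add_left: "(c + d) *\<^sub>C x = c *\<^sub>C x + d *\<^sub>C x"
    and scaleC_scaleC: "c *\<^sub>C d *\<^sub>C x = (c * d) *\<^sub>C x"
    and scaleR_scaleC: "r *\<^sub>R x = complex_of_real r *\<^sub>C x"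
    and cinner_add_right: "cinner x (y + z) = cinner x y + cinner x z"
    and cinner_scaleC_right: "cinner x (c *\<^sub>C y) = c * cinner x y"
    and cinner_commute: "cinner x y = cnj (cinner y x)"
    and inner_eq_Re_cinner: "inner x y = Re (cinner x y)"

text \<open>A bounded real-linear operator; the complex-linear ones are singled out by \<open>clinear_op\<close>.\<close>

type_synonym 'h op = "'h \<Rightarrow>\<^sub>L 'h"

definition clinear_op :: "'h::complex_hilbert op \<Rightarrow> bool" where
  "clinear_op T \<longleftrightarrow> (\<forall>c x. blinfun_apply T (c *\<^sub>C x) = c *\<^sub>C blinfun_apply T x)"

definition scale_op :: "complex \<Rightarrow> 'h::complex_hilbert op \<Rightarrow> 'h op" where
  "scale_op c T = Blinfun (\<lambda>x. c *\<^sub>C blinfun_apply T x)"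

definition adj_op :: "'h::complex_hilbert op \<Rightarrow> 'h op" where
  "adj_op T = (THE R. \<forall>x y. cinner (blinfun_apply R x) y = cinner x (blinfun_apply T y))"

text \<open>The coarsest topology making every map \<open>T \<mapsto> \<langle>x, T y\<rangle>\<close> continuous;
  the function space carries the product topology.\<close>

definition weak_operator_topology :: "'h::complex_hilbert op topology" where
  "weak_operator_topology =
     pullback_topology UNIV (\<lambda>T (x, y). cinner x (blinfun_apply T y)) euclidean"

text \<open>\<open>von_neumann_algebra e A\<close>: \<open>A\<close> is a von Neumann algebra with identity \<open>e\<close>. It follows that \<open>e\<close>
  is an orthogonal projection, and \<open>A\<close> is a von Neumann algebra in the usual unital sense on the
  Hilbert space \<open>e 'h\<close> (operators being extended by \<open>0\<close> on the complement). Not insisting on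
  \<open>e = id_blinfun\<close> lets one statement about a fixed type \<open>'h\<close> quantify over the von Neumann
  algebras on all Hilbert spaces that embed into \<open>'h\<close>.\<close>

definition von_neumann_algebra :: "'h::complex_hilbert op \<Rightarrow> 'h op set \<Rightarrow> bool" where
  "von_neumann_algebra e A \<longleftrightarrow>
     (\<forall>T\<in>A. clinear_op T) \<and>
     (\<forall>T\<in>A. \<forall>R\<in>A. T + R \<in> A \<and> T o\<^sub>L R \<in> A) \<and>
     (\<forall>T\<in>A. \<forall>c. scale_op c T \<in> A) \<and>
     (\<forall>T\<in>A. adj_op T \<in> A) \<and>
     e \<in> A \<and> (\<forall>T\<in>A. e o\<^sub>L T = T \<and> T o\<^sub>L e = T) \<and>
     closedin weak_operator_topology A"

definition linear_on_alg :: "'h::complex_hilbert op set \<Rightarrow> ('h op \<Rightarrow> 'h op) \<Rightarrow> bool" where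
  "linear_on_alg A \<phi> \<longleftrightarrow>
     (\<forall>T\<in>A. \<forall>R\<in>A. \<phi> (T + R) = \<phi> T + \<phi> R) \<and> (\<forall>T\<in>A. \<forall>c. \<phi> (scale_op c T) = scale_op c (\<phi> T))"

definition conj_linear_on_alg :: "'h::complex_hilbert op set \<Rightarrow> ('h op \<Rightarrow> 'h op) \<Rightarrow> bool" where
  "conj_linear_on_alg A \<phi> \<longleftrightarrow>
     (\<forall>T\<in>A. \<forall>R\<in>A. \<phi> (T + R) = \<phi> T + \<phi> R) \<and> (\<forall>T\<in>A. \<forall>c. \<phi> (scale_op c T) = scale_op (cnj c) (\<phi> T))"

definition multiplicative_on_alg :: "'h::complex_hilbert op set \<Rightarrow> ('h op \<Rightarrow> 'h op) \<Rightarrow> bool" where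
  "multiplicative_on_alg A \<phi> \<longleftrightarrow> (\<forall>T\<in>A. \<forall>R\<in>A. \<phi> (T o\<^sub>L R) = \<phi> T o\<^sub>L \<phi> R)"

definition anti_multiplicative_on_alg :: "'h::complex_hilbert op set \<Rightarrow> ('h op \<Rightarrow> 'h op) \<Rightarrow> bool" where
  "anti_multiplicative_on_alg A \<phi> \<longleftrightarrow> (\<forall>T\<in>A. \<forall>R\<in>A. \<phi> (T o\<^sub>L R) = \<phi> R o\<^sub>L \<phi> T)"

text \<open>Only the values of \<open>\<phi>\<close> on \<open>A\<close> matter. Real-linearity is implied by either alternative.\<close>

definition symmetry_map :: "'h::complex_hilbert op \<Rightarrow> 'h op set \<Rightarrow> ('h op \<Rightarrow> 'h op) \<Rightarrow> bool" where
  "symmetry_map e A \<phi> \<longleftrightarrow>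
     \<phi> ` A \<subseteq> A \<and>
     (linear_on_alg A \<phi> \<or> conj_linear_on_alg A \<phi>) \<and>
     (multiplicative_on_alg A \<phi> \<or> anti_multiplicative_on_alg A \<phi>) \<and>
     \<phi> e = e \<and> (\<forall>T\<in>A. \<phi> (adj_op T) = adj_op (\<phi> T))"

definition weakly_continuous :: "'h::complex_hilbert op set \<Rightarrow> ('h op \<Rightarrow> 'h op) \<Rightarrow> bool" where
  "weakly_continuous A \<phi> \<longleftrightarrow>
     continuous_map (subtopology weak_operator_topology A) (subtopology weak_operator_topology A) \<phi>"

definition symmetric_under :: "('b \<Rightarrow> 'b) set \<Rightarrow> 'b \<Rightarrow> bool" where
  "symmetric_under S T \<longleftrightarrow> (\<forall>\<phi>\<in>S. \<phi> T = T)"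

definition unitary_in :: "'h::complex_hilbert op \<Rightarrow> 'h op set \<Rightarrow> 'h op \<Rightarrow> bool" where
  "unitary_in e A U \<longleftrightarrow> U \<in> A \<and> adj_op U o\<^sub>L U = e \<and> U o\<^sub>L adj_op U = e"

text \<open>Elements of \<open>M\<^sub>m(A)\<close>: entries are indexed by \<open>{0..<m}\<close> instead of \<open>{1..m}\<close>, and a matrix is \<open>0\<close>
  outside that range so that equality of functions is equality of matrices.\<close>

type_synonym 'h opmat = "nat \<Rightarrow> nat \<Rightarrow> 'h op"

definition mat_alg :: "nat \<Rightarrow> 'h::complex_hilbert op set \<Rightarrow> 'h opmat set" where
  "mat_alg m A = {X. \<forall>i j. if i < m \<and> j < m then X i j \<in> A else X i j = 0}"

definition mat_one :: "nat \<Rightarrow> 'h::complex_hilbert op \<Rightarrow> 'h opmat" where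
  "mat_one m e = (\<lambda>i j. if i < m \<and> i = j then e else 0)"

definition mat_mult :: "nat \<Rightarrow> 'h::complex_hilbert opmat \<Rightarrow> 'h opmat \<Rightarrow> 'h opmat" where
  "mat_mult m X Y = (\<lambda>i j. \<Sum>k<m. X i k o\<^sub>L Y k j)"

definition mat_adj :: "'h::complex_hilbert opmat \<Rightarrow> 'h opmat" where
  "mat_adj X = (\<lambda>i j. adj_op (X j i))"

text \<open>Operator norm on the Hilbert space direct sum of \<open>m\<close> copies of \<open>'h\<close>.\<close>

definition mat_norm :: "nat \<Rightarrow> 'h::complex_hilbert opmat \<Rightarrow> real" where
  "mat_norm m X =
     (SUP x\<in>{x :: nat \<Rightarrow> 'h. L2_set (\<lambda>j. norm (x j)) {..<m} \<le> 1}.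
        L2_set (\<lambda>i. norm (\<Sum>j<m. blinfun_apply (X i j) (x j))) {..<m})"

definition mat_unitary_in ::
  "nat \<Rightarrow> 'h::complex_hilbert op \<Rightarrow> 'h op set \<Rightarrow> 'h opmat \<Rightarrow> bool" where
  "mat_unitary_in m e A X \<longleftrightarrow>
     X \<in> mat_alg m A \<and>
     mat_mult m (mat_adj X) X = mat_one m e \<and> mat_mult m X (mat_adj X) = mat_one m e"

definition tensor_id :: "('h::complex_hilbert op \<Rightarrow> 'h op) \<Rightarrow> 'h opmat \<Rightarrow> 'h opmat" where
  "tensor_id \<phi> X = (\<lambda>i j. \<phi> (X i j))"

definition clock_mat :: "nat \<Rightarrow> complex \<Rightarrow> 'h::complex_hilbert op \<Rightarrow> 'h opmat" where
  "clock_mat m \<omega> U = (\<lambda>i j. if i < m \<and> i = j then scale_op (\<omega> ^ i) U else 0)"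

definition shift_mat :: "nat \<Rightarrow> 'h::complex_hilbert op \<Rightarrow> 'h opmat" where
  "shift_mat m V = (\<lambda>i j. if i < m \<and> j < m \<and> j mod m = (i + 1) mod m then V else 0)"

definition has_mult_order :: "complex \<Rightarrow> nat \<Rightarrow> bool" where
  "has_mult_order \<omega> m \<longleftrightarrow> m > 0 \<and> \<omega> ^ m = 1 \<and> (\<forall>k. 0 < k \<and> k < m \<longrightarrow> \<omega> ^ k \<noteq> 1)"

text \<open>The theorem carries a smallness threshold \<open>\<epsilon> \<le> \<delta>\<close> with \<open>\<delta>\<close> depending only on \<open>m\<close>. Without it the
  existence of \<open>U'', V''\<close> fails: for the algebra of scalars, \<open>m = 2\<close>, \<open>\<omega> = -1\<close>, \<open>U = V = 1\<close>, the identity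
  matrices are commuting unitaries at distance \<open>\<epsilon> = 2\<close>, but no scalar unitaries satisfy
  \<open>U'' V'' = - V'' U''\<close>.\<close>

end

theory Submission
  imports Defs "HOL-Computational_Algebra.Formal_Power_Series"
begin

text \<open>The given commuting unitaries \<open>X, Y\<close> are close to \<open>clock(U), shift(V)\<close>, which are covariant
  under the scalar clock and shift matrices: conjugation by these multiplies \<open>clock(U)\<close> and
  \<open>shift(V)\<close> by powers of \<open>\<omega>\<close>. Conversely, if a commuting unitary pair is
  exactly covariant, then its entries \<open>U'' = X\<^sub>0\<^sub>0\<close> and \<open>V'' = Y\<^sub>0\<^sub>1\<close> are unitary and \<open>U'' V'' = \<omega> V'' U''\<close>.
  So it suffices to make an approximately covariant commuting pair exactly covariant, for one unitary \<open>g\<close>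
  of order \<open>m\<close> at a time and without losing the covariance already gained.

  For one \<open>g\<close> with \<open>g X \<approx> \<omega> X g\<close> and \<open>g Y \<approx> Y g\<close> up to \<open>\<epsilon>\<close>, cut out the spectral cell
  \<open>Re X \<ge> cos(\<pi>/m) + sqrt \<epsilon>\<close>. Its translates under \<open>g\<close> are orthogonal up to \<open>O(sqrt \<epsilon>)\<close>; orthogonalise them
  covariantly and transport the compressions of \<open>X, Y\<close> from one cell to the others. On the complement
  (the seam) \<open>X\<close> is within \<open>O(sqrt \<epsilon>)\<close> of an \<open>m\<close>-th root \<open>\<sigma>\<close> of \<open>-1\<close>; since \<open>\<sigma>\<close> and \<open>g\<close> generate
  a finite group up to scalars, averaging \<open>Y\<close> over it yields a partner commuting with both.
  Each of the two rounds costs a square root, whence \<open>\<epsilon>\<close> to the power \<open>1/4\<close>.\<close>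

section \<open>Operators on a complex Hilbert space\<close>

text \<open>All functional calculus comes from two devices: binomial series converging in norm, and
  strong limits of powers of a self-adjoint contraction. Whatever commutes with the data commutes
  with the result, and the result stays in any \<open>op_alg\<close>. The fixed points of
  \<open>S\<close> form one, weak continuity giving closure under strong limits, so working there
  makes every operator constructed \<open>S\<close>-symmetric.

  The square roots come from spectral projections, which a small perturbation controls only across a
  gap. Cutting at distance \<open>s\<close> inside the cell boundary leaves a gap
  \<open>2 * s\<close> between a cell and its translates, so a covariance error
  \<open>s\<^sup>2\<close> gives overlaps of order \<open>s\<^sup>2 / s\<close>, while the seam gets
  width of order \<open>s\<close>: the two losses balance.

  The second round exchanges the members of the pair. The unitary of the first round commutes with
  that of the second up to a scalar, which cancels in conjugations, so it passes through every
  construction; the one relation carried over this way is enough to read off the entries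
  \<open>U''\<close> and \<open>V''\<close>.\<close>

lemma scaleC_one [simp]: "1 *\<^sub>C (x::'a::complex_hilbert) = x"
  using scaleR_scaleC[of 1 x] by simp

lemma scaleC_zero_right [simp]: "c *\<^sub>C (0::'a::complex_hilbert) = 0"
  using scaleC_add_right[of c 0 0] by simp

lemma scaleC_minus_right: "c *\<^sub>C (- x::'a::complex_hilbert) = - (c *\<^sub>C x)"
  using scaleC_add_right[of c x "-x"] by (simp add: eq_neg_iff_add_eq_0 add.commute)

lemma scaleC_diff_right: "c *\<^sub>C (x - y::'a::complex_hilbert) = c *\<^sub>C x - c *\<^sub>C y"
  using scaleC_add_right[of c x "- y"] by (simp add: scaleC_minus_right)

lemma cinner_zero_right [simp]: "cinner x (0::'a::complex_hilbert) = 0"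
  using cinner_add_right[of x 0 0] by simp

lemma cinner_add_left: "cinner (x + y) (z::'a::complex_hilbert) = cinner x z + cinner y z"
  by (metis cinner_add_right cinner_commute complex_cnj_add)

lemma cinner_scaleC_left: "cinner (c *\<^sub>C x) (y::'a::complex_hilbert) = cnj c * cinner x y"
  by (metis cinner_scaleC_right cinner_commute complex_cnj_mult)

lemma cinner_self: "cinner x (x::'a::complex_hilbert) = of_real ((norm x)\<^sup>2)"
proof -
  have "Im (cinner x x) = 0"
    using arg_cong[OF cinner_commute[of x x], of Im] by simp
  moreover have "Re (cinner x x) = (norm x)\<^sup>2"
    by (simp add: power2_norm_eq_inner inner_eq_Re_cinner)
  ultimately show ?thesis by (simp add: complex_eq_iff)
qed

lemma norm_scaleC [simp]: "norm (c *\<^sub>C (x::'a::complex_hilbert)) = cmod c * norm x"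
proof -
  have "complex_of_real ((norm (c *\<^sub>C x))\<^sup>2) = (c * cnj c) * of_real ((norm x)\<^sup>2)"
    unfolding cinner_self[symmetric] cinner_scaleC_left cinner_scaleC_right by simp
  then have "complex_of_real ((norm (c *\<^sub>C x))\<^sup>2) = of_real ((cmod c * norm x)\<^sup>2)"
    by (simp add: complex_norm_square[symmetric] power_mult_distrib)
  then show ?thesis by (simp only: of_real_eq_iff power2_eq_iff_nonneg mult_nonneg_nonneg norm_ge_zero)
qed

lemma cinner_eq_inner: "cinner x (y::'a::complex_hilbert) = Complex (inner x y) (inner (\<i> *\<^sub>C x) y)"
  by (simp add: complex_eq_iff inner_eq_Re_cinner cinner_scaleC_left)

lemma cinner_ext:
  assumes "\<And>z. cinner x z = cinner y (z::'a::complex_hilbert)"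
  shows "x = y"
  using assms by (intro vector_eq_rdot[THEN iffD1]) (simp add: inner_eq_Re_cinner)

lemma bounded_linear_scaleC: "bounded_linear (\<lambda>x::'a::complex_hilbert. c *\<^sub>C x)"
proof (rule bounded_linear_intro[where K = "cmod c"])
  fix r :: real and x :: 'a
  show "c *\<^sub>C r *\<^sub>R x = r *\<^sub>R c *\<^sub>C x"
    by (simp add: scaleR_scaleC scaleC_scaleC mult.commute)
qed (simp_all add: scaleC_add_right mult.commute)

section \<open>Riesz representation and adjoints\<close>

text \<open>Meant for \<open>d\<close> the infimum of \<open>J\<close>: then \<open>par\<close> is
  the parallelogram law with the value of \<open>J\<close> at the midpoint estimated below by
  \<open>d\<close>, and \<open>lim\<close> describes a minimising sequence.\<close>

lemma Cauchy_of_parallelogram: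
  fixes J :: "'a::real_inner \<Rightarrow> real"
  assumes par: "\<And>x y. (norm (x - y))\<^sup>2 \<le> 2 * J x + 2 * J y - 4 * d"
    and lim: "\<And>n. J (x n) < d + 1 / Suc n"
  shows "Cauchy x"
proof (rule metric_CauchyI)
  fix e :: real assume "e > 0"
  then obtain N where N: "4 / Suc N < e\<^sup>2"
    using reals_Archimedean[of "e\<^sup>2/4"] by (auto simp: field_simps)
  have "dist (x i) (x j) < e" if "i \<ge> N" "j \<ge> N" for i j
  proof -
    have "1 / real (Suc i) \<le> 1 / Suc N" "1 / real (Suc j) \<le> 1 / Suc N"
      using that by (auto simp: field_simps)
    then have "(norm (x i - x j))\<^sup>2 < 4 / Suc N"
      using par[of "x i" "x j"] lim[of i] lim[of j] by simp
    then have "(norm (x i - x j))\<^sup>2 < e\<^sup>2" using N by simp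
    then show ?thesis using \<open>e > 0\<close> by (simp add: dist_norm power_less_imp_less_base)
  qed
  then show "\<exists>M. \<forall>m\<ge>M. \<forall>n\<ge>M. dist (x m) (x n) < e" by blast
qed

text \<open>The representing vector minimises \<open>\<parallel>x\<parallel>\<^sup>2 - 2 f x\<close>.\<close>

lemma riesz_real:
  fixes f :: "'a::{real_inner,complete_space} \<Rightarrow> real"
  assumes f: "bounded_linear f"
  obtains z where "\<And>y. inner z y = f y"
proof -
  interpret f: bounded_linear f by fact
  define J where "J x = (norm x)\<^sup>2 - 2 * f x" for x
  obtain K where K: "\<And>x. \<bar>f x\<bar> \<le> norm x * K" using f.bounded by auto
  have "J x \<ge> - K\<^sup>2" for x
  proof -
    have "f x \<le> norm x * K" using K[of x] by simp
    moreover have "0 \<le> (norm x - K)\<^sup>2" by simp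
    ultimately show ?thesis unfolding J_def by (simp add: power2_eq_square algebra_simps)
  qed
  then have bdd: "bdd_below (range J)" by (meson bdd_belowI2)
  define d where "d = Inf (range J)"
  have d_le: "d \<le> J x" for x unfolding d_def by (rule cInf_lower[OF _ bdd]) simp
  have "\<exists>x. J x < d + 1 / Suc n" for n
    using cInf_lessD[of "range J" "d + 1 / Suc n"] unfolding d_def by auto
  then obtain x where x: "\<And>n. J (x n) < d + 1 / Suc n" by metis
  have par: "(norm (x - y))\<^sup>2 \<le> 2 * J x + 2 * J y - 4 * d" for x y
  proof -
    have "4 * J ((1/2) *\<^sub>R (x + y)) = 2 * J x + 2 * J y - (norm (x - y))\<^sup>2"
      unfolding J_def
      by (simp add: f.scaleR f.add power2_norm_eq_inner inner_add inner_diff inner_commute algebra_simps)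
    then show ?thesis using d_le[of "(1/2) *\<^sub>R (x + y)"] by linarith
  qed
  have "Cauchy x" by (rule Cauchy_of_parallelogram[of J]) (use par x in auto)
  then obtain z where z: "x \<longlonglongrightarrow> z" using Cauchy_convergent convergent_def by blast
  have "(\<lambda>n. J (x n)) \<longlonglongrightarrow> J z"
    unfolding J_def by (intro tendsto_intros f.tendsto z)
  moreover have "(\<lambda>n. d + 1 / Suc n) \<longlonglongrightarrow> d + 0"
    by (intro tendsto_intros LIMSEQ_inverse_real_of_nat[unfolded inverse_eq_divide])
  ultimately have "J z \<le> d + 0"
    by (rule LIMSEQ_le) (use x less_imp_le in blast)
  then have Jz: "J z \<le> d" by simp
  have "inner z y = f y" for y
  proof -
    \<comment> \<open>First variation at the minimiser \<open>z\<close> in the direction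
      \<open>y\<close>; the value of \<open>t\<close> inserted below is the vertex of this
      parabola.\<close>
    have q: "0 \<le> t\<^sup>2 * (norm y)\<^sup>2 + 2 * t * (inner z y - f y)" for t
    proof -
      have "J (z + t *\<^sub>R y) \<ge> J z" using Jz d_le order_trans by blast
      moreover have "(norm (z + t *\<^sub>R y))\<^sup>2 = (norm z)\<^sup>2 + 2 * t * inner z y + t\<^sup>2 * (norm y)\<^sup>2"
        unfolding power2_norm_eq_inner
        by (simp add: inner_add inner_commute[of y z] power2_eq_square distrib_left distrib_right)
      ultimately show ?thesis unfolding J_def
        by (simp add: f.scaleR f.add algebra_simps)
    qed
    show ?thesis
    proof (cases "y = 0")
      case False
      define a where "a = inner z y - f y"
      have n: "(norm y)\<^sup>2 > 0" using False by simp
      have "0 \<le> (- a / (norm y)\<^sup>2)\<^sup>2 * (norm y)\<^sup>2 + 2 * (- a / (norm y)\<^sup>2) * a"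
        using q[of "- a / (norm y)\<^sup>2"] unfolding a_def .
      also have "\<dots> = - (a\<^sup>2 / (norm y)\<^sup>2)" using n by (simp add: field_simps power2_eq_square)
      finally have "a\<^sup>2 / (norm y)\<^sup>2 \<le> 0" by simp
      then show ?thesis using n by (simp add: a_def divide_le_0_iff power2_less_eq_zero_iff)
    qed (simp add: f.zero)
  qed
  then show thesis by (rule that)
qed

text \<open>The real Riesz theorem represents only the real part of \<open>cinner\<close>. The
  imaginary part is the real inner product with \<open>- \<i> *\<^sub>C y\<close>, so complex
  linearity of \<open>T\<close> supplies it.\<close>

lemma adjoint_exists:
  fixes T :: "'h::complex_hilbert op"
  assumes T: "clinear_op T"
  shows "\<exists>R. clinear_op R \<and> (\<forall>x y. cinner (blinfun_apply R x) y = cinner x (blinfun_apply T y))"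
proof -
  have "\<exists>z. \<forall>y. inner z y = inner x (blinfun_apply T y)" for x
    by (rule riesz_real[of "\<lambda>y. inner x (blinfun_apply T y)"])
       (auto intro: bounded_linear_inner_right_comp blinfun.bounded_linear_right)
  then obtain R where R: "\<And>x y. inner (R x) y = inner x (blinfun_apply T y)" by metis
  have bl: "bounded_linear R"
  proof (rule bounded_linear_intro[where K = "norm T"])
    show "R (x + y) = R x + R y" for x y
      by (rule vector_eq_rdot[THEN iffD1]) (simp add: inner_add_left R)
    show "R (r *\<^sub>R x) = r *\<^sub>R R x" for r x
      by (rule vector_eq_rdot[THEN iffD1]) (simp add: R)
    show "norm (R x) \<le> norm x * norm T" for x
    proof (cases "R x = 0")
      case False
      have "norm (R x) * norm (R x) = inner x (blinfun_apply T (R x))"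
        by (simp flip: R power2_norm_eq_inner add: power2_eq_square)
      also have "\<dots> \<le> norm x * norm (blinfun_apply T (R x))" by (rule norm_cauchy_schwarz)
      also have "\<dots> \<le> norm x * (norm T * norm (R x))" by (intro mult_left_mono norm_blinfun) simp
      finally show ?thesis using False by (simp add: mult.assoc[symmetric])
    qed simp
  qed
  have c: "cinner (R x) y = cinner x (blinfun_apply T y)" for x y
  proof (rule complex_eqI)
    have "Im (cinner (R x) y) = inner (R x) (- \<i> *\<^sub>C y)"
      by (simp add: inner_eq_Re_cinner cinner_scaleC_right)
    also have "\<dots> = inner x (- \<i> *\<^sub>C blinfun_apply T y)"
      unfolding R using T by (simp add: clinear_op_def)
    also have "\<dots> = Im (cinner x (blinfun_apply T y))"
      by (simp add: inner_eq_Re_cinner cinner_scaleC_right)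
    finally show "Im (cinner (R x) y) = Im (cinner x (blinfun_apply T y))" .
  qed (simp add: R flip: inner_eq_Re_cinner)
  have "clinear_op (Blinfun R)"
    unfolding clinear_op_def bounded_linear_Blinfun_apply[OF bl]
  proof (intro allI)
    show "R (a *\<^sub>C x) = a *\<^sub>C R x" for a x
      by (rule cinner_ext) (simp add: c cinner_scaleC_left)
  qed
  then show ?thesis using c by (intro exI[of _ "Blinfun R"]) (simp add: bounded_linear_Blinfun_apply[OF bl])
qed

lemma adj_op_ex1:
  fixes T :: "'h::complex_hilbert op"
  assumes "clinear_op T"
  shows "\<exists>!R. \<forall>x y. cinner (blinfun_apply R x) y = cinner x (blinfun_apply T y)"
proof -
  obtain R where R: "\<forall>x y. cinner (blinfun_apply R x) y = cinner x (blinfun_apply T y)"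
    using adjoint_exists[OF assms] by blast
  show ?thesis
  proof (rule ex1I[of _ R])
    show "\<forall>x y. cinner (blinfun_apply R x) y = cinner x (blinfun_apply T y)" by (fact R)
    fix R' assume "\<forall>x y. cinner (blinfun_apply R' x) y = cinner x (blinfun_apply T y)"
    with R show "R' = R" by (intro blinfun_eqI) (rule cinner_ext, simp)
  qed
qed

lemma cinner_adj_op:
  assumes "clinear_op (T::'h::complex_hilbert op)"
  shows "cinner (blinfun_apply (adj_op T) x) y = cinner x (blinfun_apply T y)"
  using theI'[OF adj_op_ex1[OF assms]] unfolding adj_op_def by blast

lemma clinear_adj_op:
  assumes "clinear_op (T::'h::complex_hilbert op)"
  shows "clinear_op (adj_op T)"
  unfolding clinear_op_def
proof (intro allI)
  show "blinfun_apply (adj_op T) (c *\<^sub>C x) = c *\<^sub>C blinfun_apply (adj_op T) x" for c x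
    by (rule cinner_ext) (simp add: cinner_adj_op[OF assms] cinner_scaleC_left)
qed

lemma scale_op_apply [simp]: "blinfun_apply (scale_op c T) x = c *\<^sub>C blinfun_apply T x"
  unfolding scale_op_def
  by (subst bounded_linear_Blinfun_apply)
     (auto intro: bounded_linear_compose[OF bounded_linear_scaleC] blinfun.bounded_linear_right)

lemma norm_scale_op: "norm (scale_op c T) = cmod c * norm T"
proof -
  have le: "norm (scale_op c T) \<le> cmod c * norm T" for c and T :: "'a op"
    by (rule norm_blinfun_bound) (auto simp: mult.assoc intro: mult_left_mono norm_blinfun)
  show ?thesis
  proof (cases "c = 0")
    case False
    have "scale_op (inverse c) (scale_op c T) = T"
      using False by (intro blinfun_eqI) (simp add: scaleC_scaleC)
    then have "norm T \<le> inverse (cmod c) * norm (scale_op c T)"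
      using le[of "inverse c" "scale_op c T"] by (simp add: norm_inverse)
    then show ?thesis using le[of c T] False by (simp add: field_simps)
  qed (use le[of 0 T] in simp)
qed

section \<open>The Banach algebra of complex-linear operators\<close>

typedef (overloaded) 'h cop = "{T :: 'h::complex_hilbert op. clinear_op T}"
  morphisms op_of cop_of
  by (intro exI[of _ 0]) (simp add: clinear_op_def)

setup_lifting type_definition_cop

text \<open>The unital normed-algebra class demands \<open>norm 1 = 1\<close>, which fails on the
  zero space; hence \<open>monoid_mult\<close>, with \<open>norm_one_le\<close> in place of that
  equation.\<close>

instantiation cop :: (complex_hilbert) "{real_normed_algebra, monoid_mult}"
begin

lift_definition zero_cop :: "'a cop" is 0 by (simp add: clinear_op_def)
lift_definition one_cop :: "'a cop" is id_blinfun by (simp add: clinear_op_def)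
lift_definition plus_cop :: "'a cop \<Rightarrow> 'a cop \<Rightarrow> 'a cop" is "(+)"
  by (simp add: clinear_op_def blinfun.add_left scaleC_add_right)
lift_definition uminus_cop :: "'a cop \<Rightarrow> 'a cop" is uminus
  by (simp add: clinear_op_def blinfun.minus_left scaleC_minus_right)
lift_definition minus_cop :: "'a cop \<Rightarrow> 'a cop \<Rightarrow> 'a cop" is "(-)"
  by (simp add: clinear_op_def blinfun.diff_left scaleC_diff_right)
lift_definition times_cop :: "'a cop \<Rightarrow> 'a cop \<Rightarrow> 'a cop" is "(o\<^sub>L)"
  by (simp add: clinear_op_def)
lift_definition scaleR_cop :: "real \<Rightarrow> 'a cop \<Rightarrow> 'a cop" is "(*\<^sub>R)"
  by (simp add: clinear_op_def blinfun.scaleR_left scaleR_scaleC scaleC_scaleC mult.commute)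
lift_definition norm_cop :: "'a cop \<Rightarrow> real" is norm .
definition dist_cop :: "'a cop \<Rightarrow> 'a cop \<Rightarrow> real" where "dist_cop S T = norm (S - T)"
definition sgn_cop :: "'a cop \<Rightarrow> 'a cop" where "sgn_cop S = inverse (norm S) *\<^sub>R S"
definition uniformity_cop :: "('a cop \<times> 'a cop) filter" where
  "uniformity_cop = (INF e\<in>{0<..}. principal {(x, y). dist x y < e})"
definition open_cop :: "'a cop set \<Rightarrow> bool" where
  "open_cop U = (\<forall>x\<in>U. \<forall>\<^sub>F (x', y) in uniformity. x' = x \<longrightarrow> y \<in> U)"

instance
proof
  fix x y z :: "'a cop" and a b :: real
  show "dist x y = norm (x - y)" by (rule dist_cop_def)
  show "sgn x = inverse (norm x) *\<^sub>R x" by (rule sgn_cop_def)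
  show "uniformity = (INF e\<in>{0<..}. principal {(x, y::'a cop). dist x y < e})"
    by (rule uniformity_cop_def)
  show "open U = (\<forall>x\<in>U. \<forall>\<^sub>F (x', y) in uniformity. x' = x \<longrightarrow> y \<in> U)" for U :: "'a cop set"
    by (rule open_cop_def)
  show "x * y * z = x * (y * z)" by transfer (simp add: blinfun_eqI)
  show "1 * x = x" "x * 1 = x" by (transfer, simp add: blinfun_eqI)+
  show "(x + y) * z = x * z + y * z" by transfer (rule blinfun_eqI, simp add: blinfun.add_left)
  show "x * (y + z) = x * y + x * z"
    by transfer (rule blinfun_eqI, simp add: blinfun.add_left blinfun.add_right)
  show "x + y + z = x + (y + z)" "x + y = y + x" "0 + x = x" "- x + x = 0" "x - y = x + - y"
    by (transfer, simp add: algebra_simps)+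
  show "a *\<^sub>R (x + y) = a *\<^sub>R x + a *\<^sub>R y" "(a + b) *\<^sub>R x = a *\<^sub>R x + b *\<^sub>R x"
    "a *\<^sub>R b *\<^sub>R x = (a * b) *\<^sub>R x" "1 *\<^sub>R x = x"
    by (transfer, simp add: algebra_simps)+
  show "a *\<^sub>R x * y = a *\<^sub>R (x * y)"
    by transfer (rule blinfun_eqI, simp add: blinfun.scaleR_left)
  show "x * a *\<^sub>R y = a *\<^sub>R (x * y)"
    by transfer (rule blinfun_eqI, simp add: blinfun.scaleR_left blinfun.scaleR_right)
  show "norm x = 0 \<longleftrightarrow> x = 0" by transfer simp
  show "norm (x + y) \<le> norm x + norm y" by transfer (rule norm_triangle_ineq)
  show "norm (a *\<^sub>R x) = \<bar>a\<bar> * norm x" by transfer simp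
  show "norm (x * y) \<le> norm x * norm y" by transfer (rule norm_blinfun_compose)
qed

end

instance complex_hilbert \<subseteq> banach ..

instance cop :: (complex_hilbert) banach
proof
  fix T :: "nat \<Rightarrow> 'a cop" assume "Cauchy T"
  then have "Cauchy (\<lambda>n. op_of (T n))"
    unfolding Cauchy_def dist_norm by transfer
  then have "convergent (\<lambda>n. op_of (T n))" by (rule Cauchy_convergent)
  then obtain L where L: "(\<lambda>n. op_of (T n)) \<longlonglongrightarrow> L" by (auto simp: convergent_def)
  have "clinear_op L"
    unfolding clinear_op_def
  proof (intro allI)
    fix c x
    have lim: "(\<lambda>n. blinfun_apply (op_of (T n)) y) \<longlonglongrightarrow> blinfun_apply L y" for y
      by (intro blinfun.tendsto L tendsto_const)
    have "(\<lambda>n. blinfun_apply (op_of (T n)) (c *\<^sub>C x)) \<longlonglongrightarrow> c *\<^sub>C blinfun_apply L x"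
      using op_of[of "T _"] bounded_linear.tendsto[OF bounded_linear_scaleC lim, of c x]
      by (simp add: clinear_op_def)
    then show "blinfun_apply L (c *\<^sub>C x) = c *\<^sub>C blinfun_apply L x"
      using lim LIMSEQ_unique by blast
  qed
  then have "op_of (cop_of L) = L" by (simp add: cop_of_inverse)
  then have "norm (T n - cop_of L) = norm (op_of (T n) - L)" for n
    by (simp add: norm_cop.rep_eq minus_cop.rep_eq)
  then have "(\<lambda>n. norm (T n - cop_of L)) \<longlonglongrightarrow> 0"
    using tendsto_norm_zero[OF LIM_zero[OF L]] by simp
  then have "T \<longlonglongrightarrow> cop_of L" by (rule LIM_zero_cancel[OF tendsto_norm_zero_cancel])
  then show "convergent T" by (rule convergentI)
qed

lift_definition app :: "'h::complex_hilbert cop \<Rightarrow> 'h \<Rightarrow> 'h" (infixr \<open>\<bullet>\<bullet>\<close> 72) is blinfun_apply .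
lift_definition sc :: "complex \<Rightarrow> 'h::complex_hilbert cop \<Rightarrow> 'h cop" is scale_op
  by (simp add: clinear_op_def scaleC_scaleC mult.commute)
lift_definition star :: "'h::complex_hilbert cop \<Rightarrow> 'h cop" (\<open>_\<^sup>\<star>\<close> [1000] 999) is adj_op
  by (rule clinear_adj_op)

lemma app_add [simp]: "(S + T) \<bullet>\<bullet> x = S \<bullet>\<bullet> x + T \<bullet>\<bullet> x"
  by transfer (simp add: blinfun.add_left)
lemma app_diff [simp]: "(S - T) \<bullet>\<bullet> x = S \<bullet>\<bullet> x - T \<bullet>\<bullet> x"
  by transfer (simp add: blinfun.diff_left)
lemma app_minus [simp]: "(- T) \<bullet>\<bullet> x = - (T \<bullet>\<bullet> x)"
  by transfer (simp add: blinfun.minus_left)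
lemma app_scaleR [simp]: "(r *\<^sub>R T) \<bullet>\<bullet> x = r *\<^sub>R (T \<bullet>\<bullet> x)"
  by transfer (simp add: blinfun.scaleR_left)
lemma app_zero [simp]: "0 \<bullet>\<bullet> x = 0" by transfer simp
lemma app_one [simp]: "1 \<bullet>\<bullet> x = x" by transfer simp
lemma app_times [simp]: "(S * T) \<bullet>\<bullet> x = S \<bullet>\<bullet> (T \<bullet>\<bullet> x)" by transfer simp
lemma app_sc [simp]: "sc c T \<bullet>\<bullet> x = c *\<^sub>C (T \<bullet>\<bullet> x)" by transfer simp
lemma app_add_right [simp]: "T \<bullet>\<bullet> (x + y) = T \<bullet>\<bullet> x + T \<bullet>\<bullet> y"
  by transfer (simp add: blinfun.add_right)
lemma app_diff_right [simp]: "T \<bullet>\<bullet> (x - y) = T \<bullet>\<bullet> x - T \<bullet>\<bullet> y"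
  by transfer (simp add: blinfun.diff_right)
lemma app_scaleC_right [simp]: "T \<bullet>\<bullet> (c *\<^sub>C x) = c *\<^sub>C (T \<bullet>\<bullet> x)"
  by transfer (simp add: clinear_op_def)
lemma app_zero_right [simp]: "T \<bullet>\<bullet> 0 = 0" by transfer simp
lemma app_sum [simp]: "(\<Sum>i\<in>I. T i) \<bullet>\<bullet> x = (\<Sum>i\<in>I. T i \<bullet>\<bullet> x)"
  by (induction I rule: infinite_finite_induct) auto

lemma norm_app: "norm (T \<bullet>\<bullet> x) \<le> norm T * norm x"
  by transfer (rule norm_blinfun)

lemma cop_eqI: "(\<And>x. S \<bullet>\<bullet> x = T \<bullet>\<bullet> x) \<Longrightarrow> S = T"
  by transfer (rule blinfun_eqI)

lemma norm_cop_bound: "0 \<le> K \<Longrightarrow> (\<And>x. norm (T \<bullet>\<bullet> x) \<le> K * norm x) \<Longrightarrow> norm T \<le> K"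
  by transfer (rule norm_blinfun_bound)

lemma bounded_linear_app: "bounded_linear (\<lambda>x. T \<bullet>\<bullet> x)"
  by transfer (rule blinfun.bounded_linear_right)

lemma bounded_linear_app_left: "bounded_linear (\<lambda>T. T \<bullet>\<bullet> x)"
  by (rule bounded_linear_intro[where K = "norm x"]) (use norm_app in auto)

lemma cop_of_map:
  assumes "\<And>x y. f (x + y) = f x + f y" and "\<And>c x. f (c *\<^sub>C x) = c *\<^sub>C f x"
    and "\<And>x. norm (f x) \<le> norm x * K"
  obtains T where "\<And>x. T \<bullet>\<bullet> x = f x"
proof -
  have bl: "bounded_linear f"
    by (rule bounded_linear_intro[where K = K]) (auto simp: assms(1,3) scaleR_scaleC assms(2))
  have "clinear_op (Blinfun f)"
    by (simp add: clinear_op_def bounded_linear_Blinfun_apply[OF bl] assms(2))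
  then have "cop_of (Blinfun f) \<bullet>\<bullet> x = f x" for x
    by (simp add: app.rep_eq cop_of_inverse bounded_linear_Blinfun_apply[OF bl])
  then show thesis by (rule that)
qed

lemma cinner_star: "cinner (T\<^sup>\<star> \<bullet>\<bullet> x) y = cinner x (T \<bullet>\<bullet> y)"
  by transfer (rule cinner_adj_op)

lemma cinner_star_right: "cinner x (T\<^sup>\<star> \<bullet>\<bullet> y) = cinner (T \<bullet>\<bullet> x) y"
  by (metis cinner_star cinner_commute)

lemma inner_star: "inner (T\<^sup>\<star> \<bullet>\<bullet> x) y = inner x (T \<bullet>\<bullet> y)"
  by (simp add: inner_eq_Re_cinner cinner_star)

lemma inner_star_right: "inner x (T\<^sup>\<star> \<bullet>\<bullet> y) = inner (T \<bullet>\<bullet> x) y"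
  by (simp add: inner_eq_Re_cinner cinner_star_right)

lemma star_eqI: "(\<And>x y. cinner (R \<bullet>\<bullet> x) y = cinner x (T \<bullet>\<bullet> y)) \<Longrightarrow> T\<^sup>\<star> = R"
  by (rule cop_eqI, rule cinner_ext) (simp add: cinner_star)

lemma star_star [simp]: "(T\<^sup>\<star>)\<^sup>\<star> = T"
  by (rule star_eqI) (simp add: cinner_star_right)

lemma star_mult [simp]: "(S * T)\<^sup>\<star> = T\<^sup>\<star> * S\<^sup>\<star>"
  by (rule star_eqI) (simp add: cinner_star)

lemma star_add [simp]: "(S + T)\<^sup>\<star> = S\<^sup>\<star> + T\<^sup>\<star>"
  by (rule star_eqI) (simp add: cinner_star cinner_add_left cinner_add_right)

lemma star_sc [simp]: "(sc c T)\<^sup>\<star> = sc (cnj c) (T\<^sup>\<star>)"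
  by (rule star_eqI) (simp add: cinner_star cinner_scaleC_left cinner_scaleC_right)

lemma star_zero [simp]: "0\<^sup>\<star> = (0::'h::complex_hilbert cop)"
  using star_add[of 0 0] by (metis add_cancel_right_left)

lemma star_one [simp]: "1\<^sup>\<star> = (1::'h::complex_hilbert cop)"
  by (rule star_eqI) simp

lemma star_minus [simp]: "(- T)\<^sup>\<star> = - (T\<^sup>\<star>)"
  using star_add[of T "- T"] by (simp add: eq_neg_iff_add_eq_0 add.commute)

lemma star_diff [simp]: "(S - T)\<^sup>\<star> = S\<^sup>\<star> - T\<^sup>\<star>"
  using star_add[of S "- T"] by simp

lemma star_power [simp]: "(T ^ n)\<^sup>\<star> = (T\<^sup>\<star>) ^ n"
  by (induction n) (simp_all add: power_commutes)

lemma star_sum [simp]: "(\<Sum>i\<in>I. T i)\<^sup>\<star> = (\<Sum>i\<in>I. (T i)\<^sup>\<star>)"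
  by (induction I rule: infinite_finite_induct) auto

lemma scaleR_sc: "r *\<^sub>R T = sc (of_real r) T"
  by (rule cop_eqI) (simp add: scaleR_scaleC)

lemma star_scaleR [simp]: "(r *\<^sub>R T)\<^sup>\<star> = r *\<^sub>R T\<^sup>\<star>"
  by (simp add: scaleR_sc)

lemma sc_mult_left [simp]: "sc c S * T = sc c (S * T)"
  by (rule cop_eqI) simp
lemma sc_mult_right [simp]: "S * sc c T = sc c (S * T)"
  by (rule cop_eqI) simp
lemma sc_sc [simp]: "sc c (sc d T) = sc (c * d) T"
  by (rule cop_eqI) (simp add: scaleC_scaleC)
lemma sc_one [simp]: "sc 1 T = T"
  by (rule cop_eqI) simp
lemma sc_add: "sc c (S + T) = sc c S + sc c T"
  by (rule cop_eqI) (simp add: scaleC_add_right)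
lemma sc_diff: "sc c (S - T) = sc c S - sc c T"
  by (rule cop_eqI) (simp add: scaleC_diff_right)
lemma sc_add_left: "sc (c + d) T = sc c T + sc d T"
  by (rule cop_eqI) (simp add: scaleC_add_left)
lemma sc_zero_right [simp]: "sc c 0 = 0"
  by (rule cop_eqI) simp
lemma sc_zero_left [simp]: "sc 0 T = 0"
  using scaleR_sc[of 0 T] by simp
lemma sc_minus_left [simp]: "sc (- c) T = - sc c T"
  using sc_add_left[of c "- c" T] by (simp add: eq_neg_iff_add_eq_0 add.commute)
lemma sc_sum: "sc c (\<Sum>i\<in>I. T i) = (\<Sum>i\<in>I. sc c (T i))"
  by (induction I rule: infinite_finite_induct) (auto simp: sc_add)
lemma sc_scaleR [simp]: "sc c (r *\<^sub>R T) = r *\<^sub>R sc c T"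
  by (simp add: scaleR_sc mult.commute)
lemma norm_sc [simp]: "norm (sc c T) = cmod c * norm T"
  by transfer (rule norm_scale_op)
lemma sc_power: "(sc c T) ^ n = sc (c ^ n) (T ^ n)"
  by (induction n) (auto simp: mult.commute)

lemma norm_power_Suc_le: "norm (T ^ Suc n) \<le> norm (T::'h::complex_hilbert cop) ^ Suc n"
proof (induction n)
  case (Suc n)
  have "norm (T ^ Suc (Suc n)) \<le> norm T * norm (T ^ Suc n)"
    unfolding power_Suc[of T "Suc n"] by (rule norm_mult_ineq)
  also have "\<dots> \<le> norm T * norm T ^ Suc n" by (intro mult_left_mono Suc) simp
  finally show ?case by simp
qed simp

text \<open>The two facts are proved together. \<open>sq\<close> follows from
  \<open>inner x ((T\<^sup>\<star> * T) \<bullet>\<bullet> x)\<close>; with submultiplicativity it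
  gives \<open>norm T \<le> norm (T\<^sup>\<star>)\<close>, hence equality by applying this to the
  adjoint, and the equality closes the remaining half of the identity.\<close>

lemma cstar_identity: "norm (T\<^sup>\<star> * T) = (norm T)\<^sup>2"
  and norm_star [simp]: "norm (T\<^sup>\<star>) = norm (T::'h::complex_hilbert cop)"
proof -
  have sq: "(norm T)\<^sup>2 \<le> norm (T\<^sup>\<star> * T)" for T :: "'h cop"
  proof -
    have "norm T \<le> sqrt (norm (T\<^sup>\<star> * T))"
    proof (rule norm_cop_bound)
      fix x
      have "(norm (T \<bullet>\<bullet> x))\<^sup>2 = inner x ((T\<^sup>\<star> * T) \<bullet>\<bullet> x)"
        by (simp add: power2_norm_eq_inner inner_star_right)
      also have "\<dots> \<le> norm x * (norm (T\<^sup>\<star> * T) * norm x)"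
        by (rule order_trans[OF norm_cauchy_schwarz]) (intro mult_left_mono norm_app norm_ge_zero)
      also have "\<dots> = (sqrt (norm (T\<^sup>\<star> * T)) * norm x)\<^sup>2"
        by (simp add: power_mult_distrib power2_eq_square)
      finally show "norm (T \<bullet>\<bullet> x) \<le> sqrt (norm (T\<^sup>\<star> * T)) * norm x"
        by (rule power2_le_imp_le) simp
    qed simp
    then have "(norm T)\<^sup>2 \<le> (sqrt (norm (T\<^sup>\<star> * T)))\<^sup>2" by (rule power_mono) simp
    then show ?thesis by simp
  qed
  have le: "norm T \<le> norm (T\<^sup>\<star>)" for T :: "'h cop"
  proof (cases "norm T = 0")
    case False
    have "norm T * norm T \<le> norm (T\<^sup>\<star>) * norm T"
      using sq[of T] norm_mult_ineq[of "T\<^sup>\<star>" T] by (simp add: power2_eq_square)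
    then show ?thesis using False by simp
  qed simp
  show n: "norm (T\<^sup>\<star>) = norm T" using le[of T] le[of "T\<^sup>\<star>"] by simp
  show "norm (T\<^sup>\<star> * T) = (norm T)\<^sup>2"
    using sq[of T] norm_mult_ineq[of "T\<^sup>\<star>" T] n by (simp add: power2_eq_square)
qed

lemma bounded_linear_star: "bounded_linear (star :: 'h::complex_hilbert cop \<Rightarrow> _)"
  by (rule bounded_linear_intro[where K = 1]) auto

section \<open>Binomial series\<close>

text \<open>The coefficient of \<open>x ^ n\<close> in \<open>(1 - x) powr (- s)\<close>.\<close>

definition bcoef :: "real \<Rightarrow> nat \<Rightarrow> real" where
  "bcoef s n = pochhammer s n / fact n"

lemma bcoef_0 [simp]: "bcoef s 0 = 1"
  by (simp add: bcoef_def)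

lemma bcoef_Suc: "bcoef s (Suc n) = bcoef s n * ((s + n) / Suc n)"
  by (simp add: bcoef_def pochhammer_Suc field_simps)

lemma bcoef_gchoose: "bcoef s n = (- 1) ^ n * (- s gchoose n)"
  by (simp add: bcoef_def gbinomial_pochhammer)

lemma bcoef_conv: "(\<Sum>i\<le>n. bcoef s i * bcoef t (n - i)) = bcoef (s + t) n"
proof -
  have "(\<Sum>i\<le>n. bcoef s i * bcoef t (n - i)) = (\<Sum>i\<le>n. (- 1) ^ n * ((- s gchoose i) * (- t gchoose (n - i))))"
    by (intro sum.cong refl) (auto simp: bcoef_gchoose simp flip: power_add)
  also have "\<dots> = (- 1) ^ n * ((- s + - t) gchoose n)"
    unfolding gbinomial_Vandermonde[of "- s" "- t" n, symmetric] sum_distrib_left atMost_atLeast0 ..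
  finally show ?thesis by (simp add: bcoef_gchoose add.commute)
qed

lemma bcoef_zero: "bcoef 0 n = (if n = 0 then 1 else 0)"
  by (cases n) (simp_all add: bcoef_def pochhammer_rec)

lemma bcoef_minus_one: "bcoef (- 1) n = (if n = 0 then 1 else if n = 1 then - 1 else 0)"
proof (induction n)
  case (Suc n)
  then show ?case by (cases "n = 0"; cases "n = 1") (auto simp: bcoef_Suc)
qed simp

lemma abs_bcoef_le: "\<bar>s\<bar> \<le> 1 \<Longrightarrow> \<bar>bcoef s n\<bar> \<le> 1"
proof (induction n)
  case (Suc n)
  have "\<bar>(s + n) / Suc n\<bar> \<le> 1" using Suc(2) by (auto simp: abs_le_iff field_simps)
  then show ?case using Suc unfolding bcoef_Suc abs_mult by (intro mult_le_one) auto
qed simp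

lemma bcoef_nonneg: "0 \<le> s \<Longrightarrow> 0 \<le> bcoef s n"
  by (induction n) (simp_all add: bcoef_Suc)

lemma bcoef_nonpos: "- 1 \<le> s \<Longrightarrow> s \<le> 0 \<Longrightarrow> bcoef s (Suc n) \<le> 0"
proof (induction n)
  case (Suc n)
  then show ?case unfolding bcoef_Suc[of s "Suc n"]
    by (intro mult_nonpos_nonneg divide_nonneg_nonneg) auto
qed (simp add: bcoef_Suc)

text \<open>Multiplying a power series by \<open>1 / (1 - x)\<close> turns its coefficients into
  their partial sums.\<close>

lemma sum_bcoef: "(\<Sum>i\<le>n. bcoef s i) = bcoef (s + 1) n"
proof (induction n)
  case (Suc n)
  have 1: "bcoef s (Suc n) * Suc n = s * bcoef (s + 1) n"
    by (simp add: bcoef_def pochhammer_rec add.commute del: of_nat_Suc)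
  have 2: "bcoef (s + 1) (Suc n) * Suc n = bcoef (s + 1) n * (s + 1 + n)"
    by (simp add: bcoef_Suc del: of_nat_Suc)
  have "(\<Sum>i\<le>Suc n. bcoef s i) * Suc n = bcoef (s + 1) n * Suc n + bcoef s (Suc n) * Suc n"
    using Suc by (simp add: distrib_right)
  also have "\<dots> = bcoef (s + 1) (Suc n) * Suc n"
    unfolding 1 2 by (simp add: algebra_simps)
  finally show ?case by simp
qed simp

text \<open>All coefficients after the first have the same sign, so the sums of absolute values are
  evaluated by \<open>sum_bcoef\<close> and stay below 1. This convergence at the boundary is what
  allows roots of positive operators with a kernel.\<close>

lemma summable_bcoef:
  assumes "- 1 \<le> s" "s \<le> 0"
  shows "summable (\<lambda>n. \<bar>bcoef s n\<bar>)"
proof -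
  have "summable (\<lambda>n. \<bar>bcoef s (Suc n)\<bar>)"
  proof (rule bounded_imp_summable[where B = 1])
    fix n
    have "(\<Sum>i\<le>n. \<bar>bcoef s (Suc i)\<bar>) = - (\<Sum>i\<le>n. bcoef s (Suc i))"
      using bcoef_nonpos[OF assms] by (simp add: sum_negf[symmetric] abs_of_nonpos)
    also have "\<dots> = 1 - bcoef (s + 1) (Suc n)"
      using sum_bcoef[of s "Suc n"] by (simp add: sum.atMost_Suc_shift del: sum.atMost_Suc)
    also have "\<dots> \<le> 1" using bcoef_nonneg[of "s + 1"] assms by simp
    finally show "(\<Sum>i\<le>n. \<bar>bcoef s (Suc i)\<bar>) \<le> 1" .
  qed simp
  then show ?thesis using summable_Suc_iff[of "\<lambda>n. \<bar>bcoef s n\<bar>"] by simp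
qed

text \<open>The operator \<open>1 - x\<close> to the power \<open>- s\<close>, so that
  \<open>bpow (1 / 2)\<close> is an inverse square root and \<open>bpow (- 1 / 2)\<close> a square
  root. Meaningful only under \<open>bpow_ok\<close>.\<close>

definition bpow :: "real \<Rightarrow> 'h::complex_hilbert cop \<Rightarrow> 'h cop" where
  "bpow s x = (\<Sum>n. bcoef s n *\<^sub>R x ^ n)"

text \<open>Kept as a predicate because convergence holds in two regimes: \<open>norm x < 1\<close>
  with any \<open>\<bar>s\<bar> \<le> 1\<close>, and \<open>norm x \<le> 1\<close> with
  \<open>s\<close> between \<open>- 1\<close> and 0. The algebraic laws serve both.\<close>

definition bpow_ok :: "real \<Rightarrow> 'h::complex_hilbert cop \<Rightarrow> bool" where
  "bpow_ok s x \<longleftrightarrow> summable (\<lambda>n. norm (bcoef s n *\<^sub>R x ^ n))"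

lemma norm_one_le: "norm (1::'h::complex_hilbert cop) \<le> 1"
  by (rule norm_cop_bound) auto

lemma norm_power_le: "norm ((x::'h::complex_hilbert cop) ^ n) \<le> norm x ^ n"
  using norm_power_Suc_le[of x] norm_one_le by (cases n) auto

lemma bpow_ok_lt1:
  assumes "\<bar>s\<bar> \<le> 1" "norm x < 1" shows "bpow_ok s x"
  unfolding bpow_ok_def
proof (rule summable_comparison_test)
  have "norm (bcoef s n *\<^sub>R x ^ n) \<le> 1 * norm x ^ n" for n
    unfolding norm_scaleR by (intro mult_mono abs_bcoef_le assms norm_power_le) auto
  then show "\<exists>N. \<forall>n\<ge>N. norm (norm (bcoef s n *\<^sub>R x ^ n)) \<le> norm x ^ n" by auto
  show "summable (\<lambda>n. norm x ^ n)" using assms by (simp add: summable_geometric)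
qed

lemma bpow_ok_le1:
  assumes "- 1 \<le> s" "s \<le> 0" "norm x \<le> 1" shows "bpow_ok s x"
  unfolding bpow_ok_def
proof (rule summable_comparison_test)
  have "norm (bcoef s n *\<^sub>R x ^ n) \<le> \<bar>bcoef s n\<bar> * 1" for n
    unfolding norm_scaleR
    by (intro mult_mono order_trans[OF norm_power_le] power_le_one assms) auto
  then show "\<exists>N. \<forall>n\<ge>N. norm (norm (bcoef s n *\<^sub>R x ^ n)) \<le> \<bar>bcoef s n\<bar>" by auto
qed (rule summable_bcoef[OF assms(1,2)])

lemma bpow_sums: "bpow_ok s x \<Longrightarrow> (\<lambda>n. bcoef s n *\<^sub>R x ^ n) sums bpow s x"
  unfolding bpow_ok_def bpow_def by (rule summable_sums[OF summable_norm_cancel])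

lemma bpow_mult:
  assumes "bpow_ok s x" "bpow_ok t x"
  shows "bpow s x * bpow t x = bpow (s + t) x"
proof -
  have "(\<lambda>n. \<Sum>i\<le>n. (bcoef s i *\<^sub>R x ^ i) * (bcoef t (n - i) *\<^sub>R x ^ (n - i))) sums (bpow s x * bpow t x)"
    using assms unfolding bpow_ok_def bpow_def by (rule Cauchy_product_sums)
  also have "(\<lambda>n. \<Sum>i\<le>n. (bcoef s i *\<^sub>R x ^ i) * (bcoef t (n - i) *\<^sub>R x ^ (n - i))) =
      (\<lambda>n. bcoef (s + t) n *\<^sub>R x ^ n)"
  proof
    fix n
    have "(\<Sum>i\<le>n. (bcoef s i *\<^sub>R x ^ i) * (bcoef t (n - i) *\<^sub>R x ^ (n - i))) =
        (\<Sum>i\<le>n. (bcoef s i * bcoef t (n - i)) *\<^sub>R x ^ n)"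
      by (intro sum.cong refl) (simp add: mult.commute flip: power_add)
    then show "(\<Sum>i\<le>n. (bcoef s i *\<^sub>R x ^ i) * (bcoef t (n - i) *\<^sub>R x ^ (n - i))) = bcoef (s + t) n *\<^sub>R x ^ n"
      by (simp add: bcoef_conv flip: scaleR_sum_left)
  qed
  finally show ?thesis unfolding bpow_def by (simp add: sums_iff)
qed

lemma bpow_0: "bpow 0 x = 1"
proof -
  have "(\<lambda>n. bcoef 0 n *\<^sub>R x ^ n) sums (\<Sum>n\<in>{0}. bcoef 0 n *\<^sub>R x ^ n)"
    by (rule sums_finite) (auto simp: bcoef_zero)
  then show ?thesis unfolding bpow_def by (simp add: sums_iff)
qed

lemma bpow_minus_one: "bpow (- 1) x = 1 - x"
proof -
  have "(\<lambda>n. bcoef (- 1) n *\<^sub>R x ^ n) sums (\<Sum>n\<in>{0,1}. bcoef (- 1) n *\<^sub>R x ^ n)"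
    by (rule sums_finite) (auto simp: bcoef_minus_one)
  then show ?thesis unfolding bpow_def by (simp add: sums_iff bcoef_minus_one)
qed

lemma bpow_power:
  assumes "norm x < 1" "\<bar>k * s\<bar> \<le> 1"
  shows "bpow s x ^ k = bpow (k * s) x"
  using assms(2)
proof (induction k)
  case (Suc k)
  have le: "\<bar>real k * s\<bar> \<le> \<bar>Suc k * s\<bar>" "\<bar>s\<bar> \<le> \<bar>Suc k * s\<bar>"
    by (auto simp: abs_mult mult_right_mono) (simp add: algebra_simps)
  then have "bpow s x * bpow (k * s) x = bpow (s + k * s) x"
    using Suc(2) by (intro bpow_mult bpow_ok_lt1 assms(1)) auto
  then show ?case using Suc le by (simp add: algebra_simps)
qed (simp add: bpow_0)

lemma bpow_inverse_root:
  assumes "norm x < 1" "k > 0"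
  shows "bpow (1 / k) x ^ k * (1 - x) = 1"
proof -
  have "bpow (1 / k) x ^ k * (1 - x) = bpow 1 x * bpow (- 1) x"
    using bpow_power[OF assms(1), of k "1 / k"] assms(2) by (simp add: bpow_minus_one)
  also have "\<dots> = bpow 0 x"
    by (subst bpow_mult) (auto intro: bpow_ok_lt1 assms)
  finally show ?thesis by (simp add: bpow_0)
qed

lemma power_intertwine:
  assumes "p * x = z * (p::'a::monoid_mult)" shows "p * x ^ n = z ^ n * p"
proof (induction n)
  case (Suc n)
  have "p * x ^ Suc n = (p * x) * x ^ n" by (simp add: mult.assoc)
  also have "\<dots> = z * (p * x ^ n)" by (simp add: assms mult.assoc)
  finally show ?case by (simp add: Suc mult.assoc)
qed simp

text \<open>The source of most symmetry clauses below: with \<open>z = x\<close> it says that the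
  commutant of \<open>x\<close> is contained in that of every power series in
  \<open>x\<close>.\<close>

lemma bpow_intertwine:
  assumes "p * x = z * p" "bpow_ok s x" "bpow_ok s z"
  shows "p * bpow s x = bpow s z * p"
proof -
  have "(\<lambda>n. p * (bcoef s n *\<^sub>R x ^ n)) sums (p * bpow s x)"
    by (rule sums_mult[OF bpow_sums[OF assms(2)]])
  moreover have "(\<lambda>n. (bcoef s n *\<^sub>R z ^ n) * p) sums (bpow s z * p)"
    by (rule sums_mult2[OF bpow_sums[OF assms(3)]])
  ultimately show ?thesis
    using power_intertwine[OF assms(1)] by (simp add: sums_iff)
qed

lemma star_bpow:
  assumes "bpow_ok s x" shows "(bpow s x)\<^sup>\<star> = bpow s (x\<^sup>\<star>)"
  using bounded_linear.sums[OF bounded_linear_star bpow_sums[OF assms]]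
  by (simp add: sums_iff bpow_def)

text \<open>Coefficients of modulus at most 1 give a geometric majorant; the factor 2 bounds
  \<open>1 / (1 - norm x)\<close>.\<close>

lemma norm_bpow_diff:
  assumes "\<bar>s\<bar> \<le> 1" "norm x \<le> 1 / 2"
  shows "norm (bpow s x - 1) \<le> 2 * norm x"
proof -
  have ok: "bpow_ok s x" by (rule bpow_ok_lt1) (use assms in auto)
  have *: "(\<lambda>n. bcoef s (Suc n) *\<^sub>R x ^ Suc n) sums (bpow s x - 1)"
    by (subst sums_Suc_iff[of "\<lambda>n. bcoef s n *\<^sub>R x ^ n"]) (simp add: bpow_sums[OF ok])
  have g: "(\<lambda>n. norm x * norm x ^ n) sums (norm x * (1 / (1 - norm x)))"
    by (intro sums_mult geometric_sums) (use assms in auto)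
  have "norm (bpow s x - 1) \<le> norm x * (1 / (1 - norm x))"
  proof (rule norm_sums_le[OF * g])
    fix n
    have "norm (bcoef s (Suc n) *\<^sub>R x ^ Suc n) \<le> 1 * norm x ^ Suc n"
      unfolding norm_scaleR by (intro mult_mono abs_bcoef_le assms norm_power_le) auto
    then show "norm (bcoef s (Suc n) *\<^sub>R x ^ Suc n) \<le> norm x * norm x ^ n" by simp
  qed
  also have "\<dots> \<le> norm x * 2" using assms(2) by (intro mult_left_mono) (auto simp: field_simps)
  finally show ?thesis by simp
qed

section \<open>Polar decompositions and projections in an operator algebra\<close>

text \<open>The unit \<open>E\<close> need not be the identity of the space, so that corners and
  matrix algebras are again instances. Closure is required for strong limits of sequences only, the
  form in which spectral projections arise here.\<close>

locale op_alg =
  fixes C :: "'h::complex_hilbert cop set" and E :: "'h cop"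
  assumes C_add: "S \<in> C \<Longrightarrow> T \<in> C \<Longrightarrow> S + T \<in> C"
    and C_mult: "S \<in> C \<Longrightarrow> T \<in> C \<Longrightarrow> S * T \<in> C"
    and C_sc: "T \<in> C \<Longrightarrow> sc c T \<in> C"
    and C_star: "T \<in> C \<Longrightarrow> T\<^sup>\<star> \<in> C"
    and C_lim: "(\<And>n. f n \<in> C) \<Longrightarrow> (\<And>x. (\<lambda>n. f n \<bullet>\<bullet> x) \<longlonglongrightarrow> T \<bullet>\<bullet> x) \<Longrightarrow> T \<in> C"
    and E_in: "E \<in> C"
    and E_left: "T \<in> C \<Longrightarrow> E * T = T"
    and E_right: "T \<in> C \<Longrightarrow> T * E = T"
begin

lemma E_idem: "E * E = E" by (rule E_left[OF E_in])

lemma E_star: "E\<^sup>\<star> = E"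
proof -
  have h: "E * E\<^sup>\<star> = E\<^sup>\<star>" by (rule E_left[OF C_star[OF E_in]])
  have "E * E\<^sup>\<star> = E" using arg_cong[OF h, of star] by (simp only: star_mult star_star)
  with h show ?thesis by simp
qed

lemma C_zero: "0 \<in> C" using C_sc[OF E_in, of 0] by simp
lemma C_minus: "T \<in> C \<Longrightarrow> - T \<in> C" using C_sc[of T "- 1"] by simp
lemma C_diff: "S \<in> C \<Longrightarrow> T \<in> C \<Longrightarrow> S - T \<in> C" using C_add[of S "- T"] C_minus by simp
lemma C_scaleR: "T \<in> C \<Longrightarrow> r *\<^sub>R T \<in> C" by (simp add: scaleR_sc C_sc)
lemma C_sum: "(\<And>i. i \<in> I \<Longrightarrow> T i \<in> C) \<Longrightarrow> (\<Sum>i\<in>I. T i) \<in> C"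
  by (induction I rule: infinite_finite_induct) (auto intro: C_zero C_add)
text \<open>The factor \<open>E\<close> is for \<open>n = 0\<close>: \<open>T ^ 0\<close> is the
  identity of the whole space, which may lie outside \<open>C\<close>. The same factor appears in
  \<open>C_bpow\<close>.\<close>

lemma C_power: "T \<in> C \<Longrightarrow> E * T ^ n \<in> C"
proof (induction n)
  case (Suc n)
  then have "E * T ^ Suc n = T * (E * T ^ n)"
    by (simp add: mult.assoc[symmetric] E_left E_right)
  then show ?case using Suc by (simp add: C_mult)
qed (simp add: E_in)
lemma C_power_pos: "T \<in> C \<Longrightarrow> n > 0 \<Longrightarrow> T ^ n \<in> C"
proof (induction n)
  case (Suc n) then show ?case by (cases n) (auto intro: C_mult)
qed simp

lemma C_lim_norm:
  assumes "\<And>n. f n \<in> C" "f \<longlonglongrightarrow> T" shows "T \<in> C"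
  by (rule C_lim[OF assms(1)])
     (rule bounded_linear.tendsto[OF bounded_linear_app_left assms(2)])

lemma C_bpow:
  assumes "x \<in> C" "bpow_ok s x" shows "E * bpow s x \<in> C"
proof (rule C_lim_norm)
  show "(\<lambda>N. \<Sum>n<N. E * (bcoef s n *\<^sub>R x ^ n)) \<longlonglongrightarrow> E * bpow s x"
    using sums_mult[OF bpow_sums[OF assms(2)], of E] unfolding sums_def .
qed (auto intro!: C_sum C_scaleR C_power assms)

end

definition proj :: "'h::complex_hilbert cop \<Rightarrow> bool" where
  "proj P \<longleftrightarrow> P * P = P \<and> P\<^sup>\<star> = P"

lemma proj_idem: "proj P \<Longrightarrow> P * P = P" and proj_star: "proj P \<Longrightarrow> P\<^sup>\<star> = P"
  by (auto simp: proj_def)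

lemma proj_app: "proj P \<Longrightarrow> P \<bullet>\<bullet> P \<bullet>\<bullet> x = P \<bullet>\<bullet> x"
  by (metis app_times proj_idem)

lemma proj_inner: "proj P \<Longrightarrow> inner (P \<bullet>\<bullet> x) y = inner x (P \<bullet>\<bullet> y)"
  by (metis inner_star proj_star)

lemma proj_norm_app: "proj P \<Longrightarrow> norm (P \<bullet>\<bullet> x) \<le> norm x"
proof -
  assume P: "proj P"
  have "(norm (P \<bullet>\<bullet> x))\<^sup>2 = inner (P \<bullet>\<bullet> x) x"
    using P by (simp add: power2_norm_eq_inner proj_inner proj_app inner_commute)
  also have "\<dots> \<le> norm (P \<bullet>\<bullet> x) * norm x" by (rule norm_cauchy_schwarz)
  finally show ?thesis by (cases "P \<bullet>\<bullet> x = 0") (auto simp: power2_eq_square)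
qed

lemma proj_norm: "proj P \<Longrightarrow> norm P \<le> 1"
  by (rule norm_cop_bound) (auto simp: proj_norm_app)

lemma proj_norm_lt1: "proj P \<Longrightarrow> norm P < 1 \<Longrightarrow> P = 0"
proof -
  assume P: "proj P" "norm P < 1"
  have "norm P \<le> norm P * norm P" using norm_mult_ineq[of P P] P(1) by (simp add: proj_idem)
  with P(2) show "P = 0" by (metis mult_le_cancel_left1 norm_eq_zero norm_ge_zero not_less order_antisym)
qed

lemma proj_diff:
  assumes "proj P" "proj R" "R * P = P" shows "proj (R - P)"
proof -
  have "(R * P)\<^sup>\<star> = P\<^sup>\<star>" using assms(3) by simp
  then have "P * R = P" by (simp add: proj_star[OF assms(1)] proj_star[OF assms(2)])
  then show ?thesis using assms by (simp add: proj_def algebra_simps)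
qed

lemma (in op_alg) proj_E: "proj E" by (simp add: proj_def E_idem E_star)

lemma commute_mult:
  fixes p :: "'a::semigroup_mult"
  assumes "p * a = a * p" "p * b = b * p" shows "p * (a * b) = a * b * p"
proof -
  have "p * (a * b) = a * (p * b)" using assms(1) by (simp flip: mult.assoc)
  then show ?thesis using assms(2) by (simp add: mult.assoc)
qed

lemma mult_norm_le:
  fixes S T :: "'h::complex_hilbert cop"
  assumes "norm S \<le> a" "norm T \<le> b" shows "norm (S * T) \<le> a * b"
  using norm_mult_ineq[of S T] mult_mono[OF assms] norm_ge_zero[of S] assms by (meson norm_ge_zero order_trans)

lemma unitary_norm_le:
  assumes "u\<^sup>\<star> * u = P" "proj P" shows "norm u \<le> 1"
proof -
  have "(norm u)\<^sup>2 \<le> 1" using cstar_identity[of u] proj_norm[OF assms(2)] assms(1) by simp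
  then show ?thesis using power2_le_imp_le[of "norm u" 1] by simp
qed

context op_alg
begin

text \<open>The witness is \<open>a\<close> times the inverse square root of
  \<open>a\<^sup>\<star> * a\<close>, taken in the corner of \<open>S\<close>. Then
  \<open>q\<^sup>\<star> * q = S\<close> by construction, while \<open>q * q\<^sup>\<star>\<close>
  is a projection below \<open>S\<close> at distance less than 1 from it, hence equal to
  \<open>S\<close>. If the scalars for \<open>a\<close> and its adjoint are inverse to each other,
  \<open>p\<close> commutes with \<open>a\<^sup>\<star> * a\<close> and so with the root.\<close>

lemma polar:
  assumes S: "S \<in> C" "proj S" and a: "a \<in> C" "S * a = a" "a * S = a"
    and k: "norm (a\<^sup>\<star> * a - S) \<le> k" "norm (a * a\<^sup>\<star> - S) \<le> k" "k \<le> 1 / 16"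
  shows "\<exists>q\<in>C. S * q = q \<and> q * S = q \<and> q\<^sup>\<star> * q = S \<and> q * q\<^sup>\<star> = S \<and> norm (q - a) \<le> 4 * k \<and>
    (\<forall>p l l'. p * a = sc l (a * p) \<longrightarrow> p * a\<^sup>\<star> = sc l' (a\<^sup>\<star> * p) \<longrightarrow> l * l' = 1 \<longrightarrow> p * S = S * p \<longrightarrow>
      p * q = sc l (q * p))"
proof -
  define x where "x = S - a\<^sup>\<star> * a"
  define R where "R = bpow (1 / 2) x"
  have SS: "S * S = S" "S\<^sup>\<star> = S" using S(2) by (auto simp: proj_def)
  have aS: "a\<^sup>\<star> * S = a\<^sup>\<star>" "S * a\<^sup>\<star> = a\<^sup>\<star>"
    using arg_cong[OF a(2), of star] arg_cong[OF a(3), of star] SS by auto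
  have k0: "0 \<le> k" using k(1) norm_ge_zero order_trans by blast
  have nx: "norm x \<le> k" using k(1) by (simp add: x_def norm_minus_commute)
  then have ok: "bpow_ok (1 / 2) x" "norm x < 1" using k(3) by (auto intro: bpow_ok_lt1)
  have Sx: "S * x = x" "x * S = x"
    by (simp_all add: x_def algebra_simps SS aS a) (simp_all flip: mult.assoc add: SS aS a)
  have xs: "x\<^sup>\<star> = x" by (simp add: x_def SS)
  have Rs: "R\<^sup>\<star> = R" using star_bpow[OF ok(1)] xs by (simp add: R_def)
  have RR: "R * R * (1 - x) = 1"
    using bpow_inverse_root[OF ok(2), of 2] by (simp add: R_def power2_eq_square)
  have comm: "p * R = R * p" if "p * x = x * p" for p
    unfolding R_def by (rule bpow_intertwine) (use that ok in auto)
  have SR: "S * R = R * S" "x * R = R * x" using comm Sx by auto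
  have xR: "(1 - x) * R = R * (1 - x)" by (simp add: algebra_simps SR)
  have a2: "a\<^sup>\<star> * a = S * (1 - x)" by (simp add: x_def algebra_simps SS) (simp flip: mult.assoc add: aS)
  define q where "q = a * R"
  have qC: "q \<in> C"
  proof -
    have "x \<in> C" by (auto simp: x_def intro: C_diff C_mult C_star S a)
    then have "a * (E * R) \<in> C" unfolding R_def by (intro C_mult a C_bpow ok)
    then show ?thesis by (simp add: q_def E_right[OF a(1)] flip: mult.assoc)
  qed
  have Sq: "S * q = q" "q * S = q"
    by (simp_all add: q_def a mult.assoc SR(1)[symmetric]) (simp_all flip: mult.assoc add: a)
  have qs: "q\<^sup>\<star> = R * a\<^sup>\<star>" by (simp add: q_def Rs)
  have "q\<^sup>\<star> * q = R * (a\<^sup>\<star> * a) * R" by (simp add: q_def Rs mult.assoc)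
  also have "\<dots> = S * (R * R * (1 - x))"
    unfolding a2 by (metis SR(1) xR mult.assoc)
  finally have qq: "q\<^sup>\<star> * q = S" by (simp add: RR)
  define N where "N = q * q\<^sup>\<star>"
  have N: "proj N" "S * N = N"
    using Sq qq by (auto simp: N_def proj_def) (metis mult.assoc)+
  have na: "norm a \<le> 2"
  proof -
    have "norm (a\<^sup>\<star> * a) \<le> norm S + norm (a\<^sup>\<star> * a - S)"
      using norm_triangle_ineq[of S "a\<^sup>\<star> * a - S"] by simp
    also have "\<dots> \<le> 2\<^sup>2" using proj_norm[OF S(2)] k by simp
    finally show ?thesis unfolding cstar_identity by (rule power2_le_imp_le) simp
  qed
  have R1: "norm (R - 1) \<le> 2 * k"
    unfolding R_def using norm_bpow_diff[of "1/2" x] nx k(3) by auto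
  have RR1: "norm (R * R - 1) \<le> 2 * k"
  proof -
    have "R * R = bpow 1 x" unfolding R_def by (subst bpow_mult) (use ok in auto)
    then show ?thesis using norm_bpow_diff[of 1 x] nx k(3) by auto
  qed
  have "N - S = a * ((R * R - 1) * a\<^sup>\<star>) + (a * a\<^sup>\<star> - S)"
    by (simp add: N_def q_def Rs algebra_simps)
  then have "norm (N - S) \<le> norm (a * ((R * R - 1) * a\<^sup>\<star>)) + norm (a * a\<^sup>\<star> - S)"
    using norm_triangle_ineq by metis
  also have "\<dots> \<le> 2 * (2 * k * 2) + k"
    by (intro add_mono k mult_norm_le na RR1) (simp add: na)
  finally have "norm (S - N) < 1" using k(3) by (simp add: norm_minus_commute)
  then have "N = S" using proj_norm_lt1[OF proj_diff[OF N(1) S(2) N(2)]] by simp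
  moreover have "norm (q - a) \<le> 4 * k"
  proof -
    have "q - a = a * (R - 1)" by (simp add: q_def algebra_simps)
    then show ?thesis using mult_norm_le[OF na R1] by simp
  qed
  moreover have "p * q = sc l (q * p)"
    if p: "p * a = sc l (a * p)" "p * a\<^sup>\<star> = sc l' (a\<^sup>\<star> * p)" "l * l' = 1" "p * S = S * p" for p l l'
  proof -
    have "p * (a\<^sup>\<star> * a) = sc l' (a\<^sup>\<star> * (p * a))"
      by (simp add: mult.assoc[symmetric] p) (simp add: p mult.assoc)
    also have "\<dots> = a\<^sup>\<star> * a * p" using p(3) by (simp add: p(1) mult.assoc mult.commute)
    finally have "p * x = x * p" by (simp add: x_def algebra_simps p(4))
    then have "p * R = R * p" by (rule comm)
    then show ?thesis by (simp add: q_def p(1) mult.assoc[symmetric]) (simp add: mult.assoc)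
  qed
  ultimately show ?thesis using qC Sq qq unfolding N_def by blast
qed

text \<open>The projection is \<open>(1 / 2) *\<^sub>R (E + s)\<close> with \<open>s\<close> the
  sign of \<open>2 *\<^sub>R G - E\<close>. Its square is \<open>E * (1 - x)\<close> for
  \<open>x = 4 *\<^sub>R (G - G * G)\<close>, which is small, so the inverse square root in the sign
  is a convergent series.\<close>

lemma near_projection:
  assumes G: "G \<in> C" "G\<^sup>\<star> = G" "norm (G * G - G) \<le> k" "k \<le> 1 / 16"
  shows "\<exists>T\<in>C. proj T \<and> norm (T - G) \<le> 8 * k \<and> (\<forall>p. p * G = G * p \<longrightarrow> p * E = E * p \<longrightarrow> p * T = T * p)"
proof -
  define x where "x = 4 *\<^sub>R (G - G * G)"
  define R where "R = bpow (1 / 2) x"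
  define s where "s = (2 *\<^sub>R G - E) * R"
  have EG: "E * G = G" "G * E = G" using G by (auto simp: E_left E_right)
  have EG2: "E * (G * y) = G * y" for y by (simp flip: mult.assoc add: EG)
  have k0: "0 \<le> k" using G(3) norm_ge_zero order_trans by blast
  have nx: "norm x \<le> 4 * k" using G(3) by (simp add: x_def norm_minus_commute)
  then have ok: "bpow_ok (1 / 2) x" "norm x < 1" using G(4) by (auto intro: bpow_ok_lt1)
  have xs: "x\<^sup>\<star> = x" by (simp add: x_def G)
  have xC: "x \<in> C" by (auto simp: x_def intro: C_diff C_mult C_scaleR G)
  have Rs: "R\<^sup>\<star> = R" using star_bpow[OF ok(1)] xs by (simp add: R_def)
  have RR: "R * R * (1 - x) = 1"
    using bpow_inverse_root[OF ok(2), of 2] by (simp add: R_def power2_eq_square)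
  have comm: "p * R = R * p" if "p * x = x * p" for p
    unfolding R_def by (rule bpow_intertwine) (use that ok in auto)
  have Gx: "G * x = x * G" by (simp add: x_def algebra_simps)
  have GE: "(2 *\<^sub>R G - E) * R = R * (2 *\<^sub>R G - E)"
    by (rule comm) (simp add: left_diff_distrib right_diff_distrib Gx E_left[OF xC] E_right[OF xC])
  have xR: "(1 - x) * R = R * (1 - x)" using comm[of x] by (simp add: algebra_simps)
  have ER: "E * R = R * E" by (rule comm) (simp add: E_left[OF xC] E_right[OF xC])
  have sq: "(2 *\<^sub>R G - E) * (2 *\<^sub>R G - E) = E * (1 - x)"
    by (simp add: x_def algebra_simps EG EG2 E_idem) (simp flip: scaleR_add_left)
  have "s * s = (2 *\<^sub>R G - E) * (R * (2 *\<^sub>R G - E)) * R" unfolding s_def by (simp add: mult.assoc)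
  also have "\<dots> = (2 *\<^sub>R G - E) * (2 *\<^sub>R G - E) * (R * R)" unfolding GE[symmetric] by (simp add: mult.assoc)
  also have "\<dots> = E * ((1 - x) * (R * R))" unfolding sq by (simp add: mult.assoc)
  also have "(1 - x) * (R * R) = R * R * (1 - x)" by (metis xR mult.assoc)
  finally have ss: "s * s = E" by (simp add: RR)
  have sst: "s\<^sup>\<star> = s" unfolding s_def by (simp add: Rs G E_star GE)
  have sE: "s = (2 *\<^sub>R G - E) * (E * R)"
    by (simp add: s_def algebra_simps) (simp flip: mult.assoc add: EG E_idem)
  have sC: "s \<in> C" unfolding sE R_def
    by (intro C_mult C_diff C_scaleR G E_in C_bpow xC ok)
  define T where "T = (1 / 2) *\<^sub>R (E + s)"
  have "proj T" using ss sst E_left[OF sC] E_right[OF sC]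
    by (simp add: proj_def T_def algebra_simps E_idem E_star flip: scaleR_add_left)
  moreover have "T \<in> C" unfolding T_def by (intro C_scaleR C_add E_in sC)
  moreover have "norm (T - G) \<le> 8 * k"
  proof -
    have "(norm (2 *\<^sub>R G - E))\<^sup>2 = norm (E * (1 - x))"
      using cstar_identity[of "2 *\<^sub>R G - E"] by (simp add: G E_star sq)
    also have "\<dots> \<le> 1 * (1 + norm x)"
      by (intro mult_norm_le proj_norm proj_E order_trans[OF norm_triangle_ineq4] add_mono norm_one_le order_refl)
    also have "\<dots> \<le> 2\<^sup>2" using nx G(4) by simp
    finally have n2: "norm (2 *\<^sub>R G - E) \<le> 2" by (rule power2_le_imp_le) simp
    have "T - G = (1 / 2) *\<^sub>R ((2 *\<^sub>R G - E) * (R - 1))"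
      by (simp add: T_def s_def algebra_simps)
    then have "norm (T - G) = 1 / 2 * norm ((2 *\<^sub>R G - E) * (R - 1))" by simp
    also have "\<dots> \<le> 1 / 2 * (2 * (2 * (4 * k)))"
      using norm_bpow_diff[of "1/2" x] nx G(4)
      by (intro mult_left_mono mult_norm_le n2) (auto simp: R_def)
    finally show ?thesis by simp
  qed
  moreover have "p * T = T * p" if p: "p * G = G * p" "p * E = E * p" for p
  proof -
    have "p * (G * G) = G * G * p" by (intro commute_mult p)
    then have "p * x = x * p" by (simp add: x_def algebra_simps p)
    then have "p * R = R * p" by (rule comm)
    moreover have "p * (2 *\<^sub>R G - E) = (2 *\<^sub>R G - E) * p" by (simp add: algebra_simps p)
    ultimately have "p * s = s * p" unfolding s_def by (intro commute_mult)
    then show ?thesis by (simp add: T_def algebra_simps p)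
  qed
  ultimately show ?thesis by blast
qed

end

section \<open>Spectral projections as strong limits of powers\<close>

lemma inner_power_self_adjoint:
  assumes "c\<^sup>\<star> = c"
  shows "inner (c ^ i \<bullet>\<bullet> x) (c ^ j \<bullet>\<bullet> x) = inner x (c ^ (i + j) \<bullet>\<bullet> x)"
proof -
  have "inner (c ^ i \<bullet>\<bullet> x) (c ^ j \<bullet>\<bullet> x) = inner x ((c ^ i)\<^sup>\<star> \<bullet>\<bullet> c ^ j \<bullet>\<bullet> x)"
    by (simp add: inner_star_right del: star_power)
  then show ?thesis by (simp add: assms power_add)
qed

text \<open>The squared norms \<open>N n\<close> of \<open>c ^ n \<bullet>\<bullet> x\<close>
  decrease, hence converge. For even exponents the mixed inner products are again values of
  \<open>N\<close>, so \<open>sq\<close> makes the vectors Cauchy. Odd powers would oscillate on the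
  eigenvalue \<open>- 1\<close>.\<close>

lemma strong_limit_powers:
  fixes c :: "'h::complex_hilbert cop"
  assumes c: "c\<^sup>\<star> = c" "norm c \<le> 1"
  obtains P where "proj P" "\<And>x. (\<lambda>n. c ^ (2 * n) \<bullet>\<bullet> x) \<longlonglongrightarrow> P \<bullet>\<bullet> x"
proof -
  have conv: "convergent (\<lambda>n. c ^ (2 * n) \<bullet>\<bullet> x)" for x
  proof -
    define N where "N n = (norm (c ^ n \<bullet>\<bullet> x))\<^sup>2" for n
    have "N (Suc n) \<le> N n" for n
    proof -
      have "norm (c \<bullet>\<bullet> c ^ n \<bullet>\<bullet> x) \<le> 1 * norm (c ^ n \<bullet>\<bullet> x)"
        by (rule order_trans[OF norm_app]) (intro mult_right_mono c norm_ge_zero)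
      then show ?thesis unfolding N_def by (intro power_mono) auto
    qed
    then have "decseq N" by (rule decseq_SucI)
    moreover have "\<forall>i. 0 \<le> N i" by (simp add: N_def)
    ultimately obtain L where L: "N \<longlonglongrightarrow> L" by (rule decseq_convergent)
    have sq: "(norm (c ^ (2 * i) \<bullet>\<bullet> x - c ^ (2 * j) \<bullet>\<bullet> x))\<^sup>2 = N (2 * i) + N (2 * j) - 2 * N (i + j)" for i j
    proof -
      have e: "2 * i + 2 * j = i + j + (i + j)" "2 * j + 2 * i = i + j + (i + j)" by simp_all
      show ?thesis
        unfolding N_def power2_norm_eq_inner inner_diff_left inner_diff_right
          inner_power_self_adjoint[OF c(1)] e by simp
    qed
    have "Cauchy (\<lambda>n. c ^ (2 * n) \<bullet>\<bullet> x)"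
    proof (rule metric_CauchyI)
      fix e :: real assume e: "e > 0"
      then obtain M where M: "\<And>n. n \<ge> M \<Longrightarrow> \<bar>N n - L\<bar> < e\<^sup>2 / 4"
        using LIMSEQ_D[OF L, of "e\<^sup>2 / 4"] by auto
      have "dist (c ^ (2 * i) \<bullet>\<bullet> x) (c ^ (2 * j) \<bullet>\<bullet> x) < e" if "i \<ge> M" "j \<ge> M" for i j
      proof -
        have "(norm (c ^ (2 * i) \<bullet>\<bullet> x - c ^ (2 * j) \<bullet>\<bullet> x))\<^sup>2 < e\<^sup>2"
          unfolding sq using M[of "2 * i"] M[of "2 * j"] M[of "i + j"] that by linarith
        then show ?thesis using e by (simp add: dist_norm power_less_imp_less_base)
      qed
      then show "\<exists>M. \<forall>i\<ge>M. \<forall>j\<ge>M. dist (c ^ (2 * i) \<bullet>\<bullet> x) (c ^ (2 * j) \<bullet>\<bullet> x) < e" by blast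
    qed
    then show ?thesis by (rule Cauchy_convergent)
  qed
  define f where "f x = lim (\<lambda>n. c ^ (2 * n) \<bullet>\<bullet> x)" for x
  have lim: "(\<lambda>n. c ^ (2 * n) \<bullet>\<bullet> x) \<longlonglongrightarrow> f x" for x
    using conv[of x] unfolding f_def by (simp add: convergent_LIMSEQ_iff)
  have norm_c: "norm (c ^ n) \<le> 1" for n
    using norm_power_le[of c n] power_le_one[of "norm c" n] c(2) by simp
  obtain P where P: "\<And>x. P \<bullet>\<bullet> x = f x"
  proof (rule cop_of_map)
    show "f (x + y) = f x + f y" for x y
      by (rule LIMSEQ_unique[OF lim]) (simp add: tendsto_add lim)
    show "f (k *\<^sub>C x) = k *\<^sub>C f x" for k x
      by (rule LIMSEQ_unique[OF lim])
         (simp add: bounded_linear.tendsto[OF bounded_linear_scaleC lim])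
    show "norm (f x) \<le> norm x * 1" for x
    proof (rule LIMSEQ_le_const2[OF tendsto_norm[OF lim]])
      have "norm (c ^ (2 * n) \<bullet>\<bullet> x) \<le> 1 * norm x" for n
        by (rule order_trans[OF norm_app]) (intro mult_right_mono norm_c norm_ge_zero)
      then show "\<exists>N. \<forall>n\<ge>N. norm (c ^ (2 * n) \<bullet>\<bullet> x) \<le> norm x * 1" by auto
    qed
  qed auto
  have limP: "(\<lambda>n. c ^ (2 * n) \<bullet>\<bullet> x) \<longlonglongrightarrow> P \<bullet>\<bullet> x" for x using lim by (simp add: P)
  have fix2: "c ^ 2 \<bullet>\<bullet> P \<bullet>\<bullet> x = P \<bullet>\<bullet> x" for x
  proof (rule LIMSEQ_unique)
    show "(\<lambda>n. c ^ 2 \<bullet>\<bullet> c ^ (2 * n) \<bullet>\<bullet> x) \<longlonglongrightarrow> c ^ 2 \<bullet>\<bullet> P \<bullet>\<bullet> x"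
      by (rule bounded_linear.tendsto[OF bounded_linear_app limP])
    show "(\<lambda>n. c ^ 2 \<bullet>\<bullet> c ^ (2 * n) \<bullet>\<bullet> x) \<longlonglongrightarrow> P \<bullet>\<bullet> x"
      using LIMSEQ_Suc[OF limP[of x]] by (simp add: power2_eq_square)
  qed
  have "c ^ (2 * n) \<bullet>\<bullet> P \<bullet>\<bullet> x = P \<bullet>\<bullet> x" for n x
  proof (induction n)
    case (Suc n)
    have "c ^ (2 * Suc n) \<bullet>\<bullet> P \<bullet>\<bullet> x = c ^ 2 \<bullet>\<bullet> c ^ (2 * n) \<bullet>\<bullet> P \<bullet>\<bullet> x"
      by (simp add: power2_eq_square)
    then show ?case by (simp only: Suc fix2)
  qed simp
  then have "P \<bullet>\<bullet> P \<bullet>\<bullet> x = P \<bullet>\<bullet> x" for x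
    using limP[of "P \<bullet>\<bullet> x"] LIMSEQ_unique[OF _ tendsto_const] by fastforce
  then have "P * P = P" by (intro cop_eqI) simp
  moreover have "P\<^sup>\<star> = P"
  proof (rule cop_eqI, rule vector_eq_rdot[THEN iffD1, rule_format])
    fix x y
    have l1: "(\<lambda>n. inner (c ^ (2 * n) \<bullet>\<bullet> x) y) \<longlonglongrightarrow> inner (P \<bullet>\<bullet> x) y"
      by (intro tendsto_intros limP)
    have l2: "(\<lambda>n. inner x (c ^ (2 * n) \<bullet>\<bullet> y)) \<longlonglongrightarrow> inner x (P \<bullet>\<bullet> y)"
      by (intro tendsto_intros limP)
    have e: "inner (c ^ (2 * n) \<bullet>\<bullet> x) y = inner x (c ^ (2 * n) \<bullet>\<bullet> y)" for n
      using inner_star[of "c ^ (2 * n)" x y] c(1) by simp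
    show "inner (P\<^sup>\<star> \<bullet>\<bullet> x) y = inner (P \<bullet>\<bullet> x) y"
      using LIMSEQ_unique[OF l1[unfolded e] l2] by (simp add: inner_star)
  qed
  ultimately show thesis using limP that by (auto simp: proj_def)
qed

lemma idem_commute_mult:
  fixes e :: "'a::semigroup_mult"
  assumes "e * e = e" "e * a = a * e" shows "(e * a) * (e * b) = e * (a * b)"
proof -
  have "(e * a) * (e * b) = e * (a * e) * b" by (simp add: mult.assoc)
  also have "\<dots> = (e * e) * a * b" by (simp add: mult.assoc flip: assms(2))
  finally show ?thesis by (simp add: assms(1) mult.assoc)
qed

context op_alg
begin

text \<open>\<open>B\<close> is \<open>|a| = (E - x) powr (1/2)\<close> with \<open>x = E - a\<^sup>2\<close>, its positivity being witnessed by the fourth root;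
  the projection \<open>P\<close> onto the kernel of \<open>|a| + a\<close> is the strong limit of the powers of \<open>E - (|a| + a)\<^sup>2\<close>.\<close>

lemma sign_projection_contraction:
  assumes a: "a \<in> C" "a\<^sup>\<star> = a" "norm a \<le> 1"
  shows "\<exists>Q\<in>C. proj Q \<and> Q * a = a * Q \<and> (\<forall>x. 0 \<le> inner (a \<bullet>\<bullet> Q \<bullet>\<bullet> x) (Q \<bullet>\<bullet> x)) \<and>
    (\<forall>x. inner (a \<bullet>\<bullet> (E - Q) \<bullet>\<bullet> x) ((E - Q) \<bullet>\<bullet> x) \<le> 0) \<and>
    (\<forall>p. p * a = a * p \<longrightarrow> p * E = E * p \<longrightarrow> p * Q = Q * p)"
proof -
  \<comment> \<open>Expanding the square loses twice the squared norm of
    \<open>b \<bullet>\<bullet> w\<close> and regains at most one of it. Applied to \<open>a\<close>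
    and later to the rescaled \<open>h\<close>.\<close>
  have contr: "norm (E - b * b) \<le> 1" if b: "b \<in> C" "b\<^sup>\<star> = b" "norm b \<le> 1" for b
  proof (rule norm_cop_bound)
    fix v
    define w where "w = E \<bullet>\<bullet> v"
    have Ew: "b \<bullet>\<bullet> w = b \<bullet>\<bullet> v" unfolding w_def by (metis app_times E_right[OF b(1)])
    have "(norm (w - b \<bullet>\<bullet> b \<bullet>\<bullet> w))\<^sup>2 = (norm w)\<^sup>2 - 2 * inner w (b \<bullet>\<bullet> b \<bullet>\<bullet> w) + (norm (b \<bullet>\<bullet> b \<bullet>\<bullet> w))\<^sup>2"
      unfolding power2_norm_eq_inner by (simp add: inner_diff inner_commute)
    also have "inner w (b \<bullet>\<bullet> b \<bullet>\<bullet> w) = (norm (b \<bullet>\<bullet> w))\<^sup>2"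
      using inner_star[of b w "b \<bullet>\<bullet> w"] b(2) by (simp add: power2_norm_eq_inner)
    also have "(norm (b \<bullet>\<bullet> b \<bullet>\<bullet> w))\<^sup>2 \<le> (1 * norm (b \<bullet>\<bullet> w))\<^sup>2"
      by (intro power_mono order_trans[OF norm_app] mult_right_mono b) auto
    finally have "(norm (w - b \<bullet>\<bullet> b \<bullet>\<bullet> w))\<^sup>2 \<le> (norm w)\<^sup>2"
      using zero_le_power2[of "norm (b \<bullet>\<bullet> w)"] unfolding mult_1 by linarith
    then have "norm (w - b \<bullet>\<bullet> b \<bullet>\<bullet> w) \<le> norm w" by (rule power2_le_imp_le) simp
    then show "norm ((E - b * b) \<bullet>\<bullet> v) \<le> 1 * norm v"
      using proj_norm_app[OF proj_E, of v] by (simp add: Ew) (simp add: w_def)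
  qed simp
  define x where "x = E - a * a"
  have xC: "x \<in> C" by (auto simp: x_def intro: E_in C_diff C_mult a)
  have nx: "norm x \<le> 1" unfolding x_def by (rule contr) (fact a)+
  \<comment> \<open>Only \<open>norm x \<le> 1\<close> is available, since \<open>a\<close> may have
    a kernel; the exponents are therefore taken where the series converges up to the
    boundary.\<close>
  have ok: "bpow_ok (- 1/4) x" "bpow_ok (- 1/2) x" using nx by (auto intro: bpow_ok_le1)
  define D where "D = bpow (- 1/4) x"
  have comm: "p * D = D * p" if "p * x = x * p" for p
    unfolding D_def by (rule bpow_intertwine) (use that ok in auto)
  have xs: "x\<^sup>\<star> = x" by (simp add: x_def E_star a)
  have Ds: "D\<^sup>\<star> = D" using star_bpow[OF ok(1)] xs by (simp add: D_def)
  have ED: "E * D = D * E" by (rule comm) (simp add: E_left[OF xC] E_right[OF xC])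
  have Ea: "E * a = a" "a * E = a" using a by (auto intro: E_left E_right)
  have ax: "a * x = x * a" by (simp add: x_def algebra_simps Ea)
  have aD: "a * D = D * a" by (rule comm[OF ax])
  define F where "F = E * D"
  have FC: "F \<in> C" unfolding F_def D_def by (intro C_bpow xC ok)
  have Fs: "F\<^sup>\<star> = F" by (simp add: F_def Ds E_star ED)
  have EF: "E * F = F" "F * E = F" by (rule E_left[OF FC], rule E_right[OF FC])
  define B where "B = F * F"
  have BC: "B \<in> C" by (simp add: B_def C_mult FC)
  have Bs: "B\<^sup>\<star> = B" by (simp add: B_def Fs)
  have Fc: "p * F = F * p" if "p * a = a * p" "p * E = E * p" for p
  proof -
    have "p * x = x * p"
      using commute_mult[of p a a, OF that(1) that(1)] that(2) by (simp add: x_def right_diff_distrib left_diff_distrib)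
    then show ?thesis unfolding F_def by (intro commute_mult that comm)
  qed
  have Bc: "p * B = B * p" if "p * a = a * p" "p * E = E * p" for p
    unfolding B_def by (intro commute_mult Fc that)
  have B2: "B * B = a * a"
  proof -
    have "F * F = E * (D * D)" unfolding F_def by (rule idem_commute_mult[OF E_idem ED])
    also have "D * D = bpow (- 1/2) x" unfolding D_def by (subst bpow_mult) (use ok in auto)
    finally have B: "B = E * bpow (- 1/2) x" by (simp add: B_def)
    have EH: "E * bpow (- 1/2) x = bpow (- 1/2) x * E"
      by (rule bpow_intertwine) (use ok E_left[OF xC] E_right[OF xC] in auto)
    have "B * B = E * (bpow (- 1/2) x * bpow (- 1/2) x)" unfolding B by (rule idem_commute_mult[OF E_idem EH])
    also have "bpow (- 1/2) x * bpow (- 1/2) x = bpow (- 1) x" by (subst bpow_mult) (use ok in auto)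
    finally show ?thesis by (simp add: bpow_minus_one x_def right_diff_distrib E_idem Ea flip: mult.assoc)
  qed
  have Bpos: "0 \<le> inner (B \<bullet>\<bullet> v) v" for v
    using inner_star[of F "F \<bullet>\<bullet> v" v] by (simp add: B_def Fs)
  have Ba: "a * B = B * a" by (rule Bc) (simp_all add: Ea)
  define r where "r = max 1 (norm (B + a))"
  define h where "h = (1 / r) *\<^sub>R (B + a)"
  have "norm (B + a) \<le> r" "r > 0" by (auto simp: r_def)
  then have r: "r > 0" "norm h \<le> 1" by (simp_all add: h_def del: scaleR_right_distrib)
  have hC: "h \<in> C" unfolding h_def by (intro C_scaleR C_add BC a)
  have hs: "h\<^sup>\<star> = h" by (simp add: h_def Bs a)
  define c where "c = E - h * h"
  have cC: "c \<in> C" unfolding c_def by (intro C_diff C_mult E_in hC)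
  have cs: "c\<^sup>\<star> = c" by (simp add: c_def hs E_star)
  have nc: "norm c \<le> 1" unfolding c_def by (rule contr[OF hC hs r(2)])
  obtain P where P: "proj P" and lim: "\<And>v. (\<lambda>n. c ^ (2 * n) \<bullet>\<bullet> v) \<longlonglongrightarrow> P \<bullet>\<bullet> v"
    using strong_limit_powers[OF cs nc] by blast
  have PC: "P \<in> C"
    by (rule C_lim[where f = "\<lambda>n. c ^ (2 * Suc n)"])
       (rule C_power_pos, auto intro: cC LIMSEQ_Suc[OF lim] simp del: mult_Suc_right)
  have Pc: "p * P = P * p" if "p * c = c * p" for p
  proof (rule cop_eqI)
    fix v
    have "(\<lambda>n. p \<bullet>\<bullet> c ^ (2 * n) \<bullet>\<bullet> v) \<longlonglongrightarrow> p \<bullet>\<bullet> P \<bullet>\<bullet> v"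
      by (rule bounded_linear.tendsto[OF bounded_linear_app lim])
    moreover have "p \<bullet>\<bullet> c ^ (2 * n) \<bullet>\<bullet> v = c ^ (2 * n) \<bullet>\<bullet> p \<bullet>\<bullet> v" for n
      using power_intertwine[OF that, of "2 * n"] by (metis app_times)
    ultimately show "(p * P) \<bullet>\<bullet> v = (P * p) \<bullet>\<bullet> v"
      using LIMSEQ_unique[of _ "p \<bullet>\<bullet> P \<bullet>\<bullet> v", OF _ lim[of "p \<bullet>\<bullet> v"]] by simp
  qed
  \<comment> \<open>Vectors in the range of \<open>P\<close> keep their norm under
    \<open>c = E - h * h\<close>, whereas the expanded square shows a loss of at least the squared
    norm of \<open>h \<bullet>\<bullet> w\<close>.\<close>
  have hP: "h \<bullet>\<bullet> P \<bullet>\<bullet> v = 0" for v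
  proof -
    define w where "w = P \<bullet>\<bullet> v"
    have wE: "E \<bullet>\<bullet> w = w" unfolding w_def by (metis app_times E_left[OF PC])
    have le: "norm (c \<bullet>\<bullet> y) \<le> norm y" for y
      using norm_app[of c y] mult_right_mono[OF nc, of "norm y"] by simp
    have "norm (c ^ n \<bullet>\<bullet> w) \<le> norm (c \<bullet>\<bullet> w)" if "n > 0" for n
      using that
    proof (induction n)
      case (Suc n)
      then show ?case using le[of "c ^ n \<bullet>\<bullet> w"] by (cases "n = 0") auto
    qed simp
    then have "norm (P \<bullet>\<bullet> w) \<le> norm (c \<bullet>\<bullet> w)"
      by (intro LIMSEQ_le_const2[OF tendsto_norm[OF lim]] exI[of _ 1]) auto
    then have "norm w \<le> norm (c \<bullet>\<bullet> w)" by (simp add: w_def proj_app[OF P])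
    then have 1: "(norm w)\<^sup>2 \<le> (norm (w - h \<bullet>\<bullet> h \<bullet>\<bullet> w))\<^sup>2"
      by (intro power_mono) (auto simp: c_def wE)
    have "(norm (w - h \<bullet>\<bullet> h \<bullet>\<bullet> w))\<^sup>2 = (norm w)\<^sup>2 - 2 * inner w (h \<bullet>\<bullet> h \<bullet>\<bullet> w) + (norm (h \<bullet>\<bullet> h \<bullet>\<bullet> w))\<^sup>2"
      unfolding power2_norm_eq_inner by (simp add: inner_diff inner_commute)
    also have "inner w (h \<bullet>\<bullet> h \<bullet>\<bullet> w) = (norm (h \<bullet>\<bullet> w))\<^sup>2"
      using inner_star[of h w "h \<bullet>\<bullet> w"] hs by (simp add: power2_norm_eq_inner)
    also have "(norm (h \<bullet>\<bullet> h \<bullet>\<bullet> w))\<^sup>2 \<le> (1 * norm (h \<bullet>\<bullet> w))\<^sup>2"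
      by (intro power_mono order_trans[OF norm_app] mult_right_mono r) auto
    finally have "(norm (h \<bullet>\<bullet> w))\<^sup>2 \<le> 0" using 1 unfolding mult_1 by linarith
    then show ?thesis by (simp add: w_def)
  qed
  have BaP: "(B + a) * P = 0"
  proof (rule cop_eqI)
    fix v
    have "(B + a) \<bullet>\<bullet> P \<bullet>\<bullet> v = r *\<^sub>R (h \<bullet>\<bullet> P \<bullet>\<bullet> v)" using r(1) by (simp add: h_def)
    then show "((B + a) * P) \<bullet>\<bullet> v = 0 \<bullet>\<bullet> v" by (simp add: hP)
  qed
  \<comment> \<open>Since \<open>B * B = a * a\<close> and the two commute,
    \<open>(B + a) * (B - a) = 0\<close>. So \<open>c\<close> fixes the range of
    \<open>B - a\<close>, and the limit \<open>P\<close> absorbs it: on \<open>E - P\<close> the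
    operators \<open>a\<close> and \<open>B\<close> agree, on \<open>P\<close> they are
    opposite.\<close>
  have h0: "h * (B - a) = 0" by (simp add: h_def algebra_simps B2 Ba)
  have PBa: "P * (B - a) = B - a"
  proof (rule cop_eqI)
    fix v
    have cfix: "c \<bullet>\<bullet> (B - a) \<bullet>\<bullet> y = (B - a) \<bullet>\<bullet> y" for y
    proof -
      have "c * (B - a) = E * (B - a) - h * (h * (B - a))" by (simp add: c_def left_diff_distrib mult.assoc)
      also have "\<dots> = B - a" using E_left[OF C_diff[OF BC a(1)]] h0 by simp
      finally show ?thesis by (metis app_times)
    qed
    have "c ^ n \<bullet>\<bullet> (B - a) \<bullet>\<bullet> v = (B - a) \<bullet>\<bullet> v" for n
      by (induction n) (simp_all only: power_Suc app_times cfix power_0 app_one)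
    then show "(P * (B - a)) \<bullet>\<bullet> v = (B - a) \<bullet>\<bullet> v"
      using lim[of "(B - a) \<bullet>\<bullet> v"] LIMSEQ_unique[OF _ tendsto_const] by simp
  qed
  have BaQ: "(B - a) * P = B - a"
    using arg_cong[OF PBa, of star] by (simp only: star_mult star_diff Bs a proj_star[OF P])
  define Q where "Q = E - P"
  have EP: "E * P = P" by (rule E_left[OF PC])
  have pQ: "proj Q" unfolding Q_def by (rule proj_diff[OF P proj_E EP])
  have aQ: "a * Q = B * Q"
    using BaQ by (simp add: Q_def algebra_simps Ea E_right[OF BC])
  have aP: "a * P = - (B * P)" using BaP by (simp add: algebra_simps eq_neg_iff_add_eq_0)
  have qa: "p * Q = Q * p" if p: "p * a = a * p" "p * E = E * p" for p
  proof -
    have "p * h = h * p" using Bc[OF p] p(1) by (simp add: h_def algebra_simps)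
    then have "p * c = c * p" using p(2) commute_mult[of p h h] by (simp add: c_def algebra_simps)
    then show ?thesis using Pc p(2) by (simp add: Q_def algebra_simps)
  qed
  have "Q * a = a * Q" using qa[of a] by (simp add: Ea)
  moreover have "0 \<le> inner (a \<bullet>\<bullet> Q \<bullet>\<bullet> v) (Q \<bullet>\<bullet> v)" for v
    using Bpos[of "Q \<bullet>\<bullet> v"] aQ by (metis app_times)
  moreover have "inner (a \<bullet>\<bullet> (E - Q) \<bullet>\<bullet> v) ((E - Q) \<bullet>\<bullet> v) \<le> 0" for v
  proof -
    have "a \<bullet>\<bullet> P \<bullet>\<bullet> v = - (B \<bullet>\<bullet> P \<bullet>\<bullet> v)" using aP by (metis app_times app_minus)
    then show ?thesis using Bpos[of "P \<bullet>\<bullet> v"] by (simp add: Q_def)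
  qed
  moreover have "Q \<in> C" unfolding Q_def by (intro C_diff E_in PC)
  ultimately show ?thesis using pQ qa by blast
qed

text \<open>Stands in for the spectral theorem: applied to \<open>A - t *\<^sub>R E\<close> it cuts
  the spectrum of \<open>A\<close> at \<open>t\<close>, with inequalities of quadratic forms instead
  of a spectral measure.\<close>

lemma sign_projection:
  assumes A: "A \<in> C" "A\<^sup>\<star> = A"
  shows "\<exists>Q\<in>C. proj Q \<and> Q * A = A * Q \<and> (\<forall>x. 0 \<le> inner (A \<bullet>\<bullet> Q \<bullet>\<bullet> x) (Q \<bullet>\<bullet> x)) \<and>
    (\<forall>x. inner (A \<bullet>\<bullet> (E - Q) \<bullet>\<bullet> x) ((E - Q) \<bullet>\<bullet> x) \<le> 0) \<and>
    (\<forall>p. p * A = A * p \<longrightarrow> p * E = E * p \<longrightarrow> p * Q = Q * p)"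
proof -
  define r where "r = max 1 (norm A)"
  have r: "r > 0" by (simp add: r_def)
  define a where "a = (1 / r) *\<^sub>R A"
  have "norm A \<le> r" by (simp add: r_def)
  then have a: "a \<in> C" "a\<^sup>\<star> = a" "norm a \<le> 1"
    using A r by (auto simp: a_def intro: C_scaleR)
  obtain Q where Q: "Q \<in> C" "proj Q" "Q * a = a * Q"
    "\<And>x. 0 \<le> inner (a \<bullet>\<bullet> Q \<bullet>\<bullet> x) (Q \<bullet>\<bullet> x)"
    "\<And>x. inner (a \<bullet>\<bullet> (E - Q) \<bullet>\<bullet> x) ((E - Q) \<bullet>\<bullet> x) \<le> 0"
    "\<And>p. p * a = a * p \<Longrightarrow> p * E = E * p \<Longrightarrow> p * Q = Q * p"
    using sign_projection_contraction[OF a] by blast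
  have Aa: "A = r *\<^sub>R a" using r by (simp add: a_def)
  show ?thesis
  proof (intro bexI[OF _ Q(1)] conjI allI impI Q(2))
    show "Q * A = A * Q" by (simp add: Aa Q(3))
    show "0 \<le> inner (A \<bullet>\<bullet> Q \<bullet>\<bullet> x) (Q \<bullet>\<bullet> x)" for x using Q(4)[of x] r by (simp add: Aa)
    show "inner (A \<bullet>\<bullet> (E - Q) \<bullet>\<bullet> x) ((E - Q) \<bullet>\<bullet> x) \<le> 0" for x
      using Q(5)[of x] r by (simp add: Aa mult_le_0_iff del: app_diff)
    show "p * Q = Q * p" if "p * A = A * p" "p * E = E * p" for p
      using that Q(6)[of p] by (simp add: a_def)
  qed
qed

end

section \<open>Orthogonalising almost orthogonal projections\<close>

text \<open>The bound is applied to the maximum of the family. In \<open>orthogonalize\<close> it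
  upgrades estimates to exact equalities.\<close>

lemma small_family_zero:
  fixes f :: "nat \<Rightarrow> real"
  assumes "\<And>j. 0 \<le> f j" and "\<And>j B. j < m \<Longrightarrow> (\<And>i. i < m \<Longrightarrow> f i \<le> B) \<Longrightarrow> f j \<le> c * B"
    and "c < 1" "j < m"
  shows "f j = 0"
proof -
  define B where "B = Max (f ` {..<m})"
  have le: "f i \<le> B" if "i < m" for i unfolding B_def using that by simp
  have "B \<in> f ` {..<m}" unfolding B_def using assms(4) by (intro Max_in) auto
  then have "B \<le> c * B" using assms(2) le by auto
  then have "(1 - c) * B \<le> 0" by (simp add: algebra_simps)
  then have "B \<le> 0" using assms(3) by (simp add: mult_le_0_iff)
  then show ?thesis using le[OF assms(4)] assms(1)[of j] by simp
qed

lemma norm_sum_le_card: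
  assumes "\<And>i. i < m \<Longrightarrow> norm (f i) \<le> t"
  shows "norm (\<Sum>i<m. f i) \<le> real m * t"
  using sum_norm_bound[of "{..<m}" f t] assms by simp

lemma proj_left_absorb: "proj S \<Longrightarrow> norm (S * T) \<le> norm T"
  using mult_norm_le[OF proj_norm order_refl] by simp

text \<open>This is symmetric (Loewdin) orthogonalisation: \<open>G\<close> is almost idempotent,
  \<open>P\<close> is the projection next to it, and \<open>R\<close> is the inverse square root of
  \<open>G\<close> on the range of \<open>P\<close>. The operators \<open>R * T j\<close> then have
  mutually orthogonal ranges adding up to \<open>P\<close>. Unlike a successive procedure it singles
  out no index, so a unitary that permutes the \<open>T j\<close> commutes with \<open>P\<close> and
  \<open>R\<close>.\<close>

lemma (in op_alg) orthogonalize: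
  fixes T :: "nat \<Rightarrow> 'h cop"
  assumes T: "\<And>j. j < m \<Longrightarrow> T j \<in> C" "\<And>j. j < m \<Longrightarrow> proj (T j)"
    and t: "\<And>i j. i < m \<Longrightarrow> j < m \<Longrightarrow> i \<noteq> j \<Longrightarrow> norm (T i * T j) \<le> t"
    and t0: "0 \<le> t" and k: "real m * (real m * t) \<le> k" "k \<le> 1 / 256" and m: "m > 0"
  defines "G \<equiv> \<Sum>j<m. T j"
  shows "\<exists>P\<in>C. \<exists>R\<in>C. proj P \<and> R\<^sup>\<star> = R \<and> P * R = R \<and> R * P = R \<and> (\<forall>j<m. P * T j = T j) \<and>
    (\<forall>i<m. \<forall>j<m. T i * (R * R) * T j = (if i = j then T j else 0)) \<and> R * G * R = P \<and>
    norm (R - P) \<le> 16 * k \<and> norm (P - G) \<le> 8 * k \<and>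
    (\<forall>p. p * G = G * p \<longrightarrow> p * E = E * p \<longrightarrow> p * P = P * p \<and> p * R = R * p)"
proof -
  have mt: "real m * t \<le> k"
  proof -
    have "1 * (real m * t) \<le> real m * (real m * t)" by (intro mult_right_mono) (use m t0 in auto)
    then show ?thesis using k by simp
  qed
  have k0: "0 \<le> k" using mt t0 by (meson mult_nonneg_nonneg of_nat_0_le_iff order_trans)
  have GC: "G \<in> C" unfolding G_def by (intro C_sum T) auto
  have Gs: "G\<^sup>\<star> = G" unfolding G_def star_sum by (intro sum.cong refl proj_star T) auto
  define Off where "Off j = (\<Sum>i<m. if i = j then 0 else T i * T j)" for j
  have Off1: "G * T j = T j + Off j" if "j < m" for j
  proof -
    have "G * T j = (\<Sum>i<m. (if i = j then T j else 0) + (if i = j then 0 else T i * T j))"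
      unfolding G_def sum_distrib_right by (intro sum.cong refl) (use T(2)[OF that] in \<open>auto simp: proj_idem\<close>)
    then show ?thesis using that by (simp add: sum.distrib Off_def)
  qed
  have nOff: "norm (Off j) \<le> real m * t" if "j < m" for j
    unfolding Off_def by (rule norm_sum_le_card) (use t t0 that in auto)
  have "G * G - G = (\<Sum>j<m. Off j)"
  proof -
    have "G * G = (\<Sum>j<m. G * T j)" unfolding G_def sum_distrib_left ..
    also have "\<dots> = (\<Sum>j<m. T j + Off j)" by (intro sum.cong refl Off1) auto
    finally show ?thesis by (simp add: sum.distrib G_def)
  qed
  then have "norm (G * G - G) \<le> k"
    using norm_sum_le_card[of m Off "real m * t"] nOff k(1) by simp
  then obtain P where P: "P \<in> C" "proj P" and PG: "norm (P - G) \<le> 8 * k"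
    and Pc: "\<And>p. p * G = G * p \<Longrightarrow> p * E = E * p \<Longrightarrow> p * P = P * p"
    using near_projection[OF GC Gs] k by fastforce
  have EGc: "G * E = E * G" by (simp add: E_left[OF GC] E_right[OF GC])
  have GP: "G * P = P * G" by (rule Pc) (simp_all add: EGc)
  define Q where "Q = E - P"
  have Qp: "proj Q" unfolding Q_def by (rule proj_diff[OF P(2) proj_E E_left[OF P(1)]])
  have QG: "Q * G = G * Q" by (simp add: Q_def algebra_simps GP E_left[OF GC] E_right[OF GC])
  have QP: "Q * P = 0" by (simp add: Q_def left_diff_distrib E_left[OF P(1)] proj_idem[OF P(2)])
  have nQG: "norm (Q * G) \<le> 8 * k"
  proof -
    have "Q * G = Q * (G - P)" by (simp add: right_diff_distrib QP)
    then show ?thesis using proj_left_absorb[OF Qp, of "G - P"] PG by (simp add: norm_minus_commute)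
  qed
  \<comment> \<open>\<open>Q * T j\<close> is \<open>(Q * G) * (Q * T j)\<close> minus
    \<open>Q * Off j\<close>; both terms are small multiples of the largest
    \<open>norm (Q * T i)\<close>, so \<open>P\<close> dominates each \<open>T j\<close>
    exactly.\<close>
  have QT: "norm (Q * T j) = 0" if j: "j < m" for j
  proof (rule small_family_zero[where c = "1/2" and f = "\<lambda>j. norm (Q * T j)", OF _ _ _ j])
    fix j B assume j: "j < m" and B: "\<And>i. i < m \<Longrightarrow> norm (Q * T i) \<le> B"
    have B0: "0 \<le> B" using B[OF j] norm_ge_zero order_trans by blast
    have "Q * T j = Q * G * T j - Q * Off j"
      using Off1[OF j] by (simp add: mult.assoc algebra_simps)
    also have "Q * G * T j = (Q * G) * (Q * T j)"
      by (metis QG Qp proj_idem mult.assoc)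
    finally have "norm (Q * T j) \<le> norm ((Q * G) * (Q * T j)) + norm (Q * Off j)"
      using norm_triangle_ineq4 by metis
    also have "\<dots> \<le> (8 * k) * B + real m * (B * t)"
    proof (rule add_mono)
      show "norm ((Q * G) * (Q * T j)) \<le> (8 * k) * B" by (rule mult_norm_le[OF nQG B[OF j]])
      have "norm (if i = j then 0 else (Q * T i) * (T i * T j)) \<le> B * t" if "i < m" for i
        using mult_norm_le[OF B[OF that] t[OF that j]] B0 t0 by auto
      moreover have "Q * Off j = (\<Sum>i<m. if i = j then 0 else (Q * T i) * (T i * T j))"
        unfolding Off_def sum_distrib_left
        by (intro sum.cong refl) (auto simp: mult.assoc[symmetric], simp add: mult.assoc proj_idem T)
      ultimately show "norm (Q * Off j) \<le> real m * (B * t)" by (simp only: norm_sum_le_card)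
    qed
    also have "\<dots> = (8 * k + real m * t) * B" by (simp add: algebra_simps)
    also have "\<dots> \<le> 1 / 2 * B" by (intro mult_right_mono B0) (use mt k(2) in linarith)
    finally show "norm (Q * T j) \<le> 1 / 2 * B" .
  qed auto
  have PT: "P * T j = T j" if "j < m" for j
    using QT[OF that] by (simp add: Q_def left_diff_distrib E_left[OF T(1)[OF that]])
  have PGG: "P * G = G" unfolding G_def sum_distrib_left by (intro sum.cong refl PT) auto
  define x where "x = P - G"
  have nx: "norm x \<le> 8 * k" using PG by (simp add: x_def)
  have ok: "bpow_ok (1 / 2) x" "norm x < 1" using nx k(2) by (auto intro: bpow_ok_lt1)
  have xC: "x \<in> C" unfolding x_def by (intro C_diff P GC)
  define D where "D = bpow (1 / 2) x"
  have comm: "p * D = D * p" if "p * x = x * p" for p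
    unfolding D_def by (rule bpow_intertwine) (use that ok in auto)
  have Ds: "D\<^sup>\<star> = D" using star_bpow[OF ok(1)] by (simp add: D_def x_def Gs proj_star[OF P(2)])
  have DD: "D * D * (1 - x) = 1"
    using bpow_inverse_root[OF ok(2), of 2] by (simp add: D_def power2_eq_square)
  define R where "R = P * D"
  have Px: "P * x = x * P" by (simp add: x_def algebra_simps GP)
  have PD: "P * D = D * P" by (rule comm[OF Px])
  have PP: "P * P = P" by (rule proj_idem[OF P(2)])
  have RC: "R \<in> C"
  proof -
    have "P * (E * D) \<in> C" unfolding D_def by (intro C_mult P C_bpow xC ok)
    then show ?thesis by (simp add: R_def E_right[OF P(1)] flip: mult.assoc)
  qed
  have Rs: "R\<^sup>\<star> = R" by (simp add: R_def Ds PD proj_star[OF P(2)])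
  have PR: "P * R = R" by (simp add: R_def PP flip: mult.assoc)
  have RP: "R * P = R" unfolding R_def by (metis PD PP mult.assoc)
  have Rc: "p * R = R * p" if "p * G = G * p" "p * E = E * p" for p
    unfolding R_def using Pc[OF that] that(1)
    by (intro commute_mult comm) (auto simp: x_def algebra_simps)
  have GR: "G * R = R * G" by (rule Rc) (simp_all add: EGc)
  have RR: "R * R = P * (D * D)" unfolding R_def by (rule idem_commute_mult[OF PP PD])
  have "G = P * (1 - x)" by (simp add: x_def right_diff_distrib PP PGG)
  then have "R * R * G = P * (D * D) * (P * (1 - x))" by (simp only: RR)
  also have "\<dots> = P * (D * D * (1 - x))"
    by (metis (no_types) RR RP PR mult.assoc)
  finally have RRG: "R * R * G = P" by (simp add: DD)
  have GRR: "G * (R * R) = P" using RRG GR by (metis mult.assoc)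
  have RGR: "R * G * R = P" using RRG GR by (metis mult.assoc)
  \<comment> \<open>Each defect \<open>Y i\<close> has its range inside that of \<open>T i\<close>,
    and the defects sum to \<open>G * (R * R) * T j - T j = 0\<close>. Almost orthogonal ranges
    allow this only if every defect vanishes.\<close>
  have orth: "T i * (R * R) * T j = (if i = j then T j else 0)" if i: "i < m" and j: "j < m" for i j
  proof -
    define Y where "Y i = T i * (R * R) * T j - (if i = j then T j else 0)" for i
    have TY: "T i * Y i = Y i" if "i < m" for i
      by (simp add: Y_def right_diff_distrib proj_idem[OF T(2)[OF that]] proj_idem[OF T(2)[OF j]] flip: mult.assoc)
    have "(\<Sum>i<m. Y i) = G * (R * R) * T j - T j"
      using j by (simp add: Y_def sum_subtractf G_def sum_distrib_right)
    then have Y0: "(\<Sum>i<m. Y i) = 0" by (simp add: GRR PT[OF j])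
    have "norm (Y i) = 0"
    proof (rule small_family_zero[where c = "1/2" and f = "\<lambda>j. norm (Y j)", OF _ _ _ i])
      fix l B assume l: "l < m" and B: "\<And>i. i < m \<Longrightarrow> norm (Y i) \<le> B"
      have B0: "0 \<le> B" using B[OF l] norm_ge_zero order_trans by blast
      have "0 = T l * (\<Sum>i<m. Y i)" by (simp add: Y0)
      also have "\<dots> = (\<Sum>i<m. (if i = l then Y l else 0) + (if i = l then 0 else (T l * T i) * Y i))"
        unfolding sum_distrib_left
        by (intro sum.cong refl) (auto simp: TY mult.assoc)
      also have "\<dots> = Y l + (\<Sum>i<m. if i = l then 0 else (T l * T i) * Y i)"
        using l by (simp add: sum.distrib)
      finally have "Y l = - (\<Sum>i<m. if i = l then 0 else (T l * T i) * Y i)"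
        by (simp add: eq_neg_iff_add_eq_0)
      then have "norm (Y l) = norm (\<Sum>i<m. if i = l then 0 else (T l * T i) * Y i)" by simp
      also have "\<dots> \<le> real m * (t * B)"
        by (rule norm_sum_le_card) (use mult_norm_le[OF t[OF l] B] B0 t0 in auto)
      also have "\<dots> \<le> 1 / 2 * B"
        unfolding mult.assoc[symmetric] by (intro mult_right_mono B0) (use mt k(2) in linarith)
      finally show "norm (Y l) \<le> 1 / 2 * B" .
    qed auto
    then show ?thesis by (simp add: Y_def)
  qed
  have "R - P = P * (D - 1)" by (simp add: R_def right_diff_distrib)
  then have "norm (R - P) \<le> norm (D - 1)" using proj_left_absorb[OF P(2)] by metis
  also have "\<dots> \<le> 16 * k"
    unfolding D_def using norm_bpow_diff[of "1/2" x] nx k(2) by auto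
  finally show ?thesis
    using P RC Rs PR RP PT orth RGR PG Pc Rc by blast
qed

section \<open>Quadratic forms and separated spectral subspaces\<close>

text \<open>Positivity of the form at \<open>x - t *\<^sub>R y\<close> with
  \<open>y = M \<bullet>\<bullet> x\<close> and \<open>t = 1 / c\<close> gives the bound at once.
  The case \<open>c = 0\<close> has no such \<open>t\<close> and is settled by polarisation.\<close>

lemma psd_norm_le:
  fixes M :: "'h::complex_hilbert cop"
  assumes M: "M\<^sup>\<star> = M" and lo: "\<And>x. 0 \<le> inner (M \<bullet>\<bullet> x) x" and hi: "\<And>x. inner (M \<bullet>\<bullet> x) x \<le> c * (norm x)\<^sup>2"
    and c: "0 \<le> c"
  shows "norm M \<le> c"
proof (rule norm_cop_bound[OF c])
  fix x
  define y where "y = M \<bullet>\<bullet> x"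
  define q where "q = inner (M \<bullet>\<bullet> y) y"
  have sym: "inner (M \<bullet>\<bullet> y) x = (norm y)\<^sup>2" "inner (M \<bullet>\<bullet> x) y = (norm y)\<^sup>2"
    using inner_star[of M y x] M by (simp_all add: y_def power2_norm_eq_inner)
  show "norm (M \<bullet>\<bullet> x) \<le> c * norm x"
  proof (cases "c = 0 \<or> y = 0")
    case True
    have "y = 0" if "c = 0"
    proof -
      have z: "inner (M \<bullet>\<bullet> v) v = 0" for v using lo[of v] hi[of v] that by (simp add: order_antisym)
      have "inner (M \<bullet>\<bullet> (x + y)) (x + y) = 2 * (norm y)\<^sup>2"
        using z[of x] z[of y] sym by (simp add: inner_add)
      then show ?thesis using z[of "x + y"] by simp
    qed
    then show ?thesis using True c by (auto simp: y_def)
  next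
    case False
    define t where "t = 1 / c"
    have "0 \<le> inner (M \<bullet>\<bullet> (x - t *\<^sub>R y)) (x - t *\<^sub>R y)" by (rule lo)
    also have "\<dots> = inner (M \<bullet>\<bullet> x) x - 2 * t * (norm y)\<^sup>2 + t * t * q"
      by (simp add: inner_diff sym q_def scaleR_scaleC)
         (simp add: sym flip: scaleR_scaleC)
    also have "\<dots> \<le> c * (norm x)\<^sup>2 - 2 * t * (norm y)\<^sup>2 + t * t * (c * (norm y)\<^sup>2)"
      unfolding q_def by (intro add_mono diff_mono hi mult_left_mono) (auto simp: t_def c)
    also have "t * t * (c * (norm y)\<^sup>2) = t * (norm y)\<^sup>2" using False by (simp add: t_def)
    finally have "t * (norm y)\<^sup>2 \<le> c * (norm x)\<^sup>2" by simp
    then have "(norm y)\<^sup>2 \<le> (c * norm x)\<^sup>2"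
      using False c by (simp add: t_def field_simps power2_eq_square)
    then show ?thesis using c by (auto simp: y_def intro: power2_le_imp_le)
  qed
qed

lemma norm_ge_quadratic:
  assumes "inner (y::'a::real_inner) x \<ge> c * (norm x)\<^sup>2" shows "norm y \<ge> c * norm x"
proof (cases "x = 0")
  case False
  have "(c * norm x) * norm x \<le> norm y * norm x"
    using assms norm_cauchy_schwarz[of y x] by (simp add: power2_eq_square)
  then show ?thesis using False by simp
qed simp

lemma quadratic_ge:
  assumes "norm (A::'h::complex_hilbert cop) \<le> c" shows "inner (A \<bullet>\<bullet> x) x \<ge> - c * (norm x)\<^sup>2"
    and "inner (A \<bullet>\<bullet> x) x \<le> c * (norm x)\<^sup>2"
proof -
  have "\<bar>inner (A \<bullet>\<bullet> x) x\<bar> \<le> norm (A \<bullet>\<bullet> x) * norm x" by (rule Cauchy_Schwarz_ineq2)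
  also have "\<dots> \<le> (c * norm x) * norm x"
    by (intro mult_right_mono order_trans[OF norm_app] assms) auto
  finally have "\<bar>inner (A \<bullet>\<bullet> x) x\<bar> \<le> c * (norm x)\<^sup>2" by (simp add: power2_eq_square)
  then show "inner (A \<bullet>\<bullet> x) x \<ge> - c * (norm x)\<^sup>2" "inner (A \<bullet>\<bullet> x) x \<le> c * (norm x)\<^sup>2" by auto
qed

text \<open>A Sylvester estimate: \<open>K = P P'\<close> satisfies \<open>\<parallel>(A + 1) K - K (B + 1)\<parallel> \<le> \<epsilon>\<close>.\<close>

lemma separated_projections:
  fixes A B P P' :: "'h::complex_hilbert cop"
  assumes P: "proj P" "P * A = A * P" "\<And>x. \<beta> * (norm (P \<bullet>\<bullet> x))\<^sup>2 \<le> inner (A \<bullet>\<bullet> P \<bullet>\<bullet> x) (P \<bullet>\<bullet> x)"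
    and P': "proj P'" "P' * B = B * P'" "\<And>x. inner (B \<bullet>\<bullet> P' \<bullet>\<bullet> x) (P' \<bullet>\<bullet> x) \<le> \<alpha> * (norm (P' \<bullet>\<bullet> x))\<^sup>2"
    and B: "B\<^sup>\<star> = B" "norm B \<le> 1" and AB: "norm (A - B) \<le> \<epsilon>" and ab: "- 1 \<le> \<alpha>" "\<alpha> < \<beta>"
  shows "norm (P * P') \<le> \<epsilon> / (\<beta> - \<alpha>)"
proof -
  define K where "K = P * P'"
  \<comment> \<open>Because \<open>B\<close> is at least \<open>- 1\<close>, adding 1 makes the
    compression positive; its norm can then be read off from its form by
    \<open>psd_norm_le\<close>.\<close>
  define M where "M = P' * (B + 1) * P'"
  have e0: "0 \<le> \<epsilon>" using AB norm_ge_zero order_trans by blast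
  have PK: "P \<bullet>\<bullet> K \<bullet>\<bullet> x = K \<bullet>\<bullet> x" for x by (simp add: K_def proj_app[OF P(1)])
  have nM: "norm M \<le> 1 + \<alpha>"
  proof (rule psd_norm_le)
    show "M\<^sup>\<star> = M" by (simp add: M_def B proj_star[OF P'(1)] mult.assoc)
    have M: "inner (M \<bullet>\<bullet> x) x = inner (B \<bullet>\<bullet> P' \<bullet>\<bullet> x) (P' \<bullet>\<bullet> x) + (norm (P' \<bullet>\<bullet> x))\<^sup>2" for x
      by (simp add: M_def proj_inner[OF P'(1)] inner_add power2_norm_eq_inner)
    show "0 \<le> inner (M \<bullet>\<bullet> x) x" for x
      using quadratic_ge(1)[OF B(2), of "P' \<bullet>\<bullet> x"] by (simp add: M)
    show "inner (M \<bullet>\<bullet> x) x \<le> (1 + \<alpha>) * (norm x)\<^sup>2" for x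
    proof -
      have "inner (M \<bullet>\<bullet> x) x \<le> (1 + \<alpha>) * (norm (P' \<bullet>\<bullet> x))\<^sup>2" using P'(3)[of x] by (simp add: M algebra_simps)
      also have "\<dots> \<le> (1 + \<alpha>) * (norm x)\<^sup>2"
        by (intro mult_left_mono power_mono proj_norm_app P') (use ab in auto)
      finally show ?thesis .
    qed
  qed (use ab in simp)
  have eq: "(A + 1) * K = K * M + P * (A - B) * P'"
  proof -
    have "P' * P' = P'" by (rule proj_idem[OF P'(1)])
    moreover from this have "P' * (B * P') = B * P'" by (metis P'(2) mult.assoc)
    ultimately have "K * M = P * (B * P') + K" unfolding K_def M_def
      by (simp add: distrib_left distrib_right mult.assoc)
    moreover have "A * K = P * (A * P')" unfolding K_def by (metis P(2) mult.assoc)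
    ultimately show ?thesis by (simp add: algebra_simps)
  qed
  have "norm K \<le> (norm K * (1 + \<alpha>) + \<epsilon>) / (1 + \<beta>)"
  proof (rule norm_cop_bound)
    fix x
    have "(1 + \<beta>) * norm (K \<bullet>\<bullet> x) \<le> norm ((A + 1) \<bullet>\<bullet> K \<bullet>\<bullet> x)"
      by (rule norm_ge_quadratic)
         (use P(3)[of "K \<bullet>\<bullet> x"] in \<open>simp add: PK inner_add power2_norm_eq_inner algebra_simps\<close>)
    also have "\<dots> = norm ((K * M + P * (A - B) * P') \<bullet>\<bullet> x)" using eq by (metis app_times)
    also have "\<dots> \<le> norm (K * M + P * (A - B) * P') * norm x" by (rule norm_app)
    also have "\<dots> \<le> (norm K * (1 + \<alpha>) + 1 * \<epsilon> * 1) * norm x"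
      by (intro mult_right_mono order_trans[OF norm_triangle_ineq] add_mono mult_norm_le nM AB
          proj_norm P(1) P'(1)) auto
    finally show "norm (K \<bullet>\<bullet> x) \<le> (norm K * (1 + \<alpha>) + \<epsilon>) / (1 + \<beta>) * norm x"
      using ab by (simp add: field_simps)
  qed (use ab e0 in auto)
  then have "norm K * (\<beta> - \<alpha>) \<le> \<epsilon>" using ab by (simp add: field_simps)
  then show ?thesis using ab by (simp add: field_simps K_def)
qed

section \<open>Unitary roots of minus one\<close>

lemma order_pow_inj:
  assumes "has_mult_order \<omega> m" "i < m" "j < m" "\<omega> ^ i = \<omega> ^ j"
  shows "i = j"
proof -
  have nz: "\<omega> \<noteq> 0" using assms(1) by (auto simp: has_mult_order_def power_0_left)
  have "\<not> (i < j)" if "i < m" "j < m" "\<omega> ^ i = \<omega> ^ j" for i j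
  proof
    assume "i < j"
    then have "\<omega> ^ i * \<omega> ^ (j - i) = \<omega> ^ j" by (simp flip: power_add)
    then have "\<omega> ^ i * \<omega> ^ (j - i) = \<omega> ^ i" using that(3) by simp
    then have "\<omega> ^ (j - i) = 1" using nz by simp
    then show False using assms(1) \<open>i < j\<close> that by (auto simp: has_mult_order_def)
  qed
  then show ?thesis using assms by (metis linorder_neqE_nat)
qed

lemma order_root_exists:
  assumes "has_mult_order \<omega> m" "z ^ m = 1"
  shows "\<exists>j<m. z = \<omega> ^ j"
proof -
  have m: "m > 0" "\<omega> ^ m = 1" using assms by (auto simp: has_mult_order_def)
  have fin: "finite {z::complex. z ^ m = 1}" by (rule finite_roots_unity) (use m in simp)
  have sub: "(\<lambda>j. \<omega> ^ j) ` {..<m} \<subseteq> {z. z ^ m = 1}"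
    using m by (auto simp flip: power_mult) (simp add: power_mult mult.commute[of _ m])
  have "card ((\<lambda>j. \<omega> ^ j) ` {..<m}) = m"
    by (subst card_image) (auto intro!: inj_onI order_pow_inj[OF assms(1)])
  then have "(\<lambda>j. \<omega> ^ j) ` {..<m} = {z. z ^ m = 1}"
    using card_roots_unity_eq[OF m(1)] by (intro card_subset_eq[OF fin sub]) simp
  then show ?thesis using assms(2) by auto
qed

lemma order_cmod: "has_mult_order \<omega> m \<Longrightarrow> cmod \<omega> = 1"
proof -
  assume "has_mult_order \<omega> m"
  then have "m > 0" "cmod \<omega> ^ m = 1 ^ m" by (auto simp: has_mult_order_def simp flip: norm_power)
  then show ?thesis using power_eq_imp_eq_base[of "cmod \<omega>" m 1] by simp
qed

lemma order_cnj: "has_mult_order \<omega> m \<Longrightarrow> cnj \<omega> * \<omega> = 1" "has_mult_order \<omega> m \<Longrightarrow> \<omega> * cnj \<omega> = 1"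
  using order_cmod[of \<omega> m] by (auto simp: complex_norm_square[symmetric] mult.commute[of "cnj \<omega>"])

text \<open>For \<open>\<omega> ^ j = cis (2 * x)\<close> the modulus is
  \<open>2 * \<bar>cos x\<bar>\<close>, and \<open>x\<close>, a multiple of \<open>pi / m\<close>,
  stays at distance at least \<open>pi / m\<close> from both 0 and \<open>pi\<close>.\<close>

lemma cmod_one_plus_root_le:
  assumes \<omega>: "has_mult_order \<omega> m" and j: "0 < j" "j < m"
  shows "cmod (1 + \<omega> ^ j) \<le> 2 * cos (pi / m)"
proof -
  have m: "m > 0" "\<omega> ^ m = 1" using \<omega> by (auto simp: has_mult_order_def)
  have 1: "\<omega> ^ j \<noteq> 1" using \<omega> j by (auto simp: has_mult_order_def)
  have "(\<omega> ^ j) ^ m = 1" using m by (metis power_mult mult.commute power_one)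
  then obtain k where k: "k < m" "\<omega> ^ j = cis (2 * pi * real k / real m)"
    using Complex.bij_betw_roots_unity[OF m(1)] unfolding bij_betw_def by (metis (mono_tags, lifting) imageE lessThan_iff mem_Collect_eq)
  have k0: "k \<noteq> 0"
  proof
    assume "k = 0"
    with k(2) 1 show False by simp
  qed
  define x where "x = pi * real k / real m"
  have x2: "2 * pi * real k / real m = 2 * x" by (simp add: x_def)
  have "(cmod (1 + \<omega> ^ j))\<^sup>2 = (1 + cos (2 * x))\<^sup>2 + (sin (2 * x))\<^sup>2"
    unfolding k x2 by (simp add: cmod_power2)
  also have "\<dots> = 2 + 2 * cos (2 * x)"
    using sin_cos_squared_add[of "2 * x"] by (simp add: power2_eq_square algebra_simps)
  also have "\<dots> = (2 * \<bar>cos x\<bar>)\<^sup>2" unfolding cos_double_cos by (simp add: power_mult_distrib)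
  finally have "cmod (1 + \<omega> ^ j) = 2 * \<bar>cos x\<bar>" by (rule power2_eq_imp_eq) auto
  moreover have "cos x \<le> cos (pi / m)"
    using k k0 by (intro cos_monotone_0_pi_le) (auto simp: x_def field_simps)
  moreover have "- cos x \<le> cos (pi / m)"
  proof -
    have "real k + 1 \<le> real m" using k(1) by linarith
    then have "pi * (real k + 1) \<le> pi * real m" by (intro mult_left_mono) auto
    then have "pi / m \<le> pi - x" using m(1) by (simp add: x_def field_simps)
    moreover have "x \<ge> 0" by (simp add: x_def)
    ultimately have "cos (pi - x) \<le> cos (pi / m)" by (intro cos_monotone_0_pi_le) auto
    then show ?thesis by simp
  qed
  ultimately show ?thesis by auto
qed

text \<open>A reciprocal slope of the cosine near \<open>pi / m\<close>: at angular distance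
  \<open>d\<close> inside the corner, the cosine has risen by at least
  \<open>sin (pi / (2 * m)) * d / 2\<close>; the factor \<open>m\<close> accounts for taking an
  \<open>m\<close>-th power.\<close>

definition root_const :: "nat \<Rightarrow> real" where
  "root_const m = 2 * m / sin (pi / (2 * m))"

lemma sin_pi_2m_pos: "m \<ge> 2 \<Longrightarrow> sin (pi / (2 * real m)) > 0"
  by (rule sin_gt_zero) (auto simp: field_simps)

lemma root_const_pos: "m \<ge> 2 \<Longrightarrow> root_const m > 0"
  using sin_pi_2m_pos[of m] by (simp add: root_const_def)

lemma half_le_sin:
  assumes "0 \<le> x" "x \<le> pi / 3" shows "x / 2 \<le> sin x"
proof (cases "x = 0")
  case False
  then have "0 < x" using assms by simp
  then obtain z where z: "0 < z" "z < x" "sin x - sin 0 = (x - 0) * cos z"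
    using MVT2[of 0 x sin cos] by (auto intro: DERIV_sin)
  have "cos (pi / 3) \<le> cos z" using z assms by (intro cos_monotone_0_pi_le) auto
  then have "x * (1 / 2) \<le> x * cos z" using assms by (intro mult_left_mono) (auto simp: cos_60)
  then show ?thesis using z by simp
qed simp

text \<open>A unit vector all of whose rotations by \<open>m\<close>-th roots of unity avoid the cap \<open>Re z > cos (\<pi>/m) + w\<close>
  is close to a corner of the complementary \<open>m\<close>-gon, that is, to an \<open>m\<close>-th root of \<open>-1\<close>.\<close>

lemma near_root_of_minus_one:
  assumes \<omega>: "has_mult_order \<omega> m" and m: "m \<ge> 2" and z: "cmod z = 1"
    and re: "\<And>j. j < m \<Longrightarrow> Re (\<omega> ^ j * z) \<le> cos (pi / m) + w"
  shows "cmod (z ^ m + 1) \<le> root_const m * w"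
proof -
  have m0: "real m > 0" using m by simp
  define \<theta> where "\<theta> = Arg z"
  have z\<theta>: "z = cis \<theta>" using rcis_cmod_Arg[of z] z by (simp add: rcis_def \<theta>_def)
  \<comment> \<open>The multiple of \<open>2 * pi / m\<close> that rotates \<open>z\<close> into the
    sector of half-angle \<open>pi / m\<close> around 1.\<close>
  define k where "k = round (- \<theta> * m / (2 * pi))"
  define \<psi> where "\<psi> = \<theta> + 2 * pi * k / m"
  have psi: "\<bar>\<psi>\<bar> \<le> pi / m"
  proof -
    have "\<bar>of_int k - (- \<theta> * m / (2 * pi))\<bar> \<le> 1 / 2"
      unfolding k_def by (rule of_int_round_abs_le)
    then have "(2 * pi / m) * \<bar>of_int k - (- \<theta> * m / (2 * pi))\<bar> \<le> (2 * pi / m) * (1 / 2)"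
      by (intro mult_left_mono) auto
    moreover have "(2 * pi / m) * \<bar>of_int k - (- \<theta> * m / (2 * pi))\<bar> = \<bar>(2 * pi / m) * (of_int k - (- \<theta> * m / (2 * pi)))\<bar>"
      using m0 unfolding abs_mult by (subst (2) abs_of_nonneg) auto
    moreover have "(2 * pi / m) * (of_int k - (- \<theta> * m / (2 * pi))) = \<psi>"
      using m0 by (simp add: \<psi>_def field_simps)
    ultimately have "\<bar>\<psi>\<bar> \<le> (2 * pi / m) * (1 / 2)" by linarith
    then show ?thesis by simp
  qed
  have "cis (2 * pi * k / m) ^ m = 1"
  proof -
    have "cis (2 * pi * k / m) ^ m = cis (m * (2 * pi * k / m))" by (rule Complex.DeMoivre)
    also have "m * (2 * pi * k / m) = 2 * pi * k" using m0 by simp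
    also have "cis (2 * pi * k) = 1" by (rule cis_multiple_2pi) simp
    finally show ?thesis .
  qed
  then obtain j where j: "j < m" "cis (2 * pi * k / m) = \<omega> ^ j"
    using order_root_exists[OF \<omega>] by blast
  have jz: "\<omega> ^ j * z = cis \<psi>" unfolding j(2)[symmetric] z\<theta> cis_mult by (simp add: \<psi>_def add.commute)
  \<comment> \<open>Angular distance to the nearest corner. The \<open>m\<close>-th power sends the
    corners to \<open>- 1\<close> and multiplies angles by \<open>m\<close>, so the chord to be
    bounded is at most \<open>m * d\<close>.\<close>
  define d where "d = pi / m - \<bar>\<psi>\<bar>"
  have "pi / m \<le> pi / 1" using m by (intro divide_left_mono) auto
  then have d0: "0 \<le> d" "d \<le> pi" using psi by (auto simp: d_def)
  have cos: "cos \<bar>\<psi>\<bar> - cos (pi / m) \<le> w" using re[OF j(1)] by (simp add: jz)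
  have m2: "pi / m \<le> pi / 2" using m by (intro divide_left_mono) auto
  have mono: "sin (pi / (2 * m)) \<le> sin ((\<bar>\<psi>\<bar> + pi / m) / 2)"
  proof (rule sin_monotone_2pi_le)
    show "(\<bar>\<psi>\<bar> + pi / m) / 2 \<le> pi / 2" using psi m2 by simp
    have "0 \<le> pi / (2 * m)" by simp
    then show "- (pi / 2) \<le> pi / (2 * m)" using pi_ge_zero by linarith
  qed (simp add: field_simps)
  have "d \<le> pi / 2" using m2 abs_ge_zero[of \<psi>] unfolding d_def by linarith
  then have "d / 2 \<le> pi / 3" using pi_gt_zero by linarith
  then have "d / 2 / 2 \<le> sin (d / 2)" using d0 by (intro half_le_sin) auto
  then have "2 * sin (pi / (2 * m)) * (d / 4) \<le> 2 * sin ((\<bar>\<psi>\<bar> + pi / m) / 2) * sin (d / 2)"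
    using mono d0 sin_pi_2m_pos[OF m] by (intro mult_mono) auto
  also have "\<dots> = cos \<bar>\<psi>\<bar> - cos (pi / m)"
    using cos_diff_cos[of "\<bar>\<psi>\<bar>" "pi / m"] by (simp add: d_def)
  finally have "2 * sin (pi / (2 * m)) * (d / 4) \<le> w" using cos by simp
  then have dw: "m * d \<le> root_const m * w"
    using sin_pi_2m_pos[OF m] m0 by (simp add: root_const_def field_simps)
  have "z ^ m = cis \<psi> ^ m"
    using \<omega> by (simp flip: jz add: power_mult_distrib) (metis has_mult_order_def mult.commute mult_1 power_mult power_one)
  then have zm: "z ^ m = cis (m * \<psi>)" by (simp add: Complex.DeMoivre)
  have "(cmod (z ^ m + 1))\<^sup>2 = 2 + 2 * cos (m * \<psi>)"
    unfolding zm cmod_power2 using sin_cos_squared_add[of "m * \<psi>"] by (simp add: power2_eq_square algebra_simps)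
  also have "cos (m * \<psi>) = - cos (m * d)"
  proof -
    have "cos (m * \<psi>) = cos (m * \<bar>\<psi>\<bar>)" by (simp add: abs_if)
    also have "m * \<bar>\<psi>\<bar> = pi - m * d" using m0 by (simp add: d_def field_simps)
    finally show ?thesis by simp
  qed
  also have "2 + 2 * - cos (m * d) = (2 * sin (m * d / 2))\<^sup>2"
    using cos_double_sin[of "m * d / 2"] by (simp add: power_mult_distrib)
  also have "\<dots> \<le> (m * d)\<^sup>2"
  proof -
    have "\<bar>sin (m * d / 2)\<bar> \<le> \<bar>m * d / 2\<bar>" by (rule abs_sin_x_le_abs_x)
    then have "\<bar>2 * sin (m * d / 2)\<bar> \<le> \<bar>m * d\<bar>" by (simp add: abs_mult)
    then show ?thesis by (simp add: abs_le_square_iff)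
  qed
  finally have "cmod (z ^ m + 1) \<le> m * d" by (rule power2_le_imp_le) (simp add: d0)
  then show ?thesis using dw by simp
qed


section \<open>Corners, approximate eigenvectors and roots of unitaries\<close>

lemma proj_star_absorb:
  assumes "proj S"
  shows "T * S = T \<Longrightarrow> S * T\<^sup>\<star> = T\<^sup>\<star>" "S * T = T \<Longrightarrow> T\<^sup>\<star> * S = T\<^sup>\<star>"
  using star_mult[of T S] star_mult[of S T] by (simp_all add: proj_star[OF assms])

text \<open>Lets the root and averaging lemmas be applied on the seam, with the seam projection as
  unit.\<close>

lemma (in op_alg) op_alg_corner:
  assumes S: "S \<in> C" "proj S"
  shows "op_alg {T \<in> C. S * T = T \<and> T * S = T} S"
proof
  fix T R c assume T: "T \<in> {T \<in> C. S * T = T \<and> T * S = T}"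
  then show "sc c T \<in> {T \<in> C. S * T = T \<and> T * S = T}" by (auto intro: C_sc)
  show "T\<^sup>\<star> \<in> {T \<in> C. S * T = T \<and> T * S = T}"
    using T by (auto intro: C_star proj_star_absorb[OF S(2)])
  show "S * T = T" "T * S = T" using T by auto
  assume R: "R \<in> {T \<in> C. S * T = T \<and> T * S = T}"
  show "T + R \<in> {T \<in> C. S * T = T \<and> T * S = T}"
    using T R by (auto intro: C_add simp: algebra_simps)
  have "S * (T * R) = T * R" using T by (simp flip: mult.assoc)
  moreover have "T * R * S = T * R" using R by (simp add: mult.assoc)
  ultimately show "T * R \<in> {T \<in> C. S * T = T \<and> T * S = T}" using T R by (auto intro: C_mult)
next
  fix f T
  assume f: "\<And>n. f n \<in> {T \<in> C. S * T = T \<and> T * S = T}" and l: "\<And>x. (\<lambda>n. f n \<bullet>\<bullet> x) \<longlonglongrightarrow> T \<bullet>\<bullet> x"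
  have f1: "S \<bullet>\<bullet> f n \<bullet>\<bullet> x = f n \<bullet>\<bullet> x" and f2: "f n \<bullet>\<bullet> S \<bullet>\<bullet> x = f n \<bullet>\<bullet> x" for n x
    using f[of n] by (auto simp flip: app_times)
  have "S * T = T"
  proof (rule cop_eqI)
    fix x
    have "(\<lambda>n. S \<bullet>\<bullet> f n \<bullet>\<bullet> x) \<longlonglongrightarrow> S \<bullet>\<bullet> T \<bullet>\<bullet> x"
      by (rule bounded_linear.tendsto[OF bounded_linear_app l])
    then show "(S * T) \<bullet>\<bullet> x = T \<bullet>\<bullet> x" using l[of x] by (simp add: f1 LIMSEQ_unique)
  qed
  moreover have "T * S = T"
    by (rule cop_eqI) (simp add: LIMSEQ_unique[OF l[of "S \<bullet>\<bullet> _", unfolded f2] l])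
  moreover have "T \<in> C" by (rule C_lim[OF _ l]) (use f in auto)
  ultimately show "T \<in> {T \<in> C. S * T = T \<and> T * S = T}" by blast
qed (use S in \<open>auto simp: proj_idem\<close>)

lemma proj_commuting_mult:
  assumes "proj P" "proj R" "P * R = R * P" shows "proj (P * R)"
proof -
  have "(P * R) * (P * R) = P * (R * P) * R" by (simp add: mult.assoc)
  also have "\<dots> = P * R" by (simp only: assms(3)[symmetric] mult.assoc proj_idem[OF assms(2)])
     (simp add: proj_idem[OF assms(1)] flip: mult.assoc)
  finally show ?thesis using assms by (simp add: proj_def)
qed

lemma nonzero_app: "T \<noteq> 0 \<Longrightarrow> \<exists>x. (T::'h::complex_hilbert cop) \<bullet>\<bullet> x \<noteq> 0"
  by (metis app_zero cop_eqI)

lemma nat_switch_exists: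
  assumes "Pr 0" "\<not> Pr n" shows "\<exists>i<n. Pr i \<and> \<not> Pr (Suc i)"
  using assms by (induction n) (auto, metis less_Suc_eq)

text \<open>Spectral cuts of \<open>A\<close> on a grid of step \<open>\<eta>\<close>: at the bottom
  the cut keeps all of \<open>F\<close>, at the top nothing, so it switches from nonzero to zero
  between two neighbouring grid points. The piece of \<open>F\<close> caught there is nonzero and
  has spectral width \<open>\<eta>\<close>.\<close>

lemma (in op_alg) spectral_piece:
  assumes F: "F \<in> C" "proj F" "F \<noteq> 0" and A: "A \<in> C" "A\<^sup>\<star> = A" "F * A = A * F" and \<eta>: "\<eta> > 0"
  shows "\<exists>F'\<in>C. \<exists>t. proj F' \<and> F' \<noteq> 0 \<and> F * F' = F' \<and> norm ((A - t *\<^sub>R 1) * F') \<le> \<eta> \<and>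
    (\<forall>p. p * A = A * p \<longrightarrow> p * E = E * p \<longrightarrow> p * F = F * p \<longrightarrow> p * F' = F' * p)"
proof -
  define c where "c = norm A"
  have c: "- c * (norm x)\<^sup>2 \<le> inner (A \<bullet>\<bullet> x) x" "inner (A \<bullet>\<bullet> x) x \<le> c * (norm x)\<^sup>2" for x
    unfolding c_def by (rule quadratic_ge, rule order_refl)+
  have EF: "E * F = F" "F * E = F" using F(1) by (auto intro: E_left E_right)
  have EA: "E * A = A" "A * E = A" using A(1) by (auto intro: E_left E_right)
  have "\<exists>Q. Q \<in> C \<and> proj Q \<and> (\<forall>x. 0 \<le> inner ((A - t *\<^sub>R E) \<bullet>\<bullet> Q \<bullet>\<bullet> x) (Q \<bullet>\<bullet> x)) \<and>
      (\<forall>x. inner ((A - t *\<^sub>R E) \<bullet>\<bullet> (E - Q) \<bullet>\<bullet> x) ((E - Q) \<bullet>\<bullet> x) \<le> 0) \<and>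
      (\<forall>p. p * A = A * p \<longrightarrow> p * E = E * p \<longrightarrow> p * Q = Q * p)" for t
  proof -
    have "A - t *\<^sub>R E \<in> C" "(A - t *\<^sub>R E)\<^sup>\<star> = A - t *\<^sub>R E"
      by (auto intro!: C_diff A C_scaleR E_in simp: A(2) E_star)
    then obtain Q where Q: "Q \<in> C" "proj Q" "\<forall>x. 0 \<le> inner ((A - t *\<^sub>R E) \<bullet>\<bullet> Q \<bullet>\<bullet> x) (Q \<bullet>\<bullet> x)"
      "\<forall>x. inner ((A - t *\<^sub>R E) \<bullet>\<bullet> (E - Q) \<bullet>\<bullet> x) ((E - Q) \<bullet>\<bullet> x) \<le> 0"
      "\<And>p. p * (A - t *\<^sub>R E) = (A - t *\<^sub>R E) * p \<Longrightarrow> p * E = E * p \<Longrightarrow> p * Q = Q * p"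
      using sign_projection by meson
    moreover have "p * Q = Q * p" if "p * A = A * p" "p * E = E * p" for p
      using that by (intro Q(5)) (simp_all add: right_diff_distrib left_diff_distrib)
    ultimately show ?thesis by blast
  qed
  then obtain q where q: "\<And>t. q t \<in> C" "\<And>t. proj (q t)"
    "\<And>t x. 0 \<le> inner ((A - t *\<^sub>R E) \<bullet>\<bullet> q t \<bullet>\<bullet> x) (q t \<bullet>\<bullet> x)"
    "\<And>t x. inner ((A - t *\<^sub>R E) \<bullet>\<bullet> (E - q t) \<bullet>\<bullet> x) ((E - q t) \<bullet>\<bullet> x) \<le> 0"
    "\<And>t p. p * A = A * p \<Longrightarrow> p * E = E * p \<Longrightarrow> p * q t = q t * p"
    by metis
  have Fq: "F * q t = q t * F" for t by (rule q(5)) (simp_all add: A EF)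
  have Aq: "A * q t = q t * A" for t by (rule q(5)) (simp_all add: EA)
  have hi: "t * (norm y)\<^sup>2 \<le> inner (A \<bullet>\<bullet> y) y" if "E \<bullet>\<bullet> y = y" "q t \<bullet>\<bullet> y = y" for t y
    using q(3)[of t y] that by (simp add: inner_diff power2_norm_eq_inner)
  have lo: "inner (A \<bullet>\<bullet> y) y \<le> t * (norm y)\<^sup>2" if "E \<bullet>\<bullet> y = y" "q t \<bullet>\<bullet> y = 0" for t y
    using q(4)[of t y] that by (simp add: inner_diff power2_norm_eq_inner)
  \<comment> \<open>Starting one unit below \<open>- c\<close> makes the contradiction at the bottom
    strict.\<close>
  define t where "t i = - c - 1 + real i * \<eta>" for i
  obtain n :: nat where n: "real n > (2 * c + 2) / \<eta>" using reals_Archimedean2 by blast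
  have Fn: "E \<bullet>\<bullet> F \<bullet>\<bullet> x = F \<bullet>\<bullet> x" for x using EF by (metis app_times)
  have "F * q (t 0) \<noteq> 0"
  proof
    assume 0: "F * q (t 0) = 0"
    obtain x where x: "F \<bullet>\<bullet> x \<noteq> 0" using nonzero_app[OF F(3)] by blast
    have "q (t 0) \<bullet>\<bullet> F \<bullet>\<bullet> x = 0" using 0 Fq by (metis app_times app_zero)
    from lo[OF Fn this] c(1)[of "F \<bullet>\<bullet> x"]
    have "- c * (norm (F \<bullet>\<bullet> x))\<^sup>2 \<le> t 0 * (norm (F \<bullet>\<bullet> x))\<^sup>2" by linarith
    moreover have "(norm (F \<bullet>\<bullet> x))\<^sup>2 > 0" using x by simp
    ultimately have "- c \<le> t 0" by (rule mult_right_le_imp_le)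
    then show False by (simp add: t_def)
  qed
  moreover have "\<not> F * q (t n) \<noteq> 0"
  proof
    assume "F * q (t n) \<noteq> 0"
    then obtain x where x: "(F * q (t n)) \<bullet>\<bullet> x \<noteq> 0" using nonzero_app by blast
    define y where "y = (F * q (t n)) \<bullet>\<bullet> x"
    have "q (t n) * (F * q (t n)) = F * q (t n)"
      by (metis Fq mult.assoc proj_idem q(2))
    then have "q (t n) \<bullet>\<bullet> y = y" unfolding y_def by (metis app_times)
    then have "t n * (norm y)\<^sup>2 \<le> c * (norm y)\<^sup>2"
      using hi[of y "t n"] c(2)[of y] Fn[of "q (t n) \<bullet>\<bullet> x"] by (simp add: y_def)
    moreover have "(norm y)\<^sup>2 > 0" using x by (simp add: y_def)
    ultimately have "t n \<le> c" by simp
    then show False using n \<eta> by (simp add: t_def field_simps)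
  qed
  ultimately obtain i where i: "F * q (t i) \<noteq> 0" "F * q (t (Suc i)) = 0"
    using nat_switch_exists[of "\<lambda>i. F * q (t i) \<noteq> 0" n] by blast
  define F' where "F' = F * q (t i)"
  have pF': "proj F'" unfolding F'_def by (rule proj_commuting_mult[OF F(2) q(2) Fq])
  have FF': "F * F' = F'" unfolding F'_def by (simp add: proj_idem[OF F(2)] flip: mult.assoc)
  have qF': "q (t i) * F' = F'" unfolding F'_def by (metis Fq mult.assoc proj_idem q(2))
  have q'F': "q (t (Suc i)) * F' = 0"
    unfolding F'_def mult.assoc[symmetric] Fq[symmetric] i(2) by simp
  have F'c: "p * F' = F' * p" if "p * A = A * p" "p * E = E * p" "p * F = F * p" for p
    unfolding F'_def by (intro commute_mult that q(5))
  have AF': "A * F' = F' * A" by (rule F'c) (simp_all add: EA A(3))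
  define M where "M = F' * (A - t i *\<^sub>R 1) * F'"
  have "norm M \<le> \<eta>"
  proof (rule psd_norm_le)
    show "M\<^sup>\<star> = M" by (simp add: M_def A proj_star[OF pF'] mult.assoc)
    have M: "inner (M \<bullet>\<bullet> x) x = inner (A \<bullet>\<bullet> F' \<bullet>\<bullet> x) (F' \<bullet>\<bullet> x) - t i * (norm (F' \<bullet>\<bullet> x))\<^sup>2" for x
      by (simp add: M_def proj_inner[OF pF'] inner_diff power2_norm_eq_inner)
    fix x
    have E': "E \<bullet>\<bullet> F' \<bullet>\<bullet> x = F' \<bullet>\<bullet> x" using Fn[of "q (t i) \<bullet>\<bullet> x"] by (simp add: F'_def)
    have "q (t i) \<bullet>\<bullet> F' \<bullet>\<bullet> x = F' \<bullet>\<bullet> x" using qF' by (metis app_times)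
    from hi[OF E' this] show "0 \<le> inner (M \<bullet>\<bullet> x) x" by (simp add: M)
    have "q (t (Suc i)) \<bullet>\<bullet> F' \<bullet>\<bullet> x = 0" using q'F' by (metis app_times app_zero)
    from lo[OF E' this] have "inner (M \<bullet>\<bullet> x) x \<le> \<eta> * (norm (F' \<bullet>\<bullet> x))\<^sup>2" by (simp add: M t_def algebra_simps)
    also have "\<dots> \<le> \<eta> * (norm x)\<^sup>2" using \<eta> by (intro mult_left_mono power_mono proj_norm_app pF') auto
    finally show "inner (M \<bullet>\<bullet> x) x \<le> \<eta> * (norm x)\<^sup>2" .
  qed (use \<eta> in simp)
  moreover have "M = (A - t i *\<^sub>R 1) * F'"
  proof -
    have "F' * (A - t i *\<^sub>R 1) = (A - t i *\<^sub>R 1) * F'" by (simp add: algebra_simps AF')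
    then show ?thesis unfolding M_def by (simp add: mult.assoc proj_idem[OF pF'])
  qed
  moreover have "F' \<in> C" unfolding F'_def by (intro C_mult F q)
  ultimately show ?thesis using pF' FF' i(1) F'c unfolding F'_def[symmetric] by blast
qed

lemma mult_power_commute:
  assumes "a * b = b * (a::'a::monoid_mult)" shows "(a * b) ^ n = a ^ n * b ^ n"
proof (induction n)
  case (Suc n)
  have "b * a ^ n = a ^ n * b" using power_intertwine[of b a a n] assms by simp
  then have "a * b * (a ^ n * b ^ n) = a * a ^ n * (b * b ^ n)" by (metis mult.assoc)
  then show ?case using Suc by simp
qed simp

text \<open>\<open>F\<close> is cut by the real part of \<open>u\<close> and then by its imaginary
  part; they commute because \<open>u\<close> is normal, so the second cut respects the first.
  Normalising the eigenvalue to modulus 1 doubles the error.\<close>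

lemma (in op_alg) approximate_eigenvector:
  assumes u: "u \<in> C" "u\<^sup>\<star> * u = E" "u * u\<^sup>\<star> = E"
    and F: "F \<in> C" "proj F" "F \<noteq> 0" "F * u = u * F" "F * u\<^sup>\<star> = u\<^sup>\<star> * F" and \<eta>: "0 < \<eta>" "\<eta> \<le> 1 / 4"
  shows "\<exists>v l. norm v = 1 \<and> F \<bullet>\<bullet> v = v \<and> cmod l = 1 \<and> norm (u \<bullet>\<bullet> v - l *\<^sub>C v) \<le> 4 * \<eta>"
proof -
  define A where "A = (1 / 2) *\<^sub>R (u + u\<^sup>\<star>)"
  define B where "B = (1 / 2) *\<^sub>R sc (- \<i>) (u - u\<^sup>\<star>)"
  have AC: "A \<in> C" unfolding A_def by (intro C_scaleR C_add C_star u)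
  have BC: "B \<in> C" unfolding B_def by (intro C_scaleR C_sc C_diff C_star u)
  have As: "A\<^sup>\<star> = A" by (simp add: A_def add.commute)
  have Bs: "B\<^sup>\<star> = B" by (simp add: B_def sc_diff)
  have uAB: "u = A + sc \<i> B"
    by (simp add: A_def B_def sc_diff algebra_simps flip: scaleR_add_left)
  have AB: "B * A = A * B" by (simp add: A_def B_def sc_diff sc_add algebra_simps u)
  have FA: "F * A = A * F" by (simp add: A_def algebra_simps F)
  have FB: "F * B = B * F" by (simp add: B_def sc_diff algebra_simps F)
  obtain F1 s where F1: "F1 \<in> C" "proj F1" "F1 \<noteq> 0" "F * F1 = F1" "norm ((A - s *\<^sub>R 1) * F1) \<le> \<eta>"
    "\<And>p. p * A = A * p \<Longrightarrow> p * E = E * p \<Longrightarrow> p * F = F * p \<Longrightarrow> p * F1 = F1 * p"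
    using spectral_piece[OF F(1-3) AC As FA \<eta>(1)] by blast
  have "B * F1 = F1 * B" by (rule F1(6)) (simp_all add: AB FB E_left[OF BC] E_right[OF BC])
  then obtain F2 t where F2: "F2 \<in> C" "proj F2" "F2 \<noteq> 0" "F1 * F2 = F2" "norm ((B - t *\<^sub>R 1) * F2) \<le> \<eta>"
    using spectral_piece[OF F1(1-3) BC Bs _ \<eta>(1)] by auto
  obtain x where x: "F2 \<bullet>\<bullet> x \<noteq> 0" using nonzero_app[OF F2(3)] by blast
  define v where "v = (1 / norm (F2 \<bullet>\<bullet> x)) *\<^sub>R (F2 \<bullet>\<bullet> x)"
  have nv: "norm v = 1" using x by (simp add: v_def)
  have F2v: "F2 \<bullet>\<bullet> v = v" by (simp add: v_def scaleR_scaleC proj_app[OF F2(2)])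
  have F1v: "F1 \<bullet>\<bullet> v = v" using F2(4) F2v by (metis app_times)
  have Fv: "F \<bullet>\<bullet> v = v" using F1(4) F1v by (metis app_times)
  have Ev: "E \<bullet>\<bullet> v = v" using E_left[OF F(1)] Fv by (metis app_times)
  have a: "norm (A \<bullet>\<bullet> v - s *\<^sub>R v) \<le> \<eta>"
    using norm_app[of "(A - s *\<^sub>R 1) * F1" v] F1(5) by (simp add: F1v nv)
  have b: "norm (B \<bullet>\<bullet> v - t *\<^sub>R v) \<le> \<eta>"
    using norm_app[of "(B - t *\<^sub>R 1) * F2" v] F2(5) by (simp add: F2v nv)
  define l where "l = Complex s t"
  have "l *\<^sub>C v = s *\<^sub>R v + \<i> *\<^sub>C t *\<^sub>R v"
    by (simp add: l_def scaleR_scaleC scaleC_scaleC Complex_eq flip: scaleC_add_left)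
  then have "u \<bullet>\<bullet> v - l *\<^sub>C v = (A \<bullet>\<bullet> v - s *\<^sub>R v) + \<i> *\<^sub>C (B \<bullet>\<bullet> v - t *\<^sub>R v)"
    by (subst uAB) (simp add: scaleC_diff_right)
  also have "norm \<dots> \<le> \<eta> + 1 * \<eta>" using a b by (intro order_trans[OF norm_triangle_ineq] add_mono) auto
  finally have uv: "norm (u \<bullet>\<bullet> v - l *\<^sub>C v) \<le> 2 * \<eta>" by simp
  have "(norm (u \<bullet>\<bullet> v))\<^sup>2 = inner v ((u\<^sup>\<star> * u) \<bullet>\<bullet> v)"
    by (simp add: power2_norm_eq_inner inner_star_right)
  also have "\<dots> = 1" using nv by (simp add: u Ev flip: power2_norm_eq_inner)
  finally have "norm (u \<bullet>\<bullet> v) = 1" using power2_eq_imp_eq[of "norm (u \<bullet>\<bullet> v)" 1] by simp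
  then have l1: "\<bar>1 - cmod l\<bar> \<le> 2 * \<eta>"
    using norm_triangle_ineq3[of "u \<bullet>\<bullet> v" "l *\<^sub>C v"] uv nv by simp
  then have l0: "cmod l > 0" using \<eta> by (auto simp: abs_le_iff)
  define k where "k = l / of_real (cmod l)"
  have k1: "cmod k = 1" using l0 by (simp add: k_def norm_divide)
  have "l - k = k * of_real (cmod l - 1)" using l0 by (simp add: k_def field_simps)
  then have "cmod (l - k) = \<bar>cmod l - 1\<bar>" using k1 by (simp only: norm_mult norm_of_real mult_1)
  then have kl: "norm ((l - k) *\<^sub>C v) \<le> 2 * \<eta>" using l1 nv by (simp add: abs_minus_commute)
  have "u \<bullet>\<bullet> v - k *\<^sub>C v = (u \<bullet>\<bullet> v - l *\<^sub>C v) + (l - k) *\<^sub>C v"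
    using scaleC_add_left[of "l - k" k v] by (simp add: algebra_simps)
  then have "norm (u \<bullet>\<bullet> v - k *\<^sub>C v) \<le> norm (u \<bullet>\<bullet> v - l *\<^sub>C v) + norm ((l - k) *\<^sub>C v)"
    by (simp only: norm_triangle_ineq)
  then have "norm (u \<bullet>\<bullet> v - k *\<^sub>C v) \<le> 4 * \<eta>" using uv kl by linarith
  then show ?thesis using nv Fv k1 by blast
qed

lemma norm_sub_power_app:
  assumes "norm u \<le> 1" "cmod l = 1"
  shows "norm (u ^ n \<bullet>\<bullet> v - (l ^ n) *\<^sub>C v) \<le> n * norm (u \<bullet>\<bullet> v - l *\<^sub>C v)"
proof (induction n)
  case (Suc n)
  have "u ^ Suc n \<bullet>\<bullet> v - (l ^ Suc n) *\<^sub>C v =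
      u \<bullet>\<bullet> (u ^ n \<bullet>\<bullet> v - (l ^ n) *\<^sub>C v) + (l ^ n) *\<^sub>C (u \<bullet>\<bullet> v - l *\<^sub>C v)"
    by (simp add: scaleC_diff_right scaleC_scaleC mult.commute)
  also have "norm \<dots> \<le> 1 * norm (u ^ n \<bullet>\<bullet> v - (l ^ n) *\<^sub>C v) + 1 * norm (u \<bullet>\<bullet> v - l *\<^sub>C v)"
    by (intro order_trans[OF norm_triangle_ineq] add_mono order_trans[OF norm_app] mult_right_mono assms)
       (simp_all add: norm_power assms)
  finally show ?case using Suc by (simp add: algebra_simps)
qed simp

text \<open>Replaces spectral mapping. If the norm exceeded some \<open>c > K * w\<close>, cutting
  \<open>N\<^sup>\<star> * N\<close> at \<open>c\<^sup>2\<close> would give a nonzero projection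
  commuting with \<open>u\<close>. An approximate eigenvector of \<open>u\<close> inside it carries
  the hypothesis over to its eigenvalue \<open>l\<close>, and the scalar estimate
  \<open>near_root_of_minus_one\<close> contradicts the cut.\<close>

lemma (in op_alg) power_near_minus_one:
  assumes \<omega>: "has_mult_order \<omega> m" and m: "m \<ge> 2" and w: "0 \<le> w"
    and u: "u \<in> C" "u\<^sup>\<star> * u = E" "u * u\<^sup>\<star> = E"
    and re: "\<And>j v. j < m \<Longrightarrow> E \<bullet>\<bullet> v = v \<Longrightarrow>
      inner (sc (\<omega> ^ j) u \<bullet>\<bullet> v) v \<le> (cos (pi / m) + w) * (norm v)\<^sup>2"
  shows "norm (u ^ m + E) \<le> root_const m * w"
proof (rule ccontr)
  define K where "K = root_const m"
  have K: "K > 0" unfolding K_def by (rule root_const_pos[OF m])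
  assume "\<not> norm (u ^ m + E) \<le> root_const m * w"
  then have "K * w < norm (u ^ m + E)" by (simp add: K_def)
  then obtain c where c: "K * w < c" "c < norm (u ^ m + E)" using dense by blast
  have "0 \<le> K * w" using K w by simp
  then have c0: "0 \<le> c" using c(1) by linarith
  define N where "N = u ^ m + E"
  have NC: "N \<in> C" unfolding N_def using m by (intro C_add C_power_pos u E_in) auto
  define Z where "Z = N\<^sup>\<star> * N - c\<^sup>2 *\<^sub>R E"
  have ZC: "Z \<in> C" unfolding Z_def by (intro C_diff C_mult C_star NC C_scaleR E_in)
  have Zs: "Z\<^sup>\<star> = Z" by (simp add: Z_def E_star)
  have Zq: "inner (Z \<bullet>\<bullet> v) v = (norm (N \<bullet>\<bullet> v))\<^sup>2 - c\<^sup>2 * (norm v)\<^sup>2" if "E \<bullet>\<bullet> v = v" for v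
    using that by (simp add: Z_def inner_diff inner_star power2_norm_eq_inner)
  obtain F where F: "F \<in> C" "proj F" "\<And>x. 0 \<le> inner (Z \<bullet>\<bullet> F \<bullet>\<bullet> x) (F \<bullet>\<bullet> x)"
    "\<And>x. inner (Z \<bullet>\<bullet> (E - F) \<bullet>\<bullet> x) ((E - F) \<bullet>\<bullet> x) \<le> 0"
    "\<And>p. p * Z = Z * p \<Longrightarrow> p * E = E * p \<Longrightarrow> p * F = F * p"
    using sign_projection[OF ZC Zs] by blast
  have EuE: "E * u = u" "u * E = u" "E * u\<^sup>\<star> = u\<^sup>\<star>" "u\<^sup>\<star> * E = u\<^sup>\<star>"
    by (auto intro: E_left E_right u C_star)
  have uu: "u * u\<^sup>\<star> = u\<^sup>\<star> * u" by (simp add: u)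
  have Ns: "N\<^sup>\<star> = (u\<^sup>\<star>) ^ m + E" by (simp add: N_def E_star)
  have pN: "p * Z = Z * p" if "p * u = u * p" "p * u\<^sup>\<star> = u\<^sup>\<star> * p" "p * E = E * p" for p
  proof -
    have "p * N = N * p" unfolding N_def using power_intertwine[OF that(1), of m] that(3) by (simp add: algebra_simps)
    moreover have "p * N\<^sup>\<star> = N\<^sup>\<star> * p" unfolding Ns using power_intertwine[OF that(2), of m] that(3) by (simp add: algebra_simps)
    ultimately have "p * (N\<^sup>\<star> * N) = N\<^sup>\<star> * N * p" by (intro commute_mult)
    then show ?thesis by (simp add: Z_def right_diff_distrib left_diff_distrib that)
  qed
  have Fu: "F * u = u * F" "F * u\<^sup>\<star> = u\<^sup>\<star> * F"
    by (rule F(5)[symmetric], (rule pN)?; simp add: uu EuE)+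
  show False
  proof (cases "F = 0")
    case True
    have "norm N \<le> c"
    proof (rule norm_cop_bound[OF c0])
      fix v
      have "inner (Z \<bullet>\<bullet> E \<bullet>\<bullet> v) (E \<bullet>\<bullet> v) \<le> 0" using F(4)[of v] True by simp
      then have "(norm (N \<bullet>\<bullet> E \<bullet>\<bullet> v))\<^sup>2 \<le> (c * norm (E \<bullet>\<bullet> v))\<^sup>2"
        using Zq[of "E \<bullet>\<bullet> v"] by (simp add: proj_app[OF proj_E] power_mult_distrib)
      then have "norm (N \<bullet>\<bullet> E \<bullet>\<bullet> v) \<le> c * norm (E \<bullet>\<bullet> v)" by (rule power2_le_imp_le) (simp add: c0)
      also have "\<dots> \<le> c * norm v" by (intro mult_left_mono proj_norm_app proj_E c0)
      also have "N \<bullet>\<bullet> E \<bullet>\<bullet> v = N \<bullet>\<bullet> v" using E_right[OF NC] by (metis app_times)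
      finally show "norm (N \<bullet>\<bullet> v) \<le> c * norm v" .
    qed
    then show False using c(2) by (simp add: N_def)
  next
    case False
    \<comment> \<open>Small enough that the total error \<open>4 * (K + m) * \<eta>\<close> uses at
      most half of the margin \<open>c - K * w\<close>.\<close>
    define \<eta> where "\<eta> = min (1 / 4) ((c - K * w) / (8 * (K + m)))"
    have Km: "K + m > 0" using K by simp
    have "0 < (c - K * w) / (8 * (K + m))" using c(1) Km by simp
    then have \<eta>: "0 < \<eta>" unfolding \<eta>_def by linarith
    have \<eta>1: "\<eta> \<le> 1 / 4" unfolding \<eta>_def by (rule min.cobounded1)
    have \<eta>2: "\<eta> \<le> (c - K * w) / (8 * (K + m))" unfolding \<eta>_def by (rule min.cobounded2)
    obtain v l where v: "norm v = 1" "F \<bullet>\<bullet> v = v" "cmod l = 1" "norm (u \<bullet>\<bullet> v - l *\<^sub>C v) \<le> 4 * \<eta>"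
      using approximate_eigenvector[OF u F(1,2) False Fu \<eta> \<eta>1] by blast
    have Ev: "E \<bullet>\<bullet> v = v" using E_left[OF F(1)] v(2) by (metis app_times)
    have nu: "norm u \<le> 1" by (rule unitary_norm_le[OF u(2) proj_E])
    have "Re (\<omega> ^ j * l) \<le> cos (pi / m) + (w + 4 * \<eta>)" if "j < m" for j
    proof -
      have q: "inner (a *\<^sub>C v) v = Re a" for a
        using v(1) by (simp add: inner_eq_Re_cinner cinner_scaleC_left cinner_self)
      have "inner (sc (\<omega> ^ j) u \<bullet>\<bullet> v) v =
          inner ((\<omega> ^ j * l) *\<^sub>C v) v + inner ((\<omega> ^ j) *\<^sub>C (u \<bullet>\<bullet> v - l *\<^sub>C v)) v"
        by (simp add: scaleC_diff_right inner_diff_left scaleC_scaleC)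
      then have "inner (sc (\<omega> ^ j) u \<bullet>\<bullet> v) v =
          Re (\<omega> ^ j * l) + inner ((\<omega> ^ j) *\<^sub>C (u \<bullet>\<bullet> v - l *\<^sub>C v)) v"
        by (simp only: q)
      moreover have "\<bar>inner ((\<omega> ^ j) *\<^sub>C (u \<bullet>\<bullet> v - l *\<^sub>C v)) v\<bar> \<le> 4 * \<eta>"
        using Cauchy_Schwarz_ineq2[of "(\<omega> ^ j) *\<^sub>C (u \<bullet>\<bullet> v - l *\<^sub>C v)" v] v
        by (simp add: norm_power order_cmod[OF \<omega>])
      ultimately show ?thesis using re[OF that Ev] v(1) unfolding v(1) by (simp del: app_sc)
    qed
    then have lm: "cmod (l ^ m + 1) \<le> K * (w + 4 * \<eta>)"
      unfolding K_def by (rule near_root_of_minus_one[OF \<omega> m v(3)])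
    have "N \<bullet>\<bullet> v = (u ^ m \<bullet>\<bullet> v - (l ^ m) *\<^sub>C v) + (l ^ m + 1) *\<^sub>C v"
      by (simp add: N_def Ev scaleC_add_left)
    also have "norm \<dots> \<le> m * (4 * \<eta>) + K * (w + 4 * \<eta>)"
    proof (intro order_trans[OF norm_triangle_ineq] add_mono)
      show "norm (u ^ m \<bullet>\<bullet> v - (l ^ m) *\<^sub>C v) \<le> m * (4 * \<eta>)"
        by (rule order_trans[OF norm_sub_power_app[OF nu v(3)]]) (intro mult_left_mono v, simp)
    qed (use lm v in simp)
    also have "\<dots> = K * w + 4 * (K + m) * \<eta>" by (simp add: algebra_simps)
    also have "\<dots> \<le> K * w + 4 * (K + m) * ((c - K * w) / (8 * (K + m)))"
      using Km by (intro add_left_mono mult_left_mono \<eta>2) auto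
    also have "\<dots> = K * w + (c - K * w) / 2" using Km by (simp add: field_simps)
    also have "\<dots> < c"
    proof -
      have "a + (b - a) / 2 < b" if "a < b" for a b :: real using that by (simp add: field_simps)
      then show ?thesis using c(1) .
    qed
    finally have "norm (N \<bullet>\<bullet> v) < c" .
    then have "(norm (N \<bullet>\<bullet> v))\<^sup>2 < c\<^sup>2" using c0 by (intro power_strict_mono) auto
    moreover have "0 \<le> (norm (N \<bullet>\<bullet> v))\<^sup>2 - c\<^sup>2 * (norm v)\<^sup>2" using F(3)[of v] Zq[OF Ev] v(2) by simp
    ultimately show False using v(1) by simp
  qed
qed

text \<open>\<open>\<sigma> = u (-u\<^sup>m) powr (-1/m)\<close>. Its unitarity follows because \<open>\<sigma> \<sigma>*\<close> is near \<open>E\<close> and its \<open>m\<close>-th power is \<open>E\<close>.\<close>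

lemma (in op_alg) unitary_root:
  assumes u: "u \<in> C" "u\<^sup>\<star> * u = E" "u * u\<^sup>\<star> = E" and m: "m > 0"
    and r: "norm (u ^ m + E) \<le> r" "r \<le> 1 / 16"
  shows "\<exists>\<sigma>\<in>C. \<sigma>\<^sup>\<star> * \<sigma> = E \<and> \<sigma> * \<sigma>\<^sup>\<star> = E \<and> \<sigma> ^ m = - E \<and> norm (\<sigma> - u) \<le> 2 * r \<and>
    (\<forall>p l. p * u = sc l (u * p) \<longrightarrow> l ^ m = 1 \<longrightarrow> p * E = E * p \<longrightarrow> p * \<sigma> = sc l (\<sigma> * p))"
proof -
  define x where "x = u ^ m + E"
  have xC: "x \<in> C" unfolding x_def using m by (intro C_add C_power_pos u E_in)
  have nx: "norm x \<le> r" "norm (x\<^sup>\<star>) \<le> r" using r(1) unfolding x_def[symmetric] norm_star by auto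
  have ok: "bpow_ok s x" "bpow_ok s (x\<^sup>\<star>)" if "\<bar>s\<bar> \<le> 1" for s
    using nx r(2) that by (auto intro: bpow_ok_lt1)
  have m1: "\<bar>1 / real m\<bar> \<le> 1" using m by simp
  define D where "D = bpow (1 / m) x"
  have Ds: "D\<^sup>\<star> = bpow (1 / m) (x\<^sup>\<star>)" unfolding D_def by (rule star_bpow[OF ok(1)[OF m1]])
  have commD: "p * D = D * p" if "p * x = x * p" for p
    unfolding D_def by (rule bpow_intertwine) (use that ok[OF m1] in auto)
  have commDs: "p * D\<^sup>\<star> = D\<^sup>\<star> * p" if "p * x\<^sup>\<star> = x\<^sup>\<star> * p" for p
    unfolding Ds by (rule bpow_intertwine) (use that ok[OF m1] in auto)
  have EuE: "E * u = u" "u * E = u" "E * u\<^sup>\<star> = u\<^sup>\<star>" "u\<^sup>\<star> * E = u\<^sup>\<star>"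
    by (auto intro: E_left E_right u C_star)
  have xs: "x\<^sup>\<star> = (u\<^sup>\<star>) ^ m + E" by (simp add: x_def E_star)
  have ux: "u * x = x * u" using EuE by (simp add: x_def algebra_simps power_commutes)
  have uus: "u\<^sup>\<star> * u ^ m = u ^ m * u\<^sup>\<star>" using power_intertwine[of "u\<^sup>\<star>" u u m] by (simp add: u)
  have usx: "u\<^sup>\<star> * x = x * u\<^sup>\<star>" using EuE uus by (simp add: x_def distrib_left distrib_right)
  have xxs: "x * x\<^sup>\<star> = x\<^sup>\<star> * x"
    unfolding xs using power_intertwine[OF usx[symmetric], of m] E_left[OF xC] E_right[OF xC]
    by (simp add: distrib_left distrib_right)
  have ED: "E * D = D * E" by (rule commD) (simp add: E_left[OF xC] E_right[OF xC])
  have EDs: "E * D\<^sup>\<star> = D\<^sup>\<star> * E"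
    by (rule commDs) (simp add: E_left[OF C_star[OF xC]] E_right[OF C_star[OF xC]])
  have DDs: "D * D\<^sup>\<star> = D\<^sup>\<star> * D" by (rule commDs) (simp add: commD[OF xxs[symmetric], symmetric])
  have Dm: "D ^ m * (1 - x) = 1"
    unfolding D_def by (rule bpow_inverse_root) (use nx r(2) m in auto)
  have Dsm: "(D\<^sup>\<star>) ^ m * (1 - x\<^sup>\<star>) = 1"
    unfolding Ds by (rule bpow_inverse_root) (use nx r(2) m in auto)
  define h where "h = E * (D * D\<^sup>\<star>)"
  have EDD: "E * (D * D\<^sup>\<star>) = D * D\<^sup>\<star> * E" by (intro commute_mult ED EDs)
  have Epow: "E ^ n = E" if "n > 0" for n
    using that by (induction n) (auto simp: E_idem, metis E_idem gr0I mult_1_right power_0)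
  have hpow: "h ^ n = E * (D ^ n * (D\<^sup>\<star>) ^ n)" if "n > 0" for n
    unfolding h_def using mult_power_commute[OF EDD] mult_power_commute[OF DDs] Epow[OF that] by simp
  have Ehn: "E * h ^ n = h ^ n" if "n > 0" for n
    using hpow[OF that] by (simp add: E_idem flip: mult.assoc)
  have hm: "h ^ m = E"
  proof -
    have um: "u ^ m * (u\<^sup>\<star>) ^ m = E"
      using mult_power_commute[of u "u\<^sup>\<star>" m] Epow[OF m] by (simp add: u)
    have E1x: "E * (1 - x) = - (u ^ m)" "E * (1 - x\<^sup>\<star>) = - ((u\<^sup>\<star>) ^ m)"
      using E_left[OF xC] E_left[OF C_star[OF xC]] by (simp_all add: right_diff_distrib) (simp_all add: x_def E_star)
    have x1: "x * (1 - x\<^sup>\<star>) = (1 - x\<^sup>\<star>) * x" by (simp add: algebra_simps xxs)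
    have Ds1: "(1 - x) * (D\<^sup>\<star>) ^ m = (D\<^sup>\<star>) ^ m * (1 - x)"
    proof (rule power_intertwine)
      show "(1 - x) * D\<^sup>\<star> = D\<^sup>\<star> * (1 - x)" using commDs[OF xxs] by (simp add: algebra_simps)
    qed
    have "E = E * (1 - x) * (E * (1 - x\<^sup>\<star>))" by (simp add: E1x um)
    also have "\<dots> = E * ((1 - x) * (1 - x\<^sup>\<star>))"
      by (rule idem_commute_mult[OF E_idem]) (simp add: right_diff_distrib left_diff_distrib E_left[OF xC] E_right[OF xC])
    finally have E1: "E = E * ((1 - x) * (1 - x\<^sup>\<star>))" .
    have "h ^ m = E * (D ^ m * (D\<^sup>\<star>) ^ m)" by (rule hpow[OF m])
    also have "\<dots> = (D ^ m * (D\<^sup>\<star>) ^ m) * E"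
      using hpow[OF m] commute_mult[OF power_intertwine[OF ED] power_intertwine[OF EDs]] by simp
    also have "\<dots> = (D ^ m * (D\<^sup>\<star>) ^ m) * (((1 - x) * (1 - x\<^sup>\<star>)) * E)"
      by (subst E1) (simp add: algebra_simps E_left[OF xC] E_right[OF xC] E_left[OF C_star[OF xC]] E_right[OF C_star[OF xC]],
        simp flip: mult.assoc add: E_left[OF xC] E_right[OF C_star[OF xC]])
    also have "\<dots> = D ^ m * ((D\<^sup>\<star>) ^ m * (1 - x)) * (1 - x\<^sup>\<star>) * E" by (simp only: mult.assoc)
    also have "\<dots> = (D ^ m * (1 - x)) * ((D\<^sup>\<star>) ^ m * (1 - x\<^sup>\<star>)) * E" unfolding Ds1[symmetric] by (simp only: mult.assoc)
    finally show ?thesis by (simp add: Dm Dsm)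
  qed
  have near: "norm (bpow s y - 1) \<le> 2 * r" if "\<bar>s\<bar> \<le> 1" "norm y \<le> r" for s and y :: "'h cop"
    using norm_bpow_diff[of s y] that r(2) by auto
  \<comment> \<open>The powers of \<open>D\<close> are binomial series with exponent
    \<open>n / m\<close> at most 1, so the bound is uniform in \<open>n\<close> and
    \<open>m\<close>.\<close>
  have hn: "norm (E - h ^ n) \<le> 1 / 2" if "n < m" "n > 0" for n
  proof -
    have s: "\<bar>real n * (1 / real m)\<bar> \<le> 1" using that by simp
    define a where "a = bpow (n * (1 / m)) x - 1"
    define b where "b = bpow (n * (1 / m)) (x\<^sup>\<star>) - 1"
    have "D ^ n = 1 + a" "(D\<^sup>\<star>) ^ n = 1 + b"
      unfolding Ds a_def b_def unfolding D_def using nx r(2) s by (simp_all add: bpow_power)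
    then have "E - h ^ n = - (E * (a + b + a * b))" by (simp add: hpow[OF that(2)] algebra_simps)
    then have "norm (E - h ^ n) \<le> norm (a + b + a * b)" using proj_left_absorb[OF proj_E] by (metis norm_minus_cancel)
    also have "\<dots> \<le> 2 * r + 2 * r + (2 * r) * (2 * r)"
      using near[OF s nx(1)] near[OF s nx(2)] unfolding a_def[symmetric] b_def[symmetric]
      by (intro order_trans[OF norm_triangle_ineq] add_mono mult_norm_le)
    also have "\<dots> \<le> 2 * (1/16) + 2 * (1/16) + (2 * (1/16)) * (2 * (1/16))"
      using r nx norm_ge_zero[of x] by (intro add_mono mult_mono) linarith+
    finally show ?thesis by simp
  qed
  have geo: "(h - E) * (\<Sum>k<n. h ^ k) = h ^ n - E" if "n > 0" for n
    using that
  proof (induction n)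
    case (Suc n)
    then show ?case
      by (cases "n = 0") (simp_all add: distrib_left left_diff_distrib Ehn)
  qed simp
  have "h * E = h" unfolding h_def EDD by (simp add: E_idem mult.assoc)
  then have hE0: "(h - E) * E = h - E" by (simp add: left_diff_distrib E_idem)
  \<comment> \<open>The geometric sum times \<open>h - E\<close> vanishes because
    \<open>h ^ m = E\<close>. What remains bounds \<open>m\<close> times the norm of
    \<open>h - E\<close> by half of itself. The term \<open>k = 0\<close> is split off since
    \<open>h ^ 0\<close> is 1 and not \<open>E\<close>.\<close>
  have "real m *\<^sub>R (h - E) = (h - E) * (\<Sum>k<m. 1 - h ^ k)"
    using geo[OF m] by (simp add: hm sum_subtractf right_diff_distrib scaleR_conv_of_real sum_constant_scaleR
        del: sum_constant)
  also have "\<dots> = (\<Sum>k<m. (h - E) * (if k = 0 then 0 else E - h ^ k))"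
    unfolding sum_distrib_left
    by (intro sum.cong refl)
       (auto simp: right_diff_distrib[of "h - E"] hE0)
  finally have "real m * norm (h - E) = norm (\<Sum>k<m. (h - E) * (if k = 0 then 0 else E - h ^ k))"
    by (metis abs_of_nat norm_scaleR)
  also have "\<dots> \<le> real m * (norm (h - E) * (1 / 2))"
  proof (rule norm_sum_le_card)
    fix k assume "k < m"
    then show "norm ((h - E) * (if k = 0 then 0 else E - h ^ k)) \<le> norm (h - E) * (1 / 2)"
      using mult_norm_le[OF order_refl hn, of k "h - E"] by (cases "k = 0") auto
  qed
  finally have hE: "h = E" using m by simp
  define \<sigma> where "\<sigma> = u * D"
  have uD: "u * D = D * u" by (rule commD[OF ux])
  have "\<sigma> = u * (E * D)" by (simp add: \<sigma>_def EuE flip: mult.assoc)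
  then have \<sigma>C: "\<sigma> \<in> C" unfolding D_def by (simp add: C_mult u C_bpow xC ok[OF m1])
  have "\<sigma>\<^sup>\<star> * \<sigma> = D\<^sup>\<star> * (u\<^sup>\<star> * u) * D" by (simp add: \<sigma>_def mult.assoc)
  also have "\<dots> = E * (D\<^sup>\<star> * D)" by (simp add: u EDs[symmetric] mult.assoc)
  also have "\<dots> = E" using hE by (simp add: h_def DDs)
  finally have 1: "\<sigma>\<^sup>\<star> * \<sigma> = E" .
  have "\<sigma> * \<sigma>\<^sup>\<star> = u * E * (D * D\<^sup>\<star>) * u\<^sup>\<star>" by (simp add: \<sigma>_def EuE mult.assoc)
  also have "\<dots> = u * (E * (D * D\<^sup>\<star>)) * u\<^sup>\<star>" by (simp only: mult.assoc)
  also have "\<dots> = E" using hE by (simp add: h_def EuE u)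
  finally have 2: "\<sigma> * \<sigma>\<^sup>\<star> = E" .
  have 3: "\<sigma> ^ m = - E"
  proof -
    have "\<sigma> ^ m = u ^ m * D ^ m" unfolding \<sigma>_def by (rule mult_power_commute[OF uD])
    also have "u ^ m = - (E * (1 - x))" by (simp add: right_diff_distrib E_left[OF xC]) (simp add: x_def)
    also have "- (E * (1 - x)) * D ^ m = - (E * (D ^ m * (1 - x)))"
      using power_intertwine[of "1 - x" D D m] commD[of x] by (simp add: mult.assoc algebra_simps)
    finally show ?thesis by (simp add: Dm)
  qed
  have "\<sigma> - u = u * (D - 1)" by (simp add: \<sigma>_def right_diff_distrib)
  then have 4: "norm (\<sigma> - u) \<le> 2 * r"
    using mult_norm_le[OF unitary_norm_le[OF u(2) proj_E] near[OF m1 nx(1)]] by (simp add: D_def)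
  have 5: "p * \<sigma> = sc l (\<sigma> * p)" if p: "p * u = sc l (u * p)" "l ^ m = 1" "p * E = E * p" for p l
  proof -
    have "p * u ^ m = (sc l u) ^ m * p" by (rule power_intertwine) (simp add: p)
    then have "p * x = x * p" by (simp add: x_def sc_power p distrib_left distrib_right)
    then have "p * D = D * p" by (rule commD)
    then show ?thesis by (simp add: \<sigma>_def p(1) mult.assoc[symmetric]) (simp add: mult.assoc)
  qed
  show ?thesis using \<sigma>C 1 2 3 4 5 by blast
qed

section \<open>Averaging over a cyclic group\<close>

lemma sum_cyclic_shift:
  fixes f :: "nat \<Rightarrow> 'a::ab_group_add"
  assumes "f m = f 0" shows "(\<Sum>j<m. f (Suc j)) = (\<Sum>j<m. f j)"
proof -
  have "f 0 + (\<Sum>j<m. f (Suc j)) = (\<Sum>j<m. f j) + f m"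
    by (metis sum.lessThan_Suc_shift sum.lessThan_Suc)
  then show ?thesis using assms by simp
qed

lemma sc_power_cancel: "l * cnj l = 1 \<Longrightarrow> l ^ j * cnj l ^ j = 1"
  by (metis power_mult_distrib power_one)

lemma cmod_one:
  assumes "l * cnj l = 1" shows "cmod l = 1"
proof -
  have "complex_of_real ((cmod l)\<^sup>2) = 1" using assms by (simp only: complex_norm_square)
  then have "(cmod l)\<^sup>2 = 1" by (simp only: of_real_eq_1_iff)
  then show ?thesis using power2_eq_imp_eq[of "cmod l" 1] by simp
qed

text \<open>A scalar \<open>c\<close> in \<open>g_power\<close> is harmless because conjugation does
  not see it. It is 1 for the clock and shift matrices and \<open>- 1\<close> for the root on the
  seam.\<close>

locale cyclic_alg = op_alg C E for C :: "'h::complex_hilbert cop set" and E +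
  fixes g :: "'h cop" and m :: nat and c :: complex
  assumes m_pos: "m > 0" and g_in: "g \<in> C" and g_unitary: "g\<^sup>\<star> * g = E" "g * g\<^sup>\<star> = E"
    and g_power: "g ^ m = sc c E" and c_unit: "c * cnj c = 1"
begin

definition cj :: "nat \<Rightarrow> 'h cop \<Rightarrow> 'h cop" where
  "cj j T = g ^ j * T * (g\<^sup>\<star>) ^ j"

lemma cj_0 [simp]: "cj 0 T = T" by (simp add: cj_def)

lemma cj_Suc: "cj (Suc j) T = g * cj j T * g\<^sup>\<star>"
  by (simp add: cj_def power_commutes mult.assoc)

lemma cj_in: "T \<in> C \<Longrightarrow> cj j T \<in> C"
  by (induction j) (auto simp: cj_Suc intro: C_mult C_star g_in)

lemma cj_add [simp]: "cj j (S + T) = cj j S + cj j T"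
  and cj_diff [simp]: "cj j (S - T) = cj j S - cj j T"
  and cj_sc [simp]: "cj j (sc a T) = sc a (cj j T)"
  by (simp_all add: cj_def algebra_simps)

lemma cj_minus: "cj j (- T) = - cj j T"
  using cj_diff[of j 0 T] cj_diff[of j T T] by (simp add: cj_def)

lemma cj_star: "(cj j T)\<^sup>\<star> = cj j (T\<^sup>\<star>)"
  by (simp add: cj_def mult.assoc)

lemma cj_mult:
  assumes "S \<in> C" "T \<in> C" shows "cj j (S * T) = cj j S * cj j T"
proof (induction j)
  case (Suc j)
  have "cj (Suc j) S * cj (Suc j) T = g * cj j S * (g\<^sup>\<star> * g) * cj j T * g\<^sup>\<star>"
    by (simp add: cj_Suc mult.assoc)
  also have "\<dots> = g * (cj j S * E) * cj j T * g\<^sup>\<star>" by (simp add: g_unitary mult.assoc)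
  also have "\<dots> = g * (cj j S * cj j T) * g\<^sup>\<star>"
    by (simp add: E_right[OF cj_in[OF assms(1)]] mult.assoc)
  finally show ?case by (simp add: Suc cj_Suc)
qed simp

lemma cj_E: "cj j E = E"
  by (induction j) (simp_all add: cj_Suc g_unitary E_right[OF g_in])

lemma cj_proj: "T \<in> C \<Longrightarrow> proj T \<Longrightarrow> proj (cj j T)"
  by (simp add: proj_def cj_star flip: cj_mult)

lemma g_cj: "T \<in> C \<Longrightarrow> g * cj j T = cj (Suc j) T * g"
  by (simp add: cj_Suc mult.assoc g_unitary E_right cj_in)

lemma g_norm: "norm g \<le> 1" "norm (g\<^sup>\<star>) \<le> 1"
  using unitary_norm_le[OF g_unitary(1) proj_E] by simp_all

lemma norm_cj: "norm (cj j T) \<le> norm T"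
proof (induction j)
  case (Suc j)
  have "norm (g * cj j T * g\<^sup>\<star>) \<le> 1 * norm T * 1" by (intro mult_norm_le Suc g_norm)
  then show ?case by (simp add: cj_Suc)
qed simp

lemma cj_period: "T \<in> C \<Longrightarrow> cj m T = T"
proof -
  assume T: "T \<in> C"
  have "(g\<^sup>\<star>) ^ m = sc (cnj c) E" using arg_cong[OF g_power, of star] by (simp add: E_star)
  then show ?thesis using T c_unit by (simp add: cj_def g_power E_left E_right mult.commute)
qed

lemma cj_cj: "cj i (cj j T) = cj (i + j) T"
  by (induction i) (simp_all add: cj_Suc)

lemma cj_fixed: "T \<in> C \<Longrightarrow> g * T = T * g \<Longrightarrow> cj j T = T"
  by (induction j) (simp_all add: cj_Suc mult.assoc g_unitary E_right)

lemma cj_near: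
  assumes T: "T \<in> C" and e: "norm (g * T - sc l (T * g)) \<le> e" and l: "cmod l = 1"
  shows "norm (cj j T - sc (l ^ j) T) \<le> real j * e"
proof (induction j)
  case (Suc j)
  have TG: "T * g * g\<^sup>\<star> = T" by (simp add: mult.assoc g_unitary E_right T)
  have "cj (Suc j) T - sc (l ^ Suc j) T =
      g * (cj j T - sc (l ^ j) T) * g\<^sup>\<star> + sc (l ^ j) ((g * T - sc l (T * g)) * g\<^sup>\<star>)"
    by (simp add: cj_Suc right_diff_distrib left_diff_distrib sc_diff TG mult.commute)
  also have "norm \<dots> \<le> 1 * (real j * e) * 1 + 1 * (e * 1)"
    using mult_norm_le[OF e g_norm(2)]
    by (intro order_trans[OF norm_triangle_ineq] add_mono mult_norm_le Suc g_norm) (simp add: norm_power l)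
  finally show ?case by (simp add: algebra_simps)
qed simp

lemma cj_near_le:
  assumes T: "T \<in> C" and e: "norm (g * T - sc l (T * g)) \<le> e" and l: "cmod l = 1" and j: "j \<le> m"
  shows "norm (cj j T - sc (l ^ j) T) \<le> real m * e"
proof -
  have "0 \<le> e" using e norm_ge_zero order_trans by blast
  then have "real j * e \<le> real m * e" using j by (intro mult_right_mono) auto
  then show ?thesis using cj_near[OF T e l, of j] by simp
qed

text \<open>The scalars from passing \<open>p\<close> across \<open>g\<close> and across
  \<open>g\<^sup>\<star>\<close> cancel, so a \<open>p\<close> commuting with \<open>g\<close> only
  up to a scalar still commutes with conjugation by \<open>g\<close>.\<close>

lemma cj_covariant:
  assumes p: "p * g = sc u (g * p)" "p * g\<^sup>\<star> = sc (cnj u) (g\<^sup>\<star> * p)" "u * cnj u = 1" "p * T = sc a (T * p)"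
  shows "p * cj j T = sc a (cj j T * p)"
proof (induction j)
  case (Suc j)
  have "p * cj (Suc j) T = sc u (g * (p * cj j T) * g\<^sup>\<star>)"
    by (simp add: cj_Suc p flip: mult.assoc)
  also have "\<dots> = sc (u * a) (g * cj j T * (p * g\<^sup>\<star>))" by (simp add: Suc mult.assoc)
  also have "\<dots> = sc (u * cnj u * a) (g * cj j T * g\<^sup>\<star> * p)" by (simp add: p(2) mult.assoc mult_ac)
  finally show ?case by (simp add: p(3) cj_Suc)
qed (simp add: p)

lemma cj_lower:
  assumes "T \<in> C" "P \<in> C" and b: "\<And>v. b * (norm (P \<bullet>\<bullet> v))\<^sup>2 \<le> inner (T \<bullet>\<bullet> P \<bullet>\<bullet> v) (P \<bullet>\<bullet> v)"
  shows "b * (norm (cj j P \<bullet>\<bullet> v))\<^sup>2 \<le> inner (cj j T \<bullet>\<bullet> cj j P \<bullet>\<bullet> v) (cj j P \<bullet>\<bullet> v)"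
proof (induction j arbitrary: v)
  case (Suc j)
  define y where "y = g\<^sup>\<star> \<bullet>\<bullet> v"
  have P: "cj (Suc j) P \<bullet>\<bullet> v = g \<bullet>\<bullet> cj j P \<bullet>\<bullet> y" by (simp add: cj_Suc y_def)
  have EP: "E \<bullet>\<bullet> cj j P \<bullet>\<bullet> y = cj j P \<bullet>\<bullet> y"
    using E_left[OF cj_in[OF assms(2)]] by (metis app_times)
  have gg: "inner (g \<bullet>\<bullet> x) (g \<bullet>\<bullet> cj j P \<bullet>\<bullet> y) = inner x (cj j P \<bullet>\<bullet> y)" for x
    using g_unitary(1) EP by (metis app_times inner_star_right inner_commute)
  have T: "cj (Suc j) T \<bullet>\<bullet> g \<bullet>\<bullet> cj j P \<bullet>\<bullet> y = g \<bullet>\<bullet> cj j T \<bullet>\<bullet> cj j P \<bullet>\<bullet> y"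
    using g_unitary(1) EP by (simp add: cj_Suc) (metis app_times)
  show ?case unfolding P T gg power2_norm_eq_inner using Suc[of y] by (simp add: power2_norm_eq_inner)
qed (use b in simp)

text \<open>For \<open>l ^ m = 1\<close> this is the spectral projection of conjugation by
  \<open>g\<close>, an action of the cyclic group of order \<open>m\<close>, onto the eigenvalue
  \<open>l\<close>.\<close>

definition avg :: "complex \<Rightarrow> 'h cop \<Rightarrow> 'h cop" where
  "avg l T = (1 / m) *\<^sub>R (\<Sum>j<m. sc (cnj l ^ j) (cj j T))"

lemma sum_covariant:
  assumes T: "T \<in> C" and l: "l * cnj l = 1" "l ^ m = 1"
  shows "g * (\<Sum>j<m. sc (cnj l ^ j) (cj j T)) = sc l ((\<Sum>j<m. sc (cnj l ^ j) (cj j T)) * g)"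
proof -
  have cl: "cnj l ^ m = 1" using l(2) by (metis complex_cnj_one complex_cnj_power)
  have "g * (\<Sum>j<m. sc (cnj l ^ j) (cj j T)) = (\<Sum>j<m. sc l (sc (cnj l ^ Suc j) (cj (Suc j) T) * g))"
    unfolding sum_distrib_left
    by (intro sum.cong refl) (simp add: g_cj[OF T] mult.assoc[symmetric] l(1))
  also have "\<dots> = sc l ((\<Sum>j<m. sc (cnj l ^ Suc j) (cj (Suc j) T)) * g)"
    by (simp only: sum_distrib_right sc_sum)
  also have "(\<Sum>j<m. sc (cnj l ^ Suc j) (cj (Suc j) T)) = (\<Sum>j<m. sc (cnj l ^ j) (cj j T))"
    by (rule sum_cyclic_shift) (simp add: cl cj_period T)
  finally show ?thesis .
qed

lemma avg_covariant:
  "T \<in> C \<Longrightarrow> l * cnj l = 1 \<Longrightarrow> l ^ m = 1 \<Longrightarrow> g * avg l T = sc l (avg l T * g)"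
  unfolding avg_def by (simp add: sum_covariant)

lemma avg_in: "T \<in> C \<Longrightarrow> avg l T \<in> C"
  unfolding avg_def by (intro C_scaleR C_sum C_sc cj_in)

lemma avg_star: "(avg l T)\<^sup>\<star> = avg (cnj l) (T\<^sup>\<star>)"
  by (simp add: avg_def cj_star)

lemma avg_near:
  assumes T: "T \<in> C" and e: "norm (g * T - sc l (T * g)) \<le> e" and l: "l * cnj l = 1"
  shows "norm (avg l T - T) \<le> real m * e"
proof -
  have "(\<Sum>j<m. sc (cnj l ^ j) (cj j T - sc (l ^ j) T)) = (\<Sum>j<m. sc (cnj l ^ j) (cj j T)) - real m *\<^sub>R T"
    using sc_power_cancel[OF l] by (simp add: sc_diff sum_subtractf mult.commute sum_constant_scaleR del: sum_constant)
  then have "avg l T - T = (1 / m) *\<^sub>R (\<Sum>j<m. sc (cnj l ^ j) (cj j T - sc (l ^ j) T))"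
    using m_pos by (simp add: avg_def scaleR_diff_right)
  also have "norm \<dots> \<le> (1 / m) * (real m * (real m * e))"
  proof -
    have "norm (\<Sum>j<m. sc (cnj l ^ j) (cj j T - sc (l ^ j) T)) \<le> real m * (real m * e)"
      by (rule norm_sum_le_card) (use cj_near_le[OF T e cmod_one[OF l]] cmod_one[OF l] in \<open>simp add: norm_power\<close>)
    then show ?thesis using m_pos by (simp add: field_simps)
  qed
  finally show ?thesis using m_pos by simp
qed

lemma avg_norm: "cmod l = 1 \<Longrightarrow> norm (avg l T) \<le> norm T"
proof -
  assume l: "cmod l = 1"
  have "norm (\<Sum>j<m. sc (cnj l ^ j) (cj j T)) \<le> real m * norm T"
    by (rule norm_sum_le_card) (simp add: norm_power l norm_cj)
  then show ?thesis using m_pos by (simp add: avg_def field_simps)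
qed

lemma avg_corner:
  assumes S: "S \<in> C" "g * S = S * g" and T: "T \<in> C" "S * T = T" "T * S = T"
  shows "S * avg l T = avg l T" "avg l T * S = avg l T"
proof -
  have "S * cj j T = cj j T" "cj j T * S = cj j T" for j
    using cj_mult[OF S(1) T(1), of j] cj_mult[OF T(1) S(1), of j] T cj_fixed[OF S] by simp_all
  then show "S * avg l T = avg l T" "avg l T * S = avg l T"
    by (simp_all add: avg_def sum_distrib_left sum_distrib_right)
qed

lemma avg_compatible:
  assumes p: "p * g = sc u (g * p)" "p * g\<^sup>\<star> = sc (cnj u) (g\<^sup>\<star> * p)" "u * cnj u = 1" "p * T = sc a (T * p)"
  shows "p * avg l T = sc a (avg l T * p)"
  using cj_covariant[OF p]
  by (simp add: avg_def sum_distrib_left sum_distrib_right sc_sum mult.commute)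

end

section \<open>Exactly covariant pairs near approximately covariant ones\<close>

lemma inner_star_self: "inner (T\<^sup>\<star> \<bullet>\<bullet> v) v = inner (T \<bullet>\<bullet> v) v"
  by (metis inner_star inner_commute)

text \<open>The covariance error is written \<open>s\<^sup>2\<close> so that \<open>s\<close> is the
  offset of the spectral cut and, up to a constant, the size of every resulting correction.\<close>

locale approx_pair = cyclic_alg C E g m 1
  for C :: "'h::complex_hilbert cop set" and E g m +
  fixes \<omega> :: complex and X Y :: "'h cop" and s :: real
  assumes order: "has_mult_order \<omega> m" and m2: "m \<ge> 2"
    and X_in: "X \<in> C" and X_unitary: "X\<^sup>\<star> * X = E" "X * X\<^sup>\<star> = E"
    and Y_in: "Y \<in> C" and Y_unitary: "Y\<^sup>\<star> * Y = E" "Y * Y\<^sup>\<star> = E"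
    and XY: "X * Y = Y * X"
    and Xg: "norm (g * X - sc \<omega> (X * g)) \<le> s\<^sup>2" and Yg: "norm (g * Y - Y * g) \<le> s\<^sup>2"
    and s: "0 < s" "s \<le> 1"
begin

text \<open>The symmetries of \<open>X, Y\<close> that have to survive the correction of the pair: in the second round \<open>p\<close> is
  the unitary of the first round.\<close>

definition compatible :: "'h cop \<Rightarrow> complex \<Rightarrow> bool" where
  "compatible p a \<longleftrightarrow> (\<exists>u. u * cnj u = 1 \<and> p * g = sc u (g * p) \<and> p * g\<^sup>\<star> = sc (cnj u) (g\<^sup>\<star> * p)) \<and>
    p * E = E * p \<and> p * X = X * p \<and> p * X\<^sup>\<star> = X\<^sup>\<star> * p \<and>
    a * cnj a = 1 \<and> p * Y = sc a (Y * p) \<and> p * Y\<^sup>\<star> = sc (cnj a) (Y\<^sup>\<star> * p)"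

text \<open>Real part of the end points of the arc of half-angle \<open>pi / m\<close> around 1, a
  fundamental domain for the rotations by powers of \<open>\<omega>\<close>.\<close>

abbreviation "b \<equiv> cos (pi / real m)"

lemma \<omega>_unit: "\<omega> * cnj \<omega> = 1" "\<omega> ^ m = 1" "cmod \<omega> = 1"
  using order order_cnj(2)[OF order] order_cmod[OF order] by (auto simp: has_mult_order_def)

lemma norm_XY: "norm X \<le> 1" "norm Y \<le> 1"
  using unitary_norm_le[OF X_unitary(1) proj_E] unitary_norm_le[OF Y_unitary(1) proj_E] by auto

lemma E_simps: "E * X = X" "X * E = X" "E * Y = Y" "Y * E = Y" "E * X\<^sup>\<star> = X\<^sup>\<star>" "X\<^sup>\<star> * E = X\<^sup>\<star>"
    "E * Y\<^sup>\<star> = Y\<^sup>\<star>" "Y\<^sup>\<star> * E = Y\<^sup>\<star>" "E * g = g" "g * E = g" "E * g\<^sup>\<star> = g\<^sup>\<star>" "g\<^sup>\<star> * E = g\<^sup>\<star>"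
  by (auto intro: E_left E_right X_in Y_in g_in C_star)

lemma YXs: "Y * X\<^sup>\<star> = X\<^sup>\<star> * Y"
proof -
  have "Y * X\<^sup>\<star> = X\<^sup>\<star> * X * Y * X\<^sup>\<star>" by (simp add: X_unitary E_simps)
  also have "\<dots> = X\<^sup>\<star> * (X * Y) * X\<^sup>\<star>" by (simp add: mult.assoc)
  also have "\<dots> = X\<^sup>\<star> * Y * (X * X\<^sup>\<star>)" by (simp add: XY mult.assoc)
  finally show ?thesis by (simp add: X_unitary E_simps mult.assoc)
qed

text \<open>\<open>sign_projection\<close> is applied to the shifted real part of \<open>X\<close>.
  Since \<open>inner\<close> is a real part, \<open>X\<close> and its real part have the same
  quadratic form, and no real part has to be named in the conclusions.\<close>

lemma cell:
  obtains T where "T \<in> C" "proj T" "T * X = X * T" "T * Y = Y * T" "T * X\<^sup>\<star> = X\<^sup>\<star> * T" "T * Y\<^sup>\<star> = Y\<^sup>\<star> * T"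
    "\<And>v. (b + s) * (norm (T \<bullet>\<bullet> v))\<^sup>2 \<le> inner (X \<bullet>\<bullet> T \<bullet>\<bullet> v) (T \<bullet>\<bullet> v)"
    "\<And>v. inner (X \<bullet>\<bullet> (E - T) \<bullet>\<bullet> v) ((E - T) \<bullet>\<bullet> v) \<le> (b + s) * (norm ((E - T) \<bullet>\<bullet> v))\<^sup>2"
    "\<And>p. p * X = X * p \<Longrightarrow> p * X\<^sup>\<star> = X\<^sup>\<star> * p \<Longrightarrow> p * E = E * p \<Longrightarrow> p * T = T * p"
proof -
  define A where "A = (1 / 2) *\<^sub>R (X + X\<^sup>\<star>) - (b + s) *\<^sub>R E"
  have A: "A \<in> C" "A\<^sup>\<star> = A"
    by (auto simp: A_def E_star add.commute intro!: C_diff C_scaleR C_add C_star X_in E_in)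
  obtain T where T: "T \<in> C" "proj T" "\<And>v. 0 \<le> inner (A \<bullet>\<bullet> T \<bullet>\<bullet> v) (T \<bullet>\<bullet> v)"
    "\<And>v. inner (A \<bullet>\<bullet> (E - T) \<bullet>\<bullet> v) ((E - T) \<bullet>\<bullet> v) \<le> 0"
    "\<And>p. p * A = A * p \<Longrightarrow> p * E = E * p \<Longrightarrow> p * T = T * p"
    using sign_projection[OF A] by blast
  have Aq: "inner (A \<bullet>\<bullet> v) v = inner (X \<bullet>\<bullet> v) v - (b + s) * (norm v)\<^sup>2" if "E \<bullet>\<bullet> v = v" for v
    using that by (simp add: A_def inner_diff inner_add inner_star_self power2_norm_eq_inner)
  have ET: "E * T = T" "E * (E - T) = E - T" using E_left[OF T(1)] by (simp_all add: right_diff_distrib E_idem)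
  have p: "p * T = T * p" if "p * X = X * p" "p * X\<^sup>\<star> = X\<^sup>\<star> * p" "p * E = E * p" for p
    using that by (intro T(5)) (simp_all add: A_def algebra_simps)
  have TX: "T * X = X * T" "T * X\<^sup>\<star> = X\<^sup>\<star> * T" using p[of X] p[of "X\<^sup>\<star>"] by (simp_all add: X_unitary E_simps)
  have TY: "T * Y = Y * T" using p[of Y] by (simp add: XY YXs E_simps)
  have TYs: "T * Y\<^sup>\<star> = Y\<^sup>\<star> * T"
    using arg_cong[OF TY, of star] unfolding star_mult proj_star[OF T(2)] by simp
  show thesis
  proof (rule that[OF T(1,2) TX(1) TY TX(2) TYs _ _ p])
    show "(b + s) * (norm (T \<bullet>\<bullet> v))\<^sup>2 \<le> inner (X \<bullet>\<bullet> T \<bullet>\<bullet> v) (T \<bullet>\<bullet> v)" for v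
      using T(3)[of v] Aq[of "T \<bullet>\<bullet> v"] ET(1) by (metis app_times diff_ge_0_iff_ge)
    show "inner (X \<bullet>\<bullet> (E - T) \<bullet>\<bullet> v) ((E - T) \<bullet>\<bullet> v) \<le> (b + s) * (norm ((E - T) \<bullet>\<bullet> v))\<^sup>2" for v
      using T(4)[of v] Aq[of "(E - T) \<bullet>\<bullet> v"] ET(2) by (metis app_times diff_le_0_iff_le)
  qed
qed

lemma cj_X_near: "j \<le> m \<Longrightarrow> norm (cj j X - sc (\<omega> ^ j) X) \<le> m * s\<^sup>2"
  by (rule cj_near_le[OF X_in Xg \<omega>_unit(3)])

lemma cj_Y_near: "j \<le> m \<Longrightarrow> norm (cj j Y - Y) \<le> m * s\<^sup>2"
  using cj_near_le[OF Y_in, of 1 "s\<^sup>2" j] Yg by simp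

text \<open>On the range of \<open>T\<^sub>k\<close> both \<open>Re X\<^sub>k \<ge> b + s\<close> and \<open>Re X\<^sub>k + Re (cnj \<omega> ^ k X\<^sub>k) \<le> |1 + \<omega> ^ k| \<le> 2 b\<close>.\<close>

lemma cell_separated:
  assumes T: "T \<in> C" "proj T" "T * X = X * T" "T * X\<^sup>\<star> = X\<^sup>\<star> * T"
    "\<And>v. (b + s) * (norm (T \<bullet>\<bullet> v))\<^sup>2 \<le> inner (X \<bullet>\<bullet> T \<bullet>\<bullet> v) (T \<bullet>\<bullet> v)"
    and k: "0 < k" "k < m"
  shows "norm (T * cj k T) \<le> m * s / 2"
proof -
  define A where "A = (1 / 2) *\<^sub>R (X + X\<^sup>\<star>)"
  \<comment> \<open>Undoes the rotation that conjugation puts on \<open>X\<close>: the real part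
    \<open>B\<close> of \<open>B0\<close> is close to that of \<open>X\<close>, yet commutes exactly
    with the translated cell.\<close>
  define B0 where "B0 = sc (cnj \<omega> ^ k) (cj k X)"
  define B where "B = (1 / 2) *\<^sub>R (B0 + B0\<^sup>\<star>)"
  have nl: "cmod (cnj \<omega> ^ k) = 1" by (simp add: norm_power \<omega>_unit)
  have nB0: "norm B0 \<le> 1" using norm_cj[of k X] norm_XY(1) by (simp add: B0_def nl)
  have "norm (B0 + B0\<^sup>\<star>) \<le> 1 + 1" by (rule order_trans[OF norm_triangle_ineq]) (use nB0 in simp)
  then have nB: "norm B \<le> 1" by (simp add: B_def)
  have "norm (X - B0) \<le> m * s\<^sup>2"
  proof -
    have "B0 - X = sc (cnj \<omega> ^ k) (cj k X - sc (\<omega> ^ k) X)"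
      using sc_power_cancel[OF \<omega>_unit(1), of k] by (simp add: B0_def sc_diff mult.commute)
    then have "norm (B0 - X) = norm (cj k X - sc (\<omega> ^ k) X)" by (simp add: nl)
    then show ?thesis using cj_X_near[of k] k by (simp add: norm_minus_commute)
  qed
  moreover have "A - B = (1 / 2) *\<^sub>R ((X - B0) + (X - B0)\<^sup>\<star>)" by (simp add: A_def B_def algebra_simps)
  ultimately have AB: "norm (A - B) \<le> m * s\<^sup>2"
    using norm_triangle_ineq[of "X - B0" "(X - B0)\<^sup>\<star>"] by (simp del: star_diff)
  have TB: "cj k T * B = B * cj k T"
  proof -
    have "cj k T * cj k X = cj k X * cj k T" by (simp add: T(1,3) X_in flip: cj_mult)
    moreover have "cj k T * cj k (X\<^sup>\<star>) = cj k (X\<^sup>\<star>) * cj k T" by (simp add: T(1,4) X_in C_star flip: cj_mult)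
    ultimately show ?thesis by (simp add: B_def B0_def cj_star distrib_left distrib_right)
  qed
  have hi: "inner (B \<bullet>\<bullet> cj k T \<bullet>\<bullet> v) (cj k T \<bullet>\<bullet> v) \<le> (b - s) * (norm (cj k T \<bullet>\<bullet> v))\<^sup>2" for v
  proof -
    define y where "y = cj k T \<bullet>\<bullet> v"
    have 1: "inner (B \<bullet>\<bullet> y) y = inner (B0 \<bullet>\<bullet> y) y"
      by (simp add: B_def inner_add inner_star_self del: star_add)
    have c1: "cmod (1 + cnj \<omega> ^ k) \<le> 2 * b"
      using cmod_one_plus_root_le[OF order k] by (metis complex_cnj_add complex_cnj_one complex_cnj_power complex_mod_cnj)
    have "norm (sc (1 + cnj \<omega> ^ k) (cj k X)) \<le> 2 * b * 1"
      unfolding norm_sc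
      by (rule mult_mono[OF c1 order_trans[OF norm_cj norm_XY(1)] order_trans[OF norm_ge_zero c1] norm_ge_zero])
    then have "inner (sc (1 + cnj \<omega> ^ k) (cj k X) \<bullet>\<bullet> y) y \<le> 2 * b * (norm y)\<^sup>2"
      using quadratic_ge(2) by fastforce
    then have "inner (cj k X \<bullet>\<bullet> y) y + inner (B0 \<bullet>\<bullet> y) y \<le> 2 * b * (norm y)\<^sup>2"
      by (simp add: B0_def sc_add_left inner_add scaleC_add_left)
    moreover have "(b + s) * (norm y)\<^sup>2 \<le> inner (cj k X \<bullet>\<bullet> y) y"
      unfolding y_def by (rule cj_lower[OF X_in T(1) T(5)])
    ultimately show ?thesis unfolding y_def[symmetric] 1 by (simp add: algebra_simps)
  qed
  have "b \<ge> 0" using m2 by (intro cos_ge_zero) (auto simp: field_simps intro: order_trans[of _ 0])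
  \<comment> \<open>The one division by the gap: an error \<open>m * s\<^sup>2\<close> over
    \<open>2 * s\<close> leaves a bound linear in \<open>s\<close>.\<close>
  have "norm (T * cj k T) \<le> m * s\<^sup>2 / ((b + s) - (b - s))"
  proof (rule separated_projections[OF T(2) _ _ cj_proj[OF T(1,2)] TB hi _ nB AB])
    show "T * A = A * T" by (simp add: A_def distrib_left distrib_right T)
    show "(b + s) * (norm (T \<bullet>\<bullet> x))\<^sup>2 \<le> inner (A \<bullet>\<bullet> T \<bullet>\<bullet> x) (T \<bullet>\<bullet> x)" for x
      using T(5)[of x] by (simp add: A_def inner_add inner_star_self)
    show "B\<^sup>\<star> = B" by (simp add: B_def add.commute)
  qed (use \<open>b \<ge> 0\<close> s in auto)
  also have "\<dots> = m * s / 2" using s by (simp add: power2_eq_square)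
  finally show ?thesis .
qed

lemma cells_separated:
  assumes T: "T \<in> C" "proj T" "T * X = X * T" "T * X\<^sup>\<star> = X\<^sup>\<star> * T"
    "\<And>v. (b + s) * (norm (T \<bullet>\<bullet> v))\<^sup>2 \<le> inner (X \<bullet>\<bullet> T \<bullet>\<bullet> v) (T \<bullet>\<bullet> v)"
    and ij: "i < m" "j < m" "i \<noteq> j"
  shows "norm (cj i T * cj j T) \<le> m * s / 2"
proof -
  have lt: "norm (cj i T * cj j T) \<le> m * s / 2" if "i < j" "j < m" for i j
  proof -
    have "cj i T * cj j T = cj i (T * cj (j - i) T)"
      using that by (simp add: cj_mult[OF T(1) cj_in[OF T(1)]] cj_cj)
    also have "norm \<dots> \<le> norm (T * cj (j - i) T)" by (rule norm_cj)
    also have "\<dots> \<le> m * s / 2" by (rule cell_separated[OF T]) (use that in auto)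
    finally show ?thesis .
  qed
  have "norm (cj i T * cj j T) = norm (cj j T * cj i T)"
    using norm_star[of "cj i T * cj j T"] by (simp add: cj_star proj_star[OF T(2)] del: norm_star)
  then show ?thesis using lt[of i j] lt[of j i] ij by (metis linorder_neqE_nat)
qed

end

lemma sum_mult_orthogonal:
  fixes a :: "nat \<Rightarrow> 'a::semiring_0"
  assumes "\<And>i j. i < m \<Longrightarrow> j < m \<Longrightarrow> i \<noteq> j \<Longrightarrow> a i * d j = 0"
  shows "(\<Sum>i<m. a i) * (\<Sum>j<m. d j) = (\<Sum>i<m. a i * d i)"
proof -
  have "(\<Sum>i<m. a i) * (\<Sum>j<m. d j) = (\<Sum>i<m. \<Sum>j<m. if i = j then a i * d i else 0)"
    unfolding sum_product using assms by (intro sum.cong refl) auto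
  also have "\<dots> = (\<Sum>i<m. a i * d i)" by (simp add: sum.delta)
  finally show ?thesis .
qed

section \<open>Exact covariance on the cells\<close>

context approx_pair
begin

text \<open>With \<open>k = m ^ 3 * s / 2\<close>, the parameter handed to
  \<open>orthogonalize\<close>, the two bounds are \<open>m * (32 * k + m * s) + 8 * k\<close> and
  \<open>16 * k + 2 * m ^ 2 * s\<close>.\<close>

definition "cell_err \<equiv> (16 * real m ^ 4 + 4 * real m ^ 3 + real m ^ 2) * s"
definition "comm_err \<equiv> (8 * real m ^ 3 + 2 * real m ^ 2) * s"

lemma s_sq_le: "s\<^sup>2 \<le> s"
  using s by (simp add: power2_eq_square mult_left_le)

text \<open>\<open>Z = R * T\<close> is a partial isometry defined on the first cell, and its
  translates under \<open>g\<close> have orthogonal ranges with sum \<open>P\<close>.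
  \<open>phi l V\<close> copies the part of \<open>V\<close> on that cell to all translates, with
  the phase that covariance with factor \<open>l\<close> requires. On operators commuting with
  \<open>T\<close> it is multiplicative in both arguments, so it carries the commuting unitaries
  \<open>X, Y\<close> to commuting unitaries of the corner \<open>P\<close> that are exactly
  covariant.\<close>

lemma cell_part:
  assumes small: "real m ^ 3 * s \<le> 1 / 128"
  obtains P Xt Yt where "P \<in> C" "proj P" "g * P = P * g" "Xt \<in> C" "Yt \<in> C"
    "P * Xt = Xt" "Xt * P = Xt" "P * Yt = Yt" "Yt * P = Yt"
    "Xt\<^sup>\<star> * Xt = P" "Xt * Xt\<^sup>\<star> = P" "Yt\<^sup>\<star> * Yt = P" "Yt * Yt\<^sup>\<star> = P" "Xt * Yt = Yt * Xt"
    "g * Xt = sc \<omega> (Xt * g)" "g * Yt = Yt * g"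
    "norm (Xt - X * P) \<le> cell_err" "norm (Yt - Y * P) \<le> cell_err"
    "norm (X * P - P * X) \<le> comm_err" "norm (Y * P - P * Y) \<le> comm_err"
    "\<And>j v. j < m \<Longrightarrow> E \<bullet>\<bullet> v = v \<Longrightarrow> P \<bullet>\<bullet> v = 0 \<Longrightarrow> inner (cj j X \<bullet>\<bullet> v) v \<le> (b + s) * (norm v)\<^sup>2"
    "\<And>p a. compatible p a \<Longrightarrow> p * P = P * p \<and> p * Yt = sc a (Yt * p)"
proof -
  obtain T where T: "T \<in> C" "proj T" "T * X = X * T" "T * Y = Y * T" "T * X\<^sup>\<star> = X\<^sup>\<star> * T" "T * Y\<^sup>\<star> = Y\<^sup>\<star> * T"
    and Thi: "\<And>v. (b + s) * (norm (T \<bullet>\<bullet> v))\<^sup>2 \<le> inner (X \<bullet>\<bullet> T \<bullet>\<bullet> v) (T \<bullet>\<bullet> v)"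
    and Tlo: "\<And>v. inner (X \<bullet>\<bullet> (E - T) \<bullet>\<bullet> v) ((E - T) \<bullet>\<bullet> v) \<le> (b + s) * (norm ((E - T) \<bullet>\<bullet> v))\<^sup>2"
    and Tp: "\<And>p. p * X = X * p \<Longrightarrow> p * X\<^sup>\<star> = X\<^sup>\<star> * p \<Longrightarrow> p * E = E * p \<Longrightarrow> p * T = T * p"
    using cell by blast
  \<comment> \<open>The overlap \<open>t = m * s / 2\<close> of two cells enters
    \<open>orthogonalize\<close> as \<open>m * (m * t)\<close>.\<close>
  define k where "k = real m ^ 3 * s / 2"
  have k: "real m * (real m * (m * s / 2)) \<le> k" by (simp add: k_def power3_eq_cube)
  have k': "k \<le> 1 / 256" unfolding k_def using small by linarith
  define G where "G = (\<Sum>j<m. cj j T)"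
  obtain P R where P: "P \<in> C" "proj P" and R: "R \<in> C" "R\<^sup>\<star> = R" "P * R = R" "R * P = R"
    and PT: "\<And>j. j < m \<Longrightarrow> P * cj j T = cj j T"
    and orth: "\<And>i j. i < m \<Longrightarrow> j < m \<Longrightarrow> cj i T * (R * R) * cj j T = (if i = j then cj j T else 0)"
    and RGR: "R * G * R = P" and RP: "norm (R - P) \<le> 16 * k" and PG: "norm (P - G) \<le> 8 * k"
    and PRc: "\<And>p. p * G = G * p \<Longrightarrow> p * E = E * p \<Longrightarrow> p * P = P * p \<and> p * R = R * p"
    using orthogonalize[of m "\<lambda>j. cj j T", OF cj_in[OF T(1)] cj_proj[OF T(1,2)]
        cells_separated[OF T(1,2,3,5) Thi] _ k k' m_pos] s unfolding G_def by auto
  \<comment> \<open>Conjugation permutes the translates cyclically and fixes their sum;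
    \<open>P\<close> and \<open>R\<close> depend on \<open>G\<close> alone and inherit the
    invariance.\<close>
  have gG: "g * G = G * g"
    using sum_covariant[OF T(1), of 1] by (simp add: G_def)
  have gP: "g * P = P * g" and gR: "g * R = R * g" using PRc[OF gG] by (simp_all add: E_simps)
  define Z where "Z = R * T"
  have ZC: "Z \<in> C" unfolding Z_def by (intro C_mult R T)
  have Zj: "cj j Z = R * cj j T" for j unfolding Z_def cj_mult[OF R(1) T(1)] cj_fixed[OF R(1) gR] ..
  have ZZ: "cj i (Z\<^sup>\<star>) * cj j Z = (if i = j then cj j T else 0)" if "i < m" "j < m" for i j
  proof -
    have "cj i (Z\<^sup>\<star>) * cj j Z = cj i T * (R * R) * cj j T"
      unfolding cj_star[symmetric] Zj by (simp add: cj_star R proj_star[OF T(2)] mult.assoc)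
    then show ?thesis using orth[OF that] by simp
  qed
  have ZsZ: "Z\<^sup>\<star> * Z = T" using ZZ[of 0 0] m_pos by simp
  have nZ: "norm Z \<le> 1" by (rule unitary_norm_le[OF ZsZ T(2)])
  have nZs: "norm (Z\<^sup>\<star>) \<le> 1" using nZ by simp
  have TT: "T * T = T" by (rule proj_idem[OF T(2)])
  have ZT: "Z * T = Z" "T * Z\<^sup>\<star> = Z\<^sup>\<star>" by (simp_all add: Z_def TT mult.assoc proj_star[OF T(2)] flip: mult.assoc[of T T])
  have EZ: "Z * E = Z" by (rule E_right[OF ZC])
  define phi where "phi l V = (\<Sum>j<m. sc (cnj l ^ j) (cj j (Z * V * Z\<^sup>\<star>)))" for l V
  have ZVZ: "Z * V * Z\<^sup>\<star> \<in> C" if "V \<in> C" for V using that by (intro C_mult C_star ZC)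
  have phi_in: "phi l V \<in> C" if "V \<in> C" for l V
    unfolding phi_def using that by (intro C_sum C_sc cj_in ZVZ)
  have phi_star: "(phi l V)\<^sup>\<star> = phi (cnj l) (V\<^sup>\<star>)" for l V
    by (simp add: phi_def cj_star mult.assoc)
  \<comment> \<open>Mixed terms contain \<open>cj i (Z\<^sup>\<star>) * cj j Z\<close> and vanish.
    In the diagonal terms \<open>Z\<^sup>\<star> * Z = T\<close> moves past \<open>V'\<close> and is
    absorbed by \<open>Z\<^sup>\<star>\<close>.\<close>
  have phi_mult: "phi l V * phi l' V' = phi (l * l') (V * V')"
    if V: "V \<in> C" "V' \<in> C" "T * V' = V' * T" for l l' V V'
  proof -
    have d: "Z * V' * Z\<^sup>\<star> = Z * (V' * Z\<^sup>\<star>)" by (simp add: mult.assoc)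
    have c: "cj i (Z * V * Z\<^sup>\<star>) * cj j (Z * V' * Z\<^sup>\<star>) =
        cj i (Z * V) * (cj i (Z\<^sup>\<star>) * cj j Z) * cj j (V' * Z\<^sup>\<star>)" for i j
      using cj_mult[OF C_mult[OF ZC V(1)] C_star[OF ZC], of i] cj_mult[OF ZC C_mult[OF V(2) C_star[OF ZC]], of j]
      unfolding d by (simp only: mult.assoc)
    have "cj i (Z * V * Z\<^sup>\<star>) * cj i (Z * V' * Z\<^sup>\<star>) = cj i (Z * (V * V') * Z\<^sup>\<star>)" for i
    proof -
      have "Z * V * Z\<^sup>\<star> * (Z * V' * Z\<^sup>\<star>) = Z * V * (Z\<^sup>\<star> * Z) * V' * Z\<^sup>\<star>" by (simp add: mult.assoc)
      also have "\<dots> = Z * V * (T * V') * Z\<^sup>\<star>" by (simp add: ZsZ mult.assoc)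
      also have "\<dots> = Z * (V * V') * (T * Z\<^sup>\<star>)" by (simp add: V(3) mult.assoc)
      finally show ?thesis by (simp add: ZT(2) ZVZ V flip: cj_mult)
    qed
    moreover have "cj i (Z * V * Z\<^sup>\<star>) * cj j (Z * V' * Z\<^sup>\<star>) = 0" if "i < m" "j < m" "i \<noteq> j" for i j
      unfolding c using ZZ[OF that(1,2)] that(3) by simp
    ultimately show ?thesis unfolding phi_def
      by (subst sum_mult_orthogonal) (auto simp: power_mult_distrib mult_ac)
  qed
  have phi_1E: "phi 1 E = P"
  proof -
    have "cj j (Z * E * Z\<^sup>\<star>) = R * cj j T * R" for j
    proof -
      have "cj j (Z * E * Z\<^sup>\<star>) = cj j Z * (cj j Z)\<^sup>\<star>" by (simp add: EZ cj_mult ZC C_star cj_star)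
      also have "\<dots> = R * (cj j T * cj j T) * R" unfolding Zj by (simp add: R cj_star proj_star[OF T(2)] mult.assoc)
      finally show ?thesis by (simp add: proj_idem[OF cj_proj[OF T(1,2)]])
    qed
    then show ?thesis using RGR by (simp add: phi_def G_def sum_distrib_left sum_distrib_right)
  qed
  have TE: "T * E = E * T" by (simp add: E_left E_right T)
  have Pphi: "P * phi l V = phi l V" "phi l V * P = phi l V" if "V \<in> C" "T * V = V * T" for l V
    using phi_mult[of E V 1 l] phi_mult[of V E l 1] that TE by (simp_all add: phi_1E E_in E_left E_right)
  have phi_near: "norm (phi l V - V * P) \<le> cell_err"
    if V: "V \<in> C" "T * V = V * T" "norm V \<le> 1" "\<And>j. j \<le> m \<Longrightarrow> norm (cj j V - sc (l ^ j) V) \<le> m * s\<^sup>2"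
      and l: "l * cnj l = 1" for l V
  proof -
    have ZmT: "norm (Z - T) \<le> 16 * k"
    proof -
      have "Z - T = (R - P) * T" using PT[of 0] m_pos by (simp add: Z_def left_diff_distrib)
      then show ?thesis using mult_norm_le[OF RP proj_norm[OF T(2)]] by simp
    qed
    have ZmTs: "norm (Z\<^sup>\<star> - T) \<le> 16 * k"
      using ZmT norm_star[of "Z - T"] by (simp add: proj_star[OF T(2)] del: norm_star)
    have k0: "0 \<le> k" using s by (simp add: k_def)
    have d1: "norm (Z * V * Z\<^sup>\<star> - V * T) \<le> 32 * k"
    proof -
      have "V * T = T * V * T" by (simp add: V(2) TT mult.assoc)
      then have "Z * V * Z\<^sup>\<star> - V * T = (Z - T) * V * Z\<^sup>\<star> + T * V * (Z\<^sup>\<star> - T)" by (simp add: algebra_simps)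
      also have "norm \<dots> \<le> 16 * k * 1 * 1 + 1 * 1 * (16 * k)"
        by (intro order_trans[OF norm_triangle_ineq] add_mono mult_norm_le ZmT ZmTs V(3) proj_norm[OF T(2)] nZs)
      finally show ?thesis by simp
    qed
    have termwise: "norm (sc (cnj l ^ j) (cj j (Z * V * Z\<^sup>\<star>)) - V * cj j T) \<le> 32 * k + m * s" if j: "j < m" for j
    proof -
      have nl: "cmod (cnj l ^ j) = 1" by (simp add: norm_power cmod_one[OF l])
      have "sc (cnj l ^ j) (cj j (Z * V * Z\<^sup>\<star>)) - V * cj j T =
          sc (cnj l ^ j) (cj j (Z * V * Z\<^sup>\<star> - V * T)) + sc (cnj l ^ j) ((cj j V - sc (l ^ j) V) * cj j T)"
        using sc_power_cancel[OF l, of j] by (simp add: cj_mult[OF V(1) T(1)] sc_diff algebra_simps)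
      also have "norm \<dots> \<le> 32 * k + m * s\<^sup>2 * 1"
        using order_trans[OF norm_cj d1, of j] mult_norm_le[OF V(4)[OF less_imp_le[OF j]] proj_norm[OF cj_proj[OF T(1,2)]], of j]
        by (intro order_trans[OF norm_triangle_ineq] add_mono) (simp_all add: nl)
      also have "\<dots> \<le> 32 * k + m * s" using s_sq_le by (simp add: mult_left_mono)
      finally show ?thesis .
    qed
    have "phi l V - V * P = (\<Sum>j<m. sc (cnj l ^ j) (cj j (Z * V * Z\<^sup>\<star>)) - V * cj j T) - V * (P - G)"
      by (simp add: phi_def G_def sum_subtractf sum_distrib_left right_diff_distrib)
    also have "norm \<dots> \<le> m * (32 * k + m * s) + 1 * (8 * k)"
      by (intro order_trans[OF norm_triangle_ineq4] add_mono mult_norm_le V PG norm_sum_le_card termwise)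
    also have "\<dots> = cell_err"
      by (simp add: cell_err_def k_def algebra_simps power2_eq_square power3_eq_cube power4_eq_xxxx)
    finally show ?thesis .
  qed
  have comm: "norm (V * P - P * V) \<le> comm_err"
    if V: "V \<in> C" "T * V = V * T" "norm V \<le> 1" "\<And>j. j \<le> m \<Longrightarrow> norm (cj j V - sc (l ^ j) V) \<le> m * s\<^sup>2"
      and l: "l * cnj l = 1" for l V
  proof -
    have t: "norm (V * cj j T - cj j T * V) \<le> 2 * (m * s)" if j: "j < m" for j
    proof -
      define D where "D = cj j V - sc (l ^ j) V"
      have nD: "norm D \<le> m * s" using V(4)[of j] j s_sq_le unfolding D_def
        by (meson less_imp_le mult_left_mono of_nat_0_le_iff order_trans)
      have c: "cj j V * cj j T = cj j T * cj j V" by (simp add: V(1,2) T(1) flip: cj_mult)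
      have nl: "cmod (cnj l ^ j) = 1" by (simp add: norm_power cmod_one[OF l])
      have "V * cj j T - cj j T * V = sc (cnj l ^ j) (cj j T * D - D * cj j T)"
        using sc_power_cancel[OF l, of j] by (simp add: D_def c right_diff_distrib left_diff_distrib sc_diff mult.commute)
      then have "norm (V * cj j T - cj j T * V) = norm (cj j T * D - D * cj j T)" by (simp add: nl)
      also have "\<dots> \<le> 1 * (m * s) + (m * s) * 1"
        by (intro order_trans[OF norm_triangle_ineq4] add_mono mult_norm_le nD proj_norm cj_proj T)
      finally show ?thesis by (simp only: mult_1 mult_1_right mult_2)
    qed
    have "V * P - P * V = (V * (P - G) - (P - G) * V) + (\<Sum>j<m. V * cj j T - cj j T * V)"
      by (simp add: G_def sum_subtractf sum_distrib_left sum_distrib_right right_diff_distrib left_diff_distrib)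
    also have "norm \<dots> \<le> (1 * (8 * k) + 8 * k * 1) + m * (2 * (m * s))"
      by (intro order_trans[OF norm_triangle_ineq] order_trans[OF norm_triangle_ineq4] add_mono mult_norm_le V PG norm_sum_le_card t)
    also have "\<dots> = comm_err"
      by (simp add: comm_err_def k_def algebra_simps power2_eq_square power3_eq_cube)
    finally show ?thesis .
  qed
  have one: "(1::complex) * cnj 1 = 1" by simp
  have Ynear: "norm (cj j Y - sc (1 ^ j) Y) \<le> m * s\<^sup>2" if "j \<le> m" for j using cj_Y_near[OF that] by simp
  have unit: "phi l V * phi (cnj l) (V\<^sup>\<star>) = P"
    if "V \<in> C" "T * V\<^sup>\<star> = V\<^sup>\<star> * T" "V * V\<^sup>\<star> = E" "l * cnj l = 1" for l V
    using phi_mult[OF that(1) C_star[OF that(1)] that(2), of l "cnj l"] that by (simp add: phi_1E)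
  \<comment> \<open>A vector orthogonal to \<open>P\<close> is orthogonal to every translated cell,
    so every conjugate of \<open>X\<close> obeys the upper bound of the cut there. This is the
    information the seam needs.\<close>
  have lo: "inner (cj j X \<bullet>\<bullet> v) v \<le> (b + s) * (norm v)\<^sup>2" if "j < m" "E \<bullet>\<bullet> v = v" "P \<bullet>\<bullet> v = 0" for j v
  proof -
    have "cj j T * P = cj j T"
      using arg_cong[OF PT[OF that(1)], of star] by (simp add: cj_star proj_star[OF T(2)] proj_star[OF P(2)])
    then have "cj j T \<bullet>\<bullet> v = 0" using that(3) by (metis app_times app_zero_right)
    then have v: "cj j (E - T) \<bullet>\<bullet> v = v" using that(2) by (simp add: cj_E)
    have "- (b + s) * (norm (cj j (E - T) \<bullet>\<bullet> v))\<^sup>2 \<le> inner (cj j (- X) \<bullet>\<bullet> cj j (E - T) \<bullet>\<bullet> v) (cj j (E - T) \<bullet>\<bullet> v)"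
    proof (rule cj_lower)
      show "- (b + s) * (norm ((E - T) \<bullet>\<bullet> v))\<^sup>2 \<le> inner ((- X) \<bullet>\<bullet> (E - T) \<bullet>\<bullet> v) ((E - T) \<bullet>\<bullet> v)" for v
        using Tlo[of v] unfolding app_minus inner_minus_left by linarith
    qed (intro C_minus C_diff X_in E_in T)+
    then show ?thesis unfolding v cj_minus app_minus inner_minus_left mult_minus_left by linarith
  qed
  have pc: "p * P = P * p \<and> p * phi 1 Y = sc a (phi 1 Y * p)" if p: "compatible p a" for p a
  proof -
    obtain u where u: "u * cnj u = 1" "p * g = sc u (g * p)" "p * g\<^sup>\<star> = sc (cnj u) (g\<^sup>\<star> * p)"
      and pE: "p * E = E * p" and pX: "p * X = X * p" "p * X\<^sup>\<star> = X\<^sup>\<star> * p"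
      and pY: "p * Y = sc a (Y * p)"
      using p unfolding compatible_def by blast
    have pT: "p * T = T * p" by (rule Tp[OF pX pE])
    have pTj: "p * cj j T = cj j T * p" for j using cj_covariant[OF u(2,3,1), of T 1 j] pT by simp
    have pG: "p * G = G * p" unfolding G_def sum_distrib_left sum_distrib_right by (intro sum.cong refl pTj)
    have pR: "p * P = P * p" "p * R = R * p" using PRc[OF pG pE] by auto
    have pZ: "p * Z = Z * p" unfolding Z_def by (intro commute_mult pR pT)
    have pZs: "p * Z\<^sup>\<star> = Z\<^sup>\<star> * p" unfolding Z_def star_mult R(2) proj_star[OF T(2)] by (intro commute_mult pR pT)
    have "p * (Z * Y * Z\<^sup>\<star>) = Z * (p * Y) * Z\<^sup>\<star>" by (simp add: pZ flip: mult.assoc)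
    also have "\<dots> = sc a (Z * Y * Z\<^sup>\<star> * p)" by (simp add: pY pZs mult.assoc)
    finally have "p * cj j (Z * Y * Z\<^sup>\<star>) = sc a (cj j (Z * Y * Z\<^sup>\<star>) * p)" for j by (rule cj_covariant[OF u(2,3,1)])
    then show ?thesis using pR(1) by (simp add: phi_def sum_distrib_left sum_distrib_right sc_sum)
  qed
  show thesis
  proof (rule that[of P "phi \<omega> X" "phi 1 Y"])
    show "(phi \<omega> X)\<^sup>\<star> * phi \<omega> X = P" "phi \<omega> X * (phi \<omega> X)\<^sup>\<star> = P"
      using unit[OF X_in T(5) X_unitary(2) \<omega>_unit(1)] unit[of "X\<^sup>\<star>" "cnj \<omega>"] \<omega>_unit(1)
      by (simp_all add: phi_star C_star X_in T(3) X_unitary mult.commute)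
    show "(phi 1 Y)\<^sup>\<star> * phi 1 Y = P" "phi 1 Y * (phi 1 Y)\<^sup>\<star> = P"
      using unit[OF Y_in T(6) Y_unitary(2) one] unit[of "Y\<^sup>\<star>" 1]
      by (simp_all add: phi_star C_star Y_in T(4) Y_unitary)
    show "phi \<omega> X * phi 1 Y = phi 1 Y * phi \<omega> X"
      by (simp add: phi_mult X_in Y_in T XY)
    show "g * phi \<omega> X = sc \<omega> (phi \<omega> X * g)"
      unfolding phi_def by (rule sum_covariant[OF ZVZ[OF X_in] \<omega>_unit(1,2)])
    show "g * phi 1 Y = phi 1 Y * g"
      using sum_covariant[OF ZVZ[OF Y_in] one] by (simp add: phi_def)
  qed (use P gP phi_in X_in Y_in Pphi T lo pc in \<open>simp_all add:
      phi_near[OF X_in T(3) norm_XY(1) cj_X_near \<omega>_unit(1)] phi_near[OF Y_in T(4) norm_XY(2) Ynear one]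
      comm[OF X_in T(3) norm_XY(1) cj_X_near \<omega>_unit(1)] comm[OF Y_in T(4) norm_XY(2) Ynear one]\<close>)
qed

end

section \<open>Exact covariance on the seam\<close>

lemma norm_triangle3: "norm (u + (v + w)) \<le> norm u + (norm v + norm (w::'a::real_normed_vector))"
  by (rule order_trans[OF norm_triangle_ineq]) (intro add_left_mono norm_triangle_ineq)

text \<open>Replacing \<open>a\<close> and its adjoint by the compression costs \<open>e\<close>
  each; moving \<open>V\<close> across \<open>S\<close> costs \<open>c\<close> once.\<close>

lemma (in op_alg) compression_near_unitary:
  assumes S: "S \<in> C" "proj S" and V: "V \<in> C" "V\<^sup>\<star> * V = E" "V * V\<^sup>\<star> = E"
    and c: "norm (V * S - S * V) \<le> c" and a: "norm (a - S * V * S) \<le> e" "norm a \<le> 1"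
  shows "norm (a\<^sup>\<star> * a - S) \<le> 2 * e + c" "norm (a * a\<^sup>\<star> - S) \<le> 2 * e + c"
proof -
  have SS: "S * S = S" "S\<^sup>\<star> = S" "S * (S * T) = S * T" for T
    using S(2) by (simp_all add: proj_def flip: mult.assoc)
  have SE: "S * E = S" by (rule E_right[OF S(1)])
  have nS: "norm S \<le> 1" by (rule proj_norm[OF S(2)])
  have nV: "norm V \<le> 1" "norm (V\<^sup>\<star>) \<le> 1" using unitary_norm_le[OF V(2) proj_E] by auto
  have nSVS: "norm (S * V * S) \<le> 1 * 1 * 1" by (intro mult_norm_le nS nV)
  have star: "(S * V * S)\<^sup>\<star> = S * V\<^sup>\<star> * S" by (simp add: SS mult.assoc)
  have as: "norm (a\<^sup>\<star> - S * V\<^sup>\<star> * S) \<le> e" "norm (a\<^sup>\<star>) \<le> 1" "norm (S * V\<^sup>\<star> * S) \<le> 1"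
    using a nSVS norm_star[of "a - S * V * S"] norm_star[of "S * V * S"] unfolding star star_diff by auto
  have "S * (V\<^sup>\<star> * V) * S = S" by (simp add: V SE SS)
  then have "a\<^sup>\<star> * a - S = (a\<^sup>\<star> - S * V\<^sup>\<star> * S) * a + (S * V\<^sup>\<star> * S) * (a - S * V * S) - S * V\<^sup>\<star> * (V * S - S * V) * S"
    by (simp add: algebra_simps SS)
  also have "norm \<dots> \<le> e * 1 + 1 * e + 1 * 1 * c * 1"
    by (intro order_trans[OF norm_triangle_ineq4] order_trans[OF norm_triangle_ineq] add_mono mult_norm_le as a c nS nV)
  finally show "norm (a\<^sup>\<star> * a - S) \<le> 2 * e + c" by simp
  have cs: "norm (S * V\<^sup>\<star> - V\<^sup>\<star> * S) \<le> c" using c norm_star[of "V * S - S * V"] by (simp add: SS)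
  have "S * (V * V\<^sup>\<star>) * S = S" by (simp add: V SE SS)
  then have "a * a\<^sup>\<star> - S = (a - S * V * S) * a\<^sup>\<star> + (S * V * S) * (a\<^sup>\<star> - S * V\<^sup>\<star> * S) + S * V * (S * V\<^sup>\<star> - V\<^sup>\<star> * S) * S"
    by (simp add: algebra_simps SS)
  also have "norm \<dots> \<le> e * 1 + 1 * e + 1 * 1 * c * 1"
    using nSVS by (intro order_trans[OF norm_triangle_ineq] add_mono mult_norm_le as a cs nS nV) simp_all
  finally show "norm (a * a\<^sup>\<star> - S) \<le> 2 * e + c" by simp
qed

context approx_pair
begin

text \<open>Each name is the coefficient of \<open>s\<close> in one estimate of
  \<open>seam_part\<close>: commutators with the seam projection, the defect of unitarity of the
  averaged \<open>X\<close>, the distance of \<open>u\<close> from the compression of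
  \<open>X\<close>, that of \<open>u ^ m\<close> from \<open>- S\<close>, that of
  \<open>\<sigma>\<close> from the compression, the commutator of \<open>\<sigma>\<close> with the
  averaged \<open>Y\<close>, and the defect of unitarity of the twice averaged \<open>Y\<close>.
  \<open>polar_const\<close> equals \<open>4 * compression_const + m\<close>.\<close>

definition "comm_const \<equiv> 8 * real m ^ 3 + 2 * real m ^ 2"
definition "compression_const \<equiv> 2 * real m + comm_const"
definition "polar_const \<equiv> 9 * real m + 4 * comm_const"
definition "sigma_root_const \<equiv> root_const m * (1 + real m + polar_const)"
definition "sigma_const \<equiv> 2 * sigma_root_const + polar_const"
definition "sigma_comm_const \<equiv> 2 * sigma_const + 2 * real m + 2 * comm_const"
definition "seam_const \<equiv> 2 * (real m * sigma_comm_const + real m) + comm_const"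

lemma consts_nonneg: "0 \<le> comm_const" "0 \<le> compression_const" "0 \<le> polar_const" "0 \<le> sigma_root_const" "0 \<le> sigma_const" "0 \<le> sigma_comm_const" "0 \<le> seam_const"
proof -
  show 1: "0 \<le> comm_const" by (simp add: comm_const_def)
  then show 2: "0 \<le> compression_const" "0 \<le> polar_const" by (simp_all add: compression_const_def polar_const_def)
  then show 3: "0 \<le> sigma_root_const" using root_const_pos[OF m2] by (simp add: sigma_root_const_def)
  then show 4: "0 \<le> sigma_const" using 2 by (simp add: sigma_const_def)
  then show 5: "0 \<le> sigma_comm_const" using 1 by (simp add: sigma_comm_const_def)
  then show "0 \<le> seam_const" using 1 by (simp add: seam_const_def)
qed

text \<open>The order of the corrections keeps them from spoiling each other. The compression of
  \<open>X\<close> is averaged over \<open>g\<close>, made unitary by \<open>polar\<close>, and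
  replaced by \<open>\<sigma>\<close> through \<open>unitary_root\<close>; all three steps respect
  covariance. Since \<open>\<sigma> ^ m = - S\<close>, conjugation by \<open>\<sigma>\<close> is a
  cyclic action, and averaging the \<open>g\<close>-invariant part of \<open>Y\<close> over it gives
  exact commutation. A last \<open>polar\<close> step makes the result unitary and keeps both
  relations.\<close>

lemma seam_part:
  assumes S: "S \<in> C" "proj S" "g * S = S * g"
    and XS: "norm (X * S - S * X) \<le> comm_const * s" and YS: "norm (Y * S - S * Y) \<le> comm_const * s"
    and lo: "\<And>j v. j < m \<Longrightarrow> S \<bullet>\<bullet> v = v \<Longrightarrow> inner (cj j X \<bullet>\<bullet> v) v \<le> (b + s) * (norm v)\<^sup>2"
    and small: "compression_const * s \<le> 1 / 16" "sigma_root_const * s \<le> 1 / 16" "seam_const * s \<le> 1 / 16"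
  obtains \<sigma> W where "\<sigma> \<in> C" "W \<in> C" "S * \<sigma> = \<sigma>" "\<sigma> * S = \<sigma>" "S * W = W" "W * S = W"
    "\<sigma>\<^sup>\<star> * \<sigma> = S" "\<sigma> * \<sigma>\<^sup>\<star> = S" "W\<^sup>\<star> * W = S" "W * W\<^sup>\<star> = S" "\<sigma> * W = W * \<sigma>"
    "g * \<sigma> = sc \<omega> (\<sigma> * g)" "g * W = W * g"
    "norm (\<sigma> - X * S) \<le> (sigma_const + comm_const) * s" "norm (W - Y * S) \<le> (4 * seam_const + real m * sigma_comm_const + real m + comm_const) * s"
    "\<And>p a. compatible p a \<Longrightarrow> p * S = S * p \<Longrightarrow> p * W = sc a (W * p)"
proof -
  have SS: "S * S = S" "S\<^sup>\<star> = S" "S * (S * T) = S * T" for T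
    using S(2) by (simp_all add: proj_def flip: mult.assoc)
  have nS: "norm S \<le> 1" by (rule proj_norm[OF S(2)])
  have ms: "real m * s\<^sup>2 \<le> real m * s" using s_sq_le by (intro mult_left_mono) auto
  have gSV: "norm (g * (S * V * S) - sc l (S * V * S * g)) \<le> s\<^sup>2" if V: "norm (g * V - sc l (V * g)) \<le> s\<^sup>2" for V l
  proof -
    have "g * (S * V * S) - sc l (S * V * S * g) = S * (g * V - sc l (V * g)) * S"
      by (simp add: left_diff_distrib right_diff_distrib mult.assoc S(3)[symmetric]) (simp add: S(3) flip: mult.assoc)
    then show ?thesis using mult_norm_le[OF mult_norm_le[OF nS V] nS] by simp
  qed
  have SVS: "S * V * S \<in> C" "S * (S * V * S) = S * V * S" "(S * V * S) * S = S * V * S" if "V \<in> C" for V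
    using that by (auto intro: C_mult S simp: SS mult.assoc)
  have nSVS: "norm (S * V * S) \<le> 1" if "norm V \<le> 1" for V
    using mult_norm_le[OF mult_norm_le[OF nS that] nS] by simp
  have one: "(1::complex) * cnj 1 = 1" "cmod 1 = 1" by simp_all
  define Xa where "Xa = avg \<omega> (S * X * S)"
  have Xa: "Xa \<in> C" "S * Xa = Xa" "Xa * S = Xa"
    unfolding Xa_def using avg_corner[OF S(1,3) SVS[OF X_in]] avg_in[OF SVS(1)[OF X_in]] by auto
  have Xa_near: "norm (Xa - S * X * S) \<le> real m * s"
    unfolding Xa_def using avg_near[OF SVS(1)[OF X_in] gSV[OF Xg] \<omega>_unit(1)] ms by linarith
  have nXa: "norm Xa \<le> 1"
    unfolding Xa_def by (rule order_trans[OF avg_norm[OF \<omega>_unit(3)] nSVS[OF norm_XY(1)]])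
  have Xa_k: "norm (Xa\<^sup>\<star> * Xa - S) \<le> compression_const * s" "norm (Xa * Xa\<^sup>\<star> - S) \<le> compression_const * s"
    using compression_near_unitary[OF S(1,2) X_in X_unitary XS Xa_near nXa]
    by (simp_all add: compression_const_def algebra_simps)
  have gXa: "g * Xa = sc \<omega> (Xa * g)" unfolding Xa_def by (rule avg_covariant[OF SVS(1)[OF X_in] \<omega>_unit(1,2)])
  have gXas: "g * Xa\<^sup>\<star> = sc (cnj \<omega>) (Xa\<^sup>\<star> * g)"
    unfolding Xa_def avg_star
    by (rule avg_covariant[OF C_star[OF SVS(1)[OF X_in]]])
       (use \<omega>_unit(1,2) in \<open>simp_all add: mult.commute flip: complex_cnj_power\<close>)
  obtain u where u: "u \<in> C" "S * u = u" "u * S = u" "u\<^sup>\<star> * u = S" "u * u\<^sup>\<star> = S" "norm (u - Xa) \<le> 4 * (compression_const * s)"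
    and u_cov: "\<And>p l l'. p * Xa = sc l (Xa * p) \<Longrightarrow> p * Xa\<^sup>\<star> = sc l' (Xa\<^sup>\<star> * p) \<Longrightarrow> l * l' = 1 \<Longrightarrow> p * S = S * p \<Longrightarrow>
      p * u = sc l (u * p)"
    using polar[OF S(1,2) Xa Xa_k small(1)] by metis
  have gu: "g * u = sc \<omega> (u * g)" by (rule u_cov[OF gXa gXas \<omega>_unit(1) S(3)])
  have u_near: "norm (u - S * X * S) \<le> polar_const * s"
  proof -
    have "u - S * X * S = (u - Xa) + (Xa - S * X * S)" by simp
    then have "norm (u - S * X * S) \<le> norm (u - Xa) + norm (Xa - S * X * S)" by (metis norm_triangle_ineq)
    also have "\<dots> \<le> 4 * (compression_const * s) + real m * s" by (intro add_mono u Xa_near)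
    finally show ?thesis by (simp add: polar_const_def compression_const_def algebra_simps)
  qed
  interpret cS: op_alg "{T \<in> C. S * T = T \<and> T * S = T}" S by (rule op_alg_corner[OF S(1,2)])
  have u_corner: "u \<in> {T \<in> C. S * T = T \<and> T * S = T}" using u by blast
  have wpos: "0 \<le> (1 + real m + polar_const) * s" using s consts_nonneg by simp
  have um: "norm (u ^ m + S) \<le> sigma_root_const * s"
  proof -
    \<comment> \<open>The excess over \<open>b\<close>: \<open>s\<close> from the cut,
      \<open>m * s\<close> for exchanging conjugation by \<open>g ^ j\<close> with rotation by
      \<open>\<omega> ^ j\<close>, and \<open>polar_const * s\<close> for replacing the compression
      of \<open>X\<close> by \<open>u\<close>.\<close>
    have "norm (u ^ m + S) \<le> root_const m * ((1 + real m + polar_const) * s)"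
    proof (rule cS.power_near_minus_one[OF order m2 wpos u_corner u(4,5)])
      fix j v assume j: "j < m" and Sv: "S \<bullet>\<bullet> v = v"
      have nl: "cmod (\<omega> ^ j) = 1" by (simp add: norm_power \<omega>_unit)
      have "inner (sc (\<omega> ^ j) u \<bullet>\<bullet> v) v = inner (sc (\<omega> ^ j) (u - S * X * S) \<bullet>\<bullet> v) v + inner (sc (\<omega> ^ j) X \<bullet>\<bullet> v) v"
      proof -
        have "inner (sc (\<omega> ^ j) (S * X * S) \<bullet>\<bullet> v) v = inner (S \<bullet>\<bullet> (sc (\<omega> ^ j) X \<bullet>\<bullet> v)) v"
          by (simp add: Sv)
        also have "\<dots> = inner (sc (\<omega> ^ j) X \<bullet>\<bullet> v) v" unfolding proj_inner[OF S(2)] Sv ..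
        finally show ?thesis by (simp add: sc_diff inner_diff del: app_times app_sc)
      qed
      moreover have "inner (sc (\<omega> ^ j) X \<bullet>\<bullet> v) v = inner (cj j X \<bullet>\<bullet> v) v - inner ((cj j X - sc (\<omega> ^ j) X) \<bullet>\<bullet> v) v"
        by (simp add: inner_diff del: app_sc)
      moreover have "inner (sc (\<omega> ^ j) (u - S * X * S) \<bullet>\<bullet> v) v \<le> (polar_const * s) * (norm v)\<^sup>2"
        by (rule quadratic_ge(2)) (use u_near nl in simp)
      moreover have "inner ((cj j X - sc (\<omega> ^ j) X) \<bullet>\<bullet> v) v \<ge> - (real m * s) * (norm v)\<^sup>2"
        by (rule quadratic_ge(1)) (use order_trans[OF cj_X_near ms, of j] j in simp)
      moreover have "inner (cj j X \<bullet>\<bullet> v) v \<le> (b + s) * (norm v)\<^sup>2" by (rule lo[OF j Sv])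
      ultimately have "inner (sc (\<omega> ^ j) u \<bullet>\<bullet> v) v \<le>
          (b + s) * (norm v)\<^sup>2 + (real m * s) * (norm v)\<^sup>2 + (polar_const * s) * (norm v)\<^sup>2"
        unfolding mult_minus_left by linarith
      also have "\<dots> = (b + (1 + real m + polar_const) * s) * (norm v)\<^sup>2" by (simp add: algebra_simps)
      finally show "inner (sc (\<omega> ^ j) u \<bullet>\<bullet> v) v \<le> (b + (1 + real m + polar_const) * s) * (norm v)\<^sup>2" .
    qed
    then show ?thesis by (simp add: sigma_root_const_def)
  qed
  obtain \<sigma> where \<sigma>: "\<sigma> \<in> C" "S * \<sigma> = \<sigma>" "\<sigma> * S = \<sigma>" "\<sigma>\<^sup>\<star> * \<sigma> = S" "\<sigma> * \<sigma>\<^sup>\<star> = S" "\<sigma> ^ m = - S"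
    "norm (\<sigma> - u) \<le> 2 * (sigma_root_const * s)"
    and \<sigma>_cov: "\<And>p l. p * u = sc l (u * p) \<Longrightarrow> l ^ m = 1 \<Longrightarrow> p * S = S * p \<Longrightarrow> p * \<sigma> = sc l (\<sigma> * p)"
    using cS.unitary_root[OF u_corner u(4,5) m_pos um small(2)] by blast
  have g\<sigma>: "g * \<sigma> = sc \<omega> (\<sigma> * g)" by (rule \<sigma>_cov[OF gu \<omega>_unit(2) S(3)])
  have \<sigma>_near: "norm (\<sigma> - S * X * S) \<le> sigma_const * s"
  proof -
    have "\<sigma> - S * X * S = (\<sigma> - u) + (u - S * X * S)" by simp
    then have "norm (\<sigma> - S * X * S) \<le> norm (\<sigma> - u) + norm (u - S * X * S)" by (metis norm_triangle_ineq)
    also have "\<dots> \<le> 2 * (sigma_root_const * s) + polar_const * s" by (intro add_mono \<sigma> u_near)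
    finally show ?thesis by (simp add: sigma_const_def algebra_simps)
  qed
  have n\<sigma>: "norm \<sigma> \<le> 1" by (rule unitary_norm_le[OF \<sigma>(4) S(2)])
  define Ya where "Ya = avg 1 (S * Y * S)"
  have Yg1: "norm (g * Y - sc 1 (Y * g)) \<le> s\<^sup>2" using Yg by simp
  have Ya: "Ya \<in> C" "S * Ya = Ya" "Ya * S = Ya"
    unfolding Ya_def using avg_corner[OF S(1,3) SVS[OF Y_in]] avg_in[OF SVS(1)[OF Y_in]] by auto
  have Ya_near: "norm (Ya - S * Y * S) \<le> real m * s"
    unfolding Ya_def using avg_near[OF SVS(1)[OF Y_in] gSV[OF Yg1] one(1)] ms by linarith
  have nYa: "norm Ya \<le> 1"
    unfolding Ya_def by (rule order_trans[OF avg_norm[OF one(2)] nSVS[OF norm_XY(2)]])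
  have gYa: "g * Ya = Ya * g" using avg_covariant[OF SVS(1)[OF Y_in], of 1] by (simp add: Ya_def)
  have \<sigma>Ya: "norm (\<sigma> * Ya - Ya * \<sigma>) \<le> sigma_comm_const * s"
  proof -
    define A where "A = S * X * S"
    define B where "B = S * Y * S"
    have nA: "norm A \<le> 1" unfolding A_def by (rule nSVS[OF norm_XY(1)])
    have "S * (X * Y) * S = S * (Y * X) * S" by (simp add: XY)
    then have AB: "A * B - B * A = S * Y * (X * S - S * X) * S - S * X * (Y * S - S * Y) * S"
      by (simp add: A_def B_def algebra_simps SS)
    have nAB: "norm (A * B - B * A) \<le> 2 * (comm_const * s)"
      using mult_norm_le[OF mult_norm_le[OF mult_norm_le[OF nS norm_XY(2)] XS] nS]
        mult_norm_le[OF mult_norm_le[OF mult_norm_le[OF nS norm_XY(1)] YS] nS]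
        norm_triangle_ineq4[of "S * Y * (X * S - S * X) * S" "S * X * (Y * S - S * Y) * S"]
      unfolding AB by simp
    have cb: "norm (V * V' - V' * V) \<le> r * r' + r' * r" if "norm V \<le> r" "norm V' \<le> r'" for V V' :: "'h cop" and r r'
      by (rule order_trans[OF norm_triangle_ineq4 add_mono[OF mult_norm_le[OF that] mult_norm_le[OF that(2,1)]]])
    have "\<sigma> * Ya - Ya * \<sigma> = ((\<sigma> - A) * Ya - Ya * (\<sigma> - A)) + ((A * (Ya - B) - (Ya - B) * A) + (A * B - B * A))"
      by (simp add: algebra_simps)
    then have "norm (\<sigma> * Ya - Ya * \<sigma>) \<le>
        norm ((\<sigma> - A) * Ya - Ya * (\<sigma> - A)) + (norm (A * (Ya - B) - (Ya - B) * A) + norm (A * B - B * A))"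
      by (simp only: norm_triangle3)
    also have "\<dots> \<le> (sigma_const * s * 1 + 1 * (sigma_const * s)) + ((1 * (real m * s) + real m * s * 1) + 2 * (comm_const * s))"
      using cb[OF \<sigma>_near nYa] cb[OF nA Ya_near] nAB unfolding A_def[symmetric] B_def[symmetric] by linarith
    finally show ?thesis by (simp add: sigma_comm_const_def algebra_simps)
  qed
  \<comment> \<open>On the corner of \<open>S\<close> the power \<open>\<sigma> ^ m\<close> is the
    scalar \<open>- 1\<close>, so a finite average over powers of \<open>\<sigma>\<close> is
    available.\<close>
  interpret c\<sigma>: cyclic_alg "{T \<in> C. S * T = T \<and> T * S = T}" S \<sigma> m "- 1"
    by unfold_locales (use m_pos \<sigma> in auto)
  have Ya_corner: "Ya \<in> {T \<in> C. S * T = T \<and> T * S = T}" using Ya by blast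
  define Yb where "Yb = c\<sigma>.avg 1 Ya"
  have Yb: "Yb \<in> C" "S * Yb = Yb" "Yb * S = Yb" unfolding Yb_def using c\<sigma>.avg_in[OF Ya_corner] by blast+
  have nYb: "norm Yb \<le> 1" unfolding Yb_def by (rule order_trans[OF c\<sigma>.avg_norm[OF one(2)] nYa])
  have \<sigma>Yb: "\<sigma> * Yb = Yb * \<sigma>" using c\<sigma>.avg_covariant[OF Ya_corner, of 1] by (simp add: Yb_def)
  have \<sigma>Ybs: "\<sigma> * Yb\<^sup>\<star> = Yb\<^sup>\<star> * \<sigma>"
    using c\<sigma>.avg_covariant[OF cS.C_star[OF Ya_corner], of 1] by (simp add: Yb_def c\<sigma>.avg_star)
  have Yb_near: "norm (Yb - S * Y * S) \<le> (real m * sigma_comm_const + real m) * s"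
  proof -
    have "norm (Yb - Ya) \<le> m * (sigma_comm_const * s)" unfolding Yb_def by (rule c\<sigma>.avg_near[OF Ya_corner _ one(1)]) (use \<sigma>Ya in simp)
    moreover have "Yb - S * Y * S = (Yb - Ya) + (Ya - S * Y * S)" by simp
    then have "norm (Yb - S * Y * S) \<le> norm (Yb - Ya) + norm (Ya - S * Y * S)" by (metis norm_triangle_ineq)
    ultimately show ?thesis using Ya_near by (simp add: algebra_simps)
  qed
  have gs: "g\<^sup>\<star> * \<sigma> = sc (cnj \<omega>) (\<sigma> * g\<^sup>\<star>)"
  proof -
    have "g\<^sup>\<star> * \<sigma> = g\<^sup>\<star> * \<sigma> * (g * g\<^sup>\<star>)" by (simp add: mult.assoc g_unitary E_right \<sigma>(1))
    also have "\<dots> = g\<^sup>\<star> * (\<sigma> * g) * g\<^sup>\<star>" by (simp add: mult.assoc)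
    also have "\<sigma> * g = sc (cnj \<omega>) (g * \<sigma>)" using \<omega>_unit(1) by (simp add: g\<sigma> mult.commute)
    also have "g\<^sup>\<star> * sc (cnj \<omega>) (g * \<sigma>) * g\<^sup>\<star> = sc (cnj \<omega>) ((g\<^sup>\<star> * g) * \<sigma> * g\<^sup>\<star>)" by (simp add: mult.assoc)
    finally show ?thesis by (simp add: g_unitary E_left \<sigma>(1))
  qed
  have g\<sigma>s: "g * \<sigma>\<^sup>\<star> = sc (cnj \<omega>) (\<sigma>\<^sup>\<star> * g)"
    using arg_cong[OF gs, of star] \<omega>_unit(1) by (simp add: mult.commute)
  \<comment> \<open>Here \<open>g\<close> is itself a symmetry of the averaging over
    \<open>\<sigma>\<close>: the two commute up to \<open>\<omega>\<close>, so the second average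
    keeps what the first achieved.\<close>
  have gYb: "g * Yb = Yb * g"
    unfolding Yb_def using c\<sigma>.avg_compatible[OF g\<sigma> g\<sigma>s \<omega>_unit(1), of Ya 1 1] gYa by simp
  have gYbs: "g * Yb\<^sup>\<star> = Yb\<^sup>\<star> * g"
  proof -
    have "g * Ya\<^sup>\<star> = Ya\<^sup>\<star> * g"
      using avg_covariant[OF C_star[OF SVS(1)[OF Y_in]], of 1] by (simp add: Ya_def avg_star)
    then show ?thesis
      unfolding Yb_def using c\<sigma>.avg_compatible[OF g\<sigma> g\<sigma>s \<omega>_unit(1), of "Ya\<^sup>\<star>" 1 1] by (simp add: c\<sigma>.avg_star)
  qed
  have Yb_k: "norm (Yb\<^sup>\<star> * Yb - S) \<le> seam_const * s" "norm (Yb * Yb\<^sup>\<star> - S) \<le> seam_const * s"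
    using compression_near_unitary[OF S(1,2) Y_in Y_unitary YS Yb_near nYb]
    by (simp_all add: seam_const_def algebra_simps)
  obtain W where W: "W \<in> C" "S * W = W" "W * S = W" "W\<^sup>\<star> * W = S" "W * W\<^sup>\<star> = S" "norm (W - Yb) \<le> 4 * (seam_const * s)"
    and W_cov: "\<And>p l l'. p * Yb = sc l (Yb * p) \<Longrightarrow> p * Yb\<^sup>\<star> = sc l' (Yb\<^sup>\<star> * p) \<Longrightarrow> l * l' = 1 \<Longrightarrow> p * S = S * p \<Longrightarrow>
      p * W = sc l (W * p)"
    using polar[OF S(1,2) Yb Yb_k small(3)] by metis
  have SV: "norm (S * V * S - V * S) \<le> c" if "norm (V * S - S * V) \<le> c" for V c
  proof -
    have "S * V * S - V * S = - ((V * S - S * V) * S)" by (simp add: algebra_simps SS)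
    then have "norm (S * V * S - V * S) = norm ((V * S - S * V) * S)" by (simp only: norm_minus_cancel)
    then show ?thesis using mult_norm_le[OF that nS] by simp
  qed
  show thesis
  proof (rule that[of \<sigma> W])
    show "\<sigma> * W = W * \<sigma>" using W_cov[of \<sigma> 1 1] \<sigma>Yb \<sigma>Ybs \<sigma> by simp
    show "g * W = W * g" using W_cov[of g 1 1] gYb gYbs S by simp
    have "\<sigma> - X * S = (\<sigma> - S * X * S) + (S * X * S - X * S)" by simp
    then have "norm (\<sigma> - X * S) \<le> norm (\<sigma> - S * X * S) + norm (S * X * S - X * S)" by (metis norm_triangle_ineq)
    then show "norm (\<sigma> - X * S) \<le> (sigma_const + comm_const) * s"
      using \<sigma>_near SV[OF XS] by (simp add: distrib_right)
    have "W - Y * S = (W - Yb) + ((Yb - S * Y * S) + (S * Y * S - Y * S))" by simp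
    then have "norm (W - Y * S) \<le> norm (W - Yb) + (norm (Yb - S * Y * S) + norm (S * Y * S - Y * S))"
      by (simp only: norm_triangle3)
    then show "norm (W - Y * S) \<le> (4 * seam_const + real m * sigma_comm_const + real m + comm_const) * s"
      using W(6) Yb_near SV[OF YS] by (simp add: algebra_simps)
    show "p * W = sc a (W * p)" if p: "compatible p a" and pS: "p * S = S * p" for p a
    proof -
      obtain t where t: "t * cnj t = 1" "p * g = sc t (g * p)" "p * g\<^sup>\<star> = sc (cnj t) (g\<^sup>\<star> * p)"
        and pE: "p * E = E * p" and pX: "p * X = X * p" "p * X\<^sup>\<star> = X\<^sup>\<star> * p"
        and a: "a * cnj a = 1" and pY: "p * Y = sc a (Y * p)" "p * Y\<^sup>\<star> = sc (cnj a) (Y\<^sup>\<star> * p)"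
        using p unfolding compatible_def by blast
      have pSV: "p * (S * V * S) = sc l (S * V * S * p)" if "p * V = sc l (V * p)" for V l
      proof -
        have "p * (S * V * S) = S * (p * V) * S" by (simp add: pS flip: mult.assoc)
        then show ?thesis by (simp add: that mult.assoc pS)
      qed
      have stars: "(S * V * S)\<^sup>\<star> = S * V\<^sup>\<star> * S" for V by (simp add: SS mult.assoc)
      have pXa: "p * Xa = sc 1 (Xa * p)" unfolding Xa_def
        by (rule avg_compatible[OF t(2,3,1) pSV]) (simp add: pX)
      have pXas: "p * Xa\<^sup>\<star> = sc 1 (Xa\<^sup>\<star> * p)" unfolding Xa_def avg_star stars
        by (rule avg_compatible[OF t(2,3,1) pSV]) (simp add: pX)
      have pu: "p * u = sc 1 (u * p)" by (rule u_cov[OF pXa pXas _ pS]) simp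
      have p\<sigma>: "p * \<sigma> = sc 1 (\<sigma> * p)" by (rule \<sigma>_cov[OF pu _ pS]) simp
      have p\<sigma>s: "p * \<sigma>\<^sup>\<star> = sc (cnj 1) (\<sigma>\<^sup>\<star> * p)"
      proof -
        have e: "S * \<sigma>\<^sup>\<star> = \<sigma>\<^sup>\<star>" "\<sigma>\<^sup>\<star> * S = \<sigma>\<^sup>\<star>"
          using proj_star_absorb[OF S(2)] \<sigma>(2,3) by auto
        have "p * \<sigma>\<^sup>\<star> = p * (S * \<sigma>\<^sup>\<star>)" by (simp only: e)
        also have "\<dots> = S * p * \<sigma>\<^sup>\<star>" by (simp only: pS flip: mult.assoc)
        also have "\<dots> = \<sigma>\<^sup>\<star> * (\<sigma> * p) * \<sigma>\<^sup>\<star>" by (simp only: mult.assoc \<sigma>(4)[symmetric])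
        also have "\<sigma> * p = p * \<sigma>" using p\<sigma> by simp
        also have "\<sigma>\<^sup>\<star> * (p * \<sigma>) * \<sigma>\<^sup>\<star> = \<sigma>\<^sup>\<star> * (p * S)" by (simp only: mult.assoc \<sigma>(5))
        also have "\<dots> = \<sigma>\<^sup>\<star> * p" by (simp only: pS e flip: mult.assoc)
        finally show ?thesis by simp
      qed
      have pYa: "p * Ya = sc a (Ya * p)" unfolding Ya_def
        by (rule avg_compatible[OF t(2,3,1) pSV[OF pY(1)]])
      have pYas: "p * Ya\<^sup>\<star> = sc (cnj a) (Ya\<^sup>\<star> * p)" unfolding Ya_def avg_star stars
        by (rule avg_compatible[OF t(2,3,1) pSV[OF pY(2)]])
      have "p * Yb = sc a (Yb * p)" unfolding Yb_def by (rule c\<sigma>.avg_compatible[OF p\<sigma> p\<sigma>s one(1) pYa])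
      moreover have "p * Yb\<^sup>\<star> = sc (cnj a) (Yb\<^sup>\<star> * p)"
        unfolding Yb_def c\<sigma>.avg_star by (rule c\<sigma>.avg_compatible[OF p\<sigma> p\<sigma>s one(1) pYas])
      ultimately show ?thesis using a pS by (rule W_cov)
    qed
  qed (use \<sigma> W g\<sigma> in simp_all)
qed

text \<open>Sum of the cell and seam coefficients; it also dominates the constants whose smallness
  the two parts require. It depends on \<open>m\<close> alone and is therefore available outside the
  locale as \<open>approx_pair.covariant_const m\<close>.\<close>

definition "covariant_const \<equiv> 16 * real m ^ 4 + 4 * real m ^ 3 + real m ^ 2 +
  comm_const + sigma_const + 4 * seam_const + real m * sigma_comm_const + real m"

text \<open>The two parts live on the complementary projections \<open>P\<close> and
  \<open>S\<close> and are added as blocks. The clause on \<open>compatible\<close> concerns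
  \<open>Y'\<close> because in the second round this slot holds the operator that the shift matrix
  already multiplies by \<open>\<omega>\<close>.\<close>

lemma covariant_pair_nearby:
  assumes small: "covariant_const * s \<le> 1 / 128"
  shows "\<exists>X'\<in>C. \<exists>Y'\<in>C. X'\<^sup>\<star> * X' = E \<and> X' * X'\<^sup>\<star> = E \<and> Y'\<^sup>\<star> * Y' = E \<and> Y' * Y'\<^sup>\<star> = E \<and> X' * Y' = Y' * X' \<and>
    g * X' = sc \<omega> (X' * g) \<and> g * Y' = Y' * g \<and> norm (X' - X) \<le> covariant_const * s \<and> norm (Y' - Y) \<le> covariant_const * s \<and>
    (\<forall>p a. compatible p a \<longrightarrow> p * Y' = sc a (Y' * p))"
proof -
  have m1: "real m \<ge> 1" using m2 by simp
  have pos: "real m \<le> real m ^ 2" "0 \<le> real m ^ 3" "0 \<le> real m ^ 4" "0 \<le> real m * sigma_comm_const"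
    using self_le_power[OF m1, of 2] consts_nonneg by auto
  have le: "compression_const \<le> covariant_const" "sigma_root_const \<le> covariant_const" "seam_const \<le> covariant_const" "real m ^ 3 \<le> covariant_const"
    unfolding covariant_const_def compression_const_def sigma_const_def using pos consts_nonneg m1 by linarith+
  have le_s: "c * s \<le> 1 / 128" if "c \<le> covariant_const" for c
    using mult_right_mono[OF that, of s] s small by linarith
  obtain P Xt Yt where P: "P \<in> C" "proj P" "g * P = P * g" and t: "Xt \<in> C" "Yt \<in> C"
    "P * Xt = Xt" "Xt * P = Xt" "P * Yt = Yt" "Yt * P = Yt"
    "Xt\<^sup>\<star> * Xt = P" "Xt * Xt\<^sup>\<star> = P" "Yt\<^sup>\<star> * Yt = P" "Yt * Yt\<^sup>\<star> = P" "Xt * Yt = Yt * Xt"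
    "g * Xt = sc \<omega> (Xt * g)" "g * Yt = Yt * g"
    "norm (Xt - X * P) \<le> cell_err" "norm (Yt - Y * P) \<le> cell_err"
    "norm (X * P - P * X) \<le> comm_err" "norm (Y * P - P * Y) \<le> comm_err"
    and lo: "\<And>j v. j < m \<Longrightarrow> E \<bullet>\<bullet> v = v \<Longrightarrow> P \<bullet>\<bullet> v = 0 \<Longrightarrow> inner (cj j X \<bullet>\<bullet> v) v \<le> (b + s) * (norm v)\<^sup>2"
    and pt: "\<And>p a. compatible p a \<Longrightarrow> p * P = P * p \<and> p * Yt = sc a (Yt * p)"
    using cell_part[OF le_s[OF le(4)]] by blast
  define S where "S = E - P"
  have EP: "E * P = P" "P * E = P" using P by (auto intro: E_left E_right)
  have PP: "P * P = P" by (rule proj_idem[OF P(2)])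
  have S: "S \<in> C" "proj S" "g * S = S * g"
    unfolding S_def by (auto intro: C_diff E_in P proj_diff[OF P(2) proj_E EP(1)] simp: algebra_simps P(3) E_simps)
  have SP: "S * P = 0" "P * S = 0" by (simp_all add: S_def algebra_simps EP PP)
  have XS: "norm (X * S - S * X) \<le> comm_const * s" "norm (Y * S - S * Y) \<le> comm_const * s"
    using t(16,17) by (simp_all add: S_def algebra_simps E_simps comm_const_def comm_err_def norm_minus_commute)
  have lo': "inner (cj j X \<bullet>\<bullet> v) v \<le> (b + s) * (norm v)\<^sup>2" if "j < m" "S \<bullet>\<bullet> v = v" for j v
  proof (rule lo[OF that(1)])
    show "E \<bullet>\<bullet> v = v" using that(2) E_left[OF S(1)] by (metis app_times)
    show "P \<bullet>\<bullet> v = 0" using that(2) SP(2) by (metis app_times app_zero)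
  qed
  have sm: "compression_const * s \<le> 1 / 16" "sigma_root_const * s \<le> 1 / 16" "seam_const * s \<le> 1 / 16"
    using le_s[OF le(1)] le_s[OF le(2)] le_s[OF le(3)] by linarith+
  obtain \<sigma> W where w: "\<sigma> \<in> C" "W \<in> C" "S * \<sigma> = \<sigma>" "\<sigma> * S = \<sigma>" "S * W = W" "W * S = W"
    "\<sigma>\<^sup>\<star> * \<sigma> = S" "\<sigma> * \<sigma>\<^sup>\<star> = S" "W\<^sup>\<star> * W = S" "W * W\<^sup>\<star> = S" "\<sigma> * W = W * \<sigma>"
    "g * \<sigma> = sc \<omega> (\<sigma> * g)" "g * W = W * g"
    "norm (\<sigma> - X * S) \<le> (sigma_const + comm_const) * s" "norm (W - Y * S) \<le> (4 * seam_const + real m * sigma_comm_const + real m + comm_const) * s"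
    and pw: "\<And>p a. compatible p a \<Longrightarrow> p * S = S * p \<Longrightarrow> p * W = sc a (W * p)"
    using seam_part[OF S XS lo' sm] by blast
  have orth: "A * B = 0" "B * A = 0" if "A * P = A" "S * B = B" "P * A = A" "B * S = B" for A B
  proof -
    have "A * B = A * P * (S * B)" by (simp add: that)
    also have "\<dots> = A * (P * S) * B" by (simp only: mult.assoc)
    finally show "A * B = 0" by (simp add: SP)
    have "B * A = B * S * (P * A)" by (simp add: that)
    also have "\<dots> = B * (S * P) * A" by (simp only: mult.assoc)
    finally show "B * A = 0" by (simp add: SP)
  qed
  have Pst: "P * Xt\<^sup>\<star> = Xt\<^sup>\<star>" "Xt\<^sup>\<star> * P = Xt\<^sup>\<star>" "P * Yt\<^sup>\<star> = Yt\<^sup>\<star>" "Yt\<^sup>\<star> * P = Yt\<^sup>\<star>"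
    using proj_star_absorb[OF P(2)] t by auto
  have Sst: "S * \<sigma>\<^sup>\<star> = \<sigma>\<^sup>\<star>" "\<sigma>\<^sup>\<star> * S = \<sigma>\<^sup>\<star>" "S * W\<^sup>\<star> = W\<^sup>\<star>" "W\<^sup>\<star> * S = W\<^sup>\<star>"
    using proj_star_absorb[OF S(2)] w by auto
  have PS: "P + S = E" by (simp add: S_def)
  have split: "V = V * P + V * S" if "V \<in> C" for V using E_right[OF that] by (simp add: S_def algebra_simps)
  show ?thesis
  proof (rule bexI[of _ "Xt + \<sigma>"], rule bexI[of _ "Yt + W"], intro conjI allI impI)
    show "Xt + \<sigma> \<in> C" "Yt + W \<in> C" by (intro C_add t w)+
    show "(Xt + \<sigma>)\<^sup>\<star> * (Xt + \<sigma>) = E" "(Xt + \<sigma>) * (Xt + \<sigma>)\<^sup>\<star> = E"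
      using orth[of Xt \<sigma>] orth[of "Xt\<^sup>\<star>" \<sigma>] orth[of Xt "\<sigma>\<^sup>\<star>"] t w Pst Sst PS by (simp_all add: distrib_left distrib_right)
    show "(Yt + W)\<^sup>\<star> * (Yt + W) = E" "(Yt + W) * (Yt + W)\<^sup>\<star> = E"
      using orth[of Yt W] orth[of "Yt\<^sup>\<star>" W] orth[of Yt "W\<^sup>\<star>"] t w Pst Sst PS by (simp_all add: distrib_left distrib_right)
    show "(Xt + \<sigma>) * (Yt + W) = (Yt + W) * (Xt + \<sigma>)"
      using orth[of Xt W] orth[of Yt \<sigma>] t w by (simp add: distrib_left distrib_right)
    show "g * (Xt + \<sigma>) = sc \<omega> ((Xt + \<sigma>) * g)" "g * (Yt + W) = (Yt + W) * g"
      using t w by (simp_all add: distrib_left distrib_right sc_add)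
    have nt: "norm (A + B - V) \<le> norm (A - V * P) + norm (B - V * S)" if "V \<in> C" for A B V
    proof -
      have "A + B - V = (A - V * P) + (B - V * S)" using split[OF that] by (metis add_diff_add)
      then show ?thesis by (simp only: norm_triangle_ineq)
    qed
    have nn: "0 \<le> sigma_const * s" "0 \<le> seam_const * s" "0 \<le> real m * sigma_comm_const * s" "0 \<le> real m * s"
      using consts_nonneg s by auto
    show "norm (Xt + \<sigma> - X) \<le> covariant_const * s"
      using nt[OF X_in, of Xt \<sigma>] t(14) w(14) nn unfolding covariant_const_def cell_err_def by (simp add: distrib_right)
    show "norm (Yt + W - Y) \<le> covariant_const * s"
      using nt[OF Y_in, of Yt W] t(15) w(15) nn unfolding covariant_const_def cell_err_def by (simp add: distrib_right)
    show "p * (Yt + W) = sc a ((Yt + W) * p)" if p: "compatible p a" for p a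
    proof -
      have "p * E = E * p" using p by (simp add: compatible_def)
      then have "p * S = S * p" using pt[OF p] by (simp add: S_def algebra_simps)
      then show ?thesis using pt[OF p] pw[OF p] by (simp add: distrib_left distrib_right sc_add)
    qed
  qed
qed

end

section \<open>Operator matrices\<close>

text \<open>Square-summable sequences with values in \<open>'h\<close>. This one Hilbert space contains the direct sums of
  \<open>m\<close> copies of \<open>'h\<close> for all \<open>m\<close>, so matrices of every size act on it.\<close>

typedef (overloaded) 'h l2 = "{x :: nat \<Rightarrow> 'h::complex_hilbert. summable (\<lambda>i. (norm (x i))\<^sup>2)}"
  morphisms coord Abs_l2
  by (intro exI[of _ "\<lambda>_. 0"]) simp

setup_lifting type_definition_l2

lemma norm_add_sq_le: "(norm (x + y))\<^sup>2 \<le> 2 * (norm x)\<^sup>2 + 2 * (norm (y::'a::real_normed_vector))\<^sup>2"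
proof -
  have "(norm (x + y))\<^sup>2 \<le> (norm x + norm y)\<^sup>2" by (intro power_mono norm_triangle_ineq) simp
  also have "\<dots> \<le> 2 * (norm x)\<^sup>2 + 2 * (norm y)\<^sup>2"
    using zero_le_power2[of "norm x - norm y"] by (simp add: power2_eq_square algebra_simps)
  finally show ?thesis .
qed

lemma summable_sq_add:
  assumes "summable (\<lambda>i. (norm (x i))\<^sup>2)" "summable (\<lambda>i. (norm (y i :: 'a::real_normed_vector))\<^sup>2)"
  shows "summable (\<lambda>i. (norm (x i + y i))\<^sup>2)"
proof (rule summable_comparison_test)
  show "summable (\<lambda>i. 2 * (norm (x i))\<^sup>2 + 2 * (norm (y i))\<^sup>2)"
    by (intro summable_add summable_mult assms)
qed (use norm_add_sq_le in auto)

lemma coord_summable: "summable (\<lambda>i. (norm (coord x i))\<^sup>2)"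
  using coord[of x] by simp

lemma coord_mult_summable: "summable (\<lambda>i. norm (coord x i) * norm (coord y i))"
proof (rule summable_comparison_test)
  show "summable (\<lambda>i. (norm (coord x i))\<^sup>2 + (norm (coord y i))\<^sup>2)"
    by (intro summable_add coord_summable)
  have "a * b \<le> a\<^sup>2 + b\<^sup>2" if "a \<ge> 0" "b \<ge> 0" for a b :: real
    using zero_le_power2[of "a - b"] mult_nonneg_nonneg[OF that] by (simp add: power2_eq_square algebra_simps)
  then show "\<exists>N. \<forall>n\<ge>N. norm (norm (coord x n) * norm (coord y n)) \<le> (norm (coord x n))\<^sup>2 + (norm (coord y n))\<^sup>2"
    by simp
qed

lemma coord_inner_summable: "summable (\<lambda>i. inner (coord x i) (coord y i))"
  by (rule summable_comparison_test[OF _ coord_mult_summable[of x y]]) (auto intro: Cauchy_Schwarz_ineq2)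

instantiation l2 :: (complex_hilbert) real_inner
begin

lift_definition zero_l2 :: "'a l2" is "\<lambda>_. 0" by simp
lift_definition plus_l2 :: "'a l2 \<Rightarrow> 'a l2 \<Rightarrow> 'a l2" is "\<lambda>x y i. x i + y i" by (rule summable_sq_add)
lift_definition uminus_l2 :: "'a l2 \<Rightarrow> 'a l2" is "\<lambda>x i. - x i" by simp
lift_definition minus_l2 :: "'a l2 \<Rightarrow> 'a l2 \<Rightarrow> 'a l2" is "\<lambda>x y i. x i - y i"
  using summable_sq_add[of _ "\<lambda>i. - _ i"] by simp
lift_definition scaleR_l2 :: "real \<Rightarrow> 'a l2 \<Rightarrow> 'a l2" is "\<lambda>r x i. r *\<^sub>R x i"
  by (simp add: power_mult_distrib summable_mult)
definition inner_l2 :: "'a l2 \<Rightarrow> 'a l2 \<Rightarrow> real" where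
  "inner_l2 x y = (\<Sum>i. inner (coord x i) (coord y i))"
definition norm_l2 :: "'a l2 \<Rightarrow> real" where "norm_l2 x = sqrt (inner x x)"
definition dist_l2 :: "'a l2 \<Rightarrow> 'a l2 \<Rightarrow> real" where "dist_l2 x y = norm (x - y)"
definition sgn_l2 :: "'a l2 \<Rightarrow> 'a l2" where "sgn_l2 x = inverse (norm x) *\<^sub>R x"
definition uniformity_l2 :: "('a l2 \<times> 'a l2) filter" where
  "uniformity_l2 = (INF e\<in>{0<..}. principal {(x, y). dist x y < e})"
definition open_l2 :: "'a l2 set \<Rightarrow> bool" where
  "open_l2 U = (\<forall>x\<in>U. \<forall>\<^sub>F (x', y) in uniformity. x' = x \<longrightarrow> y \<in> U)"

lemma norm_l2_sq: "(norm x)\<^sup>2 = (\<Sum>i. (norm (coord x i))\<^sup>2)"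
proof -
  have "inner x x = (\<Sum>i. (norm (coord x i))\<^sup>2)" by (simp add: inner_l2_def power2_norm_eq_inner)
  moreover have "0 \<le> (\<Sum>i. (norm (coord x i))\<^sup>2)" by (intro suminf_nonneg coord_summable) simp
  ultimately show ?thesis by (simp add: norm_l2_def)
qed

instance
proof
  fix x y z :: "'a l2" and a b :: real
  show "dist x y = norm (x - y)" by (rule dist_l2_def)
  show "sgn x = inverse (norm x) *\<^sub>R x" by (rule sgn_l2_def)
  show "uniformity = (INF e\<in>{0<..}. principal {(x, y::'a l2). dist x y < e})" by (rule uniformity_l2_def)
  show "open U = (\<forall>x\<in>U. \<forall>\<^sub>F (x', y) in uniformity. x' = x \<longrightarrow> y \<in> U)" for U :: "'a l2 set" by (rule open_l2_def)
  show "x + y + z = x + (y + z)" "x + y = y + x" "0 + x = x" "- x + x = 0" "x - y = x + - y"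
    by (transfer, simp add: algebra_simps)+
  show "a *\<^sub>R (x + y) = a *\<^sub>R x + a *\<^sub>R y" "(a + b) *\<^sub>R x = a *\<^sub>R x + b *\<^sub>R x"
    "a *\<^sub>R b *\<^sub>R x = (a * b) *\<^sub>R x" "1 *\<^sub>R x = x"
    by (transfer, simp add: algebra_simps)+
  show "inner x y = inner y x" by (simp add: inner_l2_def inner_commute)
  show "inner (x + y) z = inner x z + inner y z"
    by (simp add: inner_l2_def plus_l2.rep_eq inner_add_left suminf_add[OF coord_inner_summable coord_inner_summable])
  show "inner (a *\<^sub>R x) y = a * inner x y"
    by (simp add: inner_l2_def scaleR_l2.rep_eq suminf_mult[OF coord_inner_summable])
  show nn: "0 \<le> inner x x"
    unfolding inner_l2_def by (intro suminf_nonneg coord_inner_summable) simp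
  show "norm x = sqrt (inner x x)" by (rule norm_l2_def)
  show "inner x x = 0 \<longleftrightarrow> x = 0"
  proof
    assume "inner x x = 0"
    then have "(\<Sum>i. inner (coord x i) (coord x i)) = 0" by (simp add: inner_l2_def)
    then have "\<forall>i. inner (coord x i) (coord x i) = 0"
      by (subst (asm) suminf_eq_zero_iff[OF coord_inner_summable]) auto
    then show "x = 0" by transfer auto
  qed (simp add: inner_l2_def zero_l2.rep_eq)
qed

end

lemma coord_norm_le: "norm (coord x i) \<le> norm x"
proof (rule power2_le_imp_le)
  have "(\<Sum>j\<in>{i}. (norm (coord x j))\<^sup>2) \<le> (norm x)\<^sup>2"
    unfolding norm_l2_sq by (intro sum_le_suminf coord_summable) auto
  then show "(norm (coord x i))\<^sup>2 \<le> (norm x)\<^sup>2" by simp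
qed simp

lemma coord_add [simp]: "coord (x + y) i = coord x i + coord y i" by (simp add: plus_l2.rep_eq)
lemma coord_diff [simp]: "coord (x - y) i = coord x i - coord y i" by (simp add: minus_l2.rep_eq)

instance l2 :: (complex_hilbert) complete_space
proof
  fix X :: "nat \<Rightarrow> 'a l2" assume C: "Cauchy X"
  have "convergent (\<lambda>n. coord (X n) i)" for i
  proof (rule Cauchy_convergent, rule metric_CauchyI)
    fix e :: real assume "e > 0"
    then obtain M where M: "\<And>m n. m \<ge> M \<Longrightarrow> n \<ge> M \<Longrightarrow> dist (X m) (X n) < e" using C metric_CauchyD by blast
    then have "dist (coord (X m) i) (coord (X n) i) < e" if "m \<ge> M" "n \<ge> M" for m n
      using coord_norm_le[of "X m - X n" i] M[OF that] by (simp add: dist_norm)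
    then show "\<exists>M. \<forall>m\<ge>M. \<forall>n\<ge>M. dist (coord (X m) i) (coord (X n) i) < e" by blast
  qed
  then obtain l where l: "\<And>i. (\<lambda>n. coord (X n) i) \<longlonglongrightarrow> l i" unfolding convergent_def by metis
  \<comment> \<open>Finite partial sums pass to the coordinatewise limit with a bound independent of
    \<open>N\<close>, which then bounds the whole series.\<close>
  have part: "(\<Sum>i<N. (norm (coord (X k) i - l i))\<^sup>2) \<le> e\<^sup>2"
    if M: "\<And>n. n \<ge> k \<Longrightarrow> dist (X k) (X n) < e" for k N e
  proof (rule LIMSEQ_le_const2)
    show "(\<lambda>n. \<Sum>i<N. (norm (coord (X k) i - coord (X n) i))\<^sup>2) \<longlonglongrightarrow> (\<Sum>i<N. (norm (coord (X k) i - l i))\<^sup>2)"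
      by (intro tendsto_intros l)
    have "(\<Sum>i<N. (norm (coord (X k) i - coord (X n) i))\<^sup>2) \<le> e\<^sup>2" if "n \<ge> k" for n
    proof -
      have "(\<Sum>i<N. (norm (coord (X k - X n) i))\<^sup>2) \<le> (norm (X k - X n))\<^sup>2"
        unfolding norm_l2_sq by (intro sum_le_suminf coord_summable) auto
      also have "\<dots> \<le> e\<^sup>2" using M[OF that] by (intro power_mono) (auto simp: dist_norm)
      finally show ?thesis by simp
    qed
    then show "\<exists>M. \<forall>n\<ge>M. (\<Sum>i<N. (norm (coord (X k) i - coord (X n) i))\<^sup>2) \<le> e\<^sup>2" by blast
  qed
  have sm: "summable (\<lambda>i. (norm (coord (X k) i - l i))\<^sup>2)" and sle: "(\<Sum>i. (norm (coord (X k) i - l i))\<^sup>2) \<le> e\<^sup>2"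
    if "\<And>n. n \<ge> k \<Longrightarrow> dist (X k) (X n) < e" for k e
  proof -
    show s: "summable (\<lambda>i. (norm (coord (X k) i - l i))\<^sup>2)"
      by (rule bounded_imp_summable[where B = "e\<^sup>2"]) (use part[OF that, of "Suc _"] in \<open>auto simp: lessThan_Suc_atMost\<close>)
    show "(\<Sum>i. (norm (coord (X k) i - l i))\<^sup>2) \<le> e\<^sup>2"
      by (rule suminf_le_const[OF s part[OF that]])
  qed
  obtain M where M: "\<And>m n. m \<ge> M \<Longrightarrow> n \<ge> M \<Longrightarrow> dist (X m) (X n) < 1" using C metric_CauchyD[OF C, of 1] by auto
  have "summable (\<lambda>i. (norm (coord (X M) i + (- (coord (X M) i - l i))))\<^sup>2)"
    by (rule summable_sq_add[OF coord_summable]) (use sm[of M 1] M in \<open>simp add: norm_minus_commute\<close>)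
  then have sl: "summable (\<lambda>i. (norm (l i))\<^sup>2)" by simp
  define L where "L = Abs_l2 l"
  have L: "coord L = l" using sl by (simp add: L_def Abs_l2_inverse)
  have "X \<longlonglongrightarrow> L"
  proof (rule metric_LIMSEQ_I)
    fix e :: real assume e: "e > 0"
    then obtain M where M: "\<And>m n. m \<ge> M \<Longrightarrow> n \<ge> M \<Longrightarrow> dist (X m) (X n) < e / 2"
      using metric_CauchyD[OF C, of "e / 2"] by auto
    have "dist (X k) L < e" if "k \<ge> M" for k
    proof -
      have "(norm (X k - L))\<^sup>2 \<le> (e / 2)\<^sup>2"
        unfolding norm_l2_sq coord_diff L by (rule sle) (use M that in auto)
      then have "norm (X k - L) \<le> e / 2" using e by (rule_tac power2_le_imp_le) auto
      then show ?thesis using e by (simp add: dist_norm)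
    qed
    then show "\<exists>M. \<forall>k\<ge>M. dist (X k) L < e" by blast
  qed
  then show "convergent X" by (rule convergentI)
qed

text \<open>Real and imaginary part are estimated separately; the resulting factor 2 is immaterial
  for summability and boundedness.\<close>

lemma norm_cinner_le: "cmod (cinner x y) \<le> 2 * (norm x * norm (y::'a::complex_hilbert))"
proof -
  have "cmod (cinner x y) \<le> \<bar>inner x y\<bar> + \<bar>inner (\<i> *\<^sub>C x) y\<bar>"
    unfolding cinner_eq_inner using cmod_le[of "Complex (inner x y) (inner (\<i> *\<^sub>C x) y)"] by simp
  also have "\<dots> \<le> norm x * norm y + norm (\<i> *\<^sub>C x) * norm y" by (intro add_mono Cauchy_Schwarz_ineq2)
  finally show ?thesis by simp
qed

instantiation l2 :: (complex_hilbert) complex_hilbert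
begin

lift_definition scaleC_l2 :: "complex \<Rightarrow> 'a l2 \<Rightarrow> 'a l2" is "\<lambda>c x i. c *\<^sub>C x i"
  by (simp add: power_mult_distrib summable_mult)
definition cinner_l2 :: "'a l2 \<Rightarrow> 'a l2 \<Rightarrow> complex" where
  "cinner_l2 x y = (\<Sum>i. cinner (coord x i) (coord y i))"

instance
proof
  fix x y z :: "'a l2" and c d :: complex and r :: real
  have sm: "summable (\<lambda>i. cinner (coord x i) (coord y i))" for x y :: "'a l2"
    by (rule summable_comparison_test[OF _ summable_mult[OF coord_mult_summable[of x y], of 2]])
       (use norm_cinner_le in auto)
  show "c *\<^sub>C (x + y) = c *\<^sub>C x + c *\<^sub>C y" by transfer (simp add: scaleC_add_right)
  show "(c + d) *\<^sub>C x = c *\<^sub>C x + d *\<^sub>C x" by transfer (simp add: scaleC_add_left)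
  show "c *\<^sub>C d *\<^sub>C x = (c * d) *\<^sub>C x" by transfer (simp add: scaleC_scaleC)
  show "r *\<^sub>R x = complex_of_real r *\<^sub>C x" by transfer (simp add: scaleR_scaleC)
  show "cinner x (y + z) = cinner x y + cinner x z"
    by (simp add: cinner_l2_def cinner_add_right suminf_add[OF sm sm])
  show "cinner x (c *\<^sub>C y) = c * cinner x y"
    by (simp add: cinner_l2_def scaleC_l2.rep_eq cinner_scaleC_right suminf_mult[OF sm])
  show "cinner x y = cnj (cinner y x)"
    unfolding cinner_l2_def bounded_linear.suminf[OF bounded_linear_cnj sm]
    by (subst cinner_commute) simp
  show "inner x y = Re (cinner x y)"
    unfolding cinner_l2_def bounded_linear.suminf[OF bounded_linear_Re sm] inner_l2_def
    by (simp add: inner_eq_Re_cinner)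
qed

end

lemma coord_scaleC [simp]: "coord (c *\<^sub>C x) i = c *\<^sub>C coord x i" by (simp add: scaleC_l2.rep_eq)

lemma l2_eqI: "(\<And>i. coord x i = coord y i) \<Longrightarrow> x = y"
  by (simp add: coord_inject[symmetric] fun_eq_iff)

lemma l2_of_finite:
  obtains x where "\<And>i. coord x i = (if i < m then f i else 0)"
proof -
  have "summable (\<lambda>i. (norm (if i < m then f i else 0))\<^sup>2)"
    by (rule summable_finite[of "{..<m}"]) auto
  then have "coord (Abs_l2 (\<lambda>i. if i < m then f i else 0)) i = (if i < m then f i else 0)" for i
    by (simp add: Abs_l2_inverse)
  then show thesis by (rule that)
qed

lemma norm_l2_finite:
  assumes "\<And>i. i \<ge> m \<Longrightarrow> coord x i = 0"
  shows "norm x = L2_set (\<lambda>i. norm (coord x i)) {..<m}"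
proof -
  have "(norm x)\<^sup>2 = (\<Sum>i<m. (norm (coord x i))\<^sup>2)"
    unfolding norm_l2_sq by (rule suminf_finite) (use assms in auto)
  then have "sqrt ((norm x)\<^sup>2) = L2_set (\<lambda>i. norm (coord x i)) {..<m}" by (simp only: L2_set_def)
  then show ?thesis by simp
qed

lemma L2_set_coord_le: "L2_set (\<lambda>i. norm (coord x i)) {..<m} \<le> norm x"
proof -
  have "(\<Sum>i<m. (norm (coord x i))\<^sup>2) \<le> (norm x)\<^sup>2"
    unfolding norm_l2_sq by (intro sum_le_suminf coord_summable) auto
  then have "sqrt (\<Sum>i<m. (norm (coord x i))\<^sup>2) \<le> sqrt ((norm x)\<^sup>2)" by (rule real_sqrt_le_mono)
  then show ?thesis by (simp add: L2_set_def)
qed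

lemma cinner_l2_finite:
  assumes "\<And>i. i \<ge> m \<Longrightarrow> coord x i = 0 \<or> coord y i = 0"
  shows "cinner x y = (\<Sum>i<m. cinner (coord x i) (coord y i))"
  unfolding cinner_l2_def
proof (rule suminf_finite)
  fix i assume "i \<notin> {..<m}"
  then have "coord x i = 0 \<or> coord y i = 0" using assms by auto
  then show "cinner (coord x i) (coord y i) = 0"
    using cinner_commute[of "coord x i" "coord y i"] by auto
qed simp

lemma bounded_linear_coord: "bounded_linear (\<lambda>x. coord x i)"
  by (rule bounded_linear_intro[where K = 1]) (auto simp: scaleR_l2.rep_eq intro: coord_norm_le)

type_synonym 'h cmat = "nat \<Rightarrow> nat \<Rightarrow> 'h cop"

lemma emb_exists:
  fixes M :: "'h::complex_hilbert cmat"
  shows "\<exists>T. \<forall>x i. coord (T \<bullet>\<bullet> x) i = (if i < m then \<Sum>j<m. M i j \<bullet>\<bullet> coord x j else 0)"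
proof -
  have "\<exists>y. \<forall>i. coord y i = (if i < m then \<Sum>j<m. M i j \<bullet>\<bullet> coord x j else 0)" for x
    by (rule l2_of_finite[of m "\<lambda>i. \<Sum>j<m. M i j \<bullet>\<bullet> coord x j"]) blast
  then obtain f where f: "\<And>x i. coord (f x) i = (if i < m then \<Sum>j<m. M i j \<bullet>\<bullet> coord x j else 0)" by metis
  define K where "K = (\<Sum>i<m. \<Sum>j<m. norm (M i j))"
  obtain T where "\<And>x. T \<bullet>\<bullet> x = f x"
  proof (rule cop_of_map)
    show "f (x + y) = f x + f y" for x y by (rule l2_eqI) (simp add: f sum.distrib)
    show "f (c *\<^sub>C x) = c *\<^sub>C f x" for c x
    proof (rule l2_eqI)
      have "(\<Sum>j<m. c *\<^sub>C v j) = c *\<^sub>C (\<Sum>j<m. v j)" for v :: "nat \<Rightarrow> 'h"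
        by (induction m) (simp_all add: scaleC_add_right)
      then show "coord (f (c *\<^sub>C x)) i = coord (c *\<^sub>C f x) i" for i by (simp add: f)
    qed
    show "norm (f x) \<le> norm x * K" for x
    proof -
      have "norm (f x) = L2_set (\<lambda>i. norm (coord (f x) i)) {..<m}" by (rule norm_l2_finite) (simp add: f)
      also have "\<dots> \<le> (\<Sum>i<m. norm (coord (f x) i))" by (rule L2_set_le_sum) simp
      also have "\<dots> \<le> (\<Sum>i<m. \<Sum>j<m. norm x * norm (M i j))"
      proof (rule sum_mono)
        fix i assume "i \<in> {..<m}"
        have "norm (\<Sum>j<m. M i j \<bullet>\<bullet> coord x j) \<le> (\<Sum>j<m. norm x * norm (M i j))"
        proof (rule sum_norm_le)
          fix j
          have "norm (M i j \<bullet>\<bullet> coord x j) \<le> norm (M i j) * norm (coord x j)" by (rule norm_app)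
          also have "\<dots> \<le> norm (M i j) * norm x" by (intro mult_left_mono coord_norm_le) simp
          finally show "norm (M i j \<bullet>\<bullet> coord x j) \<le> norm x * norm (M i j)" by (simp add: mult.commute)
        qed
        then show "norm (coord (f x) i) \<le> (\<Sum>j<m. norm x * norm (M i j))" using \<open>i \<in> {..<m}\<close> by (simp add: f)
      qed
      finally show ?thesis by (simp add: K_def sum_distrib_left)
    qed
  qed auto
  then show ?thesis using f by (intro exI[of _ T]) simp
qed

text \<open>The matrix acts on the first \<open>m\<close> coordinates and the remaining ones are
  sent to 0. The unit of a matrix algebra is thus \<open>diag_emb m (\<lambda>_. e)\<close> instead
  of the identity of the sequence space, and entries of \<open>M\<close> with an index from
  \<open>m\<close> on have no effect.\<close>

definition emb :: "nat \<Rightarrow> 'h::complex_hilbert cmat \<Rightarrow> 'h l2 cop" where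
  "emb m M = (SOME T. \<forall>x i. coord (T \<bullet>\<bullet> x) i = (if i < m then \<Sum>j<m. M i j \<bullet>\<bullet> coord x j else 0))"

lemma coord_emb: "coord (emb m M \<bullet>\<bullet> x) i = (if i < m then \<Sum>j<m. M i j \<bullet>\<bullet> coord x j else 0)"
  using someI_ex[OF emb_exists[of m M]] unfolding emb_def by blast

lemma emb_add: "emb m M + emb m N = emb m (\<lambda>i j. M i j + N i j)"
  by (rule cop_eqI, rule l2_eqI) (simp add: coord_emb sum.distrib)

lemma scaleC_sum: "c *\<^sub>C (\<Sum>j\<in>I. v j) = (\<Sum>j\<in>I. c *\<^sub>C (v j::'a::complex_hilbert))"
  by (induction I rule: infinite_finite_induct) (simp_all add: scaleC_add_right)

lemma emb_sc: "sc c (emb m M) = emb m (\<lambda>i j. sc c (M i j))"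
  by (rule cop_eqI, rule l2_eqI) (simp add: coord_emb scaleC_sum)

lemma emb_diff: "emb m M - emb m N = emb m (\<lambda>i j. M i j - N i j)"
  by (rule cop_eqI, rule l2_eqI) (simp add: coord_emb sum_subtractf)

lemma app_sum_right: "T \<bullet>\<bullet> (\<Sum>j\<in>I. v j) = (\<Sum>j\<in>I. T \<bullet>\<bullet> v j)"
  by (induction I rule: infinite_finite_induct) simp_all

lemma emb_mult: "emb m M * emb m N = emb m (\<lambda>i j. \<Sum>k<m. M i k * N k j)"
proof (rule cop_eqI, rule l2_eqI)
  fix x i
  have "(\<Sum>k<m. M i k \<bullet>\<bullet> (\<Sum>j<m. N k j \<bullet>\<bullet> coord x j)) = (\<Sum>j<m. \<Sum>k<m. M i k \<bullet>\<bullet> N k j \<bullet>\<bullet> coord x j)"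
    unfolding app_sum_right by (rule sum.swap)
  then show "coord ((emb m M * emb m N) \<bullet>\<bullet> x) i = coord (emb m (\<lambda>i j. \<Sum>k<m. M i k * N k j) \<bullet>\<bullet> x) i"
    by (simp add: coord_emb)
qed

lemma cinner_sum_right: "cinner x (\<Sum>j\<in>I. v j) = (\<Sum>j\<in>I. cinner x (v j::'a::complex_hilbert))"
  by (induction I rule: infinite_finite_induct) (simp_all add: cinner_add_right)

lemma cinner_zero_left [simp]: "cinner 0 (x::'a::complex_hilbert) = 0"
  using cinner_commute[of 0 x] by simp

lemma cinner_sum_left: "cinner (\<Sum>j\<in>I. v j) x = (\<Sum>j\<in>I. cinner (v j::'a::complex_hilbert) x)"
  by (induction I rule: infinite_finite_induct) (simp_all add: cinner_add_left)

lemma emb_star: "(emb m M)\<^sup>\<star> = emb m (\<lambda>i j. (M j i)\<^sup>\<star>)"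
proof (rule star_eqI)
  fix x y
  have "cinner (emb m (\<lambda>i j. (M j i)\<^sup>\<star>) \<bullet>\<bullet> x) y = (\<Sum>i<m. \<Sum>j<m. cinner (coord x j) (M j i \<bullet>\<bullet> coord y i))"
    by (subst cinner_l2_finite[of m]) (auto simp: coord_emb cinner_sum_left cinner_star)
  also have "\<dots> = (\<Sum>j<m. \<Sum>i<m. cinner (coord x j) (M j i \<bullet>\<bullet> coord y i))" by (rule sum.swap)
  also have "\<dots> = cinner x (emb m M \<bullet>\<bullet> y)"
    by (subst cinner_l2_finite[of m]) (auto simp: coord_emb cinner_sum_right)
  finally show "cinner (emb m (\<lambda>i j. (M j i)\<^sup>\<star>) \<bullet>\<bullet> x) y = cinner x (emb m M \<bullet>\<bullet> y)" .
qed

lemma single_exists: "\<exists>y. \<forall>i. coord y i = (if i = j then v else 0)"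
proof -
  obtain y where "\<And>i. coord y i = (if i < Suc j then (if i = j then v else 0) else 0)"
    using l2_of_finite[of "Suc j" "\<lambda>i. if i = j then v else 0"] by blast
  then show ?thesis by (intro exI[of _ y]) auto
qed

definition single :: "nat \<Rightarrow> 'h::complex_hilbert \<Rightarrow> 'h l2" where
  "single j v = (SOME y. \<forall>i. coord y i = (if i = j then v else 0))"

lemma coord_single [simp]: "coord (single j v) i = (if i = j then v else 0)"
  using someI_ex[OF single_exists[of j v]] unfolding single_def by blast

lemma norm_single [simp]: "norm (single j v) = norm v"
proof -
  have "norm (single j v) = L2_set (\<lambda>i. norm (coord (single j v) i)) {..<Suc j}"
    by (rule norm_l2_finite) auto
  also have "\<dots> = sqrt (\<Sum>i<Suc j. if i = j then (norm v)\<^sup>2 else 0)"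
    unfolding L2_set_def by (intro arg_cong[of _ _ sqrt] sum.cong) auto
  finally show ?thesis by simp
qed

lemma single_add: "single j (v + w) = single j v + single j w"
  by (rule l2_eqI) simp

lemma single_scaleC: "single j (c *\<^sub>C v) = c *\<^sub>C single j v"
  by (rule l2_eqI) simp

lemma coord_emb_single: "i < m \<Longrightarrow> j < m \<Longrightarrow> coord (emb m M \<bullet>\<bullet> single j v) i = M i j \<bullet>\<bullet> v"
proof -
  assume ij: "i < m" "j < m"
  have "(\<Sum>k<m. M i k \<bullet>\<bullet> coord (single j v) k) = (\<Sum>k<m. if k = j then M i j \<bullet>\<bullet> v else 0)"
    by (intro sum.cong refl) auto
  then show ?thesis using ij by (simp add: coord_emb)
qed

lemma emb_inj: "emb m M = emb m N \<Longrightarrow> i < m \<Longrightarrow> j < m \<Longrightarrow> M i j = N i j"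
  by (rule cop_eqI) (metis coord_emb_single)

lemma norm_entry_le: "i < m \<Longrightarrow> j < m \<Longrightarrow> norm (M i j) \<le> norm (emb m M)"
proof (rule norm_cop_bound)
  fix v assume ij: "i < m" "j < m"
  have "norm (M i j \<bullet>\<bullet> v) \<le> norm (emb m M \<bullet>\<bullet> single j v)"
    using coord_norm_le[of "emb m M \<bullet>\<bullet> single j v" i] by (simp add: coord_emb_single ij)
  then show "norm (M i j \<bullet>\<bullet> v) \<le> norm (emb m M) * norm v"
    using norm_app[of "emb m M" "single j v"] by simp
qed simp

lemma emb_cong: "(\<And>i j. i < m \<Longrightarrow> j < m \<Longrightarrow> M i j = N i j) \<Longrightarrow> emb m M = emb m N"
  by (rule cop_eqI, rule l2_eqI) (simp add: coord_emb)

definition matrices :: "nat \<Rightarrow> 'h::complex_hilbert cop set \<Rightarrow> 'h l2 cop set" where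
  "matrices m B = {emb m M | M. \<forall>i<m. \<forall>j<m. M i j \<in> B}"

definition diag_emb :: "nat \<Rightarrow> (nat \<Rightarrow> 'h::complex_hilbert cop) \<Rightarrow> 'h l2 cop" where
  "diag_emb m d = emb m (\<lambda>i j. if i = j then d i else 0)"

lemma coord_diag_emb: "coord (diag_emb m d \<bullet>\<bullet> x) i = (if i < m then d i \<bullet>\<bullet> coord x i else 0)"
proof -
  have "(\<Sum>j<m. (if i = j then d i else 0) \<bullet>\<bullet> coord x j) = (\<Sum>j<m. if i = j then d i \<bullet>\<bullet> coord x i else 0)"
    by (intro sum.cong refl) auto
  then show ?thesis by (simp add: diag_emb_def coord_emb)
qed

text \<open>Strong convergence passes to entries, since the entry at \<open>i\<close>,
  \<open>j\<close> sends \<open>v\<close> to the coordinate \<open>i\<close> of the image of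
  \<open>single j v\<close>. The entrywise limits reassemble to \<open>T\<close> because all sums
  are finite.\<close>

lemma op_alg_matrices:
  assumes "op_alg B e"
  shows "op_alg (matrices m B) (diag_emb m (\<lambda>_. e))"
proof -
  interpret op_alg B e by fact
  show ?thesis
  proof
    fix S T c assume S: "S \<in> matrices m B"
    then obtain M where M: "S = emb m M" "\<forall>i<m. \<forall>j<m. M i j \<in> B" by (auto simp: matrices_def)
    show "sc c S \<in> matrices m B" using M by (auto simp: matrices_def emb_sc intro!: exI[of _ "\<lambda>i j. sc c (M i j)"] C_sc)
    show "S\<^sup>\<star> \<in> matrices m B" using M by (auto simp: matrices_def emb_star intro!: exI[of _ "\<lambda>i j. (M j i)\<^sup>\<star>"] C_star)
    have EM: "e \<bullet>\<bullet> M i j \<bullet>\<bullet> v = M i j \<bullet>\<bullet> v" "M i j \<bullet>\<bullet> e \<bullet>\<bullet> v = M i j \<bullet>\<bullet> v" if "i < m" "j < m" for i j v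
      using E_left[of "M i j"] E_right[of "M i j"] M(2) that by (metis app_times)+
    show "diag_emb m (\<lambda>_. e) * S = S"
      by (rule cop_eqI, rule l2_eqI) (simp add: M(1) coord_diag_emb coord_emb app_sum_right EM)
    show "S * diag_emb m (\<lambda>_. e) = S"
      by (rule cop_eqI, rule l2_eqI) (simp add: M(1) coord_diag_emb coord_emb EM)
    assume "T \<in> matrices m B"
    then obtain N where N: "T = emb m N" "\<forall>i<m. \<forall>j<m. N i j \<in> B" by (auto simp: matrices_def)
    show "S + T \<in> matrices m B"
      using M N by (auto simp: matrices_def emb_add intro!: exI[of _ "\<lambda>i j. M i j + N i j"] C_add)
    show "S * T \<in> matrices m B"
      using M N by (auto simp: matrices_def emb_mult intro!: exI[of _ "\<lambda>i j. \<Sum>k<m. M i k * N k j"] C_sum C_mult)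
  next
    show "diag_emb m (\<lambda>_. e) \<in> matrices m B"
      unfolding diag_emb_def matrices_def using E_in C_zero by auto
  next
    fix f T assume f: "\<And>n. f n \<in> matrices m B" and l: "\<And>x. (\<lambda>n. f n \<bullet>\<bullet> x) \<longlonglongrightarrow> T \<bullet>\<bullet> x"
    obtain M where M: "\<And>n. f n = emb m (M n)" "\<And>n i j. i < m \<Longrightarrow> j < m \<Longrightarrow> M n i j \<in> B"
      using f unfolding matrices_def mem_Collect_eq by metis
    have ex: "\<exists>N. \<forall>v. N \<bullet>\<bullet> v = coord (T \<bullet>\<bullet> single j v) i" for i j
    proof -
      obtain N where "\<And>v. N \<bullet>\<bullet> v = coord (T \<bullet>\<bullet> single j v) i"
      proof (rule cop_of_map)
        show "norm (coord (T \<bullet>\<bullet> single j v) i) \<le> norm v * norm T" for v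
          using coord_norm_le[of "T \<bullet>\<bullet> single j v" i] norm_app[of T "single j v"] by (simp add: mult.commute)
      qed (auto simp: single_add single_scaleC)
      then show ?thesis by blast
    qed
    define N where "N i j = (SOME N. \<forall>v. N \<bullet>\<bullet> v = coord (T \<bullet>\<bullet> single j v) i)" for i j
    have N: "N i j \<bullet>\<bullet> v = coord (T \<bullet>\<bullet> single j v) i" for i j v
      using someI_ex[OF ex[of j i]] unfolding N_def by blast
    have lim: "(\<lambda>n. M n i j \<bullet>\<bullet> v) \<longlonglongrightarrow> N i j \<bullet>\<bullet> v" if "i < m" "j < m" for i j v
      using bounded_linear.tendsto[OF bounded_linear_coord l[of "single j v"], of i]
      by (simp add: M(1) coord_emb_single that N)
    have "N i j \<in> B" if "i < m" "j < m" for i j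
      by (rule C_lim[OF M(2)[OF that] lim[OF that]])
    moreover have "T = emb m N"
    proof (rule cop_eqI, rule l2_eqI)
      fix x i
      have 1: "(\<lambda>n. coord (emb m (M n) \<bullet>\<bullet> x) i) \<longlonglongrightarrow> coord (T \<bullet>\<bullet> x) i"
        using bounded_linear.tendsto[OF bounded_linear_coord l[of x], of i] by (simp add: M(1))
      have 2: "(\<lambda>n. coord (emb m (M n) \<bullet>\<bullet> x) i) \<longlonglongrightarrow> coord (emb m N \<bullet>\<bullet> x) i"
        unfolding coord_emb by (cases "i < m") (auto intro!: tendsto_sum lim)
      show "coord (T \<bullet>\<bullet> x) i = coord (emb m N \<bullet>\<bullet> x) i" by (rule LIMSEQ_unique[OF 1 2])
    qed
    ultimately show "T \<in> matrices m B" by (auto simp: matrices_def)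
  qed
qed

lemma sum_eq_single:
  fixes f :: "nat \<Rightarrow> 'a::comm_monoid_add"
  assumes "a < m" "\<And>k. k < m \<Longrightarrow> k \<noteq> a \<Longrightarrow> f k = 0" shows "(\<Sum>k<m. f k) = f a"
  using assms by (subst sum.remove[of _ a]) (auto intro: sum.neutral)

lemma sum_Suc_mod:
  fixes F :: "nat \<Rightarrow> 'a::ab_group_add"
  shows "(\<Sum>j<m. F (Suc j mod m)) = (\<Sum>j<m. F j)"
proof -
  have "(\<Sum>j<m. F (Suc j mod m)) = (\<Sum>j<m. F (j mod m))" by (rule sum_cyclic_shift) simp
  also have "\<dots> = (\<Sum>j<m. F j)" by (intro sum.cong refl) auto
  finally show ?thesis .
qed

lemma Suc_mod_inj: "i < m \<Longrightarrow> j < m \<Longrightarrow> Suc i mod m = Suc j mod m \<Longrightarrow> i = j"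
  by (auto simp: mod_Suc split: if_splits)

lemma power_mod_order:
  assumes "x ^ m = (1::'a::monoid_mult)" shows "x ^ (k mod m) = x ^ k"
proof -
  have "x ^ k = x ^ (m * (k div m) + k mod m)" by simp
  then show ?thesis by (simp only: power_add power_mult assms power_one mult_1)
qed

lemma sc_eq_zero: "sc c T = 0 \<Longrightarrow> c \<noteq> 0 \<Longrightarrow> T = 0"
  using norm_sc[of c T] by simp

section \<open>Clock and shift matrices as cyclic symmetries\<close>

text \<open>With \<open>d = V\<close> this is the image of \<open>shift_mat\<close>; with
  \<open>d = E\<close> it is the scalar shift generating the symmetry of the first round.\<close>

definition shift_emb :: "nat \<Rightarrow> 'h::complex_hilbert cop \<Rightarrow> 'h l2 cop" where
  "shift_emb m d = emb m (\<lambda>i j. if j = Suc i mod m then d else 0)"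

lemma coord_shift_emb: "coord (shift_emb m d \<bullet>\<bullet> x) i = (if i < m then d \<bullet>\<bullet> coord x (Suc i mod m) else 0)"
proof -
  have "(\<Sum>j<m. (if j = Suc i mod m then d else 0) \<bullet>\<bullet> coord x j) = d \<bullet>\<bullet> coord x (Suc i mod m)" if "i < m"
    using that by (subst sum_eq_single[of "Suc i mod m"]) auto
  then show ?thesis by (simp add: shift_emb_def coord_emb)
qed

lemma diag_emb_mult: "diag_emb m d * emb m M = emb m (\<lambda>i j. d i * M i j)"
  by (rule cop_eqI, rule l2_eqI) (simp add: coord_diag_emb coord_emb app_sum_right)

lemma mult_diag_emb: "emb m M * diag_emb m d = emb m (\<lambda>i j. M i j * d j)"
  by (rule cop_eqI, rule l2_eqI) (simp add: coord_diag_emb coord_emb)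

lemma diag_emb_diag_emb: "diag_emb m d * diag_emb m d' = diag_emb m (\<lambda>i. d i * d' i)"
  by (rule cop_eqI, rule l2_eqI) (simp add: coord_diag_emb)

lemma star_diag_emb: "(diag_emb m d)\<^sup>\<star> = diag_emb m (\<lambda>i. (d i)\<^sup>\<star>)"
  unfolding diag_emb_def emb_star by (rule emb_cong) auto

lemma shift_emb_mult: "shift_emb m d * emb m M = emb m (\<lambda>i j. d * M (Suc i mod m) j)"
  by (rule cop_eqI, rule l2_eqI) (simp add: coord_shift_emb coord_emb app_sum_right)

lemma matrices_diag: "0 \<in> B \<Longrightarrow> (\<And>i. i < m \<Longrightarrow> d i \<in> B) \<Longrightarrow> diag_emb m d \<in> matrices m B"
  unfolding diag_emb_def matrices_def by auto

lemma matrices_shift: "0 \<in> B \<Longrightarrow> d \<in> B \<Longrightarrow> shift_emb m d \<in> matrices m B"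
  unfolding shift_emb_def matrices_def by auto

context op_alg
begin

lemma unitary_shift_emb:
  assumes V: "V \<in> C" "V\<^sup>\<star> * V = E" "V * V\<^sup>\<star> = E"
  shows "(shift_emb m V)\<^sup>\<star> * shift_emb m V = diag_emb m (\<lambda>_. E)"
    and "shift_emb m V * (shift_emb m V)\<^sup>\<star> = diag_emb m (\<lambda>_. E)"
proof -
  have st: "(shift_emb m V)\<^sup>\<star> = emb m (\<lambda>i j. if i = Suc j mod m then V\<^sup>\<star> else 0)"
    unfolding shift_emb_def emb_star by (rule emb_cong) auto
  have VV: "V \<bullet>\<bullet> V\<^sup>\<star> \<bullet>\<bullet> v = E \<bullet>\<bullet> v" "V\<^sup>\<star> \<bullet>\<bullet> V \<bullet>\<bullet> v = E \<bullet>\<bullet> v" for v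
    using V by (metis app_times)+
  show "(shift_emb m V)\<^sup>\<star> * shift_emb m V = diag_emb m (\<lambda>_. E)"
  proof (rule cop_eqI, rule l2_eqI)
    fix x i
    have "(\<Sum>j<m. (if i = Suc j mod m then V\<^sup>\<star> else 0) \<bullet>\<bullet> coord (shift_emb m V \<bullet>\<bullet> x) j) =
        (\<Sum>j<m. (\<lambda>k. if i = k then E \<bullet>\<bullet> coord x i else 0) (Suc j mod m))"
      by (intro sum.cong refl) (auto simp: coord_shift_emb VV)
    also have "\<dots> = (\<Sum>k<m. if i = k then E \<bullet>\<bullet> coord x i else 0)" by (rule sum_Suc_mod)
    finally show "coord (((shift_emb m V)\<^sup>\<star> * shift_emb m V) \<bullet>\<bullet> x) i = coord (diag_emb m (\<lambda>_. E) \<bullet>\<bullet> x) i"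
      by (simp add: st coord_emb coord_diag_emb)
  qed
  show "shift_emb m V * (shift_emb m V)\<^sup>\<star> = diag_emb m (\<lambda>_. E)"
  proof (rule cop_eqI, rule l2_eqI)
    fix x i
    have "(\<Sum>j<m. (if Suc i mod m = Suc j mod m then V\<^sup>\<star> else 0) \<bullet>\<bullet> coord x j) = V\<^sup>\<star> \<bullet>\<bullet> coord x i" if "i < m"
      using that Suc_mod_inj[of i m] by (subst sum_eq_single[of i]) auto
    then show "coord ((shift_emb m V * (shift_emb m V)\<^sup>\<star>) \<bullet>\<bullet> x) i = coord (diag_emb m (\<lambda>_. E) \<bullet>\<bullet> x) i"
      by (simp add: st coord_emb coord_shift_emb coord_diag_emb VV)
  qed
qed

lemma cyclic_alg_shift:
  assumes "m > 0"
  shows "cyclic_alg (matrices m C) (diag_emb m (\<lambda>_. E)) (shift_emb m E) m 1"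
proof -
  interpret M: op_alg "matrices m C" "diag_emb m (\<lambda>_. E)" by (rule op_alg_matrices) unfold_locales
  have EE: "E\<^sup>\<star> * E = E" "E * E\<^sup>\<star> = E" by (simp_all add: E_star E_idem)
  \<comment> \<open>The formula starts at the first power, since the zeroth is the identity of the
    whole space and not the unit of the algebra.\<close>
  have pow: "coord (shift_emb m E ^ Suc k \<bullet>\<bullet> x) i = (if i < m then E \<bullet>\<bullet> coord x ((i + Suc k) mod m) else 0)" for k x i
  proof (induction k arbitrary: i)
    case (Suc k)
    have "coord (shift_emb m E ^ Suc (Suc k) \<bullet>\<bullet> x) i =
        (if i < m then E \<bullet>\<bullet> coord (shift_emb m E ^ Suc k \<bullet>\<bullet> x) (Suc i mod m) else 0)"
      by (subst power_Suc) (simp only: app_times coord_shift_emb)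
    also have "\<dots> = (if i < m then E \<bullet>\<bullet> coord x ((Suc i mod m + Suc k) mod m) else 0)"
      unfolding Suc using assms by (simp add: proj_app[OF proj_E])
    also have "(Suc i mod m + Suc k) mod m = (i + Suc (Suc k)) mod m"
      using mod_add_left_eq[of "Suc i" m "Suc k"] by simp
    finally show ?case .
  qed (simp add: coord_shift_emb)
  show ?thesis
  proof
    show "shift_emb m E \<in> matrices m C" by (rule matrices_shift[OF C_zero E_in])
    show "shift_emb m E ^ m = sc 1 (diag_emb m (\<lambda>_. E))"
      using pow[of "m - 1"] assms by (intro cop_eqI l2_eqI) (simp add: coord_diag_emb)
  qed (use assms unitary_shift_emb[OF E_in EE] in auto)
qed

text \<open>Conjugate powers are chosen so that conjugation multiplies a shift by
  \<open>\<omega>\<close> itself; \<open>approx_pair\<close> then serves both rounds with the same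
  \<open>\<omega>\<close>.\<close>

lemma cyclic_alg_clock:
  assumes \<omega>: "has_mult_order \<omega> m"
  shows "cyclic_alg (matrices m C) (diag_emb m (\<lambda>_. E)) (diag_emb m (\<lambda>i. sc (cnj \<omega> ^ i) E)) m 1"
proof -
  interpret M: op_alg "matrices m C" "diag_emb m (\<lambda>_. E)" by (rule op_alg_matrices) unfold_locales
  have m: "m > 0" "\<omega> ^ m = 1" using \<omega> by (auto simp: has_mult_order_def)
  have cm: "(cnj \<omega> ^ i) ^ m = 1" for i
    using m(2) by (metis complex_cnj_one complex_cnj_power mult.commute power_mult power_one)
  have uu: "cnj \<omega> ^ i * \<omega> ^ i = 1" "\<omega> ^ i * cnj \<omega> ^ i = 1" for i
    using order_cnj[OF \<omega>] by (metis power_mult_distrib power_one)+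
  have pow: "diag_emb m d ^ Suc k = diag_emb m (\<lambda>i. d i ^ Suc k)" for d :: "nat \<Rightarrow> 'h cop" and k
    by (induction k) (simp_all add: diag_emb_diag_emb)
  have Ep: "E ^ m = E" using C_power_pos m(1) E_idem by (induction m) (auto, metis mult_1_right power_0 neq0_conv)
  show ?thesis
  proof
    show "diag_emb m (\<lambda>i. sc (cnj \<omega> ^ i) E) \<in> matrices m C"
      by (intro matrices_diag C_zero C_sc E_in)
    show "diag_emb m (\<lambda>i. sc (cnj \<omega> ^ i) E) ^ m = sc 1 (diag_emb m (\<lambda>_. E))"
      using pow[of _ "m - 1"] m(1) by (simp add: sc_power cm Ep)
  qed (use m in \<open>simp_all add: star_diag_emb diag_emb_diag_emb E_star E_idem uu\<close>)
qed

text \<open>\<open>DM\<close> makes \<open>M\<close> diagonal and \<open>DN\<close> confines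
  \<open>N\<close> to the cyclic superdiagonal, because distinct powers of \<open>\<omega>\<close>
  differ. \<open>PM\<close> gives the second diagonal entry of \<open>M\<close> as
  \<open>\<omega>\<close> times the first. The entry at \<open>0\<close>, \<open>s\<close> of
  \<open>MN\<close> is then the wanted relation, and unitarity is read off from entries in the same
  way.\<close>

lemma covariant_pair_entries:
  fixes M N :: "'h cmat"
  assumes \<omega>: "has_mult_order \<omega> m"
    and M: "\<And>i j. i < m \<Longrightarrow> j < m \<Longrightarrow> M i j \<in> C" and N: "\<And>i j. i < m \<Longrightarrow> j < m \<Longrightarrow> N i j \<in> C"
    and Mu: "(emb m M)\<^sup>\<star> * emb m M = diag_emb m (\<lambda>_. E)" "emb m M * (emb m M)\<^sup>\<star> = diag_emb m (\<lambda>_. E)"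
    and Nu: "(emb m N)\<^sup>\<star> * emb m N = diag_emb m (\<lambda>_. E)" "emb m N * (emb m N)\<^sup>\<star> = diag_emb m (\<lambda>_. E)"
    and MN: "emb m M * emb m N = emb m N * emb m M"
    and DM: "diag_emb m (\<lambda>i. sc (cnj \<omega> ^ i) E) * emb m M = emb m M * diag_emb m (\<lambda>i. sc (cnj \<omega> ^ i) E)"
    and DN: "diag_emb m (\<lambda>i. sc (cnj \<omega> ^ i) E) * emb m N = sc \<omega> (emb m N * diag_emb m (\<lambda>i. sc (cnj \<omega> ^ i) E))"
    and PM: "shift_emb m E * emb m M = sc \<omega> (emb m M * shift_emb m E)"
  defines "u \<equiv> M 0 0" and "v \<equiv> N 0 (Suc 0 mod m)"
  shows "u \<in> C" "v \<in> C" "u\<^sup>\<star> * u = E" "u * u\<^sup>\<star> = E" "v\<^sup>\<star> * v = E" "v * v\<^sup>\<star> = E" "u * v = sc \<omega> (v * u)"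
proof -
  have m: "m > 0" "\<omega> ^ m = 1" using \<omega> by (auto simp: has_mult_order_def)
  \<comment> \<open>For \<open>m = 1\<close> this index is 0, and the argument degenerates to a
    single entry.\<close>
  define s where "s = Suc 0 mod m"
  have sm: "s < m" using m by (simp add: s_def)
  have uu: "cnj \<omega> ^ i * \<omega> ^ i = 1" for i using order_cnj[OF \<omega>] by (metis power_mult_distrib power_one)
  show uC: "u \<in> C" "v \<in> C" unfolding u_def v_def using M N m by auto
  have M0: "M i j = 0" if ij: "i < m" "j < m" "i \<noteq> j" for i j
  proof -
    have "sc (cnj \<omega> ^ i) (M i j) = sc (cnj \<omega> ^ j) (M i j)"
      using emb_inj[OF DM[unfolded diag_emb_mult mult_diag_emb] ij(1,2)] by (simp add: E_left E_right M ij)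
    then have "sc (cnj \<omega> ^ i - cnj \<omega> ^ j) (M i j) = 0"
      using sc_add_left[of "cnj \<omega> ^ i" "- (cnj \<omega> ^ j)" "M i j"] by simp
    moreover have "cnj \<omega> ^ i \<noteq> cnj \<omega> ^ j"
      using order_pow_inj[OF \<omega> ij(1,2)] ij(3) by (metis complex_cnj_cancel_iff complex_cnj_power)
    ultimately show ?thesis using sc_eq_zero by fastforce
  qed
  have N0: "N i j = 0" if ij: "i < m" "j < m" "j \<noteq> Suc i mod m" for i j
  proof -
    have "sc (cnj \<omega> ^ i) (N i j) = sc (\<omega> * cnj \<omega> ^ j) (N i j)"
      using emb_inj[OF DN[unfolded diag_emb_mult mult_diag_emb emb_sc] ij(1,2)] by (simp add: E_left E_right N ij)
    then have "sc (cnj \<omega> ^ i - \<omega> * cnj \<omega> ^ j) (N i j) = 0"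
      using sc_add_left[of "cnj \<omega> ^ i" "- (\<omega> * cnj \<omega> ^ j)" "N i j"] by simp
    moreover have "cnj \<omega> ^ i \<noteq> \<omega> * cnj \<omega> ^ j"
    proof
      assume "cnj \<omega> ^ i = \<omega> * cnj \<omega> ^ j"
      then have "(cnj \<omega> ^ i * \<omega> ^ i) * \<omega> ^ j = \<omega> * \<omega> ^ i * (cnj \<omega> ^ j * \<omega> ^ j)" by simp
      then have "\<omega> ^ j = \<omega> ^ (Suc i mod m)" by (simp add: uu power_mod_order[OF m(2)])
      then show False using order_pow_inj[OF \<omega> ij(2)] ij(3) m(1) by simp
    qed
    ultimately show ?thesis using sc_eq_zero by fastforce
  qed
  have Ns0: "N k s = 0" if "k < m" "k \<noteq> 0" for k
  proof (rule N0[OF that(1) sm])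
    show "s \<noteq> Suc k mod m"
    proof
      assume "s = Suc k mod m"
      then have "k = 0" unfolding s_def by (intro Suc_mod_inj[OF that(1) m(1)]) (rule sym)
      then show False using that(2) by simp
    qed
  qed
  have Mss: "M s s = sc \<omega> u"
  proof -
    have "E * M s s = sc \<omega> (\<Sum>k<m. M 0 k * (if s = Suc k mod m then E else 0))"
      using emb_inj[OF PM[unfolded shift_emb_mult, unfolded shift_emb_def emb_mult emb_sc] m(1) sm] by (simp add: s_def)
    also have "(\<Sum>k<m. M 0 k * (if s = Suc k mod m then E else 0)) = M 0 0 * (if s = Suc 0 mod m then E else 0)"
      by (rule sum_eq_single[OF m(1)]) (use M0[OF m(1)] in auto)
    finally show ?thesis using M[OF m(1) m(1)] M[OF sm sm] by (simp add: s_def u_def E_left E_right)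
  qed
  have "(\<Sum>k<m. M 0 k * N k s) = (\<Sum>k<m. N 0 k * M k s)"
    by (rule emb_inj[OF MN[unfolded emb_mult] m(1) sm])
  also have "(\<Sum>k<m. M 0 k * N k s) = M 0 0 * N 0 s" by (rule sum_eq_single[OF m(1)]) (use M0[OF m(1)] in auto)
  also have "(\<Sum>k<m. N 0 k * M k s) = N 0 s * M s s" by (rule sum_eq_single[OF sm]) (use M0[OF _ sm] in auto)
  finally show "u * v = sc \<omega> (v * u)" unfolding Mss u_def v_def s_def[symmetric] by simp
  have "(\<Sum>k<m. (M k 0)\<^sup>\<star> * M k 0) = E"
    using emb_inj[OF Mu(1)[unfolded emb_star emb_mult diag_emb_def] m(1) m(1)] by simp
  moreover have "(\<Sum>k<m. (M k 0)\<^sup>\<star> * M k 0) = (M 0 0)\<^sup>\<star> * M 0 0"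
    by (rule sum_eq_single[OF m(1)]) (use M0[OF _ m(1)] in auto)
  ultimately show "u\<^sup>\<star> * u = E" by (simp add: u_def)
  have "(\<Sum>k<m. M 0 k * (M 0 k)\<^sup>\<star>) = E"
    using emb_inj[OF Mu(2)[unfolded emb_star emb_mult diag_emb_def] m(1) m(1)] by simp
  moreover have "(\<Sum>k<m. M 0 k * (M 0 k)\<^sup>\<star>) = M 0 0 * (M 0 0)\<^sup>\<star>"
    by (rule sum_eq_single[OF m(1)]) (use M0[OF m(1)] in auto)
  ultimately show "u * u\<^sup>\<star> = E" by (simp add: u_def)
  have "(\<Sum>k<m. (N k s)\<^sup>\<star> * N k s) = E"
    using emb_inj[OF Nu(1)[unfolded emb_star emb_mult diag_emb_def] sm sm] by simp
  moreover have "(\<Sum>k<m. (N k s)\<^sup>\<star> * N k s) = (N 0 s)\<^sup>\<star> * N 0 s"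
    by (rule sum_eq_single[OF m(1)]) (use Ns0 in auto)
  ultimately show "v\<^sup>\<star> * v = E" by (simp add: v_def s_def)
  have "(\<Sum>k<m. N 0 k * (N 0 k)\<^sup>\<star>) = E"
    using emb_inj[OF Nu(2)[unfolded emb_star emb_mult diag_emb_def] m(1) m(1)] by simp
  moreover have "(\<Sum>k<m. N 0 k * (N 0 k)\<^sup>\<star>) = N 0 s * (N 0 s)\<^sup>\<star>"
    by (rule sum_eq_single[OF sm]) (use N0[OF m(1)] in \<open>auto simp: s_def\<close>)
  ultimately show "v * v\<^sup>\<star> = E" by (simp add: v_def s_def)
qed

end

section \<open>The two rounds of correction\<close>

lemma (in op_alg) unitary_star_covariant:
  assumes p: "p\<^sup>\<star> * p = E" "p * p\<^sup>\<star> = E" and T: "T \<in> C" and l: "p * T = sc l (T * p)"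
  shows "p * T\<^sup>\<star> = sc (cnj l) (T\<^sup>\<star> * p)"
proof -
  have st: "T\<^sup>\<star> * p\<^sup>\<star> = sc (cnj l) (p\<^sup>\<star> * T\<^sup>\<star>)" using arg_cong[OF l, of star] by simp
  have "p * T\<^sup>\<star> = p * (T\<^sup>\<star> * (p\<^sup>\<star> * p))" by (simp add: p E_right C_star T)
  also have "\<dots> = p * (T\<^sup>\<star> * p\<^sup>\<star>) * p" by (simp add: mult.assoc)
  also have "\<dots> = sc (cnj l) ((p * p\<^sup>\<star>) * T\<^sup>\<star> * p)" by (simp add: st mult.assoc)
  finally show ?thesis by (simp add: p E_left C_star T)
qed

lemma approx_covariant:
  assumes "norm (p::'h::complex_hilbert cop) \<le> 1" "cmod l = 1" "p * T0 = sc l (T0 * p)" "norm (T - T0) \<le> d"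
  shows "norm (p * T - sc l (T * p)) \<le> 2 * d"
proof -
  have "p * T - sc l (T * p) = p * (T - T0) - sc l ((T - T0) * p)"
    by (simp add: right_diff_distrib left_diff_distrib sc_diff assms(3))
  also have "norm \<dots> \<le> 1 * d + d * 1"
    by (rule order_trans[OF norm_triangle_ineq4], rule add_mono)
       (use mult_norm_le[OF assms(1,4)] mult_norm_le[OF assms(4,1)] assms(2) in simp_all)
  finally show ?thesis by simp
qed

text \<open>With \<open>q\<close> the fourth root of the distance: the first round moves the pair by
  \<open>K * sqrt 2 * q\<^sup>2\<close>, after which the covariance error for the clock is at most
  \<open>2 * (K * sqrt 2 + 1) * q\<^sup>2\<close>. The second round therefore moves it by
  \<open>K * sqrt (2 * (K * sqrt 2 + 1)) * q\<close>; the summand 1 is the initial distance.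
  \<open>K\<close> is at least 1 so that smallness of \<open>K * s\<close> includes
  \<open>s \<le> 1\<close>.\<close>

definition pair_const :: "nat \<Rightarrow> real" where
  "pair_const m = (let K = max 1 (approx_pair.covariant_const m) in K * sqrt (2 * (K * sqrt 2 + 1)) + K * sqrt 2 + 1)"

lemma pair_const_pos: "pair_const m > 0"
proof -
  define K where "K = max 1 (approx_pair.covariant_const m)"
  have "K \<ge> 1" by (simp add: K_def)
  then have "K * sqrt (2 * (K * sqrt 2 + 1)) \<ge> 0" "K * sqrt 2 \<ge> 0" by simp_all
  then show ?thesis by (simp add: pair_const_def Let_def K_def[symmetric])
qed

context op_alg
begin

lemma clock_shift_relations:
  assumes \<omega>: "has_mult_order \<omega> m" and U: "U \<in> C" and V: "V \<in> C"
  shows "diag_emb m (\<lambda>i. sc (cnj \<omega> ^ i) E) * diag_emb m (\<lambda>i. sc (\<omega> ^ i) U) =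
      diag_emb m (\<lambda>i. sc (\<omega> ^ i) U) * diag_emb m (\<lambda>i. sc (cnj \<omega> ^ i) E)" (is ?t1)
    and "diag_emb m (\<lambda>i. sc (cnj \<omega> ^ i) E) * shift_emb m V = sc \<omega> (shift_emb m V * diag_emb m (\<lambda>i. sc (cnj \<omega> ^ i) E))" (is ?t2)
    and "shift_emb m E * diag_emb m (\<lambda>i. sc (\<omega> ^ i) U) = sc \<omega> (diag_emb m (\<lambda>i. sc (\<omega> ^ i) U) * shift_emb m E)" (is ?t3)
    and "shift_emb m E * shift_emb m V = shift_emb m V * shift_emb m E" (is ?t4)
    and "shift_emb m E * diag_emb m (\<lambda>i. sc (cnj \<omega> ^ i) E) =
      sc (cnj \<omega>) (diag_emb m (\<lambda>i. sc (cnj \<omega> ^ i) E) * shift_emb m E)" (is ?t5)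
proof -
  have m: "m > 0" "\<omega> ^ m = 1" "cnj \<omega> ^ m = 1"
    using \<omega> by (auto simp: has_mult_order_def simp flip: complex_cnj_power)
  have Emult: "E \<bullet>\<bullet> U \<bullet>\<bullet> v = U \<bullet>\<bullet> v" "U \<bullet>\<bullet> E \<bullet>\<bullet> v = U \<bullet>\<bullet> v" "E \<bullet>\<bullet> V \<bullet>\<bullet> v = V \<bullet>\<bullet> v" "V \<bullet>\<bullet> E \<bullet>\<bullet> v = V \<bullet>\<bullet> v" for v
    using E_left[OF U] E_right[OF U] E_left[OF V] E_right[OF V] by (metis app_times)+
  note ms = power_mod_order[OF m(2)] power_mod_order[OF m(3)]
  show ?t1 by (simp add: diag_emb_diag_emb E_left E_right U mult.commute)
  show ?t2
    using order_cnj(2)[OF \<omega>]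
    by (intro cop_eqI l2_eqI) (simp add: coord_diag_emb coord_shift_emb Emult scaleC_scaleC ms m(1) flip: mult.assoc)
  show ?t3 by (intro cop_eqI l2_eqI) (simp add: coord_diag_emb coord_shift_emb Emult scaleC_scaleC ms m(1))
  show ?t4 by (intro cop_eqI l2_eqI) (simp add: coord_shift_emb Emult m(1))
  show ?t5 by (intro cop_eqI l2_eqI) (simp add: coord_diag_emb coord_shift_emb scaleC_scaleC ms m(1))
qed

lemma omega_commuting_of_covariant_pair:
  assumes \<omega>: "has_mult_order \<omega> m"
    and A: "A \<in> matrices m C" "A\<^sup>\<star> * A = diag_emb m (\<lambda>_. E)" "A * A\<^sup>\<star> = diag_emb m (\<lambda>_. E)"
    and W: "W \<in> matrices m C" "W\<^sup>\<star> * W = diag_emb m (\<lambda>_. E)" "W * W\<^sup>\<star> = diag_emb m (\<lambda>_. E)"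
    and AW: "A * W = W * A"
    and DA: "diag_emb m (\<lambda>i. sc (cnj \<omega> ^ i) E) * A = A * diag_emb m (\<lambda>i. sc (cnj \<omega> ^ i) E)"
    and DW: "diag_emb m (\<lambda>i. sc (cnj \<omega> ^ i) E) * W = sc \<omega> (W * diag_emb m (\<lambda>i. sc (cnj \<omega> ^ i) E))"
    and PA: "shift_emb m E * A = sc \<omega> (A * shift_emb m E)"
    and dA: "norm (A - diag_emb m (\<lambda>i. sc (\<omega> ^ i) U)) \<le> d" and dW: "norm (W - shift_emb m V) \<le> d"
  shows "\<exists>u\<in>C. \<exists>v\<in>C. u\<^sup>\<star> * u = E \<and> u * u\<^sup>\<star> = E \<and> v\<^sup>\<star> * v = E \<and> v * v\<^sup>\<star> = E \<and> u * v = sc \<omega> (v * u) \<and>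
    norm (u - U) \<le> d \<and> norm (v - V) \<le> d"
proof -
  have m: "m > 0" using \<omega> by (auto simp: has_mult_order_def)
  then have s: "Suc 0 mod m < m" by simp
  obtain M where M: "A = emb m M" "\<And>i j. i < m \<Longrightarrow> j < m \<Longrightarrow> M i j \<in> C" using A(1) by (auto simp: matrices_def)
  obtain N where N: "W = emb m N" "\<And>i j. i < m \<Longrightarrow> j < m \<Longrightarrow> N i j \<in> C" using W(1) by (auto simp: matrices_def)
  note ex = covariant_pair_entries[OF \<omega> M(2) N(2) A(2,3)[unfolded M(1)] W(2,3)[unfolded N(1)] AW[unfolded M(1) N(1)]
      DA[unfolded M(1)] DW[unfolded N(1)] PA[unfolded M(1)]]
  have "norm (M 0 0 - U) \<le> d"
    using norm_entry_le[OF m m, of "\<lambda>i j. M i j - (if i = j then sc (\<omega> ^ i) U else 0)"] dA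
    by (simp add: M(1) diag_emb_def emb_diff)
  moreover have "norm (N 0 (Suc 0 mod m) - V) \<le> d"
    using norm_entry_le[OF m s, of "\<lambda>i j. N i j - (if j = Suc i mod m then V else 0)"] dW
    unfolding N(1) shift_emb_def emb_diff by simp
  ultimately show ?thesis using ex by blast
qed

text \<open>The first round corrects \<open>X, Y\<close> with respect to the shift \<open>P\<close>,
  the second corrects \<open>Y1, X1\<close> with respect to the clock \<open>D\<close>. The pair
  obtained last has both clock relations and the shift relation for \<open>X2\<close>, which is all
  that \<open>covariant_pair_entries\<close> asks of a commuting unitary pair.\<close>

lemma commuting_to_omega_commuting:
  assumes \<omega>: "has_mult_order \<omega> m"
    and U: "U \<in> C" "U\<^sup>\<star> * U = E" "U * U\<^sup>\<star> = E" and V: "V \<in> C" "V\<^sup>\<star> * V = E" "V * V\<^sup>\<star> = E"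
    and X: "X \<in> matrices m C" "X\<^sup>\<star> * X = diag_emb m (\<lambda>_. E)" "X * X\<^sup>\<star> = diag_emb m (\<lambda>_. E)"
    and Y: "Y \<in> matrices m C" "Y\<^sup>\<star> * Y = diag_emb m (\<lambda>_. E)" "Y * Y\<^sup>\<star> = diag_emb m (\<lambda>_. E)"
    and XY: "X * Y = Y * X"
    and dX: "norm (X - diag_emb m (\<lambda>i. sc (\<omega> ^ i) U)) \<le> q ^ 4" and dY: "norm (Y - shift_emb m V) \<le> q ^ 4"
    and q: "0 \<le> q" "pair_const m * q \<le> 1 / 128"
  shows "\<exists>u\<in>C. \<exists>v\<in>C. u\<^sup>\<star> * u = E \<and> u * u\<^sup>\<star> = E \<and> v\<^sup>\<star> * v = E \<and> v * v\<^sup>\<star> = E \<and> u * v = sc \<omega> (v * u) \<and>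
    norm (u - U) \<le> pair_const m * q \<and> norm (v - V) \<le> pair_const m * q"
proof -
  define K where "K = max 1 (approx_pair.covariant_const m)"
  define Q where "Q = pair_const m"
  have K1: "K \<ge> 1" "approx_pair.covariant_const m \<le> K" by (simp_all add: K_def)
  define r where "r = sqrt (2 * (K * sqrt 2 + 1))"
  have Kp: "K * sqrt 2 > 0" using K1 by simp
  then have "K * sqrt 2 + 1 > 0" by (rule add_pos_pos) simp
  then have "2 * (K * sqrt 2 + 1) > 0" by (rule mult_pos_pos[rotated]) simp
  then have r: "r > 0" "r\<^sup>2 = 2 * (K * sqrt 2 + 1)" unfolding r_def by (simp_all only: real_sqrt_gt_0_iff real_sqrt_pow2 less_imp_le)
  have r0: "r \<ge> 0" using r by simp
  have Q: "Q = K * r + K * sqrt 2 + 1" by (simp add: Q_def pair_const_def Let_def K_def r_def)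
  have Q1: "Q \<ge> 1" using K1 r0 by (simp add: Q)
  have Qq: "Q * q \<le> 1 / 128" using q(2) by (simp add: Q_def)
  have q1: "q \<le> 1" using mult_right_mono[OF Q1 q(1)] Qq by simp
  have q2: "q\<^sup>2 \<le> q" using q q1 by (simp add: power2_eq_square mult_left_le)
  have q4: "q ^ 4 \<le> q\<^sup>2" using q q1 by (intro power_decreasing) auto
  have m: "m > 0" "\<omega> ^ m = 1" using \<omega> by (auto simp: has_mult_order_def)
  have \<omega>1: "cmod \<omega> = 1" by (rule order_cmod[OF \<omega>])
  define I where "I = diag_emb m (\<lambda>_. E)"
  define P where "P = shift_emb m E"
  define D where "D = diag_emb m (\<lambda>i. sc (cnj \<omega> ^ i) E)"
  define cU where "cU = diag_emb m (\<lambda>i. sc (\<omega> ^ i) U)"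
  define sV where "sV = shift_emb m V"
  note rel = clock_shift_relations[OF \<omega> U(1) V(1), folded P_def D_def cU_def sV_def]
  note fin = omega_commuting_of_covariant_pair[OF \<omega>, folded I_def P_def D_def, of _ _ U _ V, folded cU_def sV_def]
  note X' = X[folded I_def] and Y' = Y[folded I_def] and dX' = dX[folded cU_def] and dY' = dY[folded sV_def]
  interpret P: cyclic_alg "matrices m C" I P m 1
    unfolding I_def P_def by (rule cyclic_alg_shift[OF m(1)])
  interpret D: cyclic_alg "matrices m C" I D m 1
    unfolding I_def D_def by (rule cyclic_alg_clock[OF \<omega>])
  have q4Q: "q ^ 4 \<le> Q * q" using q4 q2 mult_right_mono[OF Q1 q(1)] by simp
  \<comment> \<open>\<open>approx_pair\<close> assumes \<open>m \<ge> 2\<close> and a positive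
    offset. For \<open>m = 1\<close> the symmetries are trivial, and for \<open>q = 0\<close> the
    given pair is already the clock and shift pair.\<close>
  consider "m = 1" | "q = 0" | "m \<ge> 2" "q > 0" using m(1) q(1) by fastforce
  then show ?thesis
  proof cases
    case 1
    have \<omega>: "\<omega> = 1" using m(2) 1 by simp
    have DI: "D = I" by (simp add: D_def I_def \<omega>)
    have PI: "P = I"
      unfolding P_def I_def 1 by (intro cop_eqI l2_eqI) (simp add: coord_shift_emb coord_diag_emb)
    show ?thesis
      by (rule fin[OF X' Y' XY]) (use dX' dY' q4Q in \<open>simp_all add: DI PI \<omega> P.E_left P.E_right X Y flip: Q_def\<close>)
  next
    case 2
    then have "X = cU" "Y = sV" using dX' dY' by simp_all
    then show ?thesis using fin[OF X' Y' XY, of "Q * q"] rel 2 by (simp add: Q_def)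
  next
    case 3
    \<comment> \<open>Its square is the covariance error \<open>2 * q ^ 4\<close> that
      \<open>approx_covariant\<close> gives for operators at distance \<open>q ^ 4\<close> from
      exactly covariant ones.\<close>
    define s1 where "s1 = sqrt 2 * q\<^sup>2"
    have s1: "s1 > 0" "s1\<^sup>2 = 2 * q ^ 4" using 3 by (simp_all add: s1_def power_mult_distrib flip: power_mult)
    have Ks1: "K * s1 \<le> K * sqrt 2 * q" using q2 K1 by (simp add: s1_def mult_left_mono mult.assoc)
    have Ks1Q: "K * s1 \<le> 1 / 128"
    proof -
      have "0 \<le> K * r * q" using K1 r0 q by simp
      then show ?thesis using Ks1 Qq q(1) by (simp add: Q distrib_right)
    qed
    have s1K: "s1 \<le> K * s1" using K1 s1 by simp
    interpret A1: approx_pair "matrices m C" I P m \<omega> X Y s1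
    proof unfold_locales
      show "norm (P * X - sc \<omega> (X * P)) \<le> s1\<^sup>2"
        using approx_covariant[OF P.g_norm(1) \<omega>1 rel(3) dX'] by (simp add: s1)
      show "norm (P * Y - Y * P) \<le> s1\<^sup>2"
        using approx_covariant[OF P.g_norm(1), of 1 sV] rel(4) dY' by (simp add: s1)
      show "s1 \<le> 1" using Ks1Q s1K by simp
    qed (use \<omega> 3 X' Y' XY s1 in auto)
    have cK: "approx_pair.covariant_const m * s1 \<le> K * s1" using K1 s1 by (intro mult_right_mono) auto
    obtain X1 Y1 where X1: "X1 \<in> matrices m C" "X1\<^sup>\<star> * X1 = I" "X1 * X1\<^sup>\<star> = I"
      and Y1: "Y1 \<in> matrices m C" "Y1\<^sup>\<star> * Y1 = I" "Y1 * Y1\<^sup>\<star> = I" and XY1: "X1 * Y1 = Y1 * X1"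
      and PX1: "P * X1 = sc \<omega> (X1 * P)" and PY1: "P * Y1 = Y1 * P"
      and d1: "norm (X1 - X) \<le> approx_pair.covariant_const m * s1" "norm (Y1 - Y) \<le> approx_pair.covariant_const m * s1"
      using A1.covariant_pair_nearby[OF order_trans[OF cK Ks1Q]] by blast
    have near: "norm (X1 - cU) \<le> K * s1 + q ^ 4" "norm (Y1 - sV) \<le> K * s1 + q ^ 4"
      using norm_triangle_ineq[of "X1 - X" "X - cU"] norm_triangle_ineq[of "Y1 - Y" "Y - sV"] d1 cK dX' dY' by simp_all
    \<comment> \<open>\<open>r\<close> is chosen so that \<open>s2\<^sup>2\<close> covers the error
      that the first correction leaves with respect to \<open>D\<close>.\<close>
    define s2 where "s2 = r * q"
    have s2: "s2 > 0" using 3 r by (simp add: s2_def)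
    have s2sq: "2 * (K * s1 + q ^ 4) \<le> s2\<^sup>2"
    proof -
      have "s2\<^sup>2 = 2 * (K * sqrt 2 + 1) * q\<^sup>2" by (simp add: s2_def r(2) power_mult_distrib)
      then show ?thesis using q4 by (simp add: s1_def algebra_simps)
    qed
    have Ks2: "K * s2 = K * r * q" by (simp add: s2_def)
    have Ks2Q: "K * s2 \<le> 1 / 128"
    proof -
      have "0 \<le> K * sqrt 2 * q" using K1 q by simp
      then show ?thesis using Qq q(1) by (simp add: Ks2 Q distrib_right)
    qed
    have s2K: "s2 \<le> K * s2" using K1 s2 by simp
    \<comment> \<open>The roles are exchanged: \<open>D\<close> multiplies \<open>Y1\<close> by
      approximately \<open>\<omega>\<close> and approximately commutes with
      \<open>X1\<close>.\<close>
    interpret A2: approx_pair "matrices m C" I D m \<omega> Y1 X1 s2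
    proof unfold_locales
      show "norm (D * Y1 - sc \<omega> (Y1 * D)) \<le> s2\<^sup>2"
        using approx_covariant[OF D.g_norm(1) \<omega>1 rel(2) near(2)] s2sq by simp
      show "norm (D * X1 - X1 * D) \<le> s2\<^sup>2"
        using approx_covariant[OF D.g_norm(1), of 1 cU] rel(1) near(1) s2sq by fastforce
      show "s2 \<le> 1" using Ks2Q s2K by simp
    qed (use \<omega> 3 X1 Y1 XY1 s2 in auto)
    have cK2: "approx_pair.covariant_const m * s2 \<le> K * s2" using K1 s2 by (intro mult_right_mono) auto
    obtain Y2 X2 where Y2: "Y2 \<in> matrices m C" "Y2\<^sup>\<star> * Y2 = I" "Y2 * Y2\<^sup>\<star> = I"
      and X2: "X2 \<in> matrices m C" "X2\<^sup>\<star> * X2 = I" "X2 * X2\<^sup>\<star> = I" and YX2: "Y2 * X2 = X2 * Y2"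
      and DY2: "D * Y2 = sc \<omega> (Y2 * D)" and DX2: "D * X2 = X2 * D"
      and d2: "norm (Y2 - Y1) \<le> approx_pair.covariant_const m * s2" "norm (X2 - X1) \<le> approx_pair.covariant_const m * s2"
      and p: "\<And>p a. A2.compatible p a \<Longrightarrow> p * X2 = sc a (X2 * p)"
      using A2.covariant_pair_nearby[OF order_trans[OF cK2 Ks2Q]] by blast
    \<comment> \<open>The first-round relations in the language of the second: \<open>P\<close>
      commutes with \<open>Y1\<close>, multiplies \<open>X1\<close> by \<open>\<omega>\<close>, and
      commutes with \<open>D\<close> up to \<open>cnj \<omega>\<close>. Hence the new
      \<open>X2\<close> keeps its relation to \<open>P\<close>.\<close>
    have "A2.compatible P \<omega>"
      unfolding A2.compatible_def
    proof (intro conjI exI)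
      have PD: "P * D = sc (cnj \<omega>) (D * P)" by (rule rel(5))
      then show "P * D = sc (cnj \<omega>) (D * P)" .
      show "P * D\<^sup>\<star> = sc (cnj (cnj \<omega>)) (D\<^sup>\<star> * P)"
        by (rule P.unitary_star_covariant[OF P.g_unitary D.g_in PD])
      show "P * Y1\<^sup>\<star> = Y1\<^sup>\<star> * P"
        using P.unitary_star_covariant[OF P.g_unitary Y1(1), of 1] PY1 by simp
      show "P * X1\<^sup>\<star> = sc (cnj \<omega>) (X1\<^sup>\<star> * P)"
        by (rule P.unitary_star_covariant[OF P.g_unitary X1(1) PX1])
    qed (use order_cnj[OF \<omega>] PX1 PY1 P.E_left[OF P.g_in] P.E_right[OF P.g_in] in \<open>simp_all add: mult.commute\<close>)
    then have PX2: "P * X2 = sc \<omega> (X2 * P)" by (rule p)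
    have "K * s2 + (K * s1 + q ^ 4) \<le> Q * q"
      using Ks1 q4 q2 by (simp add: Ks2 Q distrib_right)
    then have "norm (X2 - cU) \<le> Q * q" "norm (Y2 - sV) \<le> Q * q"
      using norm_triangle_ineq[of "X2 - X1" "X1 - cU"] norm_triangle_ineq[of "Y2 - Y1" "Y1 - sV"] d2 cK2 near by simp_all
    then show ?thesis unfolding Q_def using fin[OF X2 Y2 YX2[symmetric] DX2 DY2 PX2] by blast
  qed
qed

end

section \<open>Fixed points of weakly continuous symmetries\<close>

text \<open>The topology is pulled back from a product, where a sequence converges exactly when all
  its coordinates do; here the coordinates are the matrix coefficients.\<close>

lemma wot_eventually:
  fixes L :: "'h::complex_hilbert op"
  assumes lim: "\<And>x y. (\<lambda>n. cinner x (blinfun_apply (F n) y)) \<longlonglongrightarrow> cinner x (blinfun_apply L y)"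
    and W: "openin weak_operator_topology W" "L \<in> W"
  shows "\<forall>\<^sub>F n in sequentially. F n \<in> W"
proof -
  define h :: "'h op \<Rightarrow> 'h \<times> 'h \<Rightarrow> complex" where "h T = (\<lambda>(x, y). cinner x (blinfun_apply T y))" for T
  obtain O' where O': "open O'" "W = h -` O'"
    using W(1) unfolding weak_operator_topology_def openin_pullback_topology h_def by auto
  have "limitin (product_topology (\<lambda>_. euclidean) UNIV) (\<lambda>n. h (F n)) (h L) sequentially"
    unfolding limitin_componentwise by (auto simp: h_def lim)
  then have "(\<lambda>n. h (F n)) \<longlonglongrightarrow> h L" by (simp add: euclidean_product_topology)
  then have "\<forall>\<^sub>F n in sequentially. h (F n) \<in> O'"
    by (rule topological_tendstoD[OF _ O'(1)]) (use W(2) O'(2) in auto)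
  then show ?thesis by (simp add: O'(2))
qed

lemma openin_wot_ball:
  fixes x y :: "'h::complex_hilbert"
  shows "openin weak_operator_topology {T. cinner x (blinfun_apply T y) \<in> ball z r}"
proof -
  have "open {f :: 'h \<times> 'h \<Rightarrow> complex. f (x, y) \<in> ball z r}"
    using open_vimage[OF open_ball[of z r] continuous_on_product_coordinates[of "(x, y)"]] by (simp add: vimage_def)
  moreover have "{T. cinner x (blinfun_apply T y) \<in> ball z r} =
      (\<lambda>T (x, y). cinner x (blinfun_apply T y)) -` {f. f (x, y) \<in> ball z r} \<inter> UNIV" by auto
  ultimately show ?thesis
    unfolding weak_operator_topology_def openin_pullback_topology by (metis open_openin)
qed

lemma op_of_cop_of: "clinear_op T \<Longrightarrow> op_of (cop_of T) = T"
  by (simp add: cop_of_inverse)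

lemmas op_of_simps = plus_cop.rep_eq minus_cop.rep_eq times_cop.rep_eq zero_cop.rep_eq sc.rep_eq star.rep_eq

lemma op_of_sum: "op_of (\<Sum>i\<in>I. T i) = (\<Sum>i\<in>I. op_of (T i))"
  by (induction I rule: infinite_finite_induct) (simp_all add: op_of_simps)

lemma op_of_eq_iff: "op_of S = op_of T \<longleftrightarrow> S = T"
  by (rule op_of_inject)

text \<open>Used in place of \<open>A\<close> as coefficient algebra, so that membership in it gives
  symmetry of the constructed unitaries.\<close>

definition fixed_alg :: "'h::complex_hilbert op set \<Rightarrow> ('h op \<Rightarrow> 'h op) set \<Rightarrow> 'h cop set" where
  "fixed_alg A S = {T. op_of T \<in> A \<and> symmetric_under S (op_of T)}"

text \<open>A strong limit is a weak limit, so weak closedness keeps it in \<open>A\<close>. Were it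
  moved by some \<open>\<phi>\<close>, a matrix coefficient would separate it from its image; weak
  continuity puts the fixed approximants, from some index on, near the image, while they also
  converge to the limit.\<close>

lemma op_alg_fixed_alg:
  fixes A :: "'h::complex_hilbert op set"
  assumes A: "von_neumann_algebra e A"
    and S: "\<forall>\<phi>\<in>S. symmetry_map e A \<phi> \<and> linear_on_alg A \<phi> \<and> multiplicative_on_alg A \<phi> \<and> weakly_continuous A \<phi>"
  shows "op_alg (fixed_alg A S) (cop_of e)"
proof -
  have lin: "\<And>T. T \<in> A \<Longrightarrow> clinear_op T"
    and cl: "\<And>T R. T \<in> A \<Longrightarrow> R \<in> A \<Longrightarrow> T + R \<in> A" "\<And>T R. T \<in> A \<Longrightarrow> R \<in> A \<Longrightarrow> T o\<^sub>L R \<in> A"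
      "\<And>T c. T \<in> A \<Longrightarrow> scale_op c T \<in> A" "\<And>T. T \<in> A \<Longrightarrow> adj_op T \<in> A"
    and e: "e \<in> A" "\<And>T. T \<in> A \<Longrightarrow> e o\<^sub>L T = T" "\<And>T. T \<in> A \<Longrightarrow> T o\<^sub>L e = T"
    and closed: "closedin weak_operator_topology A"
    using A unfolding von_neumann_algebra_def by blast+
  have oe: "op_of (cop_of e) = e" by (rule op_of_cop_of[OF lin[OF e(1)]])
  have hom: "\<phi> (T + R) = \<phi> T + \<phi> R" "\<phi> (scale_op c T) = scale_op c (\<phi> T)" "\<phi> (T o\<^sub>L R) = \<phi> T o\<^sub>L \<phi> R"
    "\<phi> (adj_op T) = adj_op (\<phi> T)" if "\<phi> \<in> S" "T \<in> A" "R \<in> A" for \<phi> T R c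
    using S that unfolding linear_on_alg_def multiplicative_on_alg_def symmetry_map_def by blast+
  show ?thesis
  proof
    fix T R c assume T: "T \<in> fixed_alg A S"
    show "sc c T \<in> fixed_alg A S" "T\<^sup>\<star> \<in> fixed_alg A S"
      using T unfolding fixed_alg_def symmetric_under_def by (auto simp: op_of_simps cl hom[OF _ _ e(1)])
    show "cop_of e * T = T" "T * cop_of e = T"
      using T e(2,3) by (auto simp: fixed_alg_def op_of_simps oe simp flip: op_of_eq_iff)
    assume R: "R \<in> fixed_alg A S"
    show "T + R \<in> fixed_alg A S" "T * R \<in> fixed_alg A S"
      using T R hom unfolding fixed_alg_def symmetric_under_def
      by (simp_all add: op_of_simps cl) metis+
  next
    show "cop_of e \<in> fixed_alg A S"
      using e(1) S by (auto simp: fixed_alg_def oe symmetric_under_def symmetry_map_def)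
  next
    fix f T assume f: "\<And>n. f n \<in> fixed_alg A S" and l: "\<And>x. (\<lambda>n. f n \<bullet>\<bullet> x) \<longlonglongrightarrow> T \<bullet>\<bullet> x"
    have fA: "op_of (f n) \<in> A" for n using f by (simp add: fixed_alg_def)
    have lim: "(\<lambda>n. cinner x (blinfun_apply (op_of (f n)) y)) \<longlonglongrightarrow> cinner x (blinfun_apply (op_of T) y)" for x y
    proof -
      have "bounded_linear (\<lambda>z. cinner x z)"
      proof (rule bounded_linear_intro[where K = "2 * norm x"])
        show "norm (cinner x z) \<le> norm z * (2 * norm x)" for z
          using norm_cinner_le[of x z] by (simp add: mult_ac)
      qed (simp_all add: cinner_add_right scaleR_scaleC cinner_scaleC_right scaleR_conv_of_real)
      then show ?thesis using bounded_linear.tendsto[OF _ l[of y]] by (simp add: app.rep_eq)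
    qed
    have TA: "op_of T \<in> A"
    proof (rule ccontr)
      assume "op_of T \<notin> A"
      moreover have "openin weak_operator_topology (- A)"
        using closed by (simp add: closedin_def weak_operator_topology_def topspace_pullback_topology Compl_eq_Diff_UNIV)
      ultimately have "\<forall>\<^sub>F n in sequentially. op_of (f n) \<in> - A" by (intro wot_eventually[OF lim]) auto
      then show False using fA by simp
    qed
    have "\<phi> (op_of T) = op_of T" if \<phi>: "\<phi> \<in> S" for \<phi>
    proof (rule ccontr)
      assume "\<phi> (op_of T) \<noteq> op_of T"
      then obtain y where "blinfun_apply (\<phi> (op_of T)) y \<noteq> blinfun_apply (op_of T) y" using blinfun_eqI by blast
      then obtain x where "cinner (blinfun_apply (\<phi> (op_of T)) y) x \<noteq> cinner (blinfun_apply (op_of T) y) x"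
        using cinner_ext by blast
      then have xy: "cinner x (blinfun_apply (\<phi> (op_of T)) y) \<noteq> cinner x (blinfun_apply (op_of T) y)"
        by (metis cinner_commute)
      \<comment> \<open>Half the distance, so that the discs of radius \<open>r\<close> around the
        two coefficients are disjoint.\<close>
      define r where "r = dist (cinner x (blinfun_apply (\<phi> (op_of T)) y)) (cinner x (blinfun_apply (op_of T) y)) / 2"
      have r: "r > 0" using xy by (simp add: r_def)
      define W where "W = {R. cinner x (blinfun_apply R y) \<in> ball (cinner x (blinfun_apply (\<phi> (op_of T)) y)) r}"
      have "openin (subtopology weak_operator_topology A) (W \<inter> A)"
        unfolding W_def by (intro openin_subtopology_Int openin_wot_ball)
      moreover have "continuous_map (subtopology weak_operator_topology A) (subtopology weak_operator_topology A) \<phi>"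
        using S \<phi> by (simp add: weakly_continuous_def)
      ultimately have "openin (subtopology weak_operator_topology A)
          {R \<in> topspace (subtopology weak_operator_topology A). \<phi> R \<in> W \<inter> A}"
        by (rule openin_continuous_map_preimage[rotated])
      then obtain Z where Z: "openin weak_operator_topology Z"
        "{R \<in> topspace (subtopology weak_operator_topology A). \<phi> R \<in> W \<inter> A} = Z \<inter> A"
        unfolding openin_subtopology by blast
      have top: "topspace (subtopology weak_operator_topology A) = A"
        by (simp add: weak_operator_topology_def topspace_pullback_topology)
      have "\<phi> (op_of T) \<in> A" using S \<phi> TA by (auto simp: symmetry_map_def)
      moreover have "\<phi> (op_of T) \<in> W" using r by (simp add: W_def)
      ultimately have "op_of T \<in> Z" using Z(2) TA unfolding top by blast
      then have "\<forall>\<^sub>F n in sequentially. op_of (f n) \<in> Z" by (rule wot_eventually[OF lim Z(1)])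
      moreover have "\<phi> (op_of (f n)) = op_of (f n)" for n
        using f \<phi> by (auto simp: fixed_alg_def symmetric_under_def)
      moreover have "\<phi> R \<in> W" if "R \<in> Z" "R \<in> A" for R using Z(2) that unfolding top by blast
      ultimately have ev1: "\<forall>\<^sub>F n in sequentially. op_of (f n) \<in> W"
        using fA by (metis (mono_tags, lifting) eventually_mono)
      have "\<forall>\<^sub>F n in sequentially. dist (cinner x (blinfun_apply (op_of (f n)) y)) (cinner x (blinfun_apply (op_of T) y)) < r"
        by (rule tendstoD[OF lim r])
      with ev1 have "\<forall>\<^sub>F n::nat in sequentially. False"
      proof eventually_elim
        case (elim n)
        then show False
          using dist_triangle[of "cinner x (blinfun_apply (\<phi> (op_of T)) y)" "cinner x (blinfun_apply (op_of T) y)"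
              "cinner x (blinfun_apply (op_of (f n)) y)"]
          by (simp add: W_def r_def)
      qed
      then show False by simp
    qed
    then show "T \<in> fixed_alg A S" using TA by (simp add: fixed_alg_def symmetric_under_def)
  qed
qed

section \<open>Transfer between concrete and embedded matrices\<close>

text \<open>A real supremum dominates its members only for a set bounded above; \<open>bdd\<close>
  supplies the sum of all entry norms as a bound. Square-summable sequences of norm at most 1 then
  enter the supremum through their first \<open>m\<close> coordinates, and scaling treats the
  rest.\<close>

lemma norm_emb_le_mat_norm:
  assumes M: "\<And>i j. i < m \<Longrightarrow> j < m \<Longrightarrow> op_of (M i j) = X i j"
  shows "norm (emb m M) \<le> mat_norm m X"
proof -
  define S where "S = {x :: nat \<Rightarrow> 'a. L2_set (\<lambda>j. norm (x j)) {..<m} \<le> 1}"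
  define f where "f x = L2_set (\<lambda>i. norm (\<Sum>j<m. blinfun_apply (X i j) (x j))) {..<m}" for x
  have nf: "mat_norm m X = (SUP x\<in>S. f x)" by (simp add: mat_norm_def S_def f_def)
  have bdd: "bdd_above (f ` S)"
  proof (rule bdd_aboveI2)
    fix x assume "x \<in> S"
    then have x: "norm (x j) \<le> 1" if "j < m" for j
      using member_le_L2_set[of "{..<m}" j "\<lambda>j. norm (x j)"] that by (simp add: S_def)
    have "f x \<le> (\<Sum>i<m. norm (\<Sum>j<m. blinfun_apply (X i j) (x j)))"
      unfolding f_def by (rule L2_set_le_sum) simp
    also have "\<dots> \<le> (\<Sum>i<m. \<Sum>j<m. norm (X i j) * 1)"
      by (intro sum_mono sum_norm_le order_trans[OF norm_blinfun] mult_left_mono x) auto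
    finally show "f x \<le> (\<Sum>i<m. \<Sum>j<m. norm (X i j) * 1)" .
  qed
  have fe: "f (coord x) = norm (emb m M \<bullet>\<bullet> x)" for x
  proof -
    have "norm (emb m M \<bullet>\<bullet> x) = L2_set (\<lambda>i. norm (coord (emb m M \<bullet>\<bullet> x) i)) {..<m}"
      by (rule norm_l2_finite) (simp add: coord_emb)
    also have "\<dots> = f (coord x)"
      unfolding f_def
    proof (rule L2_set_cong)
      fix i assume i: "i \<in> {..<m}"
      then have "(\<Sum>j<m. M i j \<bullet>\<bullet> coord x j) = (\<Sum>j<m. blinfun_apply (X i j) (coord x j))"
        by (intro sum.cong) (auto simp: app.rep_eq M)
      then show "norm (coord (emb m M \<bullet>\<bullet> x) i) = norm (\<Sum>j<m. blinfun_apply (X i j) (coord x j))"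
        using i by (simp add: coord_emb)
    qed simp
    finally show ?thesis by simp
  qed
  have up: "norm (emb m M \<bullet>\<bullet> x) \<le> mat_norm m X" if "norm x \<le> 1" for x
  proof -
    have "coord x \<in> S" using order_trans[OF L2_set_coord_le that] by (simp add: S_def)
    then show ?thesis unfolding nf fe[symmetric] by (rule cSUP_upper[OF _ bdd])
  qed
  have n0: "0 \<le> mat_norm m X" using up[of 0] by simp
  show ?thesis
  proof (rule norm_cop_bound[OF n0])
    fix x :: "'a l2"
    show "norm (emb m M \<bullet>\<bullet> x) \<le> mat_norm m X * norm x"
    proof (cases "x = 0")
      case False
      define y where "y = (1 / norm x) *\<^sub>R x"
      have x: "x = norm x *\<^sub>R y" using False by (simp add: y_def)
      have "norm y \<le> 1" using False by (simp add: y_def)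
      then have "norm (emb m M \<bullet>\<bullet> y) \<le> mat_norm m X" by (rule up)
      moreover have "norm (emb m M \<bullet>\<bullet> x) = norm (emb m M \<bullet>\<bullet> y) * norm x"
        by (subst x) (simp add: scaleR_scaleC)
      ultimately show ?thesis by (simp add: mult_right_mono)
    qed simp
  qed
qed

lemma emb_unitary:
  fixes X :: "'h::complex_hilbert opmat"
  assumes e: "clinear_op e" and X: "\<And>i j. i < m \<Longrightarrow> j < m \<Longrightarrow> op_of (M i j) = X i j"
    and u: "mat_mult m (mat_adj X) X = mat_one m e" "mat_mult m X (mat_adj X) = mat_one m e"
  shows "(emb m M)\<^sup>\<star> * emb m M = diag_emb m (\<lambda>_. cop_of e)" "emb m M * (emb m M)\<^sup>\<star> = diag_emb m (\<lambda>_. cop_of e)"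
proof -
  show "(emb m M)\<^sup>\<star> * emb m M = diag_emb m (\<lambda>_. cop_of e)"
    unfolding emb_star emb_mult diag_emb_def
  proof (rule emb_cong)
    fix i j assume "i < m" "j < m"
    then show "(\<Sum>k<m. (M k i)\<^sup>\<star> * M k j) = (if i = j then cop_of e else 0)"
      using fun_cong[OF fun_cong[OF u(1)], of i j] X
      by (auto simp: mat_mult_def mat_adj_def mat_one_def op_of_sum op_of_simps op_of_cop_of[OF e] simp flip: op_of_eq_iff)
  qed
  show "emb m M * (emb m M)\<^sup>\<star> = diag_emb m (\<lambda>_. cop_of e)"
    unfolding emb_star emb_mult diag_emb_def
  proof (rule emb_cong)
    fix i j assume "i < m" "j < m"
    then show "(\<Sum>k<m. M i k * (M j k)\<^sup>\<star>) = (if i = j then cop_of e else 0)"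
      using fun_cong[OF fun_cong[OF u(2)], of i j] X
      by (auto simp: mat_mult_def mat_adj_def mat_one_def op_of_sum op_of_simps op_of_cop_of[OF e] simp flip: op_of_eq_iff)
  qed
qed

theorem theorem4p4:
  fixes m :: nat
  assumes "m \<ge> 1"
  shows "\<exists>C>0. \<exists>\<delta>>0.
    \<forall>(e :: 'h::complex_hilbert op) A S U V \<omega> X Y.
      von_neumann_algebra e A \<longrightarrow>
      (\<forall>\<phi>\<in>S. symmetry_map e A \<phi> \<and> linear_on_alg A \<phi> \<and> multiplicative_on_alg A \<phi> \<and>
              weakly_continuous A \<phi>) \<longrightarrow>
      unitary_in e A U \<longrightarrow> symmetric_under S U \<longrightarrow>
      unitary_in e A V \<longrightarrow> symmetric_under S V \<longrightarrow>
      has_mult_order \<omega> m \<longrightarrow>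
      mat_unitary_in m e A X \<longrightarrow> symmetric_under (tensor_id ` S) X \<longrightarrow>
      mat_unitary_in m e A Y \<longrightarrow> symmetric_under (tensor_id ` S) Y \<longrightarrow>
      mat_mult m X Y = mat_mult m Y X \<longrightarrow>
      (let \<epsilon> = max (mat_norm m (X - clock_mat m \<omega> U)) (mat_norm m (Y - shift_mat m V)) in
        \<epsilon> \<le> \<delta> \<longrightarrow>
        (\<exists>U'' V''.
           unitary_in e A U'' \<and> symmetric_under S U'' \<and>
           unitary_in e A V'' \<and> symmetric_under S V'' \<and>
           U'' o\<^sub>L V'' = scale_op \<omega> (V'' o\<^sub>L U'') \<and>
           norm (U'' - U) \<le> C * \<epsilon> powr (1/4) \<and>
           norm (V'' - V) \<le> C * \<epsilon> powr (1/4)))"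
proof -
  define C where "C = pair_const m"
  have C: "C > 0" unfolding C_def by (rule pair_const_pos)
  \<comment> \<open>The threshold at which \<open>C\<close> times the fourth root reaches
    \<open>1 / 128\<close>, the smallness required for both rounds.\<close>
  define \<delta> where "\<delta> = (1 / (128 * C)) ^ 4"
  have \<delta>: "\<delta> > 0" using C by (simp add: \<delta>_def)
  show ?thesis
  proof (rule exI[of _ C], rule conjI[OF C], rule exI[of _ \<delta>], rule conjI[OF \<delta>],
      intro allI impI, unfold Let_def, intro impI)
    fix e :: "'h op" and A S U V \<omega> X Y
    assume A: "von_neumann_algebra e A"
      and S: "\<forall>\<phi>\<in>S. symmetry_map e A \<phi> \<and> linear_on_alg A \<phi> \<and> multiplicative_on_alg A \<phi> \<and> weakly_continuous A \<phi>"
      and U: "unitary_in e A U" "symmetric_under S U" and V: "unitary_in e A V" "symmetric_under S V"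
      and \<omega>: "has_mult_order \<omega> m"
      and X: "mat_unitary_in m e A X" "symmetric_under (tensor_id ` S) X"
      and Y: "mat_unitary_in m e A Y" "symmetric_under (tensor_id ` S) Y"
      and XY: "mat_mult m X Y = mat_mult m Y X"
      and small: "max (mat_norm m (X - clock_mat m \<omega> U)) (mat_norm m (Y - shift_mat m V)) \<le> \<delta>"
    define \<epsilon> where "\<epsilon> = max (mat_norm m (X - clock_mat m \<omega> U)) (mat_norm m (Y - shift_mat m V))"
    interpret op_alg "fixed_alg A S" "cop_of e" by (rule op_alg_fixed_alg[OF A S])
    have lin: "clinear_op T" if "T \<in> A" for T using A that by (simp add: von_neumann_algebra_def)
    have eA: "e \<in> A" using A by (simp add: von_neumann_algebra_def)
    have oe: "op_of (cop_of e) = e" by (rule op_of_cop_of[OF lin[OF eA]])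
    have unit: "cop_of W \<in> fixed_alg A S" "(cop_of W)\<^sup>\<star> * cop_of W = cop_of e" "cop_of W * (cop_of W)\<^sup>\<star> = cop_of e"
      "op_of (cop_of W) = W" if "unitary_in e A W" "symmetric_under S W" for W
    proof -
      show o: "op_of (cop_of W) = W" using that(1) by (auto simp: unitary_in_def intro: op_of_cop_of lin)
      show "cop_of W \<in> fixed_alg A S" using that by (simp add: fixed_alg_def o unitary_in_def)
      show "(cop_of W)\<^sup>\<star> * cop_of W = cop_of e" "cop_of W * (cop_of W)\<^sup>\<star> = cop_of e"
        using that(1) by (simp_all add: unitary_in_def op_of_simps o oe flip: op_of_eq_iff)
    qed
    have entries: "Z i j \<in> A" "symmetric_under S (Z i j)" "op_of (cop_of (Z i j)) = Z i j"
      if "mat_unitary_in m e A Z" "symmetric_under (tensor_id ` S) Z" "i < m" "j < m" for Z i j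
    proof -
      show 1: "Z i j \<in> A" using that(1,3,4) by (auto simp: mat_unitary_in_def mat_alg_def)
      show "symmetric_under S (Z i j)"
        using that(2) by (auto simp: symmetric_under_def tensor_id_def dest: fun_cong)
      show "op_of (cop_of (Z i j)) = Z i j" by (rule op_of_cop_of[OF lin[OF 1]])
    qed
    have emb: "emb m (\<lambda>i j. cop_of (Z i j)) \<in> matrices m (fixed_alg A S)"
      "(emb m (\<lambda>i j. cop_of (Z i j)))\<^sup>\<star> * emb m (\<lambda>i j. cop_of (Z i j)) = diag_emb m (\<lambda>_. cop_of e)"
      "emb m (\<lambda>i j. cop_of (Z i j)) * (emb m (\<lambda>i j. cop_of (Z i j)))\<^sup>\<star> = diag_emb m (\<lambda>_. cop_of e)"
      if "mat_unitary_in m e A Z" "symmetric_under (tensor_id ` S) Z" for Z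
    proof -
      show "emb m (\<lambda>i j. cop_of (Z i j)) \<in> matrices m (fixed_alg A S)"
        unfolding matrices_def using entries[OF that] by (auto simp: fixed_alg_def)
      show "(emb m (\<lambda>i j. cop_of (Z i j)))\<^sup>\<star> * emb m (\<lambda>i j. cop_of (Z i j)) = diag_emb m (\<lambda>_. cop_of e)"
        "emb m (\<lambda>i j. cop_of (Z i j)) * (emb m (\<lambda>i j. cop_of (Z i j)))\<^sup>\<star> = diag_emb m (\<lambda>_. cop_of e)"
        using emb_unitary[OF lin[OF eA] entries(3)[OF that]] that(1) by (auto simp: mat_unitary_in_def)
    qed
    have comm: "emb m (\<lambda>i j. cop_of (X i j)) * emb m (\<lambda>i j. cop_of (Y i j)) =
        emb m (\<lambda>i j. cop_of (Y i j)) * emb m (\<lambda>i j. cop_of (X i j))"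
      unfolding emb_mult
    proof (rule emb_cong)
      fix i j assume "i < m" "j < m"
      then show "(\<Sum>k<m. cop_of (X i k) * cop_of (Y k j)) = (\<Sum>k<m. cop_of (Y i k) * cop_of (X k j))"
        using fun_cong[OF fun_cong[OF XY], of i j] entries(3)[OF X] entries(3)[OF Y]
        by (simp add: mat_mult_def op_of_sum op_of_simps flip: op_of_eq_iff)
    qed
    have "norm (emb m (\<lambda>i j. cop_of (X i j)) - diag_emb m (\<lambda>i. sc (\<omega> ^ i) (cop_of U))) \<le> mat_norm m (X - clock_mat m \<omega> U)"
      unfolding diag_emb_def emb_diff
      by (rule norm_emb_le_mat_norm) (simp add: op_of_simps entries(3)[OF X] clock_mat_def unit(4)[OF U])
    then have dX: "norm (emb m (\<lambda>i j. cop_of (X i j)) - diag_emb m (\<lambda>i. sc (\<omega> ^ i) (cop_of U))) \<le> \<epsilon>"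
      by (simp add: \<epsilon>_def)
    have "norm (emb m (\<lambda>i j. cop_of (Y i j)) - shift_emb m (cop_of V)) \<le> mat_norm m (Y - shift_mat m V)"
      unfolding shift_emb_def emb_diff
      by (rule norm_emb_le_mat_norm) (simp add: op_of_simps entries(3)[OF Y] shift_mat_def unit(4)[OF V])
    then have dY: "norm (emb m (\<lambda>i j. cop_of (Y i j)) - shift_emb m (cop_of V)) \<le> \<epsilon>" by (simp add: \<epsilon>_def)
    have \<epsilon>0: "0 \<le> \<epsilon>" by (rule order_trans[OF norm_ge_zero dX])
    define q where "q = \<epsilon> powr (1 / 4)"
    have q0: "0 \<le> q" by (simp add: q_def)
    \<comment> \<open>The exponent laws for \<open>powr\<close> want a positive base; for
      \<open>\<epsilon> = 0\<close> the value of \<open>powr\<close> is 0 and the claim is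
      immediate.\<close>
    have q4: "q ^ 4 = \<epsilon>"
    proof (cases "\<epsilon> = 0")
      case False
      then have "\<epsilon> > 0" using \<epsilon>0 by simp
      then have "q ^ 4 = \<epsilon> powr (1 / 4 * real 4)" unfolding q_def by (simp only: powr_powr[symmetric] powr_realpow powr_gt_zero)
      then show ?thesis using \<open>\<epsilon> > 0\<close> by simp
    qed (simp add: q_def)
    have "q \<le> 1 / (128 * C)"
    proof (rule power_le_imp_le_base)
      show "q ^ Suc 3 \<le> (1 / (128 * C)) ^ Suc 3" using small q4 unfolding \<epsilon>_def[symmetric] \<delta>_def by simp
    qed (use C in simp)
    then have Cq: "pair_const m * q \<le> 1 / 128" using C unfolding C_def[symmetric] by (simp add: field_simps)
    obtain u v where uv: "u \<in> fixed_alg A S" "v \<in> fixed_alg A S"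
      "u\<^sup>\<star> * u = cop_of e" "u * u\<^sup>\<star> = cop_of e" "v\<^sup>\<star> * v = cop_of e" "v * v\<^sup>\<star> = cop_of e" "u * v = sc \<omega> (v * u)"
      "norm (u - cop_of U) \<le> C * q" "norm (v - cop_of V) \<le> C * q"
      using commuting_to_omega_commuting[OF \<omega> unit(1-3)[OF U] unit(1-3)[OF V] emb[OF X] emb[OF Y] comm
          dX[folded q4] dY[folded q4] q0 Cq] unfolding C_def by blast
    have pull_back: "unitary_in e A (op_of w)" "symmetric_under S (op_of w)"
      if "w \<in> fixed_alg A S" "w\<^sup>\<star> * w = cop_of e" "w * w\<^sup>\<star> = cop_of e" for w
      using that(1) arg_cong[OF that(2), of op_of] arg_cong[OF that(3), of op_of]
      by (auto simp: unitary_in_def fixed_alg_def op_of_simps oe)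
    have nm: "norm (op_of w - W) = norm (w - cop_of W)" if "op_of (cop_of W) = W" for w W
      by (simp add: norm_cop.rep_eq op_of_simps that)
    show "\<exists>U'' V''. unitary_in e A U'' \<and> symmetric_under S U'' \<and> unitary_in e A V'' \<and> symmetric_under S V'' \<and>
        U'' o\<^sub>L V'' = scale_op \<omega> (V'' o\<^sub>L U'') \<and>
        norm (U'' - U) \<le> C * max (mat_norm m (X - clock_mat m \<omega> U)) (mat_norm m (Y - shift_mat m V)) powr (1 / 4) \<and>
        norm (V'' - V) \<le> C * max (mat_norm m (X - clock_mat m \<omega> U)) (mat_norm m (Y - shift_mat m V)) powr (1 / 4)"
      unfolding \<epsilon>_def[symmetric] q_def[symmetric]
      by (rule exI[of _ "op_of u"], rule exI[of _ "op_of v"])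
        (use pull_back[OF uv(1,3,4)] pull_back[OF uv(2,5,6)] arg_cong[OF uv(7), of op_of] uv(8,9)
          nm[OF unit(4)[OF U], of u] nm[OF unit(4)[OF V], of v] in \<open>simp add: op_of_simps\<close>)
  qed
qed

end
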